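(* The first Hamiltonians generated by $D(\lambda)=T_{K+1,K+1}(\lambda)$, i.e. the coefficients $D^{(n)}$ of $\lambda^{-n}$ in its expansion in $\lambda^{-1}$, read $$D^{(1)}=igN,\qquad D^{(2)}=-\tfrac12g^2N^2+gP,\qquad D^{(3)}=-\tfrac{i g^3}{6}N^3+ig^2NP+igH,$$ where $$N=\int_{-\infty}^\infty dx\,\Phi^\dagger(x)\Phi(x),\qquad P=\int_{-\infty}^\infty dx\,\Phi^\dagger(x)\partial\Phi(x),$$ $$H=\int_{-\infty}^\infty dx\,\partial\Phi^\dagger(x)\partial\Phi(x)+g\int_{-\infty}^\infty dx\,\big(\Phi^\dagger(x)\Phi(x)\big)^2 .$$ This shows that $D(\lambda)$ generates the Hamiltonians of the nonlinear super-Schrödinger hierarchy, so that the relation $\{D(\lambda),t(\mu)\}=0$ proves that the super-Yangian $Y(gl(M|N))$ is a symmetry of this hierarchy. Here $t(\lambda)$ is the $K\times K$ submatrix of $T(\lambda)$ with the last row and column removed; it defines a classical version of $Y(gl(M|N))$ through $$\{t_1(\lambda),t_2(\mu)\}=\frac{g}{\lambda-\mu}\,[P_{12},t(\lambda)\otimes t(\mu)],$$ and $\{D(\lambda),D(\mu)\}=0$.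
   Context: Grading: $M,N$ are the numbers of bosonic and fermionic fields (this integer $N$ is not to be confused with the functional $N$ of the claim), $K=M+N$, $g>0$; $[j]=0$ for $1\le j\le M$, $[j]=1$ for $M<j\le K$, $[K+1]=0$. $E_{jk}$ is the elementary matrix of grade $[j]+[k]$; tensor products are $\mathbb Z_2$-graded: $(A\otimes B)(C\otimes D)=(-1)^{[B][C]}AC\otimes BD$. A matrix $U=\sum U_{ab}E_{ab}$ is even if $[U_{ab}]=[a]+[b]$; entries commute with the $E_{ab}$; $U_1=\sum U_{ab}E_{ab}\otimes\mathbb I$, $U_2=\sum U_{ab}\mathbb I\otimes E_{ab}$, $U\otimes V=U_1V_2$. $P_{12}=\sum_{i,j=1}^K(-1)^{[j]}E_{ij}\otimes E_{ji}$. Classical fields $\phi_j(x),\phi_j^\dagger(x)$, $1\le j\le K$: classical graded fields of grade $[j]$ on $\mathbb R$, vanishing at infinity, $\phi_j^\dagger$ being the adjoint of $\phi_j$; $\Phi^\dagger\Phi=\sum_{j=1}^K\phi_j^\dagger\phi_j$, and similarly with derivatives ($\partial=\partial_x$). Graded Poisson bracket $\{F,G\}=i\sum_{\ell=1}^K\int dx\,(-1)^{[F][\ell]}\Big((-1)^{[\ell]}\frac{\delta F}{\delta\phi_\ell(x)}\frac{\delta G}{\delta\phi_\ell^\dagger(x)}-\frac{\delta F}{\delta\phi_\ell^\dagger(x)}\frac{\delta G}{\delta\phi_\ell(x)}\Big)$, for which $\{\phi_j(x),\phi_k^\dagger(y)\}=i\delta_{jk}\delta(x-y)$; for even matrices $\{F_1,G_2\}=\sum\{F_{ab},G_{cd}\}E_{ab}\otimes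 E_{cd}$. $H$ is the Hamiltonian of the classical nonlinear super-Schrödinger equation $i\partial_t\phi_j=-\partial_x^2\phi_j+2g(\sum_k\phi_k^\dagger\phi_k)\phi_j$. Monodromy matrix: $\Sigma=\mathbb I_{K+1}-2E_{K+1,K+1}$, $\Omega(x)=i\sqrt g\sum_{j=1}^K(\phi_j(x)E_{j,K+1}-\phi_j^\dagger(x)E_{K+1,j})$, $L(\lambda;x)=\frac{i\lambda}2\Sigma+\Omega(x)$, $E(\lambda;x)=\exp(\frac{ix\lambda}2\Sigma)$; $T(\lambda;x,y)$ ($x>y$) solves $\partial_xT=L(\lambda;x)T$, $T(\lambda;x,x)=\mathbb I$; $T(\lambda)=\lim_{x\to\infty,y\to-\infty}E(\lambda;-x)T(\lambda;x,y)E(\lambda;y)$.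
   Formalization: The relation for {t_1,t_2} is proved with −g/(λ−μ), the sign the stated conventions force (the printed sign fails for M+N≥2); {D(λ),t(μ)}=0 is for Im λ≥0≥Im μ, not both real, where the bracket integral diverges; the fields are Schwartz functions. *)

theory Defs
  imports "HOL-Probability.Distributions" "HOL-Library.Z2"
begin

section \<open>The algebra of values of the classical graded fields\<close>

text \<open>
  Classical graded fields take values in a complex Banach algebra that is graded over the
  two-element field \<^typ>\<open>bit\<close>, supercommutative, and carries an adjoint.  The standard model is
  the Banach-Grassmann algebra of absolutely summable series in countably many anticommuting
  generators.  The class also has the instance of the complex numbers (no odd part), i.e. the
  purely bosonic theory.
\<close>

class scaleC =
  fixes scaleC :: "complex \<Rightarrow> 'a \<Rightarrow> 'a" (infixr "*\<^sub>C" 75)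

class banach_superalgebra = real_normed_algebra_1 + banach + scaleC +
  fixes homog :: "bit \<Rightarrow> 'a set"
    and adj :: "'a \<Rightarrow> 'a" ("_\<^sup>\<dagger>" [1000] 999)
  assumes scaleC_add_right: "c *\<^sub>C (x + y) = c *\<^sub>C x + c *\<^sub>C y"
    and scaleC_add_left: "(c + d) *\<^sub>C x = c *\<^sub>C x + d *\<^sub>C x"
    and scaleC_scaleC: "c *\<^sub>C d *\<^sub>C x = (c * d) *\<^sub>C x"
    and scaleC_of_real: "complex_of_real r *\<^sub>C x = r *\<^sub>R x"
    and scaleC_mult_left: "(c *\<^sub>C x) * y = c *\<^sub>C (x * y)"
    and scaleC_mult_right: "x * (c *\<^sub>C y) = c *\<^sub>C (x * y)"
    and norm_scaleC: "norm (c *\<^sub>C x) = cmod c * norm x"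
    and homog_add: "x \<in> homog p \<Longrightarrow> y \<in> homog p \<Longrightarrow> x + y \<in> homog p"
    and homog_scaleC: "x \<in> homog p \<Longrightarrow> c *\<^sub>C x \<in> homog p"
    and homog_closed: "closed (homog p)"
    and homog_one: "1 \<in> homog 0"
    and homog_mult: "x \<in> homog p \<Longrightarrow> y \<in> homog q \<Longrightarrow> x * y \<in> homog (p + q)"
    and homog_decomp: "\<exists>y\<in>homog 0. \<exists>z\<in>homog 1. x = y + z"
    and homog_disjoint: "x \<in> homog 0 \<Longrightarrow> x \<in> homog 1 \<Longrightarrow> x = 0"
    and supercommute: "x \<in> homog p \<Longrightarrow> y \<in> homog q \<Longrightarrow>
          x * y = (if p * q = 1 then - (y * x) else y * x)"
    and adj_add: "(x + y)\<^sup>\<dagger> = x\<^sup>\<dagger> + y\<^sup>\<dagger>"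
    and adj_scaleC: "(c *\<^sub>C x)\<^sup>\<dagger> = cnj c *\<^sub>C x\<^sup>\<dagger>"
    and adj_mult: "(x * y)\<^sup>\<dagger> = y\<^sup>\<dagger> * x\<^sup>\<dagger>"
    and adj_adj: "(x\<^sup>\<dagger>)\<^sup>\<dagger> = x"
    and norm_adj: "norm (x\<^sup>\<dagger>) = norm x"
    and adj_homog: "x \<in> homog p \<Longrightarrow> x\<^sup>\<dagger> \<in> homog p"

instantiation complex :: banach_superalgebra
begin
definition scaleC_complex :: "complex \<Rightarrow> complex \<Rightarrow> complex" where "scaleC_complex = (*)"
definition homog_complex :: "bit \<Rightarrow> complex set" where "homog_complex p = (if p = 0 then UNIV else {0})"
definition adj_complex :: "complex \<Rightarrow> complex" where "adj_complex = cnj"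
instance
  by standard
    (auto simp: scaleC_complex_def homog_complex_def adj_complex_def algebra_simps
        norm_mult scaleR_conv_of_real)
end

text \<open>
  Grassmann algebras with infinitely many generators have this property; finitely generated ones
  do not.  It makes functional derivatives with respect to odd fields unique.
\<close>
definition odd_separating :: "'a::banach_superalgebra itself \<Rightarrow> bool" where
  "odd_separating _ \<longleftrightarrow> (\<forall>a::'a. (\<forall>\<theta>\<in>homog 1. \<theta> * a = 0) \<longrightarrow> a = 0)"


section \<open>Fields\<close>

definition grade :: "nat \<Rightarrow> nat \<Rightarrow> nat \<Rightarrow> bit" where
  "grade M N j = (if M < j \<and> j \<le> M + N then 1 else 0)"

definition gsign :: "bit \<Rightarrow> 'a::ring_1" where
  "gsign p = (if p = 0 then 1 else - 1)"

text \<open>\<open>d n\<close> is the \<open>n\<close>-th derivative of \<open>f\<close>.\<close>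
definition schwartz :: "(real \<Rightarrow> 'a::real_normed_vector) \<Rightarrow> bool" where
  "schwartz f \<longleftrightarrow> (\<exists>d :: nat \<Rightarrow> real \<Rightarrow> 'a. d 0 = f \<and>
     (\<forall>n x. (d n has_vector_derivative d (Suc n) x) (at x)) \<and>
     (\<forall>k n. bounded (range (\<lambda>x. x ^ k *\<^sub>R d n x))))"

text \<open>A field configuration is \<open>j \<mapsto> x \<mapsto> \<phi>\<^sub>j(x)\<close>; only the indices \<open>1 \<le> j \<le> M + N\<close> matter.\<close>
type_synonym 'a config = "nat \<Rightarrow> real \<Rightarrow> 'a"

definition fields :: "nat \<Rightarrow> nat \<Rightarrow> 'a::banach_superalgebra config set" where
  "fields M N = {\<phi>. \<forall>j\<in>{1..M + N}. schwartz (\<phi> j) \<and> (\<forall>x. \<phi> j x \<in> homog (grade M N j))}"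


section \<open>Functional derivatives and the graded Poisson bracket\<close>

text \<open>
  \<open>A l x\<close> and \<open>B l x\<close> are the left functional derivatives of \<open>F\<close> at \<open>\<phi>\<close> with respect to
  \<open>\<phi>\<^sub>l(x)\<close> and \<open>\<phi>\<^sub>l\<^sup>\<dagger>(x)\<close>: the variations stand to the left.  Left derivatives are the ones for
  which the sign factors in \<open>has_poisson\<close> give a graded Poisson bracket.
  The two families are separately determined because \<open>h\<close> may be replaced by \<open>\<i> h\<close>.
\<close>
definition is_gradient ::
  "nat \<Rightarrow> nat \<Rightarrow> ('a::banach_superalgebra config \<Rightarrow> 'a) \<Rightarrow> 'a config \<Rightarrow>
   (nat \<Rightarrow> real \<Rightarrow> 'a) \<Rightarrow> (nat \<Rightarrow> real \<Rightarrow> 'a) \<Rightarrow> bool" where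
  "is_gradient M N F \<phi> A B \<longleftrightarrow>
     (\<forall>l\<in>{1..M + N}. continuous_on UNIV (A l) \<and> bounded (range (A l)) \<and>
                      continuous_on UNIV (B l) \<and> bounded (range (B l))) \<and>
     (\<forall>h\<in>fields M N. \<exists>v.
        ((\<lambda>\<epsilon>. F (\<lambda>j x. \<phi> j x + \<epsilon> *\<^sub>R h j x)) has_vector_derivative v) (at 0) \<and>
        ((\<lambda>x. \<Sum>l=1..M + N. h l x * A l x + (h l x)\<^sup>\<dagger> * B l x) has_integral v) UNIV)"

text \<open>
  \<open>has_poisson M N p F G \<phi> v\<close>: the functional \<open>F\<close> has grade \<open>p\<close> and the value of \<open>{F, G}\<close> at
  \<open>\<phi>\<close> is \<open>v\<close>.
\<close>
definition has_poisson ::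
  "nat \<Rightarrow> nat \<Rightarrow> bit \<Rightarrow> ('a::banach_superalgebra config \<Rightarrow> 'a) \<Rightarrow> ('a config \<Rightarrow> 'a) \<Rightarrow>
   'a config \<Rightarrow> 'a \<Rightarrow> bool" where
  "has_poisson M N p F G \<phi> v \<longleftrightarrow>
     (\<forall>\<psi>\<in>fields M N. F \<psi> \<in> homog p) \<and>
     (\<exists>A B C D.
        is_gradient M N F \<phi> A B \<and> is_gradient M N G \<phi> C D \<and>
        ((\<lambda>x. \<i> *\<^sub>C (\<Sum>l=1..M + N. gsign (p * grade M N l) *
            (gsign (grade M N l) * A l x * D l x - B l x * C l x))) has_integral v) UNIV)"

text \<open>
  If odd elements separate points (or there are no odd fields), functional derivatives are unique,
  so \<open>has_poisson\<close> determines the value of the bracket.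
\<close>

lemma poly_gauss_bounded:
  fixes q :: "real poly" and \<mu> \<sigma> :: real
  assumes "\<sigma> > 0"
  shows "bounded (range (\<lambda>x. poly q x * normal_density \<mu> \<sigma> x))"
proof -
  define c where "c = 1 / (2 * \<sigma>\<^sup>2)"
  define C where "C = exp (\<bar>\<mu>\<bar> + 1 / (4 * c)) / sqrt (2 * pi * \<sigma>\<^sup>2)"
  have c: "c > 0" using assms by (simp add: c_def)
  have mono: "\<bar>x\<bar> ^ m * normal_density \<mu> \<sigma> x \<le> fact m * C" for m and x :: real
  proof -
    have s: "(\<lambda>n. \<bar>x\<bar> ^ n /\<^sub>R fact n) sums exp \<bar>x\<bar>" by (rule exp_converges)
    have "(\<Sum>n\<in>{m}. \<bar>x\<bar> ^ n /\<^sub>R fact n) \<le> (\<Sum>n. \<bar>x\<bar> ^ n /\<^sub>R fact n)"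
      by (rule sum_le_suminf[OF sums_summable[OF s]]) auto
    then have "\<bar>x\<bar> ^ m /\<^sub>R fact m \<le> exp \<bar>x\<bar>" using sums_unique[OF s] by simp
    then have 1: "\<bar>x\<bar> ^ m \<le> fact m * exp \<bar>x\<bar>" by (simp add: field_simps)
    have "0 \<le> (2 * c * \<bar>x - \<mu>\<bar> - 1)\<^sup>2" by simp
    then have "4 * c * \<bar>x - \<mu>\<bar> \<le> 4 * c * (c * (x - \<mu>)\<^sup>2) + 1"
      by (simp add: power2_eq_square algebra_simps)
    then have "\<bar>x - \<mu>\<bar> \<le> c * (x - \<mu>)\<^sup>2 + 1 / (4 * c)" using c by (simp add: field_simps)
    then have "\<bar>x\<bar> - c * (x - \<mu>)\<^sup>2 \<le> \<bar>\<mu>\<bar> + 1 / (4 * c)" by linarith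
    then have "exp (\<bar>x\<bar> - c * (x - \<mu>)\<^sup>2) \<le> exp (\<bar>\<mu>\<bar> + 1 / (4 * c))" by simp
    then have 2: "exp \<bar>x\<bar> * exp (- (c * (x - \<mu>)\<^sup>2)) \<le> exp (\<bar>\<mu>\<bar> + 1 / (4 * c))"
      by (simp add: exp_add[symmetric])
    have nd: "normal_density \<mu> \<sigma> x = exp (- (c * (x - \<mu>)\<^sup>2)) / sqrt (2 * pi * \<sigma>\<^sup>2)"
      by (simp add: normal_density_def c_def)
    have "\<bar>x\<bar> ^ m * exp (- (c * (x - \<mu>)\<^sup>2)) \<le> fact m * exp \<bar>x\<bar> * exp (- (c * (x - \<mu>)\<^sup>2))"
      by (rule mult_right_mono[OF 1]) simp
    also have "\<dots> = fact m * (exp \<bar>x\<bar> * exp (- (c * (x - \<mu>)\<^sup>2)))" by simp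
    also have "\<dots> \<le> fact m * exp (\<bar>\<mu>\<bar> + 1 / (4 * c))" by (rule mult_left_mono[OF 2]) simp
    finally show ?thesis using assms unfolding nd C_def
      by (simp add: divide_right_mono)
  qed
  have "norm (poly q x * normal_density \<mu> \<sigma> x) \<le> (\<Sum>i\<le>degree q. \<bar>coeff q i\<bar> * (fact i * C))" for x
  proof -
    have "norm (poly q x * normal_density \<mu> \<sigma> x)
        = \<bar>\<Sum>i\<le>degree q. coeff q i * x ^ i\<bar> * normal_density \<mu> \<sigma> x"
      by (simp add: poly_altdef abs_mult)
    also have "\<dots> \<le> (\<Sum>i\<le>degree q. \<bar>coeff q i * x ^ i\<bar>) * normal_density \<mu> \<sigma> x"
      by (rule mult_right_mono[OF sum_abs]) simp
    also have "\<dots> = (\<Sum>i\<le>degree q. \<bar>coeff q i\<bar> * (\<bar>x\<bar> ^ i * normal_density \<mu> \<sigma> x))"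
      by (simp add: sum_distrib_right abs_mult power_abs mult.assoc)
    also have "\<dots> \<le> (\<Sum>i\<le>degree q. \<bar>coeff q i\<bar> * (fact i * C))"
      by (intro sum_mono mult_left_mono mono) simp
    finally show ?thesis .
  qed
  then show ?thesis unfolding bounded_iff by blast
qed

lemma normal_density_deriv:
  assumes "\<sigma> > 0"
  shows "(normal_density \<mu> \<sigma> has_real_derivative - ((x - \<mu>) / \<sigma>\<^sup>2) * normal_density \<mu> \<sigma> x) (at x)"
  unfolding normal_density_def[abs_def]
  by (rule derivative_eq_intros refl | use assms in \<open>simp add: power2_eq_square field_simps\<close>)+

lemma schwartz_gauss:
  fixes \<theta> :: "'a::real_normed_vector"
  assumes s: "\<sigma> > 0"
  shows "schwartz (\<lambda>x. normal_density \<mu> \<sigma> x *\<^sub>R \<theta>)"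
proof -
  define p where "p = rec_nat (1 :: real poly)
    (\<lambda>_ q. pderiv q - [: - \<mu> / \<sigma>\<^sup>2, 1 / \<sigma>\<^sup>2 :] * q)"
  have p0: "p 0 = 1" and pS: "p (Suc n) = pderiv (p n) - [: - \<mu> / \<sigma>\<^sup>2, 1 / \<sigma>\<^sup>2 :] * p n" for n
    by (simp_all add: p_def)
  define d where "d n x = (poly (p n) x * normal_density \<mu> \<sigma> x) *\<^sub>R \<theta>" for n x
  have "d 0 = (\<lambda>x. normal_density \<mu> \<sigma> x *\<^sub>R \<theta>)" by (simp add: d_def p0 fun_eq_iff)
  moreover have "(d n has_vector_derivative d (Suc n) x) (at x)" for n x
  proof -
    have "((\<lambda>x. poly (p n) x * normal_density \<mu> \<sigma> x) has_real_derivative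
        poly (pderiv (p n)) x * normal_density \<mu> \<sigma> x
        + - ((x - \<mu>) / \<sigma>\<^sup>2) * normal_density \<mu> \<sigma> x * poly (p n) x) (at x)"
      by (rule DERIV_mult[OF poly_DERIV normal_density_deriv[OF s]])
    also have "poly (pderiv (p n)) x * normal_density \<mu> \<sigma> x
        + - ((x - \<mu>) / \<sigma>\<^sup>2) * normal_density \<mu> \<sigma> x * poly (p n) x
        = poly (p (Suc n)) x * normal_density \<mu> \<sigma> x"
      using s by (simp add: pS field_simps)
    finally show ?thesis unfolding d_def[abs_def]
      by (intro has_vector_derivative_scaleR[THEN has_vector_derivative_eq_rhs])
         (auto intro!: derivative_eq_intros)
  qed
  moreover have "bounded (range (\<lambda>x. x ^ k *\<^sub>R d n x))" for k n
  proof -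
    have "bounded (range (\<lambda>x. poly (monom 1 k * p n) x * normal_density \<mu> \<sigma> x))"
      by (rule poly_gauss_bounded[OF s])
    then obtain B where "\<And>x. norm (poly (monom 1 k * p n) x * normal_density \<mu> \<sigma> x) \<le> B"
      by (auto simp: bounded_iff)
    then have B: "\<And>x. \<bar>x ^ k * (poly (p n) x * normal_density \<mu> \<sigma> x)\<bar> \<le> B"
      by (simp add: poly_monom mult.assoc)
    have "norm (x ^ k *\<^sub>R d n x) \<le> B * norm \<theta>" for x
      using mult_right_mono[OF B[of x] norm_ge_zero[of \<theta>]] by (simp add: d_def abs_mult mult.assoc)
    then show ?thesis unfolding bounded_iff by blast
  qed
  ultimately show ?thesis unfolding schwartz_def by blast
qed

lemma gauss_integral_zero_imp_zero:
  fixes f :: "real \<Rightarrow> 'a::banach"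
  assumes cont: "continuous_on UNIV f" and bdd: "bounded (range f)"
    and int0: "\<And>\<sigma>. \<sigma> > 0 \<Longrightarrow> ((\<lambda>x. normal_density \<mu> \<sigma> x *\<^sub>R f x) has_integral 0) UNIV"
  shows "f \<mu> = 0"
proof -
  obtain B where B: "\<And>x. norm (f x) \<le> B" using bdd by (auto simp: bounded_iff)
  have B0: "0 \<le> B" using B[of 0] norm_ge_zero order_trans by blast
  have "norm (f \<mu>) \<le> e" if e: "e > 0" for e
  proof -
    obtain \<delta> where \<delta>: "\<delta> > 0" "\<And>x. dist x \<mu> < \<delta> \<Longrightarrow> dist (f x) (f \<mu>) < e / 2"
      using cont e unfolding continuous_on_iff by (metis UNIV_I half_gt_zero)
    have pw: "norm (f x - f \<mu>) \<le> e / 2 + 2 * B / \<delta>\<^sup>2 * (x - \<mu>)\<^sup>2" for x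
    proof (cases "\<bar>x - \<mu>\<bar> < \<delta>")
      case True
      then have "norm (f x - f \<mu>) < e / 2" using \<delta>(2)[of x] by (simp add: dist_norm)
      moreover have "0 \<le> 2 * B / \<delta>\<^sup>2 * (x - \<mu>)\<^sup>2" using B0 by simp
      ultimately show ?thesis by linarith
    next
      case False
      then have "\<delta>\<^sup>2 \<le> (x - \<mu>)\<^sup>2" using \<delta>(1) by (metis abs_le_square_iff abs_of_pos not_less)
      then have "1 \<le> (x - \<mu>)\<^sup>2 / \<delta>\<^sup>2" using \<delta>(1) by simp
      then have "2 * B \<le> 2 * B * ((x - \<mu>)\<^sup>2 / \<delta>\<^sup>2)" using B0
        by (metis mult.right_neutral mult_left_mono mult_nonneg_nonneg zero_le_numeral)
      moreover have "norm (f x - f \<mu>) \<le> 2 * B"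
        using norm_triangle_ineq4[of "f x" "f \<mu>"] B[of x] B[of \<mu>] by linarith
      ultimately show ?thesis using e by simp
    qed
    define \<sigma> where "\<sigma> = sqrt (e / 2 / (2 * B / \<delta>\<^sup>2 + 1))"
    have pos: "2 * B / \<delta>\<^sup>2 + 1 > 0" using B0 by (simp add: add_nonneg_pos)
    have \<sigma>: "\<sigma> > 0" "\<sigma>\<^sup>2 = e / 2 / (2 * B / \<delta>\<^sup>2 + 1)"
      using e pos by (simp_all add: \<sigma>_def)
    have i0: "(normal_density \<mu> \<sigma> has_integral 1) UNIV"
      using has_integral_integral_lborel[OF integrable_normal_density[OF \<sigma>(1)]]
        integral_normal_density[OF \<sigma>(1)] by metis
    have hb: "has_bochner_integral lborel (\<lambda>x. normal_density \<mu> \<sigma> x * (x - \<mu>)\<^sup>2) (\<sigma>\<^sup>2)"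
      using normal_moment_even[OF \<sigma>(1), of \<mu> 1] by (simp add: fact_numeral)
    have i2: "((\<lambda>x. normal_density \<mu> \<sigma> x * (x - \<mu>)\<^sup>2) has_integral \<sigma>\<^sup>2) UNIV"
      using has_integral_integral_lborel hb
      by (metis has_bochner_integral_integral_eq has_bochner_integral_integrable integrable.intros)
    have gi: "((\<lambda>x. e / 2 * normal_density \<mu> \<sigma> x + 2 * B / \<delta>\<^sup>2 * (normal_density \<mu> \<sigma> x * (x - \<mu>)\<^sup>2))
        has_integral (e / 2 * 1 + 2 * B / \<delta>\<^sup>2 * \<sigma>\<^sup>2)) UNIV"
      by (intro has_integral_add has_integral_mult_right i0 i2)
    have fi: "((\<lambda>x. normal_density \<mu> \<sigma> x *\<^sub>R f x - normal_density \<mu> \<sigma> x *\<^sub>R f \<mu>) has_integral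
        (0 - 1 *\<^sub>R f \<mu>)) UNIV"
      by (intro has_integral_diff int0 \<sigma> has_integral_scaleR_left i0)
    have "norm (0 - 1 *\<^sub>R f \<mu>) \<le> e / 2 * 1 + 2 * B / \<delta>\<^sup>2 * \<sigma>\<^sup>2"
    proof -
      have "norm (normal_density \<mu> \<sigma> x *\<^sub>R f x - normal_density \<mu> \<sigma> x *\<^sub>R f \<mu>)
          \<le> e / 2 * normal_density \<mu> \<sigma> x + 2 * B / \<delta>\<^sup>2 * (normal_density \<mu> \<sigma> x * (x - \<mu>)\<^sup>2)" for x
      proof -
        have "norm (normal_density \<mu> \<sigma> x *\<^sub>R f x - normal_density \<mu> \<sigma> x *\<^sub>R f \<mu>)
            = normal_density \<mu> \<sigma> x * norm (f x - f \<mu>)"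
          by (simp add: scaleR_diff_right[symmetric])
        also have "\<dots> \<le> normal_density \<mu> \<sigma> x * (e / 2 + 2 * B / \<delta>\<^sup>2 * (x - \<mu>)\<^sup>2)"
          by (rule mult_left_mono[OF pw]) simp
        finally show ?thesis by (simp add: algebra_simps)
      qed
      then have "norm (integral UNIV (\<lambda>x. normal_density \<mu> \<sigma> x *\<^sub>R f x - normal_density \<mu> \<sigma> x *\<^sub>R f \<mu>))
         \<le> integral UNIV (\<lambda>x. e / 2 * normal_density \<mu> \<sigma> x + 2 * B / \<delta>\<^sup>2 * (normal_density \<mu> \<sigma> x * (x - \<mu>)\<^sup>2))"
        using fi gi by (intro Henstock_Kurzweil_Integration.integral_norm_bound_integral) (auto simp: has_integral_integrable)
      then show ?thesis by (simp only: integral_unique[OF fi] integral_unique[OF gi])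
    qed
    also have "\<dots> \<le> e / 2 + (2 * B / \<delta>\<^sup>2 + 1) * \<sigma>\<^sup>2" using \<sigma>(1) by (simp add: algebra_simps)
    also have "\<dots> = e" 
    proof -
      have "P * (e / 2 / P) = e / 2" if "P > 0" for P :: real using that by simp
      from this[OF pos] show ?thesis unfolding \<sigma>(2) by (simp only: field_sum_of_halves)
    qed
    finally show ?thesis by simp
  qed
  then show ?thesis using dense[of 0 "norm (f \<mu>)"] by (meson leD zero_less_norm_iff)
qed

lemma is_gradient_unique:
  fixes F :: "'a::banach_superalgebra config \<Rightarrow> 'a"
  assumes sep: "N = 0 \<or> odd_separating TYPE('a)"
    and grad: "is_gradient M N F \<phi> A B" "is_gradient M N F \<phi> A' B'"
    and l: "l \<in> {1..M + N}"
  shows "A l = A' l \<and> B l = B' l"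
proof -
  define U where "U = A l" define U' where "U' = A' l"
  define V where "V = B l" define V' where "V' = B' l"
  note defs = U_def U'_def V_def V'_def
  have cb: "continuous_on UNIV U" "continuous_on UNIV U'" "bounded (range U)" "bounded (range U')"
    "continuous_on UNIV V" "continuous_on UNIV V'" "bounded (range V)" "bounded (range V')"
    using grad l unfolding is_gradient_def defs by auto
  have z: "(0::'a) \<in> homog p" for p
  proof -
    obtain y z :: 'a where "y \<in> homog 0" "z \<in> homog 1" using homog_decomp[of "0::'a"] by blast
    then obtain x :: 'a where "x \<in> homog p" by (cases p) auto
    then have "complex_of_real 0 *\<^sub>C x \<in> homog p" by (rule homog_scaleC)
    then show ?thesis by (simp only: scaleC_of_real scaleR_zero_left)
  qed
  have bnd_mult: "bounded (range (\<lambda>x. c * f x))" if bf: "bounded (range f)" for c :: 'a and f :: "real \<Rightarrow> 'a"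
  proof -
    obtain b where "\<And>x. norm (f x) \<le> b" using bf by (metis bounded_iff rangeI)
    then have "norm (c * f x) \<le> norm c * b" for x
      by (meson norm_mult_ineq mult_left_mono norm_ge_zero order_trans)
    then show ?thesis unfolding bounded_iff by blast
  qed
  have test: "\<theta> * (U x - U' x) = 0 \<and> \<theta>\<^sup>\<dagger> * (V x - V' x) = 0" if th: "\<theta> \<in> homog (grade M N l)" for \<theta> x
  proof -
    have main: "\<eta> * (U x - U' x) + \<eta>\<^sup>\<dagger> * (V x - V' x) = 0" if et: "\<eta> \<in> homog (grade M N l)" for \<eta> x
    proof (rule gauss_integral_zero_imp_zero[where \<mu> = x])
      show "continuous_on UNIV (\<lambda>x. \<eta> * (U x - U' x) + \<eta>\<^sup>\<dagger> * (V x - V' x))"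
        by (intro continuous_intros cb)
      have "bounded (range (\<lambda>x. U x - U' x))" "bounded (range (\<lambda>x. V x - V' x))"
        using cb by (auto intro: bounded_minus_comp)
      then show "bounded (range (\<lambda>x. \<eta> * (U x - U' x) + \<eta>\<^sup>\<dagger> * (V x - V' x)))"
        by (intro bounded_plus_comp bnd_mult)
      fix \<sigma> :: real assume s: "\<sigma> > 0"
      define h where "h = (\<lambda>j y. normal_density x \<sigma> y *\<^sub>R (if j = l then \<eta> else 0))"
      have hom: "r *\<^sub>R a \<in> homog q" if "a \<in> homog q" for r q and a :: 'a
        using homog_scaleC[OF that, of "complex_of_real r"] by (simp only: scaleC_of_real)
      have hf: "h \<in> fields M N" unfolding fields_def h_def
        by (intro CollectI ballI conjI allI schwartz_gauss[OF s] hom) (use et z in auto)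
      obtain v where v: "((\<lambda>\<epsilon>. F (\<lambda>j x. \<phi> j x + \<epsilon> *\<^sub>R h j x)) has_vector_derivative v) (at 0)"
        "((\<lambda>x. \<Sum>l=1..M + N. h l x * A l x + (h l x)\<^sup>\<dagger> * B l x) has_integral v) UNIV"
        using grad(1) hf unfolding is_gradient_def by blast
      obtain v' where v': "((\<lambda>\<epsilon>. F (\<lambda>j x. \<phi> j x + \<epsilon> *\<^sub>R h j x)) has_vector_derivative v') (at 0)"
        "((\<lambda>x. \<Sum>l=1..M + N. h l x * A' l x + (h l x)\<^sup>\<dagger> * B' l x) has_integral v') UNIV"
        using grad(2) hf unfolding is_gradient_def by blast
      have "v = v'" using v(1) v'(1) by (rule vector_derivative_unique_at)
      moreover have hd: "(h j y)\<^sup>\<dagger> = normal_density x \<sigma> y *\<^sub>R (if j = l then \<eta>\<^sup>\<dagger> else 0)" for j y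
      proof -
        have "(r *\<^sub>R a)\<^sup>\<dagger> = r *\<^sub>R a\<^sup>\<dagger>" for r and a :: 'a
          by (metis adj_scaleC complex_cnj_complex_of_real scaleC_of_real)
        moreover have "(0::'a)\<^sup>\<dagger> = 0" using norm_adj[of "0::'a"] by simp
        ultimately show ?thesis by (simp add: h_def)
      qed
      have e: "(\<Sum>l=1..M + N. h l y * X l y + (h l y)\<^sup>\<dagger> * Y l y)
           = normal_density x \<sigma> y *\<^sub>R (\<eta> * X l y + \<eta>\<^sup>\<dagger> * Y l y)" for X Y :: "nat \<Rightarrow> real \<Rightarrow> 'a" and y
      proof -
        have "(\<Sum>j=1..M + N. h j y * X j y + (h j y)\<^sup>\<dagger> * Y j y)
          = (\<Sum>j=1..M + N. if j = l then normal_density x \<sigma> y *\<^sub>R (\<eta> * X j y + \<eta>\<^sup>\<dagger> * Y j y) else 0)"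
          by (intro sum.cong refl) (simp add: hd, simp add: h_def scaleR_add_right)
        then show ?thesis using l by (simp add: sum.delta)
      qed
      ultimately have "((\<lambda>y. normal_density x \<sigma> y *\<^sub>R (\<eta> * A l y + \<eta>\<^sup>\<dagger> * B l y)
          - normal_density x \<sigma> y *\<^sub>R (\<eta> * A' l y + \<eta>\<^sup>\<dagger> * B' l y)) has_integral v - v) UNIV"
        using v(2) v'(2) unfolding e by (intro has_integral_diff) auto
      then show "((\<lambda>y. normal_density x \<sigma> y *\<^sub>R (\<eta> * (U y - U' y) + \<eta>\<^sup>\<dagger> * (V y - V' y))) has_integral 0) UNIV"
        by (simp add: defs algebra_simps)
    qed
    define a where "a = \<theta> * (U x - U' x)"
    define b where "b = \<theta>\<^sup>\<dagger> * (V x - V' x)"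
    have 1: "a + b = 0" using main[OF th] by (simp add: a_def b_def)
    have "\<i> *\<^sub>C a + (- \<i>) *\<^sub>C b = 0"
      using main[OF homog_scaleC[OF th, of \<i>]]
      by (simp only: a_def b_def adj_scaleC scaleC_mult_left complex_cnj_i)
    then have "(- \<i>) *\<^sub>C (\<i> *\<^sub>C a + (- \<i>) *\<^sub>C b) = (- \<i>) *\<^sub>C (0 *\<^sub>C a)"
      using scaleC_of_real[of 0 a] by simp
    then have 2: "1 *\<^sub>C a + (- 1) *\<^sub>C b = 0 *\<^sub>C a" by (simp add: scaleC_add_right scaleC_scaleC)
    have "1 *\<^sub>C a = a" "(-1) *\<^sub>C b = - b" "0 *\<^sub>C a = 0"
      using scaleC_of_real[of 1 a] scaleC_of_real[of "-1" b] scaleC_of_real[of 0 a] by simp_all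
    with 2 have "a = b" by simp
    with 1 have "2 *\<^sub>R a = 0" by (simp add: scaleR_2)
    with \<open>a = b\<close> show ?thesis by (simp add: a_def b_def)
  qed
  have "U x = U' x \<and> V x = V' x" for x
  proof (cases "grade M N l")
    case zero
    have one: "(1::'a)\<^sup>\<dagger> = 1" using adj_mult[of "1::'a" "1\<^sup>\<dagger>"] by (simp add: adj_adj)
    show ?thesis using test[of 1 x] homog_one zero by (simp add: one)
  next
    case one
    then have "N \<noteq> 0" by (auto simp: grade_def split: if_splits)
    then have sep': "odd_separating TYPE('a)" using sep by simp
    have "\<theta> * (U x - U' x) = 0" "\<theta> * (V x - V' x) = 0" if "\<theta> \<in> homog 1" for \<theta>
      using test[of \<theta> x] test[of "\<theta>\<^sup>\<dagger>" x] that adj_homog[of \<theta> 1] one by (auto simp: adj_adj)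
    then have "U x - U' x = 0" "V x - V' x = 0" using sep' unfolding odd_separating_def by blast+
    then show ?thesis by simp
  qed
  then show ?thesis by (auto simp: defs)
qed

lemma has_poisson_unique:
  fixes F :: "'a::banach_superalgebra config \<Rightarrow> 'a"
  assumes sep: "N = 0 \<or> odd_separating TYPE('a)"
    and v: "has_poisson M N p F G \<phi> v" and w: "has_poisson M N p F G \<phi> w"
  shows "v = w"
proof -
  obtain A B C D where 1: "is_gradient M N F \<phi> A B" "is_gradient M N G \<phi> C D"
    "((\<lambda>x. \<i> *\<^sub>C (\<Sum>l=1..M + N. gsign (p * grade M N l) *
            (gsign (grade M N l) * A l x * D l x - B l x * C l x))) has_integral v) UNIV"
    using v unfolding has_poisson_def by blast
  obtain A' B' C' D' where 2: "is_gradient M N F \<phi> A' B'" "is_gradient M N G \<phi> C' D'"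
    "((\<lambda>x. \<i> *\<^sub>C (\<Sum>l=1..M + N. gsign (p * grade M N l) *
            (gsign (grade M N l) * A' l x * D' l x - B' l x * C' l x))) has_integral w) UNIV"
    using w unfolding has_poisson_def by blast
  have e: "A l = A' l \<and> B l = B' l \<and> C l = C' l \<and> D l = D' l" if "l \<in> {1..M + N}" for l
    using is_gradient_unique[OF sep 1(1) 2(1) that] is_gradient_unique[OF sep 1(2) 2(2) that] by simp
  have eq: "(\<lambda>x. \<i> *\<^sub>C (\<Sum>l=1..M + N. gsign (p * grade M N l) *
            (gsign (grade M N l) * A l x * D l x - B l x * C l x)))
      = (\<lambda>x. \<i> *\<^sub>C (\<Sum>l=1..M + N. gsign (p * grade M N l) *
            (gsign (grade M N l) * A' l x * D' l x - B' l x * C' l x)))"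
    using e by (intro ext arg_cong[where f = "scaleC \<i>"] sum.cong) auto
  show ?thesis by (rule has_integral_unique[OF 1(3)[unfolded eq] 2(3)])
qed


section \<open>Matrices and graded tensor products\<close>

text \<open>Matrices are indexed from 1; their size is an argument of the operations.\<close>

definition mone :: "nat \<Rightarrow> nat \<Rightarrow> 'b::semiring_1" where
  "mone a b = (if a = b then 1 else 0)"

definition elem_mat :: "nat \<Rightarrow> nat \<Rightarrow> nat \<Rightarrow> nat \<Rightarrow> 'b::semiring_1" where
  "elem_mat j k a b = (if a = j \<and> b = k then 1 else 0)"

definition mmul :: "nat \<Rightarrow> (nat \<Rightarrow> nat \<Rightarrow> 'b::semiring_1) \<Rightarrow> (nat \<Rightarrow> nat \<Rightarrow> 'b) \<Rightarrow> nat \<Rightarrow> nat \<Rightarrow> 'b" where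
  "mmul n A B a b = (\<Sum>c=1..n. A a c * B c b)"

primrec mpow :: "nat \<Rightarrow> (nat \<Rightarrow> nat \<Rightarrow> 'b::semiring_1) \<Rightarrow> nat \<Rightarrow> nat \<Rightarrow> nat \<Rightarrow> 'b" where
  "mpow n A 0 = mone"
| "mpow n A (Suc k) = mmul n A (mpow n A k)"

definition mexp :: "nat \<Rightarrow> (nat \<Rightarrow> nat \<Rightarrow> complex) \<Rightarrow> nat \<Rightarrow> nat \<Rightarrow> complex" where
  "mexp n A a b = (\<Sum>k. mpow n A k a b / fact k)"

definition cmat :: "(nat \<Rightarrow> nat \<Rightarrow> complex) \<Rightarrow> nat \<Rightarrow> nat \<Rightarrow> 'a::banach_superalgebra" where
  "cmat A a b = A a b *\<^sub>C 1"

text \<open>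
  \<open>X a b c d\<close> is the coefficient of \<open>E\<^sub>a\<^sub>b \<otimes> E\<^sub>c\<^sub>d\<close>.  Coefficients commute with the elementary
  matrices, and \<open>(E\<^sub>a\<^sub>e \<otimes> E\<^sub>c\<^sub>f)(E\<^sub>e\<^sub>b \<otimes> E\<^sub>f\<^sub>d)\<close> is \<open>E\<^sub>a\<^sub>b \<otimes> E\<^sub>c\<^sub>d\<close> with the sign of moving
  \<open>E\<^sub>c\<^sub>f\<close> past \<open>E\<^sub>e\<^sub>b\<close>.
\<close>
type_synonym 'b tensor = "nat \<Rightarrow> nat \<Rightarrow> nat \<Rightarrow> nat \<Rightarrow> 'b"

definition tmul :: "nat \<Rightarrow> nat \<Rightarrow> 'b::ring_1 tensor \<Rightarrow> 'b tensor \<Rightarrow> 'b tensor" where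
  "tmul M N X Y a b c d =
     (\<Sum>e=1..M + N. \<Sum>f=1..M + N.
        gsign ((grade M N c + grade M N f) * (grade M N e + grade M N b)) *
        X a e c f * Y e b f d)"

definition tcomm :: "nat \<Rightarrow> nat \<Rightarrow> 'b::ring_1 tensor \<Rightarrow> 'b tensor \<Rightarrow> 'b tensor" where
  "tcomm M N X Y a b c d = tmul M N X Y a b c d - tmul M N Y X a b c d"

definition leg1 :: "(nat \<Rightarrow> nat \<Rightarrow> 'b::ring_1) \<Rightarrow> 'b tensor" where
  "leg1 U a b c d = U a b * mone c d"

definition leg2 :: "(nat \<Rightarrow> nat \<Rightarrow> 'b::ring_1) \<Rightarrow> 'b tensor" where
  "leg2 U a b c d = mone a b * U c d"

definition tensor_mat ::
  "nat \<Rightarrow> nat \<Rightarrow> (nat \<Rightarrow> nat \<Rightarrow> 'b::ring_1) \<Rightarrow> (nat \<Rightarrow> nat \<Rightarrow> 'b) \<Rightarrow> 'b tensor" where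
  "tensor_mat M N U V = tmul M N (leg1 U) (leg2 V)"

definition P12 :: "nat \<Rightarrow> nat \<Rightarrow> 'b::ring_1 tensor" where
  "P12 M N a b c d =
     (\<Sum>i=1..M + N. \<Sum>j=1..M + N. gsign (grade M N j) * elem_mat i j a b * elem_mat j i c d)"

text \<open>\<open>{U\<^sub>1, W\<^sub>2} = V\<close> for even \<open>(M + N) \<times> (M + N)\<close> matrices of functionals.\<close>
definition has_poisson_mat ::
  "nat \<Rightarrow> nat \<Rightarrow> ('a::banach_superalgebra config \<Rightarrow> nat \<Rightarrow> nat \<Rightarrow> 'a) \<Rightarrow>
   ('a config \<Rightarrow> nat \<Rightarrow> nat \<Rightarrow> 'a) \<Rightarrow> 'a config \<Rightarrow> 'a tensor \<Rightarrow> bool" where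
  "has_poisson_mat M N U W \<phi> V \<longleftrightarrow>
     (\<forall>a\<in>{1..M + N}. \<forall>b\<in>{1..M + N}. \<forall>c\<in>{1..M + N}. \<forall>d\<in>{1..M + N}.
        has_poisson M N (grade M N a + grade M N b) (\<lambda>\<psi>. U \<psi> a b) (\<lambda>\<psi>. W \<psi> c d) \<phi> (V a b c d))"


section \<open>The monodromy matrix\<close>

definition Sigma_mat :: "nat \<Rightarrow> nat \<Rightarrow> nat \<Rightarrow> nat \<Rightarrow> complex" where
  "Sigma_mat M N a b = mone a b - 2 * elem_mat (M + N + 1) (M + N + 1) a b"

definition Omega_mat ::
  "nat \<Rightarrow> nat \<Rightarrow> real \<Rightarrow> 'a::banach_superalgebra config \<Rightarrow> real \<Rightarrow> nat \<Rightarrow> nat \<Rightarrow> 'a" where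
  "Omega_mat M N g \<phi> x a b = (\<i> * complex_of_real (sqrt g)) *\<^sub>C
     (\<Sum>j=1..M + N. \<phi> j x * elem_mat j (M + N + 1) a b - (\<phi> j x)\<^sup>\<dagger> * elem_mat (M + N + 1) j a b)"

definition Lax_mat ::
  "nat \<Rightarrow> nat \<Rightarrow> real \<Rightarrow> complex \<Rightarrow> 'a::banach_superalgebra config \<Rightarrow> real \<Rightarrow> nat \<Rightarrow> nat \<Rightarrow> 'a" where
  "Lax_mat M N g \<zeta> \<phi> x a b =
     cmat (\<lambda>a b. \<i> * \<zeta> / 2 * Sigma_mat M N a b) a b + Omega_mat M N g \<phi> x a b"

text \<open>
  With \<open>{\<phi>\<^sub>j(x), \<phi>\<^sub>k\<^sup>\<dagger>(y)} = \<i> \<delta>\<^sub>j\<^sub>k \<delta>(x - y)\<close> this Lax matrix satisfies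
  \<open>{L\<^sub>1(\<zeta>; x), L\<^sub>2(\<mu>; y)} = - g / (\<zeta> - \<mu>) [P\<^sub>1\<^sub>2, L\<^sub>1(\<zeta>; x) + L\<^sub>2(\<mu>; x)] \<delta>(x - y)\<close>.
  The minus sign carries over to the bracket of the entries of the monodromy matrix; it
  disappears if the sign of the Poisson bracket is reversed.
\<close>

definition E_mat :: "nat \<Rightarrow> nat \<Rightarrow> complex \<Rightarrow> real \<Rightarrow> nat \<Rightarrow> nat \<Rightarrow> complex" where
  "E_mat M N \<zeta> x = mexp (M + N + 1) (\<lambda>a b. \<i> * complex_of_real x * \<zeta> / 2 * Sigma_mat M N a b)"

definition is_transfer ::
  "nat \<Rightarrow> nat \<Rightarrow> real \<Rightarrow> complex \<Rightarrow> 'a::banach_superalgebra config \<Rightarrow> real \<Rightarrow>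
   (real \<Rightarrow> nat \<Rightarrow> nat \<Rightarrow> 'a) \<Rightarrow> bool" where
  "is_transfer M N g \<zeta> \<phi> y X \<longleftrightarrow>
     (\<forall>a\<in>{1..M + N + 1}. \<forall>b\<in>{1..M + N + 1}. X y a b = mone a b \<and>
        (\<forall>x\<ge>y. ((\<lambda>s. X s a b) has_vector_derivative
                  mmul (M + N + 1) (Lax_mat M N g \<zeta> \<phi> x) (X x) a b) (at x within {y..})))"

definition transfer_mat ::
  "nat \<Rightarrow> nat \<Rightarrow> real \<Rightarrow> complex \<Rightarrow> 'a::banach_superalgebra config \<Rightarrow> real \<Rightarrow> real \<Rightarrow>
   nat \<Rightarrow> nat \<Rightarrow> 'a" where
  "transfer_mat M N g \<zeta> \<phi> x y = (SOME X. is_transfer M N g \<zeta> \<phi> y X) x"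

definition dressed_transfer ::
  "nat \<Rightarrow> nat \<Rightarrow> real \<Rightarrow> complex \<Rightarrow> 'a::banach_superalgebra config \<Rightarrow> real \<Rightarrow> real \<Rightarrow>
   nat \<Rightarrow> nat \<Rightarrow> 'a" where
  "dressed_transfer M N g \<zeta> \<phi> x y =
     mmul (M + N + 1) (mmul (M + N + 1) (cmat (E_mat M N \<zeta> (- x))) (transfer_mat M N g \<zeta> \<phi> x y))
       (cmat (E_mat M N \<zeta> y))"

text \<open>
  The limit is taken entry by entry, because the entries extend off the real \<open>\<zeta>\<close>-axis to different
  half-planes: \<open>T\<^sub>K\<^sub>+\<^sub>1\<^sub>,\<^sub>K\<^sub>+\<^sub>1(\<zeta>)\<close> exists for \<open>Im \<zeta> \<ge> 0\<close> and the \<open>K \<times> K\<close> block for \<open>Im \<zeta> \<le> 0\<close>.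
\<close>
definition monodromy_converges ::
  "nat \<Rightarrow> nat \<Rightarrow> real \<Rightarrow> complex \<Rightarrow> 'a::banach_superalgebra config \<Rightarrow> nat \<Rightarrow> nat \<Rightarrow> bool" where
  "monodromy_converges M N g \<zeta> \<phi> a b \<longleftrightarrow>
     (\<exists>l. ((\<lambda>(x, y). dressed_transfer M N g \<zeta> \<phi> x y a b) \<longlongrightarrow> l) (at_top \<times>\<^sub>F at_bot))"

definition monodromy ::
  "nat \<Rightarrow> nat \<Rightarrow> real \<Rightarrow> complex \<Rightarrow> 'a::banach_superalgebra config \<Rightarrow> nat \<Rightarrow> nat \<Rightarrow> 'a" where
  "monodromy M N g \<zeta> \<phi> a b =
     Lim (at_top \<times>\<^sub>F at_bot) (\<lambda>(x, y). dressed_transfer M N g \<zeta> \<phi> x y a b)"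

definition D_fun ::
  "nat \<Rightarrow> nat \<Rightarrow> real \<Rightarrow> complex \<Rightarrow> 'a::banach_superalgebra config \<Rightarrow> 'a" where
  "D_fun M N g \<zeta> \<phi> = monodromy M N g \<zeta> \<phi> (M + N + 1) (M + N + 1)"

definition t_mat ::
  "nat \<Rightarrow> nat \<Rightarrow> real \<Rightarrow> complex \<Rightarrow> 'a::banach_superalgebra config \<Rightarrow> nat \<Rightarrow> nat \<Rightarrow> 'a" where
  "t_mat M N g \<zeta> \<phi> a b =
     (if a \<in> {1..M + N} \<and> b \<in> {1..M + N} then monodromy M N g \<zeta> \<phi> a b else 0)"

text \<open>
  Expansions in inverse powers of \<open>\<zeta>\<close> are asymptotic (in general they diverge), for \<open>\<zeta> \<rightarrow> \<infinity>\<close> in the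
  closed upper half-plane.
\<close>
definition uhp_infinity :: "complex filter" where
  "uhp_infinity = inf at_infinity (principal {\<zeta>. 0 \<le> Im \<zeta>})"

definition has_inverse_expansion :: "(complex \<Rightarrow> 'a::banach_superalgebra) \<Rightarrow> (nat \<Rightarrow> 'a) \<Rightarrow> bool" where
  "has_inverse_expansion f d \<longleftrightarrow>
     (\<forall>n. ((\<lambda>\<zeta>. \<zeta> ^ n *\<^sub>C (f \<zeta> - (\<Sum>k\<le>n. inverse (\<zeta> ^ k) *\<^sub>C d k))) \<longlongrightarrow> 0) uhp_infinity)"

definition D_coeff ::
  "nat \<Rightarrow> nat \<Rightarrow> real \<Rightarrow> nat \<Rightarrow> 'a::banach_superalgebra config \<Rightarrow> 'a" where
  "D_coeff M N g n \<phi> = (THE d. has_inverse_expansion (\<lambda>\<zeta>. D_fun M N g \<zeta> \<phi>) d) n"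


section \<open>The functionals \<open>N\<close>, \<open>P\<close>, \<open>H\<close>\<close>

definition field_density :: "nat \<Rightarrow> nat \<Rightarrow> 'a::banach_superalgebra config \<Rightarrow> real \<Rightarrow> 'a" where
  "field_density M N \<phi> x = (\<Sum>j=1..M + N. (\<phi> j x)\<^sup>\<dagger> * \<phi> j x)"

definition number_fun :: "nat \<Rightarrow> nat \<Rightarrow> 'a::banach_superalgebra config \<Rightarrow> 'a" where
  "number_fun M N \<phi> = integral UNIV (field_density M N \<phi>)"

definition momentum_fun :: "nat \<Rightarrow> nat \<Rightarrow> 'a::banach_superalgebra config \<Rightarrow> 'a" where
  "momentum_fun M N \<phi> =
     integral UNIV (\<lambda>x. \<Sum>j=1..M + N. (\<phi> j x)\<^sup>\<dagger> * vector_derivative (\<phi> j) (at x))"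

definition hamiltonian_fun :: "nat \<Rightarrow> nat \<Rightarrow> real \<Rightarrow> 'a::banach_superalgebra config \<Rightarrow> 'a" where
  "hamiltonian_fun M N g \<phi> =
     integral UNIV (\<lambda>x. \<Sum>j=1..M + N.
       vector_derivative (\<lambda>y. (\<phi> j y)\<^sup>\<dagger>) (at x) * vector_derivative (\<phi> j) (at x))
     + g *\<^sub>R integral UNIV (\<lambda>x. (field_density M N \<phi> x)\<^sup>2)"

definition smeared :: "nat \<Rightarrow> (real \<Rightarrow> real) \<Rightarrow> 'a::banach_superalgebra config \<Rightarrow> 'a" where
  "smeared j f \<phi> = integral UNIV (\<lambda>x. f x *\<^sub>R \<phi> j x)"

text \<open>
  The right-hand side of the nonlinear super-Schroedinger equation.  With the bracket
  \<open>{\<phi>\<^sub>j(x), \<phi>\<^sub>k\<^sup>\<dagger>(y)} = \<i> \<delta>\<^sub>j\<^sub>k \<delta>(x - y)\<close>, the equation \<open>\<i> \<partial>\<^sub>t \<phi>\<^sub>j = nlss \<dots> \<phi> j\<close> is \<open>\<partial>\<^sub>t \<phi>\<^sub>j = {H, \<phi>\<^sub>j}\<close>.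
\<close>
definition nlss :: "nat \<Rightarrow> nat \<Rightarrow> real \<Rightarrow> 'a::banach_superalgebra config \<Rightarrow> nat \<Rightarrow> real \<Rightarrow> 'a" where
  "nlss M N g \<phi> j x =
     - vector_derivative (\<lambda>y. vector_derivative (\<phi> j) (at y)) (at x)
     + (2 * g) *\<^sub>R (field_density M N \<phi> x * \<phi> j x)"

end

theory Submission
  imports Defs
begin

text \<open>
  The entries \<open>T\<^sub>a\<^sub>b\<close> with \<open>a, b\<close> in the same diagonal block are limits of Jost solutions: of the column
  \<open>L\<close> normalised at \<open>- \<infinity>\<close> and of the row \<open>R\<close> normalised at \<open>+ \<infinity>\<close>.  For two configurations,
  \<open>\<Sum>\<^sub>e R\<^sub>e L\<^sub>e\<close> (row of the first, column of the second) interpolates between the two values of \<open>T\<^sub>a\<^sub>b\<close>, so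
  the difference of these values is the integral of \<open>R (\<Omega>' - \<Omega>) L\<close>, and the functional derivatives
  of \<open>T\<^sub>a\<^sub>b\<close> are products of components of \<open>R\<close> and \<open>L\<close>.  The integrand of a Poisson bracket is then
  the derivative of a signed quadrilinear expression in two rows and two columns, whose limits at
  \<open>\<plusminus> \<infinity>\<close> give the brackets.

  Inserting a series in \<open>\<zeta>\<^sup>-\<^sup>1\<close> into the equation of the last column determines the coefficients of
  \<open>D\<close>; a Gronwall estimate shows that the series is asymptotic, and its first terms are polynomials in
  \<open>N\<close>, \<open>P\<close> and \<open>H\<close>.  Along the imaginary axis the Jost solutions, hence the gradients and the
  integrands of the brackets, have expansions uniform in \<open>x\<close>, so that the brackets of the
  coefficients are obtained by comparing powers of \<open>\<zeta>\<close>.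
\<close>

section \<open>Arithmetic in a graded Banach algebra\<close>

text \<open>Two facts carry the analysis. Dividing a solution by the exponential of its own index
  leaves a diagonal part with nonpositive real part, so the Gronwall constant depends only on the
  size of the fields and not on \<zeta>; the same estimate then yields the Jost solutions, their
  dependence on the fields, and the asymptotics for large \<zeta>. And the potential is dominated by
  a multiple of \<open>1 / (1 + x\<^sup>2)\<close>, whose primitive is \<open>arctan\<close>;
  comparing derivatives replaces measure theory for functions with values in an arbitrary Banach
  algebra. The primitive of the bracket integrand exists because \<Omega> does not contain the
  spectral parameter: its contributions cancel in pairs once the graded entries have been reordered,
  and the diagonal terms leave \<zeta> - \<mu> times the product of the gradients. Hence the
  denominator \<zeta> - \<mu>, and a separate argument for \<zeta> = \<mu>. In the bracket of D with
  t the boundary terms consist of components in the other block, which decay only off the real axis;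
  hence the condition that \<zeta> and \<mu> are not both real.\<close>

interpretation scaleC: bounded_bilinear "scaleC :: complex \<Rightarrow> 'a \<Rightarrow> 'a::banach_superalgebra"
proof
  fix a b :: complex and x y :: 'a and r :: real
  have c: "complex_of_real r * a = a * complex_of_real r" by simp
  show "(a + b) *\<^sub>C x = a *\<^sub>C x + b *\<^sub>C x" by (rule scaleC_add_left)
  show "a *\<^sub>C (x + y) = a *\<^sub>C x + a *\<^sub>C y" by (rule scaleC_add_right)
  show "(r *\<^sub>R a) *\<^sub>C x = r *\<^sub>R (a *\<^sub>C x)"
    by (simp add: scaleR_conv_of_real[of r a] scaleC_of_real[of r "a *\<^sub>C x", symmetric] scaleC_scaleC)
  show "a *\<^sub>C (r *\<^sub>R x) = r *\<^sub>R (a *\<^sub>C x)"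
    by (simp only: scaleC_of_real[of r x, symmetric] scaleC_of_real[of r "a *\<^sub>C x", symmetric] scaleC_scaleC c)
  show "\<exists>K. \<forall>a (x::'a). norm (a *\<^sub>C x) \<le> norm a * norm x * K"
    by (rule exI[of _ 1]) (simp add: norm_scaleC)
qed

lemma scaleC_one [simp]: "1 *\<^sub>C (x::'a::banach_superalgebra) = x"
  using scaleC_of_real[of 1 x] by simp

lemma scaleC_minus1: "(- 1) *\<^sub>C (x::'a::banach_superalgebra) = - x"
  by (simp add: scaleC.minus_left)

lemma scaleR_eq_scaleC: "r *\<^sub>R (x::'a::banach_superalgebra) = complex_of_real r *\<^sub>C x"
  by (simp add: scaleC_of_real)

lemma adj_scaleR: "(r *\<^sub>R (x::'a::banach_superalgebra))\<^sup>\<dagger> = r *\<^sub>R x\<^sup>\<dagger>"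
  by (simp add: scaleR_eq_scaleC adj_scaleC)

lemma bounded_linear_adj: "bounded_linear (adj :: 'a \<Rightarrow> 'a::banach_superalgebra)"
  by (rule bounded_linear_intro[where K = 1]) (simp_all add: adj_add adj_scaleR norm_adj)

lemmas adj_zero [simp] = linear_0[OF bounded_linear.linear[OF bounded_linear_adj]]
  and adj_minus = linear_neg[OF bounded_linear.linear[OF bounded_linear_adj]]
  and adj_diff = linear_diff[OF bounded_linear.linear[OF bounded_linear_adj]]
  and adj_sum = linear_sum[OF bounded_linear.linear[OF bounded_linear_adj]]
  and adj_tendsto = bounded_linear.tendsto[OF bounded_linear_adj]
  and adj_continuous_on = bounded_linear.continuous_on[OF bounded_linear_adj]
  and adj_has_vector_derivative = bounded_linear.has_vector_derivative[OF bounded_linear_adj]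

lemma adj_one [simp]: "(1::'a::banach_superalgebra)\<^sup>\<dagger> = 1"
  using adj_mult[of "1::'a" "1\<^sup>\<dagger>"] by (simp add: adj_adj)

text \<open>Closed subspaces are what limits, integrals and derivatives of curves cannot leave; this
  is how the grading is carried through the analysis.\<close>

definition closed_space :: "'a::real_normed_vector set \<Rightarrow> bool" where
  "closed_space S \<longleftrightarrow> closed S \<and> subspace S"

text \<open>No axiom puts 0 into the graded parts. The decomposition shows that they are nonempty,
  and scaling an element by 0 stays inside.\<close>

lemma homog_zero [simp]: "(0::'a::banach_superalgebra) \<in> homog p"
proof -
  obtain y z :: 'a where "y \<in> homog 0" "z \<in> homog 1" using homog_decomp[of "0::'a"] by blast
  then obtain x :: 'a where "x \<in> homog p" by (cases p) auto
  then have "0 *\<^sub>C x \<in> homog p" by (rule homog_scaleC)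
  then show ?thesis by (simp add: scaleC.zero_left)
qed

lemma closed_space_homog: "closed_space (homog p :: 'a::banach_superalgebra set)"
  unfolding closed_space_def subspace_def
  by (auto simp: homog_closed scaleR_eq_scaleC intro: homog_add homog_scaleC)

lemma homog_scaleR: "(x::'a::banach_superalgebra) \<in> homog p \<Longrightarrow> r *\<^sub>R x \<in> homog p"
  and homog_minus: "x \<in> homog p \<Longrightarrow> - x \<in> homog p"
  and homog_diff: "x \<in> homog p \<Longrightarrow> y \<in> homog p \<Longrightarrow> x - y \<in> homog p"
  and homog_sum: "(\<And>i. i \<in> I \<Longrightarrow> f i \<in> homog p) \<Longrightarrow> sum f I \<in> homog p"
  using closed_space_homog[of p] unfolding closed_space_def
  by (auto intro: subspace_scale subspace_neg subspace_diff subspace_sum)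

lemma homog_mult': "(x::'a::banach_superalgebra) \<in> homog p \<Longrightarrow> y \<in> homog q \<Longrightarrow> p + q = r \<Longrightarrow> x * y \<in> homog r"
  using homog_mult by auto

lemma gsign_mult: "gsign p * gsign q = (gsign (p + q) :: 'a::ring_1)"
  by (cases p; cases q) (simp_all add: gsign_def)

lemma gsign_commute: "gsign p * (x::'a::ring_1) = x * gsign p"
  by (simp add: gsign_def)

lemma gsign_homog: "(x::'a::banach_superalgebra) \<in> homog q \<Longrightarrow> gsign p * x \<in> homog q"
  by (simp add: gsign_def homog_minus)

lemma gsign_commute_homog:
  "(x::'a::banach_superalgebra) \<in> homog p \<Longrightarrow> y \<in> homog q \<Longrightarrow> x * y = gsign (p * q) * (y * x)"
  using supercommute[of x p y q] by (cases p; cases q) (simp_all add: gsign_def)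

lemma norm_gsign_mult [simp]: "norm (gsign p * (x::'a::real_normed_algebra_1)) = norm x"
  by (simp add: gsign_def)

lemma norm_mult_le:
  "norm (x::'a::real_normed_algebra) \<le> a \<Longrightarrow> norm y \<le> b \<Longrightarrow> norm (x * y) \<le> a * b"
  by (meson norm_mult_ineq mult_mono norm_ge_zero order_trans)

section \<open>Integration over the line\<close>

text \<open>Mean value inequality against a majorant \<open>\<psi>\<close>, which is often a
  multiple of \<open>arctan\<close>. The one-point interval is split off because the general
  inequality wants a proper interval.\<close>

lemma norm_diff_le_by_derivative:
  fixes f :: "real \<Rightarrow> 'a::real_normed_vector" and \<psi> :: "real \<Rightarrow> real"
  assumes "a \<le> b"
    and "\<And>x. a \<le> x \<Longrightarrow> x \<le> b \<Longrightarrow> (f has_vector_derivative f' x) (at x within {a..b})"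
    and "\<And>x. a \<le> x \<Longrightarrow> x \<le> b \<Longrightarrow> (\<psi> has_vector_derivative \<psi>' x) (at x within {a..b})"
    and "\<And>x. a \<le> x \<Longrightarrow> x \<le> b \<Longrightarrow> norm (f' x) \<le> \<psi>' x"
  shows "norm (f b - f a) \<le> \<psi> b - \<psi> a"
proof (cases "a = b")
  case False
  then have ab: "a < b" using assms(1) by simp
  have wi: "at x within {a..b} = at x" if "a < x" "x < b" for x
    using that by (intro at_within_interior) simp
  show ?thesis
  proof (rule differentiable_bound_general[OF ab])
    show "continuous_on {a..b} f" "continuous_on {a..b} \<psi>"
      using assms(2,3) by (auto intro!: continuous_on_vector_derivative)
    fix x assume x: "a < x" "x < b"
    show "(f has_vector_derivative f' x) (at x)" "(\<psi> has_vector_derivative \<psi>' x) (at x)"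
      using assms(2,3)[of x] x wi[of x] by auto
    show "norm (f' x) \<le> \<psi>' x" using assms(4) x by simp
  qed
qed simp

text \<open>A tagged Riemann sum of values in a subspace stays in it, so an integral lies in the
  closure. The argument is run twice: for boxes, and for the exhaustion of the line by
  boxes.\<close>

lemma has_integral_closed_space:
  fixes f :: "real \<Rightarrow> 'a::banach"
  assumes f: "(f has_integral v) S" and V: "closed_space V" and fV: "\<And>x. x \<in> S \<Longrightarrow> f x \<in> V"
  shows "v \<in> V"
proof -
  have cl: "closed V" and sub: "subspace V" using V by (auto simp: closed_space_def)
  have box: "w \<in> V" if w: "(h has_integral w) (cbox a b)" and hV: "\<And>x. h x \<in> V"
    for h :: "real \<Rightarrow> 'a" and w a b
  proof -
    have "\<exists>u\<in>V. dist u w < e" if e: "e > 0" for e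
    proof -
      obtain \<gamma> where g: "gauge \<gamma>" "\<And>\<D>. \<D> tagged_division_of (cbox a b) \<Longrightarrow> \<gamma> fine \<D> \<Longrightarrow>
          norm ((\<Sum>(x, k)\<in>\<D>. measure lborel k *\<^sub>R h x) - w) < e"
        using iffD1[OF has_integral w, rule_format, OF e] by metis
      obtain p where p: "p tagged_division_of (cbox a b)" "\<gamma> fine p"
        using fine_division_exists[OF g(1)] by blast
      have "(\<Sum>(x, k)\<in>p. measure lborel k *\<^sub>R h x) \<in> V"
        unfolding split_def by (intro subspace_sum[OF sub] subspace_scale[OF sub] hV)
      then show ?thesis using g(2)[OF p] unfolding dist_norm by blast
    qed
    then have "w \<in> closure V" by (simp add: closure_approachable)
    then show ?thesis using cl by simp
  qed
  let ?h = "\<lambda>x. if x \<in> S then f x else 0"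
  have hV: "?h x \<in> V" for x using fV subspace_0[OF sub] by auto
  have "\<exists>u\<in>V. dist u v < e" if e: "e > 0" for e
  proof -
    obtain B where B: "B > 0" "\<And>a b. ball 0 B \<subseteq> cbox a b \<Longrightarrow>
        \<exists>z. (?h has_integral z) (cbox a b) \<and> norm (z - v) < e"
      using iffD1[OF has_integral' f, rule_format, OF e] by auto
    have "ball 0 B \<subseteq> cbox (- B) B" by (auto simp: dist_real_def)
    then obtain z where z: "(?h has_integral z) (cbox (- B) B)" "norm (z - v) < e" using B(2) by blast
    then show ?thesis using box[OF z(1) hV] by (auto simp: dist_norm)
  qed
  then have "v \<in> closure V" by (simp add: closure_approachable)
  then show ?thesis using cl by simp
qed

lemma has_vector_derivative_closed_space:
  fixes f :: "real \<Rightarrow> 'a::real_normed_vector"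
  assumes f: "(f has_vector_derivative v) (at x)" and V: "closed_space V" and fV: "\<And>x. f x \<in> V"
  shows "v \<in> V"
proof -
  have cl: "closed V" and sub: "subspace V" using V by (auto simp: closed_space_def)
  have "((\<lambda>h. (f (x + h) - f x) /\<^sub>R h) \<longlongrightarrow> v) (at 0)"
  proof (rule LIM_zero_cancel, rule tendsto_norm_zero_cancel)
    have "((\<lambda>h. norm (f (x + h) - f x - h *\<^sub>R v) / norm h) \<longlongrightarrow> 0) (at 0)"
      using f unfolding has_vector_derivative_def has_derivative_at by blast
    moreover have "\<forall>\<^sub>F h in at 0. norm (f (x + h) - f x - h *\<^sub>R v) / norm h
        = norm ((f (x + h) - f x) /\<^sub>R h - v)"
      unfolding eventually_at_filter
    proof (intro always_eventually allI impI)
      fix h :: real assume h: "h \<noteq> 0"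
      have "(f (x + h) - f x) /\<^sub>R h - v = inverse h *\<^sub>R (f (x + h) - f x - h *\<^sub>R v)"
        using h by (simp add: scaleR_diff_right[of "inverse h" _ "h *\<^sub>R v"])
      then have "norm ((f (x + h) - f x) /\<^sub>R h - v) = norm (inverse h) * norm (f (x + h) - f x - h *\<^sub>R v)"
        by (simp only: norm_scaleR real_norm_def)
      then show "norm (f (x + h) - f x - h *\<^sub>R v) / norm h = norm ((f (x + h) - f x) /\<^sub>R h - v)"
        by (simp only: divide_inverse norm_inverse mult.commute)
    qed
    ultimately show "((\<lambda>h. norm ((f (x + h) - f x) /\<^sub>R h - v)) \<longlongrightarrow> 0) (at 0)"
      by (rule Lim_transform_eventually)
  qed
  moreover have "(f (x + h) - f x) /\<^sub>R h \<in> V" for h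
    by (rule subspace_scale[OF sub subspace_diff[OF sub fV fV]])
  ultimately show ?thesis
    using Lim_in_closed_set[OF cl, of "\<lambda>h. (f (x + h) - f x) /\<^sub>R h" "at 0" v] by simp
qed

text \<open>The gauge integral over the line is already the improper one, so limits of the primitive
  at both ends determine it.\<close>

lemma has_integral_FTC_UNIV:
  fixes F :: "real \<Rightarrow> 'a::banach"
  assumes F: "\<And>x. (F has_vector_derivative f x) (at x)"
    and top: "(F \<longlongrightarrow> u) at_top" and bot: "(F \<longlongrightarrow> v) at_bot"
  shows "(f has_integral (u - v)) UNIV"
proof (subst has_integral', intro allI impI)
  fix e :: real assume e: "e > 0"
  obtain b1 where b1: "\<And>x. x \<ge> b1 \<Longrightarrow> dist (F x) u < e / 2"
    using tendstoD[OF top, of "e / 2"] e by (auto simp: eventually_at_top_linorder)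
  obtain b2 where b2: "\<And>x. x \<le> b2 \<Longrightarrow> dist (F x) v < e / 2"
    using tendstoD[OF bot, of "e / 2"] e by (auto simp: eventually_at_bot_linorder)
  define B where "B = \<bar>b1\<bar> + \<bar>b2\<bar> + 1"
  have "\<exists>z. ((\<lambda>x. if x \<in> UNIV then f x else 0) has_integral z) (cbox a b) \<and> norm (z - (u - v)) < e"
    if ab: "ball 0 B \<subseteq> cbox a b" for a b
  proof -
    have "- (\<bar>b1\<bar> + \<bar>b2\<bar>) \<in> cbox a b" "\<bar>b1\<bar> + \<bar>b2\<bar> \<in> cbox a b"
      using ab by (auto simp: B_def subset_iff dist_real_def)
    then have *: "a \<le> b2" "b1 \<le> b" "a \<le> b" by auto
    have "(f has_integral (F b - F a)) {a..b}"
      by (rule fundamental_theorem_of_calculus[OF *(3)]) (rule has_vector_derivative_at_within[OF F])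
    moreover have "norm ((F b - F a) - (u - v)) < e"
    proof -
      have "norm ((F b - F a) - (u - v)) = norm ((F b - u) - (F a - v))" by (simp add: algebra_simps)
      also have "\<dots> \<le> norm (F b - u) + norm (F a - v)" by (rule norm_triangle_ineq4)
      also have "\<dots> < e" using b1[OF *(2)] b2[OF *(1)] by (simp add: dist_norm)
      finally show ?thesis .
    qed
    ultimately show ?thesis by auto
  qed
  then show "\<exists>B>0. \<forall>a b. ball 0 B \<subseteq> cbox a b \<longrightarrow>
      (\<exists>z. ((\<lambda>x. if x \<in> UNIV then f x else 0) has_integral z) (cbox a b) \<and> norm (z - (u - v)) < e)"
    by (intro exI[of _ B]) (auto simp: B_def)
qed

lemma ex_primitive:
  fixes f :: "real \<Rightarrow> 'a::banach"
  assumes "continuous_on UNIV f"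
  shows "\<exists>F. F 0 = 0 \<and> (\<forall>x. (F has_vector_derivative f x) (at x))"
proof -
  define F where "F x = integral {0..x} f - integral {x..0} f" for x
  \<comment> \<open>On \<open>{-c..c}\<close> the function \<open>F\<close> differs from the
    integral starting at \<open>-c\<close> by a constant. This reduces differentiability at points
    of either sign to the theorem for integrals with a fixed lower end.\<close>
  have eq: "F x = integral {-c..x} f - integral {-c..0} f" if "x \<in> {-c..c}" for x c
  proof (cases "x \<ge> 0")
    case True
    have "integral {-c..0} f + integral {0..x} f = integral {-c..x} f"
      using that True assms
      by (intro Henstock_Kurzweil_Integration.integral_combine integrable_continuous_interval) (auto intro: continuous_on_subset)
    moreover have "integral {x..0} f = 0" using True by (cases "x = 0") auto
    ultimately show ?thesis by (simp add: F_def algebra_simps)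
  next
    case False
    have "integral {-c..x} f + integral {x..0} f = integral {-c..0} f"
      using that False assms
      by (intro Henstock_Kurzweil_Integration.integral_combine integrable_continuous_interval) (auto intro: continuous_on_subset)
    then show ?thesis using False by (simp add: F_def algebra_simps)
  qed
  have "(F has_vector_derivative f x) (at x)" for x
  proof -
    define c where "c = \<bar>x\<bar> + 1"
    have x: "x \<in> {-c<..<c}" by (auto simp: c_def)
    have "((\<lambda>x. integral {-c..x} f - integral {-c..0} f) has_vector_derivative f x) (at x within {-c..c})"
      using assms x by (intro has_vector_derivative_diff_const[THEN iffD2] integral_has_vector_derivative)
        (auto intro: continuous_on_subset)
    then have "(F has_vector_derivative f x) (at x within {-c..c})"
      by (rule has_vector_derivative_transform[rotated 2]) (use x eq in auto)
    moreover have "at x within {-c..c} = at x" using x by (intro at_within_interior) simp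
    ultimately show ?thesis by simp
  qed
  moreover have "F 0 = 0" by (simp add: F_def)
  ultimately show ?thesis by blast
qed

section \<open>The weight \<open>1 / (1 + (s * x)\<^sup>2)\<close> and primitives dominated by
  it\<close>

definition wt :: "real \<Rightarrow> real \<Rightarrow> real" where "wt s x = inverse (1 + (s * x)\<^sup>2)"

abbreviation "wt1 \<equiv> wt 1"

lemma wt_nonneg: "wt s x \<ge> 0" and wt_le_1: "wt s x \<le> 1"
  by (auto simp: wt_def add_pos_nonneg inverse_le_1_iff)

lemma wt_minus [simp]: "wt s (- x) = wt s x" by (simp add: wt_def)

text \<open>A smaller \<open>s\<close> gives a wider weight. The width is kept as a parameter
  because \<open>fast_bound\<close> controls a weakly damped component by a wide weight.\<close>

lemma wt_antimono: "0 \<le> s \<Longrightarrow> s \<le> 1 \<Longrightarrow> wt 1 x \<le> wt s x"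
  unfolding wt_def by (intro le_imp_inverse_le add_left_mono)
    (auto simp: add_pos_nonneg power_mult_distrib power_le_one mult_left_le_one_le)

lemma arctan_deriv: "(arctan has_vector_derivative wt 1 x) (at x within S)"
  using DERIV_arctan[of x] by (simp add: wt_def has_real_derivative_iff_has_vector_derivative[symmetric]
      has_field_derivative_at_within)

lemma arctan_bot: "(arctan \<longlongrightarrow> - (pi / 2)) at_bot"
  and arctan_top: "(arctan \<longlongrightarrow> pi / 2) at_top"
  using tendsto_arctan_at_bot tendsto_arctan_at_top by simp_all

lemma arctan_range: "- (pi / 2) < arctan x" "arctan x < pi / 2"
  using arctan_bounded[of x] by auto

text \<open>Increments of any primitive are at most \<open>C\<close> times increments of
  \<open>arctan\<close>. Since \<open>arctan\<close> converges at both ends, the primitive is Cauchy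
  there, and its values are controlled by the distance of \<open>arctan\<close> from its
  limit.\<close>

lemma ex_primitive_from_bot:
  fixes f :: "real \<Rightarrow> 'a::banach"
  assumes cont: "continuous_on UNIV f" and bd: "\<And>x. norm (f x) \<le> C * wt1 x"
  shows "\<exists>F v. (\<forall>x. (F has_vector_derivative f x) (at x)) \<and> (F \<longlongrightarrow> 0) at_bot \<and> (F \<longlongrightarrow> v) at_top
    \<and> norm v \<le> C * pi \<and> (\<forall>x. norm (F x) \<le> C * (arctan x + pi / 2))"
proof -
  obtain F0 where F0: "\<And>x. (F0 has_vector_derivative f x) (at x)"
    using ex_primitive[OF cont] by blast
  have C0: "C \<ge> 0" using order_trans[OF norm_ge_zero bd[of 0]] by (simp add: wt_def)
  have est: "norm (F0 b - F0 a) \<le> C * arctan b - C * arctan a" if "a \<le> b" for a b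
    by (rule norm_diff_le_by_derivative[OF that has_vector_derivative_at_within[OF F0]
        has_vector_derivative_mult_right[OF arctan_deriv] bd])
  have cauchy: "\<exists>l. (F0 \<longlongrightarrow> l) G" if G: "G \<noteq> bot" and l: "(arctan \<longlongrightarrow> l) G" for G l
  proof -
    have "cauchy_filter (filtermap F0 G)"
      unfolding cauchy_filter_metric_filtermap
    proof (intro allI impI)
      fix e :: real assume e: "e > 0"
      \<comment> \<open>The 1 added to \<open>C\<close> keeps the quotient meaningful for
        \<open>C = 0\<close>.\<close>
      have "\<forall>\<^sub>F x in G. dist (arctan x) l < e / (2 * (C + 1))"
        using e C0 by (intro tendstoD[OF l]) simp
      moreover have "dist (F0 x) (F0 y) < e"
        if "dist (arctan x) l < e / (2 * (C + 1))" "dist (arctan y) l < e / (2 * (C + 1))" for x y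
      proof -
        have "dist (F0 x) (F0 y) \<le> C * \<bar>arctan x - arctan y\<bar>"
          using est[of x y] est[of y x]
          by (cases "x \<le> y") (auto simp: dist_norm norm_minus_commute algebra_simps abs_if arctan_less_iff)
        also have "\<dots> \<le> (C + 1) * \<bar>arctan x - arctan y\<bar>" by (intro mult_right_mono) auto
        also have "\<bar>arctan x - arctan y\<bar> < e / (C + 1)"
        proof -
          have tri: "\<bar>a - b\<bar> < d + d" if "\<bar>a - m\<bar> < d" "\<bar>b - m\<bar> < d" for a b d m :: real
            using that by linarith
          have half: "e / (2 * u) + e / (2 * u) = e / u" for u :: real by (simp flip: add_divide_distrib mult_2)
          note tri[OF that[unfolded dist_real_def]]
          also have "e / (2 * (C + 1)) + e / (2 * (C + 1)) = e / (C + 1)" by (rule half)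
          finally show ?thesis .
        qed
        then have "(C + 1) * \<bar>arctan x - arctan y\<bar> < e" using C0 by (simp add: field_simps)
        finally show ?thesis .
      qed
      ultimately show "\<exists>P. eventually P G \<and> (\<forall>x y. P x \<and> P y \<longrightarrow> dist (F0 x) (F0 y) < e)"
        by blast
    qed
    then have "\<exists>l. filtermap F0 G \<le> nhds l"
      using complete_UNIV[where 'a = 'a] G unfolding complete_uniform by (simp add: filtermap_bot_iff)
    then show ?thesis by (auto simp: filterlim_def)
  qed
  obtain l0 where l0: "(F0 \<longlongrightarrow> l0) at_bot" using cauchy[OF _ arctan_bot] by auto
  obtain l1 where l1: "(F0 \<longlongrightarrow> l1) at_top" using cauchy[OF _ arctan_top] by auto
  define F where "F x = F0 x - l0" for x
  have Fb: "norm (F x) \<le> C * (arctan x + pi / 2)" for x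
  proof (rule tendsto_le[OF trivial_limit_at_bot_linorder])
    show "((\<lambda>y. C * arctan x - C * arctan y) \<longlongrightarrow> C * (arctan x + pi / 2)) at_bot"
      by (rule tendsto_eq_intros arctan_bot refl | simp add: algebra_simps)+
    show "((\<lambda>y. norm (F0 x - F0 y)) \<longlongrightarrow> norm (F x)) at_bot" unfolding F_def
      by (intro tendsto_intros l0)
    show "\<forall>\<^sub>F y in at_bot. norm (F0 x - F0 y) \<le> C * arctan x - C * arctan y"
      using eventually_le_at_bot[of x] by eventually_elim (use est in auto)
  qed
  have top: "(F \<longlongrightarrow> l1 - l0) at_top" unfolding F_def by (intro tendsto_intros l1)
  have "norm (l1 - l0) \<le> C * pi"
  proof (rule tendsto_upperbound[OF tendsto_norm[OF top]])
    show "\<forall>\<^sub>F x in at_top. norm (F x) \<le> C * pi"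
    proof (intro always_eventually allI)
      fix x have "C * (arctan x + pi / 2) \<le> C * pi"
        using arctan_range[of x] C0 by (intro mult_left_mono) auto
      then show "norm (F x) \<le> C * pi" using Fb[of x] by linarith
    qed
  qed simp
  moreover have "(F has_vector_derivative f x) (at x)" for x
    unfolding F_def by (intro has_vector_derivative_diff_const[THEN iffD2] F0)
  moreover have "(F \<longlongrightarrow> 0) at_bot"
    unfolding F_def using tendsto_diff[OF l0 tendsto_const[of l0]] by simp
  ultimately show ?thesis using Fb top by blast
qed

text \<open>The constant \<open>pi\<close> is the total mass of \<open>wt1\<close>.\<close>

lemma integral_dominated_wt:
  fixes f :: "real \<Rightarrow> 'a::banach"
  assumes "continuous_on UNIV f" and "\<And>x. norm (f x) \<le> C * wt1 x"
  shows "(f has_integral integral UNIV f) UNIV" and "norm (integral UNIV f) \<le> C * pi"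
proof -
  obtain F v where F: "\<And>x. (F has_vector_derivative f x) (at x)" "(F \<longlongrightarrow> 0) at_bot"
    "(F \<longlongrightarrow> v) at_top" "norm v \<le> C * pi"
    using ex_primitive_from_bot[OF assms] by blast
  have "(f has_integral v) UNIV" using has_integral_FTC_UNIV[OF F(1,3,2)] by simp
  then show "(f has_integral integral UNIV f) UNIV" "norm (integral UNIV f) \<le> C * pi"
    using F(4) by (simp_all add: integral_unique)
qed

section \<open>Linear systems of differential equations\<close>

text \<open>Bounded coefficients make the Peano-Baker series converge on every compact interval,
  with terms of size \<open>B * (D * (x - y)) ^ k / fact k\<close>. Each term, and hence the sum,
  stays in the sets \<open>S e\<close>; these will be the graded parts.\<close>

lemma linear_ode_exists:
  fixes A :: "real \<Rightarrow> nat \<Rightarrow> nat \<Rightarrow> 'a::{real_normed_algebra_1,banach}"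
  assumes fin: "finite I"
    and cont: "\<And>e f. e \<in> I \<Longrightarrow> f \<in> I \<Longrightarrow> continuous_on {y..} (\<lambda>x. A x e f)"
    and bd: "\<And>x e f. e \<in> I \<Longrightarrow> f \<in> I \<Longrightarrow> y \<le> x \<Longrightarrow> norm (A x e f) \<le> C"
    and S: "\<And>e. e \<in> I \<Longrightarrow> closed_space (S e)" "\<And>e. e \<in> I \<Longrightarrow> c0 e \<in> S e"
      "\<And>x e f v. e \<in> I \<Longrightarrow> f \<in> I \<Longrightarrow> v \<in> S f \<Longrightarrow> A x e f * v \<in> S e"
  shows "\<exists>X. \<forall>e\<in>I. X y e = c0 e \<and> (\<forall>x\<ge>y. X x e \<in> S e \<and>
    ((\<lambda>s. X s e) has_vector_derivative (\<Sum>f\<in>I. A x e f * X x f)) (at x within {y..}))"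
proof (cases "I = {}")
  case False
  have C0: "C \<ge> 0" using False bd[of _ _ y] norm_ge_zero order_trans by blast
  \<comment> \<open>Terms of a series rather than successive approximations: term
    \<open>Suc k\<close> is the integral of the coefficient matrix applied to term
    \<open>k\<close>.\<close>
  define X where "X = rec_nat (\<lambda>x e. c0 e) (\<lambda>k Xk x e. integral {y..x} (\<lambda>s. \<Sum>f\<in>I. A s e f * Xk s f))"
  have X0: "X 0 x e = c0 e" and XS: "X (Suc k) x e = integral {y..x} (\<lambda>s. \<Sum>f\<in>I. A s e f * X k s f)"
    for x e k by (simp_all add: X_def)
  define B where "B = (\<Sum>e\<in>I. norm (c0 e))"
  define D where "D = card I * C"
  have B0: "B \<ge> 0" and D0: "D \<ge> 0" using C0 by (auto simp: B_def D_def intro: sum_nonneg)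
  have Xk: "(\<forall>e\<in>I. continuous_on {y..} (\<lambda>x. X k x e)) \<and>
      (\<forall>e\<in>I. \<forall>x\<ge>y. norm (X k x e) \<le> B * (D * (x - y)) ^ k / fact k \<and> X k x e \<in> S e)" for k
  proof (induction k)
    case 0
    have "norm (c0 e) \<le> B" if "e \<in> I" for e unfolding B_def
      by (rule member_le_sum[OF that]) (use fin in auto)
    then show ?case using S by (simp add: X0)
  next
    case (Suc k)
    have ic: "continuous_on {y..b} (\<lambda>s. \<Sum>f\<in>I. A s e f * X k s f)" if "e \<in> I" for e b
      using Suc cont that by (intro continuous_intros continuous_on_subset[where s = "{y..}" and t = "{y..b}"]) auto
    have der: "((\<lambda>s. X (Suc k) s e) has_vector_derivative (\<Sum>f\<in>I. A x e f * X k x f)) (at x within {y..b})"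
      if "e \<in> I" "x \<in> {y..b}" for e x b
      unfolding XS by (rule integral_has_vector_derivative[OF ic[OF that(1)] that(2)])
    have "continuous_on {y..} (\<lambda>x. X (Suc k) x e)" if e: "e \<in> I" for e
      unfolding continuous_on_eq_continuous_within
    proof
      fix x assume x: "x \<in> {y..}"
      have "continuous (at x within {y..x+1}) (\<lambda>x. X (Suc k) x e)"
        by (rule has_vector_derivative_continuous[OF der[OF e]]) (use x in auto)
      moreover have "at x within {y..x+1} = at x within {y..}"
        by (rule at_within_nhd[of _ "{x-1<..<x+1}"]) auto
      ultimately show "continuous (at x within {y..}) (\<lambda>x. X (Suc k) x e)" by simp
    qed
    moreover have "norm (X (Suc k) x e) \<le> B * (D * (x - y)) ^ Suc k / fact (Suc k) \<and> X (Suc k) x e \<in> S e"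
      if e: "e \<in> I" and x: "x \<ge> y" for e x
    proof
      have "norm (X (Suc k) x e - X (Suc k) y e)
          \<le> B * D ^ Suc k / fact (Suc k) * (x - y) ^ Suc k - B * D ^ Suc k / fact (Suc k) * (y - y) ^ Suc k"
      proof (rule norm_diff_le_by_derivative[OF x])
        fix s assume s: "y \<le> s" "s \<le> x"
        show "((\<lambda>s. X (Suc k) s e) has_vector_derivative (\<Sum>f\<in>I. A s e f * X k s f)) (at s within {y..x})"
          by (rule der) (use e s in auto)
        have d1: "((\<lambda>s. s - y) has_real_derivative 1) (at s within {y..x})"
          by (auto intro!: derivative_eq_intros)
        have "((\<lambda>s. B * D ^ Suc k / fact (Suc k) * (s - y) ^ Suc k) has_real_derivative
            B * D ^ Suc k / fact (Suc k) * (Suc k * (s - y) ^ k)) (at s within {y..x})"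
          using DERIV_power[OF d1, of "Suc k"] by (intro DERIV_cmult) (simp del: of_nat_Suc)
        then show "((\<lambda>s. B * D ^ Suc k / fact (Suc k) * (s - y) ^ Suc k) has_vector_derivative
            B * D ^ Suc k / fact (Suc k) * (Suc k * (s - y) ^ k)) (at s within {y..x})"
          by (simp only: has_real_derivative_iff_has_vector_derivative)
        have "norm (\<Sum>f\<in>I. A s e f * X k s f) \<le> (\<Sum>f\<in>I. C * (B * (D * (s - y)) ^ k / fact k))"
          by (intro sum_norm_le norm_mult_le bd) (use Suc e s in auto)
        also have "\<dots> = D * (B * (D * (s - y)) ^ k / fact k)" by (simp add: D_def)
        also have "\<dots> = B * D ^ Suc k / fact (Suc k) * (Suc k * (s - y) ^ k)"
          unfolding power_mult_distrib by (simp add: field_simps del: of_nat_Suc)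
        finally show "norm (\<Sum>f\<in>I. A s e f * X k s f) \<le> \<dots>" .
      qed
      then show "norm (X (Suc k) x e) \<le> B * (D * (x - y)) ^ Suc k / fact (Suc k)"
        by (simp add: XS power_mult_distrib mult_ac)
      have "((\<lambda>s. \<Sum>f\<in>I. A s e f * X k s f) has_integral X (Suc k) x e) {y..x}"
        unfolding XS using integrable_continuous_interval[OF ic[OF e]] by (rule integrable_integral)
      then show "X (Suc k) x e \<in> S e"
      proof (rule has_integral_closed_space[OF _ S(1)[OF e]])
        fix s assume "s \<in> {y..x}"
        then show "(\<Sum>f\<in>I. A s e f * X k s f) \<in> S e"
          using Suc S e by (intro subspace_sum) (auto simp: closed_space_def)
      qed
    qed
    ultimately show ?case by blast
  qed
  have der: "((\<lambda>s. X (Suc k) s e) has_vector_derivative (\<Sum>f\<in>I. A x e f * X k x f)) (at x within {y..b})"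
    if "e \<in> I" "x \<in> {y..b}" for e x b k
    unfolding XS
  proof (rule integral_has_vector_derivative[OF _ that(2)])
    show "continuous_on {y..b} (\<lambda>s. \<Sum>f\<in>I. A s e f * X k s f)"
      using Xk cont that by (intro continuous_intros continuous_on_subset[where s = "{y..}" and t = "{y..b}"]) auto
  qed
  define G where "G x e = (\<Sum>k. X k x e)" for x e
  have unif: "uniform_limit {y..b} (\<lambda>n x. \<Sum>i<n. X i x e) (\<lambda>x. G x e) sequentially" if e: "e \<in> I" for e b
    unfolding G_def
  proof (rule Weierstrass_m_test)
    show "summable (\<lambda>k. B * (D * (b - y)) ^ k / fact k)"
    proof -
      have "summable (\<lambda>k. B * (inverse (fact k) * (D * (b - y)) ^ k))"
        by (intro summable_mult summable_exp)
      then show ?thesis by (simp add: divide_inverse mult_ac)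
    qed
    fix k x assume x: "x \<in> {y..b}"
    then have "norm (X k x e) \<le> B * (D * (x - y)) ^ k / fact k" using Xk e by auto
    also have "\<dots> \<le> B * (D * (b - y)) ^ k / fact k"
      using x B0 D0 by (intro divide_right_mono mult_left_mono power_mono) auto
    finally show "norm (X k x e) \<le> B * (D * (b - y)) ^ k / fact k" .
  qed
  have sums: "(\<lambda>k. X k x e) sums G x e" if "e \<in> I" "x \<ge> y" for e x
    using tendsto_uniform_limitI[OF unif[OF that(1), of x], of x] that by (simp add: sums_def)
  have Gder: "((\<lambda>s. G s e) has_vector_derivative (\<Sum>f\<in>I. A x e f * G x f)) (at x within {y..b})"
    if e: "e \<in> I" and x: "x \<in> {y..b}" for e x b
  proof -
    \<comment> \<open>The derivative of term \<open>Suc k\<close> is the matrix applied to term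
      \<open>k\<close>, so n + 1 differentiated terms correspond to n terms of the series; hence the
      shift by \<open>eventually_sequentially_Suc\<close> at the end.\<close>
    define d where "d k x = (case k of 0 \<Rightarrow> 0 | Suc k \<Rightarrow> \<Sum>f\<in>I. A x e f * X k x f)" for k x
    have sumd: "(\<Sum>i<Suc n. d i x) = (\<Sum>f\<in>I. A x e f * (\<Sum>i<n. X i x f))" for n x
      by (subst sum.lessThan_Suc_shift)
        (simp add: d_def sum_distrib_left sum.swap[of _ "{..<n}"])
    have "\<exists>g. \<forall>x\<in>{y..b}. (\<lambda>n. X n x e) sums g x \<and>
        (g has_derivative (\<lambda>h. h *\<^sub>R (\<Sum>f\<in>I. A x e f * G x f))) (at x within {y..b})"
    proof (rule has_derivative_series[where f' = "\<lambda>n x h. h *\<^sub>R d n x"])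
      show "convex {y..b}" by simp
      show "y \<in> {y..b}" using x by auto
      show "(\<lambda>n. X n y e) sums G y e" using sums e by simp
      fix n x assume x: "x \<in> {y..b}"
      show "((\<lambda>x. X n x e) has_derivative (\<lambda>h. h *\<^sub>R d n x)) (at x within {y..b})"
      proof (cases n)
        case 0 then show ?thesis by (simp add: X0 d_def)
      next
        case (Suc k) then show ?thesis using der[OF e x, of k] by (simp add: d_def has_vector_derivative_def)
      qed
    next
      fix \<epsilon> :: real assume \<epsilon>: "\<epsilon> > 0"
      \<comment> \<open>The 1 is added because \<open>D\<close> may be 0.\<close>
      define \<delta> where "\<delta> = \<epsilon> / (D + 1)"
      have \<delta>: "\<delta> > 0" using \<epsilon> D0 by (simp add: \<delta>_def)
      have "\<forall>\<^sub>F n in sequentially. \<forall>f\<in>I. \<forall>x\<in>{y..b}. dist (\<Sum>i<n. X i x f) (G x f) < \<delta>"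
        using fin unif \<delta> by (auto simp: eventually_ball_finite_distrib uniform_limit_iff)
      then have "\<forall>\<^sub>F n in sequentially. \<forall>x\<in>{y..b}. \<forall>h. norm ((\<Sum>i<Suc n. h *\<^sub>R d i x)
          - h *\<^sub>R (\<Sum>f\<in>I. A x e f * G x f)) \<le> \<epsilon> * norm h"
      proof eventually_elim
        case (elim n)
        show ?case
        proof (intro ballI allI)
          fix x h assume x: "x \<in> {y..b}"
          have "norm (\<Sum>f\<in>I. A x e f * ((\<Sum>i<n. X i x f) - G x f)) \<le> (\<Sum>f\<in>I. C * \<delta>)"
            using elim x e by (intro sum_norm_le norm_mult_le bd) (auto simp: dist_norm less_imp_le)
          also have "\<dots> = D * \<delta>" by (simp add: D_def)
          also have "\<dots> \<le> \<epsilon>" using D0 \<epsilon> by (simp add: \<delta>_def field_simps)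
          finally have *: "norm ((\<Sum>i<Suc n. d i x) - (\<Sum>f\<in>I. A x e f * G x f)) \<le> \<epsilon>"
            by (simp only: sumd sum_subtractf[symmetric] right_diff_distrib)
          have "(\<Sum>i<Suc n. h *\<^sub>R d i x) - h *\<^sub>R (\<Sum>f\<in>I. A x e f * G x f)
              = h *\<^sub>R ((\<Sum>i<Suc n. d i x) - (\<Sum>f\<in>I. A x e f * G x f))"
            by (simp only: scaleR_sum_right scaleR_diff_right)
          then show "norm ((\<Sum>i<Suc n. h *\<^sub>R d i x) - h *\<^sub>R (\<Sum>f\<in>I. A x e f * G x f)) \<le> \<epsilon> * norm h"
            using mult_left_mono[OF *, of "\<bar>h\<bar>"] by (simp only: norm_scaleR real_norm_def abs_ge_zero mult.commute)
        qed
      qed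
      then show "\<forall>\<^sub>F n in sequentially. \<forall>x\<in>{y..b}. \<forall>h. norm ((\<Sum>i<n. h *\<^sub>R d i x)
          - h *\<^sub>R (\<Sum>f\<in>I. A x e f * G x f)) \<le> \<epsilon> * norm h"
        by (rule eventually_sequentially_Suc[THEN iffD1])
    qed
    then obtain g where g: "\<And>x. x \<in> {y..b} \<Longrightarrow> (\<lambda>n. X n x e) sums g x"
      "\<And>x. x \<in> {y..b} \<Longrightarrow> (g has_vector_derivative (\<Sum>f\<in>I. A x e f * G x f)) (at x within {y..b})"
      unfolding has_vector_derivative_def by blast
    have "G x e = g x" if "x \<in> {y..b}" for x using sums[OF e, of x] g(1)[OF that] that sums_unique2 by auto
    then show ?thesis by (rule has_vector_derivative_transform[OF x _ g(2)[OF x]])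
  qed
  have "G y e = c0 e \<and> (\<forall>x\<ge>y. G x e \<in> S e \<and>
      ((\<lambda>s. G s e) has_vector_derivative (\<Sum>f\<in>I. A x e f * G x f)) (at x within {y..}))"
    if e: "e \<in> I" for e
  proof (intro conjI allI impI)
    have "X k y e = (if k = 0 then c0 e else 0)" for k by (cases k) (simp_all add: X0 XS)
    then have "(\<lambda>k. X k y e) sums c0 e" using sums_single[of 0 "\<lambda>_. c0 e"] by simp
    then show "G y e = c0 e" using sums[OF e, of y] sums_unique2 by blast
    fix x assume x: "y \<le> x"
    have cl: "closed (S e)" and sub: "subspace (S e)" using S(1)[OF e] by (auto simp: closed_space_def)
    have "(\<Sum>k<n. X k x e) \<in> S e" for n using Xk e x by (intro subspace_sum[OF sub]) auto
    then show "G x e \<in> S e" using sums[OF e x] unfolding sums_def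
      by (intro Lim_in_closed_set[OF cl _ sequentially_bot]) auto
    have "at x within {y..x+1} = at x within {y..}"
      by (rule at_within_nhd[of _ "{x-1<..<x+1}"]) auto
    then show "((\<lambda>s. G s e) has_vector_derivative (\<Sum>f\<in>I. A x e f * G x f)) (at x within {y..})"
      using Gder[OF e, of x "x + 1"] x by simp
  qed
  then show ?thesis by (intro exI[of _ G]) blast
qed simp

section \<open>Variation of constants and Gronwall estimates\<close>

lemma exp_has_vector_derivative_scaleC:
  fixes w :: "real \<Rightarrow> 'a::banach_superalgebra"
  assumes "(w has_vector_derivative w') (at s within S)"
  shows "((\<lambda>s. exp (c * (complex_of_real r - of_real s)) *\<^sub>C w s) has_vector_derivative
    exp (c * (complex_of_real r - of_real s)) *\<^sub>C (w' - c *\<^sub>C w s)) (at s within S)"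
proof -
  have "((\<lambda>s. exp (c * (complex_of_real r - of_real s))) has_vector_derivative
      exp (c * (complex_of_real r - of_real s)) * (- c)) (at s within S)"
    by (rule has_vector_derivative_real_field[THEN has_vector_derivative_at_within,
          of "\<lambda>z. exp (c * (complex_of_real r - z))"])
      (auto intro!: derivative_eq_intros)
  from scaleC.has_vector_derivative[OF this assms] show ?thesis
    by (rule has_vector_derivative_eq_rhs)
      (simp add: scaleC_scaleC scaleC.minus_left scaleC.diff_right)
qed

text \<open>The exponential factor removes the diagonal term and equals 1 at \<open>x1\<close>. Only
  \<open>Re c\<close> enters the estimate, so a large imaginary part of \<open>c\<close> costs
  nothing.\<close>

lemma duhamel_bound:
  fixes w :: "real \<Rightarrow> 'a::banach_superalgebra"
  assumes le: "x0 \<le> x1"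
    and w: "\<And>s. x0 \<le> s \<Longrightarrow> s \<le> x1 \<Longrightarrow> (w has_vector_derivative c *\<^sub>C w s + r s) (at s within {x0..x1})"
    and \<psi>: "\<And>s. x0 \<le> s \<Longrightarrow> s \<le> x1 \<Longrightarrow> (\<psi> has_vector_derivative \<psi>' s) (at s within {x0..x1})"
    and bd: "\<And>s. x0 \<le> s \<Longrightarrow> s \<le> x1 \<Longrightarrow> exp (Re c * (x1 - s)) * norm (r s) \<le> \<psi>' s"
  shows "norm (w x1) \<le> exp (Re c * (x1 - x0)) * norm (w x0) + (\<psi> x1 - \<psi> x0)"
proof -
  let ?F = "\<lambda>s. exp (c * (complex_of_real x1 - of_real s)) *\<^sub>C w s"
  have ne: "norm (exp (c * (complex_of_real x1 - of_real s)) *\<^sub>C v) = exp (Re c * (x1 - s)) * norm v"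
    for s and v :: 'a by (simp add: norm_scaleC)
  have "norm (?F x1 - ?F x0) \<le> \<psi> x1 - \<psi> x0"
  proof (rule norm_diff_le_by_derivative[OF le _ \<psi>])
    fix s assume s: "x0 \<le> s" "s \<le> x1"
    show "(?F has_vector_derivative exp (c * (complex_of_real x1 - of_real s)) *\<^sub>C r s) (at s within {x0..x1})"
      using exp_has_vector_derivative_scaleC[OF w[OF s], of c x1] by simp
    show "norm (exp (c * (complex_of_real x1 - of_real s)) *\<^sub>C r s) \<le> \<psi>' s"
      using bd[OF s] by (simp only: ne)
  qed
  moreover have "norm (?F x1) \<le> norm (?F x0) + norm (?F x1 - ?F x0)" by (metis norm_triangle_sub add.commute)
  ultimately show ?thesis by (simp add: ne)
qed

text \<open>The exponential bounds the total growth of \<open>exp (2 * q * arctan s)\<close> along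
  the line; the factor 2 comes from absorbing half of the maximum in
  \<open>gronwall\<close>.\<close>

definition gron :: "real \<Rightarrow> real" where "gron q = 2 * exp (2 * q * pi)"

lemma gron_pos: "gron q > 0" by (simp add: gron_def)

text \<open>Measure each component against \<open>E s = exp (2 * q * (arctan s - arctan x0))\<close>
  and look at the point where the quotient is largest over all components. The rate is twice what
  the coupling needs, so the variation-of-constants inequality at that point returns at most half of
  the maximum. The diagonal part enters only through \<open>Re (c e) \<le> 0\<close>, which makes
  the constant independent of the spectral parameter.\<close>

lemma gronwall:
  fixes Z :: "real \<Rightarrow> nat \<Rightarrow> 'a::banach_superalgebra" and C :: real
  assumes fin: "finite I" and le: "x0 \<le> x1" and e: "e \<in> I" and C: "0 \<le> C"
    and Z: "\<And>e s. e \<in> I \<Longrightarrow> x0 \<le> s \<Longrightarrow> s \<le> x1 \<Longrightarrow> ((\<lambda>s. Z s e) has_vector_derivative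
        c e *\<^sub>C Z s e + ((\<Sum>f\<in>I. Om s e f * Z s f) + r s e)) (at s within {x0..x1})"
    and c: "\<And>e. e \<in> I \<Longrightarrow> Re (c e) \<le> 0"
    and Om: "\<And>e f s. e \<in> I \<Longrightarrow> f \<in> I \<Longrightarrow> norm (Om s e f) \<le> C * wt1 s"
    and r: "\<And>e s. e \<in> I \<Longrightarrow> norm (r s e) \<le> \<eta> * wt1 s"
    and \<delta>: "\<And>e. e \<in> I \<Longrightarrow> norm (Z x0 e) \<le> \<delta>"
  shows "norm (Z x1 e) \<le> gron (real (card I) * C) * (\<delta> + \<eta> * pi)"
proof -
  define q where "q = card I * C"
  define E where "E s = exp (2 * q * (arctan s - arctan x0))" for s
  have q0: "q \<ge> 0" using C by (simp add: q_def)
  have \<delta>0: "\<delta> \<ge> 0" using order_trans[OF norm_ge_zero \<delta>[OF e]] .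
  have \<eta>0: "\<eta> \<ge> 0" using order_trans[OF norm_ge_zero r[OF e, of 0]] by (simp add: wt_def)
  have E1: "E s \<ge> 1" if "s \<ge> x0" for s
    using that q0 by (auto simp: E_def arctan_le_iff)
  have Epos: "E s > 0" for s by (simp add: E_def)
  have contZ: "continuous_on {x0..x1} (\<lambda>s. Z s e)" if "e \<in> I" for e
    using Z[OF that] by (intro continuous_on_vector_derivative) auto
  have "\<exists>t\<in>{x0..x1}. \<forall>s\<in>{x0..x1}. norm (Z s e) / E s \<le> norm (Z t e) / E t" if "e \<in> I" for e
    using le contZ[OF that] unfolding E_def
    by (intro continuous_attains_sup continuous_intros) auto
  then obtain t where t: "\<And>e. e \<in> I \<Longrightarrow> t e \<in> {x0..x1}"
    "\<And>e s. e \<in> I \<Longrightarrow> s \<in> {x0..x1} \<Longrightarrow> norm (Z s e) / E s \<le> norm (Z (t e) e) / E (t e)"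
    by metis
  define M where "M = Max ((\<lambda>e. norm (Z (t e) e) / E (t e)) ` I)"
  have "M \<in> (\<lambda>e. norm (Z (t e) e) / E (t e)) ` I" unfolding M_def using fin e by (intro Max_in) auto
  then obtain m where m: "m \<in> I" "M = norm (Z (t m) m) / E (t m)" by blast
  have ZM: "norm (Z s f) \<le> M * E s" if "f \<in> I" "s \<in> {x0..x1}" for f s
  proof -
    have "norm (Z s f) / E s \<le> norm (Z (t f) f) / E (t f)" using t(2) that by blast
    also have "\<dots> \<le> M" unfolding M_def using fin that by (intro Max_ge) auto
    finally show ?thesis using Epos[of s] by (simp add: field_simps)
  qed
  have M0: "M \<ge> 0" using m Epos[of "t m"] by simp
  let ?T = "t m"
  have T: "x0 \<le> ?T" "?T \<le> x1" using t(1)[OF m(1)] by auto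
  \<comment> \<open>The derivative of the first term is \<open>q * M * wt1 s * E s\<close>, exactly
    the bound for the coupling to all components.\<close>
  let ?\<psi> = "\<lambda>s. M / 2 * E s + \<eta> * arctan s"
  have "norm (Z ?T m) \<le> exp (Re (c m) * (?T - x0)) * norm (Z x0 m) + (?\<psi> ?T - ?\<psi> x0)"
  proof (rule duhamel_bound[OF T(1)])
    fix s assume s: "x0 \<le> s" "s \<le> ?T"
    show "((\<lambda>s. Z s m) has_vector_derivative
        c m *\<^sub>C Z s m + ((\<Sum>f\<in>I. Om s m f * Z s f) + r s m)) (at s within {x0..?T})"
      by (rule has_vector_derivative_within_subset[OF Z]) (use m s T in auto)
    have "(E has_real_derivative E s * (2 * q * wt1 s)) (at s within {x0..?T})"
      unfolding E_def by (rule derivative_eq_intros refl | simp add: wt_def)+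
    then have "(E has_vector_derivative E s * (2 * q * wt1 s)) (at s within {x0..?T})"
      by (simp add: has_real_derivative_iff_has_vector_derivative)
    then show "(?\<psi> has_vector_derivative M / 2 * (E s * (2 * q * wt1 s)) + \<eta> * wt1 s) (at s within {x0..?T})"
      by (intro has_vector_derivative_add has_vector_derivative_mult_right arctan_deriv)
    have "norm ((\<Sum>f\<in>I. Om s m f * Z s f) + r s m) \<le> (\<Sum>f\<in>I. (C * wt1 s) * (M * E s)) + \<eta> * wt1 s"
      using m(1) s T by (intro norm_triangle_mono sum_norm_le norm_mult_le Om r ZM) auto
    also have "\<dots> = M / 2 * (E s * (2 * q * wt1 s)) + \<eta> * wt1 s" by (simp add: q_def algebra_simps)
    finally have n: "norm ((\<Sum>f\<in>I. Om s m f * Z s f) + r s m) \<le> \<dots>" .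
    have "Re (c m) * (?T - s) \<le> 0" using c[OF m(1)] s by (intro mult_nonpos_nonneg) auto
    then have "exp (Re (c m) * (?T - s)) * norm ((\<Sum>f\<in>I. Om s m f * Z s f) + r s m)
        \<le> 1 * norm ((\<Sum>f\<in>I. Om s m f * Z s f) + r s m)" by (intro mult_right_mono) auto
    then show "exp (Re (c m) * (?T - s)) * norm ((\<Sum>f\<in>I. Om s m f * Z s f) + r s m)
        \<le> M / 2 * (E s * (2 * q * wt1 s)) + \<eta> * wt1 s" using n by linarith
  qed
  also have "exp (Re (c m) * (?T - x0)) * norm (Z x0 m) \<le> 1 * \<delta>"
    using c[OF m(1)] T \<delta>[OF m(1)] by (intro mult_mono) (auto intro: mult_nonpos_nonneg)
  also have "?\<psi> ?T - ?\<psi> x0 = M / 2 * (E ?T - 1) + \<eta> * (arctan ?T - arctan x0)"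
    by (simp add: E_def algebra_simps)
  also have "\<eta> * (arctan ?T - arctan x0) \<le> \<eta> * pi"
    using arctan_range[of ?T] arctan_range[of x0] \<eta>0 by (intro mult_left_mono) auto
  finally have 1: "norm (Z ?T m) \<le> \<delta> + \<eta> * pi + M / 2 * E ?T" using M0 by (simp add: field_simps)
  have "norm (Z ?T m) = M * E ?T" using m(2) Epos[of ?T] by simp
  then have "M * E ?T \<le> 2 * (\<delta> + \<eta> * pi)" using 1 by simp
  moreover have "M * 1 \<le> M * E ?T" using M0 E1[OF T(1)] by (intro mult_left_mono)
  ultimately have M2: "M \<le> 2 * (\<delta> + \<eta> * pi)" by simp
  have "arctan x1 - arctan x0 \<le> pi" using arctan_range[of x1] arctan_range[of x0] by simp
  then have "E x1 \<le> exp (2 * q * pi)" unfolding E_def using q0 by (simp add: mult_left_mono)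
  have "norm (Z x1 e) \<le> M * E x1" using ZM[OF e] le by auto
  also have "\<dots> \<le> 2 * (\<delta> + \<eta> * pi) * exp (2 * q * pi)"
    using M2 \<open>E x1 \<le> _\<close> \<delta>0 \<eta>0 Epos[of x1] M0 by (intro mult_mono) auto
  finally show ?thesis by (simp add: gron_def q_def algebra_simps)
qed

section \<open>Jost solutions\<close>

text \<open>The diagonal part is kept apart from \<open>Om\<close>: it carries the spectral
  parameter and does not decay in \<open>x\<close>, whereas \<open>Om\<close> will be
  integrable.\<close>

definition is_sol :: "nat set \<Rightarrow> (nat \<Rightarrow> complex) \<Rightarrow> (real \<Rightarrow> nat \<Rightarrow> nat \<Rightarrow> 'a::banach_superalgebra) \<Rightarrow>
    real set \<Rightarrow> (real \<Rightarrow> nat \<Rightarrow> 'a) \<Rightarrow> bool" where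
  "is_sol I c Om S X \<longleftrightarrow> (\<forall>e\<in>I. \<forall>x\<in>S. ((\<lambda>s. X s e) has_vector_derivative
     c e *\<^sub>C X x e + (\<Sum>f\<in>I. Om x e f * X x f)) (at x within S))"

lemma is_sol_subset: "is_sol I c Om S X \<Longrightarrow> T \<subseteq> S \<Longrightarrow> is_sol I c Om T X"
  unfolding is_sol_def by (meson has_vector_derivative_within_subset subsetD)

definition is_jost :: "nat set \<Rightarrow> (nat \<Rightarrow> complex) \<Rightarrow> (real \<Rightarrow> nat \<Rightarrow> nat \<Rightarrow> 'a::banach_superalgebra) \<Rightarrow>
    nat \<Rightarrow> (real \<Rightarrow> nat \<Rightarrow> 'a) \<Rightarrow> bool" where
  "is_jost I c Om b L \<longleftrightarrow> is_sol I c Om UNIV L \<and> (\<forall>e\<in>I. ((\<lambda>x. L x e) \<longlongrightarrow> mone e b) at_bot)"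

text \<open>The equations constrain components in \<open>I\<close> only, so the choice is unique
  merely there; see \<open>jost_unique\<close>.\<close>

definition jost :: "nat set \<Rightarrow> (nat \<Rightarrow> complex) \<Rightarrow> (real \<Rightarrow> nat \<Rightarrow> nat \<Rightarrow> 'a::banach_superalgebra) \<Rightarrow>
    nat \<Rightarrow> real \<Rightarrow> nat \<Rightarrow> 'a" where
  "jost I c Om b = (SOME L. is_jost I c Om b L)"

lemma norm_mone_le: "norm (mone e b :: 'a::real_normed_algebra_1) \<le> 1"
  by (simp add: mone_def)

lemma norm_le_of_eps:
  fixes a b :: real
  assumes "\<And>\<delta>. \<delta> > 0 \<Longrightarrow> a \<le> G * \<delta> + b" and "G > 0"
  shows "a \<le> b"
proof (rule field_le_epsilon)
  fix e :: real assume "e > 0"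
  then show "a \<le> b + e" using assms(1)[of "e / G"] assms(2) by simp
qed

text \<open>The diagonal part \<open>c\<close> is normalised so that the component of the solution that tends to 1 at
  \<open>- \<infinity>\<close> has \<open>c b = 0\<close>; then \<open>Re (c e) \<le> 0\<close> says that no other component grows.\<close>
locale jsys =
  fixes I :: "nat set" and c :: "nat \<Rightarrow> complex"
    and Om :: "real \<Rightarrow> nat \<Rightarrow> nat \<Rightarrow> 'a::banach_superalgebra" and C :: real
  assumes fin: "finite I" and c_le: "\<And>e. e \<in> I \<Longrightarrow> Re (c e) \<le> 0" and C0: "0 \<le> C"
    and Om_bd: "\<And>x e f. norm (Om x e f) \<le> C * wt1 x"
    and Om_cont: "\<And>e f. continuous_on UNIV (\<lambda>x. Om x e f)"
begin

abbreviation "q \<equiv> real (card I) * C"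

lemma q0: "q \<ge> 0" using C0 by simp

text \<open>Closure under scalars and under \<open>Om\<close> keeps a solution that starts in these
  spaces inside them. The instance is the grading, where component \<open>e\<close> lies in the part
  of grade \<open>gr e + gr b\<close>.\<close>

definition inv_family :: "(nat \<Rightarrow> 'a set) \<Rightarrow> bool" where
  "inv_family S \<longleftrightarrow> (\<forall>e\<in>I. closed_space (S e) \<and> (\<forall>v\<in>S e. \<forall>z. z *\<^sub>C v \<in> S e) \<and>
     (\<forall>f\<in>I. \<forall>v\<in>S f. \<forall>x. Om x e f * v \<in> S e))"

lemma sol_exists:
  assumes S: "inv_family S" and c0: "\<And>e. e \<in> I \<Longrightarrow> c0 e \<in> S e"
  shows "\<exists>X. is_sol I c Om {y..} X \<and> (\<forall>e\<in>I. X y e = c0 e \<and> (\<forall>x\<ge>y. X x e \<in> S e))"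
proof -
  define A where "A x e f = (if e = f then c e *\<^sub>C 1 else 0) + Om x e f" for x e f
  have sumA: "(\<Sum>f\<in>I. A x e f * X f) = c e *\<^sub>C X e + (\<Sum>f\<in>I. Om x e f * X f)" if "e \<in> I" for x e X
  proof -
    have "(\<Sum>f\<in>I. A x e f * X f) = (\<Sum>f\<in>I. if e = f then c e *\<^sub>C X e else 0) + (\<Sum>f\<in>I. Om x e f * X f)"
      unfolding sum.distrib[symmetric]
      by (intro sum.cong refl) (auto simp: A_def distrib_right scaleC_mult_left)
    then show ?thesis using that fin by simp
  qed
  have "\<exists>X. \<forall>e\<in>I. X y e = c0 e \<and> (\<forall>x\<ge>y. X x e \<in> S e \<and>
    ((\<lambda>s. X s e) has_vector_derivative (\<Sum>f\<in>I. A x e f * X x f)) (at x within {y..}))"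
  proof (rule linear_ode_exists[OF fin _ _ _ c0])
    show "continuous_on {y..} (\<lambda>x. A x e f)" for e f unfolding A_def
      by (intro continuous_intros continuous_on_subset[OF Om_cont]) auto
    show "norm (A x e f) \<le> (\<Sum>e\<in>I. cmod (c e)) + C" if "e \<in> I" for x e f
      unfolding A_def
    proof (rule norm_triangle_mono)
      have "cmod (c e) \<le> (\<Sum>e\<in>I. cmod (c e))" by (rule member_le_sum[OF that]) (use fin in auto)
      then show "norm (if e = f then c e *\<^sub>C (1::'a) else 0) \<le> (\<Sum>e\<in>I. cmod (c e))"
        using order_trans[OF norm_ge_zero[of "c e"]] by (auto simp: norm_scaleC)
      have "C * wt1 x \<le> C * 1" by (intro mult_left_mono wt_le_1 C0)
      then show "norm (Om x e f) \<le> C" using Om_bd[of x e f] by linarith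
    qed
    show "closed_space (S e)" if "e \<in> I" for e using S that by (simp add: inv_family_def)
    show "A x e f * v \<in> S e" if *: "e \<in> I" "f \<in> I" "v \<in> S f" for x e f v
    proof -
      have sub: "subspace (S e)" using S * by (simp add: inv_family_def closed_space_def)
      have 1: "(if e = f then c e *\<^sub>C 1 else 0) * v \<in> S e"
        using S * subspace_0[OF sub] by (auto simp: inv_family_def scaleC_mult_left)
      have 2: "Om x e f * v \<in> S e" using S * by (simp add: inv_family_def)
      show ?thesis unfolding A_def distrib_right by (rule subspace_add[OF sub 1 2])
    qed
  qed
  then obtain X where X: "\<And>e. e \<in> I \<Longrightarrow> X y e = c0 e" "\<And>e x. e \<in> I \<Longrightarrow> x \<ge> y \<Longrightarrow> X x e \<in> S e"
    "\<And>e x. e \<in> I \<Longrightarrow> x \<ge> y \<Longrightarrow>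
      ((\<lambda>s. X s e) has_vector_derivative (\<Sum>f\<in>I. A x e f * X x f)) (at x within {y..})"
    by blast
  have "is_sol I c Om {y..} X" unfolding is_sol_def using X(3) by (simp add: sumA)
  then show ?thesis using X(1,2) by blast
qed

lemma sol_bound:
  assumes X: "is_sol I c Om {y..} X" and le: "y \<le> x" and e: "e \<in> I"
    and \<delta>: "\<And>e. e \<in> I \<Longrightarrow> norm (X y e) \<le> \<delta>"
  shows "norm (X x e) \<le> gron q * \<delta>"
proof -
  have "norm (X x e) \<le> gron q * (\<delta> + 0 * pi)"
  proof (rule gronwall[where Z = X and r = "\<lambda>_ _. 0" and \<eta> = 0, OF fin le e C0 _ c_le Om_bd _ \<delta>])
    fix e s assume "e \<in> I" "y \<le> s" "s \<le> x"
    then show "((\<lambda>s. X s e) has_vector_derivative c e *\<^sub>C X s e + ((\<Sum>f\<in>I. Om s e f * X s f) + 0))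
        (at s within {y..x})"
      using is_sol_subset[OF X, of "{y..x}"] by (simp add: is_sol_def)
  qed auto
  then show ?thesis by simp
qed

lemma sol_diff:
  assumes "is_sol I c Om S X" "is_sol I c Om S Y"
  shows "is_sol I c Om S (\<lambda>x e. X x e - Y x e)"
  unfolding is_sol_def
proof (intro ballI)
  fix e x assume "e \<in> I" "x \<in> S"
  then have "((\<lambda>s. X s e) has_vector_derivative c e *\<^sub>C X x e + (\<Sum>f\<in>I. Om x e f * X x f)) (at x within S)"
    "((\<lambda>s. Y s e) has_vector_derivative c e *\<^sub>C Y x e + (\<Sum>f\<in>I. Om x e f * Y x f)) (at x within S)"
    using assms by (auto simp: is_sol_def)
  from has_vector_derivative_diff[OF this]
  show "((\<lambda>s. X s e - Y s e) has_vector_derivative c e *\<^sub>C (X x e - Y x e)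
      + (\<Sum>f\<in>I. Om x e f * (X x f - Y x f))) (at x within S)"
    by (simp add: scaleC.diff_right right_diff_distrib sum_subtractf algebra_simps)
qed

text \<open>Both bounds are uniform in the starting point \<open>y\<close>. The second becomes small
  when \<open>x\<close> and \<open>y\<close> go to - infinity together, being a difference of values
  of \<open>arctan\<close>; this makes solutions started further and further left a Cauchy
  family.\<close>

lemma sol_from_base:
  assumes Y: "is_sol I c Om {y..} Y" and Yy: "\<And>e. e \<in> I \<Longrightarrow> Y y e = mone e b"
    and b: "c b = 0" and le: "y \<le> x" and e: "e \<in> I"
  shows "norm (Y x e) \<le> gron q" and "norm (Y x e - mone e b) \<le> q * gron q * (arctan x - arctan y)"
proof -
  have bd: "norm (Y x e) \<le> gron q" if "e \<in> I" "y \<le> x" for e x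
    using sol_bound[OF Y that(2,1), of 1] Yy norm_mone_le by auto
  then show "norm (Y x e) \<le> gron q" using e le by blast
  let ?G = "gron q"
  have "norm (Y x e - mone e b) \<le> exp (Re (c e) * (x - y)) * norm (Y y e - mone e b)
      + (q * ?G * arctan x - q * ?G * arctan y)"
  proof (rule duhamel_bound[OF le])
    fix s assume s: "y \<le> s" "s \<le> x"
    have "((\<lambda>s. Y s e) has_vector_derivative c e *\<^sub>C Y s e + (\<Sum>f\<in>I. Om s e f * Y s f)) (at s within {y..x})"
      using is_sol_subset[OF Y, of "{y..x}"] e s by (simp add: is_sol_def)
    \<comment> \<open>The unit vector is annihilated by the diagonal part: either its entry is 0 or
      \<open>c b = 0\<close>.\<close>
    moreover have "c e *\<^sub>C (mone e b :: 'a) = 0"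
      using b by (auto simp: mone_def scaleC.zero_left scaleC.zero_right)
    ultimately show "((\<lambda>s. Y s e - mone e b) has_vector_derivative c e *\<^sub>C (Y s e - mone e b)
        + (\<Sum>f\<in>I. Om s e f * Y s f)) (at s within {y..x})"
      by (simp add: scaleC.diff_right has_vector_derivative_diff_const)
    show "((\<lambda>s. q * ?G * arctan s) has_vector_derivative q * ?G * wt1 s) (at s within {y..x})"
      by (intro has_vector_derivative_mult_right arctan_deriv)
    have "norm (\<Sum>f\<in>I. Om s e f * Y s f) \<le> (\<Sum>f\<in>I. C * wt1 s * ?G)"
      by (intro sum_norm_le norm_mult_le Om_bd bd s)
    then have 1: "norm (\<Sum>f\<in>I. Om s e f * Y s f) \<le> q * ?G * wt1 s" by (simp add: mult_ac)
    have "exp (Re (c e) * (x - s)) \<le> 1" using c_le[OF e] s by (auto intro: mult_nonpos_nonneg)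
    then show "exp (Re (c e) * (x - s)) * norm (\<Sum>f\<in>I. Om s e f * Y s f) \<le> q * ?G * wt1 s"
      using mult_right_mono[of _ 1 "norm (\<Sum>f\<in>I. Om s e f * Y s f)"] 1 by fastforce
  qed
  then show "norm (Y x e - mone e b) \<le> q * gron q * (arctan x - arctan y)"
    using Yy[OF e] by (simp add: right_diff_distrib)
qed

text \<open>The solution is the limit of the solutions \<open>Y y\<close> that start as the unit
  vector at \<open>y\<close>. At the later of two starting points the solutions differ by at most
  \<open>\<kappa> y\<close>, and \<open>sol_bound\<close> propagates this to the right with a fixed
  factor. The last clause is the rate of this limit, uniform in \<open>x\<close>; it later reduces
  the double limit in the monodromy matrix to a single one.\<close>

lemma jost_exists:
  assumes S: "inv_family S" and b: "b \<in> I" "c b = 0" and Sb: "1 \<in> S b"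
  shows "\<exists>L. is_jost I c Om b L \<and> (\<forall>x. \<forall>e\<in>I. L x e \<in> S e \<and> norm (L x e) \<le> gron q) \<and>
    (\<forall>y Y. is_sol I c Om {y..} Y \<and> (\<forall>e\<in>I. Y y e = mone e b) \<longrightarrow>
      (\<forall>x\<ge>y. \<forall>e\<in>I. norm (Y x e - L x e) \<le> gron q * (q * gron q * (arctan y + pi / 2))))"
proof -
  let ?G = "gron q"
  define \<kappa> where "\<kappa> y = q * ?G * (arctan y + pi / 2)" for y
  have G0: "?G > 0" by (rule gron_pos)
  have \<kappa>0: "(\<kappa> \<longlongrightarrow> 0) at_bot"
    unfolding \<kappa>_def by (rule tendsto_eq_intros arctan_bot refl | simp)+
  have "\<exists>X. is_sol I c Om {y..} X \<and> (\<forall>e\<in>I. X y e = mone e b \<and> (\<forall>x\<ge>y. X x e \<in> S e))" for y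
  proof (rule sol_exists[OF S])
    fix e assume "e \<in> I"
    then show "mone e b \<in> S e" using S Sb by (auto simp: mone_def inv_family_def closed_space_def intro: subspace_0)
  qed
  then obtain Y where Y: "\<And>y. is_sol I c Om {y..} (Y y)" "\<And>y e. e \<in> I \<Longrightarrow> Y y y e = mone e b"
    "\<And>y x e. e \<in> I \<Longrightarrow> y \<le> x \<Longrightarrow> Y y x e \<in> S e"
    by metis
  have close: "norm (Y y x e - Y y' x e) \<le> ?G * \<kappa> y" if "y' \<le> y" "y \<le> x" "e \<in> I" for y y' x e
  proof (rule sol_bound[OF sol_diff that(2,3)])
    show "is_sol I c Om {y..} (Y y)" by (rule Y)
    show "is_sol I c Om {y..} (Y y')" by (rule is_sol_subset[OF Y(1)]) (use that in auto)
    fix e assume e: "e \<in> I"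
    have "norm (Y y' y e - mone e b) \<le> q * ?G * (arctan y - arctan y')"
      by (rule sol_from_base(2)[OF Y(1,2) b(2) that(1) e])
    also have "\<dots> \<le> \<kappa> y" unfolding \<kappa>_def
      using arctan_range[of y'] G0 q0 by (intro mult_left_mono) auto
    finally show "norm (Y y y e - Y y' y e) \<le> \<kappa> y" using Y(2)[OF e] by (simp add: norm_minus_commute)
  qed
  define L where "L x e = lim (\<lambda>n. Y (- real n) x e)" for x e
  have conv: "(\<lambda>n. Y (- real n) x e) \<longlonglongrightarrow> L x e" if e: "e \<in> I" for x e
  proof -
    have "Cauchy (\<lambda>n. Y (- real n) x e)"
    proof (rule metric_CauchyI)
      fix \<epsilon> :: real assume \<epsilon>: "\<epsilon> > 0"
      have "((\<lambda>y. ?G * \<kappa> y) \<longlongrightarrow> 0) at_bot" using tendsto_mult_right_zero[OF \<kappa>0] by simp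
      from tendstoD[OF this, of "\<epsilon> / 2"] have "\<forall>\<^sub>F y in at_bot. \<bar>?G * \<kappa> y\<bar> < \<epsilon> / 2"
        using \<epsilon> by (simp add: dist_real_def)
      then have "\<forall>\<^sub>F y in at_bot. ?G * \<kappa> y < \<epsilon> / 2 \<and> y \<le> x"
        using eventually_le_at_bot[of x] by eventually_elim auto
      then obtain y where y: "?G * \<kappa> y < \<epsilon> / 2" "y \<le> x"
        using eventually_happens'[OF trivial_limit_at_bot_linorder] by blast
      obtain n0 :: nat where "- y \<le> real n0" using real_arch_simple by blast
      then have *: "- real n \<le> y" if "n \<ge> n0" for n using that by linarith
      show "\<exists>M. \<forall>m\<ge>M. \<forall>n\<ge>M. dist (Y (- real m) x e) (Y (- real n) x e) < \<epsilon>"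
      proof (intro exI allI impI)
        fix m n assume mn: "n0 \<le> m" "n0 \<le> n"
        have "norm (Y y x e - Y (- real m) x e) < \<epsilon> / 2" "norm (Y y x e - Y (- real n) x e) < \<epsilon> / 2"
          using close[OF * y(2) e] y(1) mn by (meson le_less_trans)+
        then show "dist (Y (- real m) x e) (Y (- real n) x e) < \<epsilon>"
          using dist_triangle_half_r[of "Y y x e"] by (simp add: dist_norm)
      qed
    qed
    then show ?thesis unfolding L_def by (simp add: Cauchy_convergent_iff convergent_LIMSEQ_iff)
  qed
  have ev: "\<forall>\<^sub>F n in sequentially. - real n \<le> y" for y
  proof -
    obtain n0 :: nat where "- y \<le> real n0" using real_arch_simple by blast
    then show ?thesis unfolding eventually_sequentially by (intro exI[of _ n0]) auto
  qed
  have YL: "norm (Y y x e - L x e) \<le> ?G * \<kappa> y" if "y \<le> x" "e \<in> I" for y x e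
  proof (rule tendsto_upperbound)
    show "(\<lambda>n. norm (Y y x e - Y (- real n) x e)) \<longlonglongrightarrow> norm (Y y x e - L x e)"
      by (intro tendsto_intros conv that)
    show "\<forall>\<^sub>F n in sequentially. norm (Y y x e - Y (- real n) x e) \<le> ?G * \<kappa> y"
      using ev[of y] by eventually_elim (use close that in auto)
  qed simp
  have LS: "L x e \<in> S e" if e: "e \<in> I" for x e
  proof (rule Lim_in_closed_set[OF _ _ sequentially_bot conv[OF e]])
    show "closed (S e)" using S e by (simp add: inv_family_def closed_space_def)
    show "\<forall>\<^sub>F n in sequentially. Y (- real n) x e \<in> S e"
      using ev[of x] by eventually_elim (use Y(3) e in auto)
  qed
  have Lbd: "norm (L x e) \<le> ?G" if e: "e \<in> I" for x e
  proof (rule tendsto_upperbound[OF tendsto_norm[OF conv[OF e]] _ sequentially_bot])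
    show "\<forall>\<^sub>F n in sequentially. norm (Y (- real n) x e) \<le> ?G"
      using ev[of x] by eventually_elim (rule sol_from_base(1)[OF Y(1,2) b(2) _ e])
  qed
  have Lbot: "((\<lambda>x. L x e) \<longlongrightarrow> mone e b) at_bot" if e: "e \<in> I" for e
  proof (rule LIM_zero_cancel, rule Lim_null_comparison)
    show "\<forall>\<^sub>F y in at_bot. norm (L y e - mone e b) \<le> ?G * \<kappa> y"
      using YL[OF order_refl e] Y(2)[OF e] by (auto simp: norm_minus_commute)
    show "((\<lambda>y. ?G * \<kappa> y) \<longlongrightarrow> 0) at_bot" using tendsto_mult_right_zero[OF \<kappa>0] by simp
  qed
  have "is_sol I c Om UNIV L"
    unfolding is_sol_def
  proof (intro ballI)
    fix e and x :: real assume e: "e \<in> I"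
    \<comment> \<open>Any starting point left of \<open>x\<close> will do: one-sided derivatives of
      \<open>Z\<close> become two-sided at the interior point \<open>x\<close>.\<close>
    define x0 where "x0 = x - 1"
    obtain Z where Z: "is_sol I c Om {x0..} Z" "\<And>e. e \<in> I \<Longrightarrow> Z x0 e = L x0 e"
      using sol_exists[OF S, of "L x0" x0] LS by blast
    \<comment> \<open>Both are within a multiple of \<open>\<kappa> y\<close> of \<open>Y y\<close>
      for every \<open>y \<le> x0\<close>, so they agree. The differential equation thus passes to
      the limit without being differentiated term by term.\<close>
    have ZL: "Z s e = L s e" if s: "s \<ge> x0" and e: "e \<in> I" for s e
    proof -
      have "norm (Z s e - L s e) \<le> (?G + 1) * (?G * \<kappa> y)" if y: "y \<le> x0" for y
      proof -
        have "norm (Z s e - Y y s e) \<le> ?G * (?G * \<kappa> y)"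
        proof (rule sol_bound[OF sol_diff[OF Z(1)] s e])
          show "is_sol I c Om {x0..} (Y y)" by (rule is_sol_subset[OF Y(1)]) (use y in auto)
          show "norm (Z x0 e - Y y x0 e) \<le> ?G * \<kappa> y" if "e \<in> I" for e
            using YL[OF y that] Z(2)[OF that] by (simp add: norm_minus_commute)
        qed
        moreover have "norm (Y y s e - L s e) \<le> ?G * \<kappa> y" using YL y s e by auto
        ultimately show ?thesis
          using norm_triangle_ineq[of "Z s e - Y y s e" "Y y s e - L s e"] by (simp add: algebra_simps)
      qed
      then have "\<forall>\<^sub>F y in at_bot. norm (Z s e - L s e) \<le> (?G + 1) * (?G * \<kappa> y)"
        using eventually_le_at_bot[of x0] by (rule eventually_mono[rotated])
      moreover have "((\<lambda>y. (?G + 1) * (?G * \<kappa> y)) \<longlongrightarrow> 0) at_bot"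
        using tendsto_mult_right_zero[OF tendsto_mult_right_zero[OF \<kappa>0]] by simp
      ultimately have "norm (Z s e - L s e) \<le> 0"
        by (intro tendsto_lowerbound[OF _ _ trivial_limit_at_bot_linorder])
      then show ?thesis by simp
    qed
    have Zd: "((\<lambda>s. Z s e) has_vector_derivative c e *\<^sub>C Z x e + (\<Sum>f\<in>I. Om x e f * Z x f)) (at x within {x0..})"
      using Z(1) e by (simp add: is_sol_def x0_def)
    have "((\<lambda>s. Z s e) has_vector_derivative c e *\<^sub>C L x e + (\<Sum>f\<in>I. Om x e f * L x f)) (at x)"
    proof -
      have 1: "at x within {x0..} = at x" by (rule at_within_interior) (simp add: x0_def)
      have 2: "Z x f = L x f" if "f \<in> I" for f by (rule ZL[OF _ that]) (simp add: x0_def)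
      have 3: "(\<Sum>f\<in>I. Om x e f * Z x f) = (\<Sum>f\<in>I. Om x e f * L x f)" by (simp add: 2)
      show ?thesis using Zd unfolding 1 2[OF e] 3 .
    qed
    then have "((\<lambda>s. L s e) has_vector_derivative c e *\<^sub>C L x e + (\<Sum>f\<in>I. Om x e f * L x f)) (at x)"
      by (rule has_vector_derivative_transform_within_open[of _ _ _ "{x0<..}"])
        (use ZL e in \<open>auto simp: x0_def\<close>)
    then show "((\<lambda>s. L s e) has_vector_derivative c e *\<^sub>C L x e + (\<Sum>f\<in>I. Om x e f * L x f)) (at x within UNIV)"
      by simp
  qed
  moreover have "norm (Y' x e - L x e) \<le> ?G * \<kappa> y"
    if "is_sol I c Om {y..} Y'" "\<forall>e\<in>I. Y' y e = mone e b" "y \<le> x" "e \<in> I" for y Y' x e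
  proof -
    have "norm (Y' x e - Y y x e) \<le> ?G * 0"
      by (rule sol_bound[OF sol_diff[OF that(1) Y(1)] that(3,4)]) (use that(2) Y(2) in auto)
    then show ?thesis using YL[OF that(3,4)] by simp
  qed
  ultimately show ?thesis using Lbot LS Lbd unfolding is_jost_def \<kappa>_def by blast
qed

text \<open>Start at a point where all components are below an arbitrary \<delta>, then let \<delta>
  go to 0; the bound left over involves the inhomogeneity alone.\<close>

lemma gronwall_from_bot:
  assumes e: "e \<in> I"
    and Z: "\<And>e s. e \<in> I \<Longrightarrow> ((\<lambda>s. Z s e) has_vector_derivative
        c e *\<^sub>C Z s e + ((\<Sum>f\<in>I. Om s e f * Z s f) + r s e)) (at s)"
    and r: "\<And>e s. e \<in> I \<Longrightarrow> norm (r s e) \<le> \<eta> * wt1 s"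
    and bot: "\<And>e. e \<in> I \<Longrightarrow> ((\<lambda>x. Z x e) \<longlongrightarrow> 0) at_bot"
  shows "norm (Z x e) \<le> gron q * (\<eta> * pi)"
proof (rule norm_le_of_eps[OF _ gron_pos])
  fix \<delta> :: real assume \<delta>: "\<delta> > 0"
  have "\<forall>\<^sub>F y in at_bot. norm (Z y e) < \<delta>" if "e \<in> I" for e
    using tendstoD[OF bot[OF that] \<delta>] by simp
  then have "\<forall>\<^sub>F y in at_bot. y \<le> x \<and> (\<forall>e\<in>I. norm (Z y e) < \<delta>)"
    using fin by (intro eventually_conj eventually_le_at_bot eventually_ball_finite) auto
  then obtain y where y: "y \<le> x" "\<And>e. e \<in> I \<Longrightarrow> norm (Z y e) \<le> \<delta>"
    using eventually_happens'[OF trivial_limit_at_bot_linorder, of "\<lambda>y. y \<le> x \<and> (\<forall>e\<in>I. norm (Z y e) < \<delta>)"]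
    by (auto intro: less_imp_le)
  have "norm (Z x e) \<le> gron q * (\<delta> + \<eta> * pi)"
    by (rule gronwall[where Z = Z and r = r, OF fin y(1) e C0 has_vector_derivative_at_within[OF Z] c_le Om_bd r y(2)])
  then show "norm (Z x e) \<le> gron q * \<delta> + gron q * (\<eta> * pi)" by (simp add: algebra_simps)
qed

lemma jost_unique:
  assumes "is_jost I c Om b L" "is_jost I c Om b L'" and e: "e \<in> I"
  shows "L x e = L' x e"
proof -
  have "is_sol I c Om UNIV (\<lambda>x e. L x e - L' x e)"
    using assms by (intro sol_diff) (auto simp: is_jost_def)
  moreover have "((\<lambda>x. L x e - L' x e) \<longlongrightarrow> 0) at_bot" if "e \<in> I" for e
    using assms that tendsto_diff[of "\<lambda>x. L x e" "mone e b" at_bot "\<lambda>x. L' x e" "mone e b"] by (simp add: is_jost_def)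
  ultimately have "norm (L x e - L' x e) \<le> gron q * (0 * pi)"
    by (intro gronwall_from_bot[where r = "\<lambda>_ _. 0" and Z = "\<lambda>x e. L x e - L' x e", OF e]) (auto simp: is_sol_def)
  then show ?thesis by simp
qed

text \<open>Uniqueness carries the properties of the solution built in \<open>jost_exists\<close>
  over to the chosen one.\<close>

lemma jost_is_jost:
  assumes S: "inv_family S" and b: "b \<in> I" "c b = 0" and Sb: "1 \<in> S b"
  shows "is_jost I c Om b (jost I c Om b)"
    and "e \<in> I \<Longrightarrow> jost I c Om b x e \<in> S e"
    and "e \<in> I \<Longrightarrow> norm (jost I c Om b x e) \<le> gron q"
    and "is_sol I c Om {y..} Y \<Longrightarrow> (\<And>e. e \<in> I \<Longrightarrow> Y y e = mone e b) \<Longrightarrow> y \<le> x \<Longrightarrow> e \<in> I \<Longrightarrow>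
      norm (Y x e - jost I c Om b x e) \<le> gron q * (q * gron q * (arctan y + pi / 2))"
proof -
  obtain L where L: "is_jost I c Om b L" "\<And>x e. e \<in> I \<Longrightarrow> L x e \<in> S e"
    "\<And>x e. e \<in> I \<Longrightarrow> norm (L x e) \<le> gron q"
    "\<And>y Y x e. is_sol I c Om {y..} Y \<Longrightarrow> \<forall>e\<in>I. Y y e = mone e b \<Longrightarrow> y \<le> x \<Longrightarrow> e \<in> I \<Longrightarrow>
      norm (Y x e - L x e) \<le> gron q * (q * gron q * (arctan y + pi / 2))"
    using jost_exists[OF assms] by blast
  show j: "is_jost I c Om b (jost I c Om b)" unfolding jost_def by (rule someI[of _ L]) (rule L)
  have eq: "jost I c Om b x e = L x e" if "e \<in> I" for x e by (rule jost_unique[OF j L(1) that])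
  show "e \<in> I \<Longrightarrow> jost I c Om b x e \<in> S e" "e \<in> I \<Longrightarrow> norm (jost I c Om b x e) \<le> gron q"
    "is_sol I c Om {y..} Y \<Longrightarrow> (\<And>e. e \<in> I \<Longrightarrow> Y y e = mone e b) \<Longrightarrow> y \<le> x \<Longrightarrow> e \<in> I \<Longrightarrow>
      norm (Y x e - jost I c Om b x e) \<le> gron q * (q * gron q * (arctan y + pi / 2))"
    using L(2-4) by (simp_all add: eq)
qed

end

text \<open>Barrier argument. The derivative of
  \<open>exp (\<tau> * (s - x)) * wt \<sigma> s\<close> is at least \<sigma> times
  \<open>exp (\<tau> * (s - x)) * wt1 s\<close>, because the logarithmic derivative of
  \<open>wt \<sigma>\<close> is at most \<sigma> in absolute value while \<tau> is at least
  \<open>2 * \<sigma>\<close>. So a damped component does not merely stay bounded but inherits an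
  integrable weight, of width \<open>1 / \<sigma>\<close>.\<close>

lemma fast_bound:
  fixes w :: "real \<Rightarrow> 'a::banach_superalgebra"
  assumes w: "\<And>s. (w has_vector_derivative c *\<^sub>C w s + r s) (at s)"
    and bot: "(w \<longlongrightarrow> 0) at_bot" and r: "\<And>s. norm (r s) \<le> \<eta> * wt1 s"
    and s: "0 < \<sigma>" "\<sigma> \<le> 1" "2 * \<sigma> \<le> - Re c"
  shows "norm (w x) \<le> \<eta> / \<sigma> * wt \<sigma> x"
proof -
  define \<tau> where "\<tau> = - Re c"
  have \<eta>0: "\<eta> \<ge> 0" using order_trans[OF norm_ge_zero r[of 0]] by (simp add: wt_def)
  have est: "norm (w x) \<le> norm (w y) + \<eta> / \<sigma> * wt \<sigma> x" if le: "y \<le> x" for y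
  proof -
    let ?\<psi> = "\<lambda>s. \<eta> / \<sigma> * (exp (\<tau> * (s - x)) * wt \<sigma> s)"
    let ?wt' = "\<lambda>s. - (2 * \<sigma>\<^sup>2 * s) * (wt \<sigma> s)\<^sup>2"
    let ?\<psi>' = "\<lambda>s. \<eta> / \<sigma> * (exp (\<tau> * (s - x)) * (\<tau> * wt \<sigma> s + ?wt' s))"
    have "norm (w x) \<le> exp (Re c * (x - y)) * norm (w y) + (?\<psi> x - ?\<psi> y)"
    proof (rule duhamel_bound[OF le has_vector_derivative_at_within[OF w], where \<psi>' = ?\<psi>'])
      fix s assume "y \<le> s" "s \<le> x"
      have "1 + (\<sigma> * s)\<^sup>2 \<noteq> 0" by (metis add_pos_nonneg less_irrefl zero_le_power2 zero_less_one)
      then have "(wt \<sigma> has_real_derivative ?wt' s) (at s)" unfolding wt_def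
        by (auto intro!: derivative_eq_intros simp: power2_eq_square field_simps)
      then have "(?\<psi> has_real_derivative ?\<psi>' s) (at s)"
        by (intro DERIV_cmult) (auto intro!: derivative_eq_intros simp: algebra_simps)
      then show "(?\<psi> has_vector_derivative ?\<psi>' s) (at s within {y..x})"
        by (simp add: has_real_derivative_iff_has_vector_derivative has_vector_derivative_at_within)
      \<comment> \<open>This is
        \<open>2 * (\<sigma> * s) \<le> 1 + (\<sigma> * s)\<^sup>2\<close>.\<close>
      have "2 * \<sigma>\<^sup>2 * s * wt \<sigma> s \<le> \<sigma>"
      proof -
        have "0 \<le> (1 - \<sigma> * s)\<^sup>2" by simp
        then have "\<sigma> * (2 * (\<sigma> * s)) \<le> \<sigma> * (1 + (\<sigma> * s)\<^sup>2)"
          using s by (intro mult_left_mono) (auto simp: power2_eq_square algebra_simps)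
        moreover have pos: "0 < 1 + (\<sigma> * s)\<^sup>2" by (simp add: add_pos_nonneg)
        moreover have "2 * \<sigma>\<^sup>2 * s * wt \<sigma> s = \<sigma> * (2 * (\<sigma> * s)) / (1 + (\<sigma> * s)\<^sup>2)"
          by (simp add: wt_def divide_inverse power2_eq_square)
        ultimately show ?thesis by (simp only: pos_divide_le_eq)
      qed
      then have "2 * \<sigma>\<^sup>2 * s * wt \<sigma> s * wt \<sigma> s \<le> \<sigma> * wt \<sigma> s" by (intro mult_right_mono wt_nonneg)
      moreover have "2 * \<sigma> * wt \<sigma> s \<le> \<tau> * wt \<sigma> s" using s by (intro mult_right_mono wt_nonneg) (simp add: \<tau>_def)
      ultimately have "\<sigma> * wt \<sigma> s \<le> \<tau> * wt \<sigma> s + ?wt' s" by (simp add: power2_eq_square mult_ac)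
      moreover have "\<sigma> * wt1 s \<le> \<sigma> * wt \<sigma> s" using s wt_antimono[of \<sigma> s] by (intro mult_left_mono) auto
      ultimately have "\<sigma> * wt1 s \<le> \<tau> * wt \<sigma> s + ?wt' s" by linarith
      then have "\<eta> / \<sigma> * (\<sigma> * wt1 s) \<le> \<eta> / \<sigma> * (\<tau> * wt \<sigma> s + ?wt' s)"
        by (rule mult_left_mono) (use \<eta>0 s in simp)
      then have nr: "norm (r s) \<le> \<eta> / \<sigma> * (\<tau> * wt \<sigma> s + ?wt' s)" using r[of s] s by simp
      have ex: "Re c * (x - s) = \<tau> * (s - x)" by (simp add: \<tau>_def algebra_simps)
      show "exp (Re c * (x - s)) * norm (r s) \<le> ?\<psi>' s"
        unfolding ex using mult_left_mono[OF nr, of "exp (\<tau> * (s - x))"] by (simp add: mult_ac)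
    qed
    moreover have "exp (Re c * (x - y)) * norm (w y) \<le> 1 * norm (w y)"
      using s le by (intro mult_right_mono) (auto intro: mult_nonpos_nonneg)
    moreover have "?\<psi> y \<ge> 0" using \<eta>0 s wt_nonneg[of \<sigma> y] by simp
    ultimately show ?thesis by simp
  qed
  show ?thesis
  proof (rule tendsto_lowerbound[OF _ _ trivial_limit_at_bot_linorder])
    show "((\<lambda>y. norm (w y) + \<eta> / \<sigma> * wt \<sigma> x) \<longlongrightarrow> \<eta> / \<sigma> * wt \<sigma> x) at_bot"
      using tendsto_add[OF tendsto_norm[OF bot] tendsto_const] by simp
    show "\<forall>\<^sub>F y in at_bot. norm (w x) \<le> norm (w y) + \<eta> / \<sigma> * wt \<sigma> x"
      using eventually_le_at_bot[of x] by eventually_elim (rule est)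
  qed
qed

lemma wt_at_top: "\<sigma> > 0 \<Longrightarrow> (wt \<sigma> \<longlongrightarrow> 0) at_top"
proof -
  assume s: "\<sigma> > 0"
  have "filterlim (\<lambda>x. 1 + (\<sigma> * x)\<^sup>2) at_top at_top"
    by (intro filterlim_tendsto_add_at_top[OF tendsto_const] filterlim_pow_at_top
        filterlim_tendsto_pos_mult_at_top[OF tendsto_const s] filterlim_ident) auto
  then show ?thesis unfolding wt_def by (rule tendsto_inverse_0_at_top)
qed

section \<open>The Jost solutions of the Lax matrix\<close>

lemma ex_limit_at_top:
  fixes F :: "real \<Rightarrow> 'a::banach"
  assumes F: "\<And>x. (F has_vector_derivative f x) (at x)" and "continuous_on UNIV f"
    and "\<And>x. norm (f x) \<le> C * wt1 x"
  shows "\<exists>l. (F \<longlongrightarrow> l) at_top"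
proof -
  obtain G v where G: "\<And>x. (G has_vector_derivative f x) (at x)" "(G \<longlongrightarrow> v) at_top"
    using ex_primitive_from_bot[OF assms(2,3)] by blast
  have "((\<lambda>x. F x - G x) has_vector_derivative 0) (at x within UNIV)" for x
    using has_vector_derivative_diff[OF F G(1), of x] by simp
  then obtain k where "\<And>x. F x - G x = k"
    using has_vector_derivative_zero_constant[of UNIV "\<lambda>x. F x - G x"] by auto
  then have "F = (\<lambda>x. G x + k)" by (auto simp: algebra_simps)
  then show ?thesis using tendsto_add[OF G(2) tendsto_const] by blast
qed

lemma schwartz_wt_bound:
  fixes f :: "real \<Rightarrow> 'a::real_normed_vector"
  assumes "schwartz f"
  shows "\<exists>B. \<forall>x. norm (f x) \<le> B * wt1 x"
proof -
  obtain d where d: "d 0 = f" "\<And>k n. bounded (range (\<lambda>x. x ^ k *\<^sub>R d n x))"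
    using assms by (auto simp: schwartz_def)
  obtain B0 where B0: "\<And>x. norm (f x) \<le> B0" using d(2)[of 0 0] d(1) by (auto simp: bounded_iff)
  obtain B2 where "\<And>x. norm (x ^ 2 *\<^sub>R d 0 x) \<le> B2" using d(2)[of 2 0] by (auto simp: bounded_iff)
  then have B2: "\<And>x. x\<^sup>2 * norm (f x) \<le> B2" using d(1) by simp
  have "norm (f x) \<le> (B0 + B2) * wt1 x" for x
  proof -
    have "norm (f x) * (1 + x\<^sup>2) \<le> B0 + B2" using B0[of x] B2[of x] by (simp add: algebra_simps)
    moreover have "0 < 1 + x\<^sup>2" by (simp add: add_pos_nonneg)
    ultimately show ?thesis by (simp add: wt_def divide_inverse[symmetric] pos_le_divide_eq)
  qed
  then show ?thesis by blast
qed

lemma schwartz_continuous: "schwartz f \<Longrightarrow> continuous_on UNIV f"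
  unfolding schwartz_def
  by (metis continuous_at_imp_continuous_on has_vector_derivative_continuous)

lemma schwartz_reflect:
  fixes f :: "real \<Rightarrow> 'a::real_normed_vector"
  assumes "schwartz f" shows "schwartz (\<lambda>x. f (- x))"
proof -
  obtain d where d: "d 0 = f" "\<And>n x. (d n has_vector_derivative d (Suc n) x) (at x)"
    "\<And>k n. bounded (range (\<lambda>x. x ^ k *\<^sub>R d n x))" using assms by (auto simp: schwartz_def)
  define e where "e n x = (-1) ^ n *\<^sub>R d n (- x)" for n :: nat and x :: real
  have "(e n has_vector_derivative e (Suc n) x) (at x)" for n x
  proof -
    have "((\<lambda>x. d n (- x)) has_vector_derivative - d (Suc n) (- x)) (at x)"
      using vector_diff_chain_at[of uminus "-1" x "d n" "d (Suc n) (- x)"] d(2)[of n "- x"]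
      by (simp add: o_def has_vector_derivative_minus[OF has_vector_derivative_id])
    then show ?thesis unfolding e_def[abs_def]
      using has_vector_derivative_scaleR[OF DERIV_const[of "(-1) ^ n"], of _ "- d (Suc n) (- x)" x UNIV]
      by simp
  qed
  moreover have "bounded (range (\<lambda>x. x ^ k *\<^sub>R e n x))" for k n
  proof -
    obtain B where "\<And>x. norm (x ^ k *\<^sub>R d n x) \<le> B" using d(3)[of k n] by (auto simp: bounded_iff)
    then have B: "\<bar>x\<bar> ^ k * norm (d n x) \<le> B" for x by (simp add: power_abs)
    have "norm (x ^ k *\<^sub>R e n x) \<le> B" for x using B[of "- x"] by (simp add: e_def power_abs abs_mult)
    then show ?thesis unfolding bounded_iff by blast
  qed
  moreover have "e 0 = (\<lambda>x. f (- x))" by (simp add: e_def d(1) fun_eq_iff)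
  ultimately show ?thesis unfolding schwartz_def by blast
qed

definition refl_cfg :: "'a config \<Rightarrow> 'a config" where "refl_cfg \<phi> j x = \<phi> j (- x)"

lemma refl_fields: "\<phi> \<in> fields M N \<Longrightarrow> refl_cfg \<phi> \<in> fields M N"
  by (auto simp: fields_def refl_cfg_def[abs_def] schwartz_reflect)

locale super_nls =
  fixes M N :: nat and g :: real
  assumes g_pos: "0 < g"
begin

abbreviation "K \<equiv> {1..M + N}"
abbreviation "m \<equiv> M + N + 1"
abbreviation "I \<equiv> {1..M + N + 1}"
abbreviation "gr \<equiv> grade M N"
abbreviation "Om \<equiv> Omega_mat M N g"
abbreviation "sqg \<equiv> \<i> * complex_of_real (sqrt g)"

definition sg :: "nat \<Rightarrow> complex" where "sg e = (if e = m then - 1 else 1)"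

text \<open>Exponent of component \<open>e\<close> after division by
  \<open>exp (\<i> * \<zeta> / 2 * sg b * x)\<close>. It vanishes on the block of \<open>b\<close>
  and is plus or minus \<open>\<i> * \<zeta>\<close> on the other block, which is why each block has
  its own half-plane.\<close>

definition cd :: "complex \<Rightarrow> nat \<Rightarrow> nat \<Rightarrow> complex" where
  "cd \<zeta> b e = \<i> * \<zeta> / 2 * (sg e - sg b)"

text \<open>The half-plane in which the Jost solutions with index \<open>b\<close> exist.\<close>
definition good :: "complex \<Rightarrow> nat \<Rightarrow> bool" where
  "good \<zeta> b \<longleftrightarrow> (if b = m then 0 \<le> Im \<zeta> else Im \<zeta> \<le> 0)"

definition bnd :: "real \<Rightarrow> 'a::banach_superalgebra config \<Rightarrow> bool" where
  "bnd B \<phi> \<longleftrightarrow> 0 \<le> B \<and> (\<forall>j\<in>K. \<forall>x. norm (\<phi> j x) \<le> B * wt1 x)"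

lemma sum_I: "sum h I = sum h K + h m" for h :: "nat \<Rightarrow> 'b::comm_monoid_add"
  using sum.cl_ivl_Suc[of h 1 "M + N"] by simp

lemma m_in: "m \<in> I" and K_I: "j \<in> K \<Longrightarrow> j \<in> I" and K_ne_m: "j \<in> K \<Longrightarrow> j \<noteq> m"
  and I_cases: "e \<in> I \<Longrightarrow> e \<noteq> m \<Longrightarrow> e \<in> K"
  by auto

lemma gr_m [simp]: "gr m = 0" "gr (Suc (M + N)) = 0" by (simp_all add: grade_def)

lemma Om_eq: "Om \<phi> x e f = (if e \<in> K \<and> f = m then sqg *\<^sub>C \<phi> e x
    else if e = m \<and> f \<in> K then - (sqg *\<^sub>C (\<phi> f x)\<^sup>\<dagger>) else 0)"
proof -
  have "Om \<phi> x e f = sqg *\<^sub>C ((\<Sum>j\<in>K. if j = e then (if f = m then \<phi> j x else 0) else 0)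
      - (\<Sum>j\<in>K. if j = f then (if e = m then (\<phi> j x)\<^sup>\<dagger> else 0) else 0))"
    unfolding Omega_mat_def sum_subtractf[symmetric] elem_mat_def
    by (intro arg_cong[where f = "scaleC sqg"] sum.cong refl) auto
  also have "\<dots> = (if e \<in> K \<and> f = m then sqg *\<^sub>C \<phi> e x
    else if e = m \<and> f \<in> K then - (sqg *\<^sub>C (\<phi> f x)\<^sup>\<dagger>) else 0)"
    by (subst (1 2) sum.delta) (auto simp: scaleC.zero_right scaleC.minus_right)
  finally show ?thesis .
qed

lemma sum_Om: "e \<in> I \<Longrightarrow> (\<Sum>f\<in>I. Om \<phi> x e f * X f) =
    (if e = m then - (sqg *\<^sub>C (\<Sum>j\<in>K. (\<phi> j x)\<^sup>\<dagger> * X j)) else sqg *\<^sub>C (\<phi> e x * X m))"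
proof -
  assume e: "e \<in> I"
  show ?thesis
  proof (cases "e = m")
    case True
    have "(\<Sum>f\<in>K. Om \<phi> x m f * X f) = (\<Sum>f\<in>K. - (sqg *\<^sub>C ((\<phi> f x)\<^sup>\<dagger> * X f)))"
      by (intro sum.cong refl) (auto simp: Om_eq scaleC_mult_left)
    then show ?thesis using True by (simp only: sum_I) (simp add: Om_eq scaleC.sum_right sum_negf)
  next
    case False
    then have "(\<Sum>f\<in>K. Om \<phi> x e f * X f) = 0" by (intro sum.neutral) (auto simp: Om_eq)
    moreover have "e \<in> K" using e False by auto
    ultimately show ?thesis using False by (simp only: sum_I) (simp add: Om_eq scaleC_mult_left)
  qed
qed

lemma norm_sqg: "cmod sqg = sqrt g" using g_pos by (simp add: norm_mult)

lemma Om_bd: "bnd B \<phi> \<Longrightarrow> norm (Om \<phi> x e f) \<le> sqrt g * B * wt1 x"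
proof -
  assume B: "bnd B \<phi>"
  have "norm (Om \<phi> x e f) \<le> sqrt g * (B * wt1 x)"
    using B wt_nonneg[of 1 x] g_pos by (auto simp: Om_eq norm_scaleC norm_sqg norm_adj bnd_def)
  then show ?thesis by (simp add: mult.assoc)
qed

lemma fields_bnd: assumes "\<phi> \<in> fields M N" obtains B where "bnd B \<phi>"
proof -
  have "\<forall>j\<in>K. \<exists>B. \<forall>x. norm (\<phi> j x) \<le> B * wt1 x"
    using assms schwartz_wt_bound by (auto simp: fields_def)
  then obtain b where b: "\<And>j x. j \<in> K \<Longrightarrow> norm (\<phi> j x) \<le> b j * wt1 x" by metis
  have b0: "b j \<ge> 0" if "j \<in> K" for j using order_trans[OF norm_ge_zero b[OF that, of 0]] by (simp add: wt_def)
  have "norm (\<phi> j x) \<le> sum b K * wt1 x" if "j \<in> K" for j x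
  proof -
    have "b j \<le> sum b K" using b0 that by (intro member_le_sum) auto
    then show ?thesis using b[OF that, of x] mult_right_mono[OF _ wt_nonneg[of 1 x], of "b j" "sum b K"] by linarith
  qed
  then have "bnd (sum b K) \<phi>" unfolding bnd_def using b0 by (auto intro: sum_nonneg)
  then show ?thesis by (rule that)
qed

lemma Om_cont: "\<phi> \<in> fields M N \<Longrightarrow> continuous_on UNIV (\<lambda>x. Om \<phi> x e f)"
proof -
  assume p: "\<phi> \<in> fields M N"
  have c: "continuous_on UNIV (\<phi> j)" if "j \<in> K" for j
    using p that by (auto simp: fields_def intro: schwartz_continuous)
  have 1: "e \<in> K \<Longrightarrow> continuous_on UNIV (\<lambda>x. sqg *\<^sub>C \<phi> e x)"
    "f \<in> K \<Longrightarrow> continuous_on UNIV (\<lambda>x. - (sqg *\<^sub>C (\<phi> f x)\<^sup>\<dagger>))"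
    by (auto intro!: continuous_on_minus scaleC.continuous_on continuous_on_const c adj_continuous_on)
  show ?thesis unfolding Om_eq using 1 by (cases "e \<in> K \<and> f = m"; cases "e = m \<and> f \<in> K") auto
qed

lemma field_homog: "\<phi> \<in> fields M N \<Longrightarrow> j \<in> K \<Longrightarrow> \<phi> j x \<in> homog (gr j)"
  by (auto simp: fields_def)

lemma Om_homog: "\<phi> \<in> fields M N \<Longrightarrow> Om \<phi> x e f \<in> homog (gr e + gr f)"
proof -
  assume p: "\<phi> \<in> fields M N"
  have 1: "sqg *\<^sub>C \<phi> e x \<in> homog (gr e + gr m)" if "e \<in> K"
    using field_homog[OF p that] by (simp only: gr_m add_0_right homog_scaleC)
  have 2: "- (sqg *\<^sub>C (\<phi> f x)\<^sup>\<dagger>) \<in> homog (gr m + gr f)" if "f \<in> K"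
    using field_homog[OF p that] by (simp only: gr_m add_0_left homog_scaleC homog_minus adj_homog)
  show ?thesis unfolding Om_eq using 1 2 homog_zero by (simp only: split: if_split) blast
qed

text \<open>\<Omega> is hermitian, since \<open>sqg\<close> is imaginary. Together with the
  reflection of the line this turns the row equation into a column equation.\<close>

lemma Om_adj: "(Om \<phi> x e f)\<^sup>\<dagger> = Om \<phi> x f e"
  by (auto simp: Om_eq adj_minus adj_scaleC adj_adj scaleC.minus_left)

lemma cd_le: "good \<zeta> b \<Longrightarrow> Re (cd \<zeta> b e) \<le> 0"
  by (auto simp: cd_def sg_def good_def)

lemma cd_same: "sg a = sg b \<Longrightarrow> cd \<zeta> a = cd \<zeta> b" and cd_zero: "sg a = sg b \<Longrightarrow> cd \<zeta> b a = 0"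
  by (auto simp: cd_def)

text \<open>Conjugating the exponent amounts to reflecting \<zeta> in the imaginary axis, which
  preserves the half-plane.\<close>

lemma cd_cnj: "cnj (cd \<zeta> b e) = cd (- cnj \<zeta>) b e"
  by (simp add: cd_def sg_def)

lemma good_cnj: "good (- cnj \<zeta>) b = good \<zeta> b" by (simp add: good_def)

lemma good_same: "sg a = sg b \<Longrightarrow> good \<zeta> a = good \<zeta> b"
  by (auto simp: good_def sg_def split: if_splits)

lemma sg_K: "j \<in> K \<Longrightarrow> sg j = 1" and sg_m: "sg m = - 1"
  by (auto simp: sg_def)

lemma jsys_Om:
  assumes "\<phi> \<in> fields M N" "good \<zeta> b" "bnd B \<phi>"
  shows "jsys I (cd \<zeta> b) (Om \<phi>) (sqrt g * B)"
  using assms by unfold_locales (auto simp: cd_le Om_cont Om_bd bnd_def less_imp_le[OF g_pos])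

definition jcol :: "complex \<Rightarrow> nat \<Rightarrow> 'a::banach_superalgebra config \<Rightarrow> real \<Rightarrow> nat \<Rightarrow> 'a" where
  "jcol \<zeta> b \<phi> = jost I (cd \<zeta> b) (Om \<phi>) b"

text \<open>The adjoint equation on the reflected line has the form of the original one at \<open>- cnj \<zeta>\<close>, so
  rows need no separate construction.\<close>
definition jrow :: "complex \<Rightarrow> nat \<Rightarrow> 'a::banach_superalgebra config \<Rightarrow> real \<Rightarrow> nat \<Rightarrow> 'a" where
  "jrow \<zeta> a \<phi> x e = (jcol (- cnj \<zeta>) a (refl_cfg \<phi>) (- x) e)\<^sup>\<dagger>"

text \<open>Bound for the Jost solutions of fields with \<open>bnd B\<close>; it does not involve
  \<zeta>.\<close>

definition Gc :: "real \<Rightarrow> real" where "Gc B = gron (real (card I) * (sqrt g * B))"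

text \<open>\<Omega> is an even matrix: passing from component \<open>f\<close> to component
  \<open>e\<close> changes the grade by \<open>gr e + gr f\<close>.\<close>

lemma inv_family_homog:
  assumes "\<phi> \<in> fields M N" "good \<zeta> b" "bnd B \<phi>"
  shows "jsys.inv_family I (Om \<phi>) (\<lambda>e. homog (gr e + gr b))"
  unfolding jsys.inv_family_def[OF jsys_Om[OF assms]]
proof (intro ballI conjI allI closed_space_homog)
  fix e f x and v :: 'a assume v: "v \<in> homog (gr f + gr b)"
  show "Om \<phi> x e f * v \<in> homog (gr e + gr b)"
    by (rule homog_mult'[OF Om_homog[OF assms(1)] v]) (cases "gr e"; cases "gr f"; cases "gr b"; simp)
qed (rule homog_scaleC)

context
  fixes \<phi> :: "'a::banach_superalgebra config" and \<zeta> :: complex and b :: nat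
  assumes \<phi>: "\<phi> \<in> fields M N" and good: "good \<zeta> b" and b: "b \<in> I"
begin

lemma jcol_facts:
  assumes B: "bnd B \<phi>"
  shows "is_jost I (cd \<zeta> b) (Om \<phi>) b (jcol \<zeta> b \<phi>)"
    and "e \<in> I \<Longrightarrow> jcol \<zeta> b \<phi> x e \<in> homog (gr e + gr b)"
    and "e \<in> I \<Longrightarrow> norm (jcol \<zeta> b \<phi> x e) \<le> Gc B"
    and "is_sol I (cd \<zeta> b) (Om \<phi>) {y..} Y \<Longrightarrow> (\<And>e. e \<in> I \<Longrightarrow> Y y e = mone e b) \<Longrightarrow> y \<le> x \<Longrightarrow> e \<in> I \<Longrightarrow>
      norm (Y x e - jcol \<zeta> b \<phi> x e) \<le> Gc B * (real (card I) * (sqrt g * B) * Gc B * (arctan y + pi / 2))"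
proof -
  have one: "1 \<in> homog (gr b + gr b)" using homog_one by (cases "gr b") auto
  note j = jsys.jost_is_jost[OF jsys_Om[OF \<phi> good B] inv_family_homog[OF \<phi> good B] b cd_zero[OF refl] one]
  show "is_jost I (cd \<zeta> b) (Om \<phi>) b (jcol \<zeta> b \<phi>)"
    "e \<in> I \<Longrightarrow> jcol \<zeta> b \<phi> x e \<in> homog (gr e + gr b)"
    "e \<in> I \<Longrightarrow> norm (jcol \<zeta> b \<phi> x e) \<le> Gc B"
    "is_sol I (cd \<zeta> b) (Om \<phi>) {y..} Y \<Longrightarrow> (\<And>e. e \<in> I \<Longrightarrow> Y y e = mone e b) \<Longrightarrow> y \<le> x \<Longrightarrow> e \<in> I \<Longrightarrow>
      norm (Y x e - jcol \<zeta> b \<phi> x e) \<le> Gc B * (real (card I) * (sqrt g * B) * Gc B * (arctan y + pi / 2))"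
    unfolding jcol_def Gc_def using j by blast+
qed

lemma jcol_deriv: "e \<in> I \<Longrightarrow> ((\<lambda>s. jcol \<zeta> b \<phi> s e) has_vector_derivative
    cd \<zeta> b e *\<^sub>C jcol \<zeta> b \<phi> x e + (\<Sum>f\<in>I. Om \<phi> x e f * jcol \<zeta> b \<phi> x f)) (at x)"
  and jcol_bot: "e \<in> I \<Longrightarrow> ((\<lambda>x. jcol \<zeta> b \<phi> x e) \<longlongrightarrow> mone e b) at_bot"
  and jcol_homog: "e \<in> I \<Longrightarrow> jcol \<zeta> b \<phi> x e \<in> homog (gr e + gr b)"
proof -
  obtain B where B: "bnd B \<phi>" using fields_bnd[OF \<phi>] .
  show "e \<in> I \<Longrightarrow> ((\<lambda>s. jcol \<zeta> b \<phi> s e) has_vector_derivative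
    cd \<zeta> b e *\<^sub>C jcol \<zeta> b \<phi> x e + (\<Sum>f\<in>I. Om \<phi> x e f * jcol \<zeta> b \<phi> x f)) (at x)"
    "e \<in> I \<Longrightarrow> ((\<lambda>x. jcol \<zeta> b \<phi> x e) \<longlongrightarrow> mone e b) at_bot"
    "e \<in> I \<Longrightarrow> jcol \<zeta> b \<phi> x e \<in> homog (gr e + gr b)"
    using jcol_facts(1,2)[OF B] by (auto simp: is_jost_def is_sol_def)
qed

lemma jcol_cont: "e \<in> I \<Longrightarrow> continuous_on UNIV (\<lambda>x. jcol \<zeta> b \<phi> x e)"
  by (intro continuous_at_imp_continuous_on ballI has_vector_derivative_continuous[OF jcol_deriv])

lemma jcol_bdd: "\<exists>G. \<forall>x. \<forall>e\<in>I. norm (jcol \<zeta> b \<phi> x e) \<le> G"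
  using fields_bnd[OF \<phi>] jcol_facts(3) by metis

text \<open>Within the block of \<open>b\<close> the diagonal term is 0, so the derivative is
  dominated by the weight and the component converges. For real \<zeta> the other block carries an
  oscillating factor and in general has no limit.\<close>

lemma jcol_top: "a \<in> I \<Longrightarrow> sg a = sg b \<Longrightarrow> \<exists>l. ((\<lambda>x. jcol \<zeta> b \<phi> x a) \<longlongrightarrow> l) at_top"
proof -
  assume a: "a \<in> I" "sg a = sg b"
  obtain B where B: "bnd B \<phi>" using fields_bnd[OF \<phi>] .
  show ?thesis
  proof (rule ex_limit_at_top)
    show "((\<lambda>x. jcol \<zeta> b \<phi> x a) has_vector_derivative (\<Sum>f\<in>I. Om \<phi> x a f * jcol \<zeta> b \<phi> x f)) (at x)" for x
      using jcol_deriv[OF a(1), of x] by (simp add: cd_zero[OF a(2)] scaleC.zero_left)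
    show "continuous_on UNIV (\<lambda>x. \<Sum>f\<in>I. Om \<phi> x a f * jcol \<zeta> b \<phi> x f)"
      by (intro continuous_intros Om_cont \<phi> jcol_cont) auto
    show "norm (\<Sum>f\<in>I. Om \<phi> x a f * jcol \<zeta> b \<phi> x f) \<le> (\<Sum>f\<in>I. sqrt g * B * Gc B) * wt1 x" for x
    proof -
      have "norm (\<Sum>f\<in>I. Om \<phi> x a f * jcol \<zeta> b \<phi> x f) \<le> (\<Sum>f\<in>I. sqrt g * B * wt1 x * Gc B)"
        by (intro sum_norm_le norm_mult_le Om_bd B jcol_facts(3)[OF B])
      then show ?thesis by (simp add: sum_distrib_right mult_ac)
    qed
  qed
qed

end

text \<open>The monodromy entry obtained from one limit instead of two;
  \<open>monodromy_eq_Tm\<close> identifies them.\<close>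

definition Tm :: "complex \<Rightarrow> nat \<Rightarrow> nat \<Rightarrow> 'a::banach_superalgebra config \<Rightarrow> 'a" where
  "Tm \<zeta> a b \<phi> = Lim at_top (\<lambda>x. jcol \<zeta> b \<phi> x a)"

lemma jcol_Tm:
  assumes "\<phi> \<in> fields M N" "good \<zeta> b" "b \<in> I" "a \<in> I" "sg a = sg b"
  shows "((\<lambda>x. jcol \<zeta> b \<phi> x a) \<longlongrightarrow> Tm \<zeta> a b \<phi>) at_top"
  using jcol_top[OF assms] tendsto_Lim[OF trivial_limit_at_top_linorder] unfolding Tm_def by blast

lemma Tm_homog:
  assumes "\<phi> \<in> fields M N" "good \<zeta> b" "b \<in> I" "a \<in> I" "sg a = sg b"
  shows "Tm \<zeta> a b \<phi> \<in> homog (gr a + gr b)"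
  by (rule Lim_in_closed_set[OF homog_closed _ trivial_limit_at_top_linorder jcol_Tm[OF assms]])
    (intro always_eventually allI jcol_homog assms)

context
  fixes \<phi> :: "'a::banach_superalgebra config" and \<zeta> :: complex and a :: nat
  assumes \<phi>: "\<phi> \<in> fields M N" and good: "good \<zeta> a" and a: "a \<in> I"
begin

lemmas jrow_assms = refl_fields[OF \<phi>] good_cnj[THEN iffD2, OF good] a

text \<open>Reflection changes the sign of the derivative, the adjoint reverses products, and
  \<open>Om_adj\<close> transposes \<Omega>.\<close>

lemma jrow_deriv: "e \<in> I \<Longrightarrow> ((\<lambda>s. jrow \<zeta> a \<phi> s e) has_vector_derivative
    - (cd \<zeta> a e *\<^sub>C jrow \<zeta> a \<phi> x e) - (\<Sum>f\<in>I. jrow \<zeta> a \<phi> x f * Om \<phi> x f e)) (at x)"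
proof -
  assume e: "e \<in> I"
  let ?L = "\<lambda>s e. jcol (- cnj \<zeta>) a (refl_cfg \<phi>) s e"
  let ?D = "cd (- cnj \<zeta>) a e *\<^sub>C ?L (- x) e + (\<Sum>f\<in>I. Om (refl_cfg \<phi>) (- x) e f * ?L (- x) f)"
  have "((\<lambda>s. ?L (- s) e) has_vector_derivative - ?D) (at x)"
    using vector_diff_chain_at[of uminus "-1" x "\<lambda>s. ?L s e" ?D] jcol_deriv[OF jrow_assms e, of "- x"]
    by (simp add: o_def has_vector_derivative_minus[OF has_vector_derivative_id])
  from adj_has_vector_derivative[OF this]
  have "((\<lambda>s. jrow \<zeta> a \<phi> s e) has_vector_derivative (- ?D)\<^sup>\<dagger>) (at x)" by (simp add: jrow_def)
  also have "Om (refl_cfg \<phi>) (- x) = Om \<phi> x"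
    by (simp add: Om_eq refl_cfg_def fun_eq_iff)
  then have "(- ?D)\<^sup>\<dagger> = - (cd \<zeta> a e *\<^sub>C jrow \<zeta> a \<phi> x e) - (\<Sum>f\<in>I. jrow \<zeta> a \<phi> x f * Om \<phi> x f e)"
    by (simp only: adj_minus adj_add adj_scaleC adj_sum adj_mult Om_adj jrow_def cd_cnj[symmetric]
        complex_cnj_cnj minus_add_distrib diff_conv_add_uminus)
  finally show ?thesis .
qed

lemma jrow_top: "e \<in> I \<Longrightarrow> ((\<lambda>x. jrow \<zeta> a \<phi> x e) \<longlongrightarrow> mone e a) at_top"
proof -
  assume e: "e \<in> I"
  have "((\<lambda>x. (jcol (- cnj \<zeta>) a (refl_cfg \<phi>) (- x) e)\<^sup>\<dagger>) \<longlongrightarrow> (mone e a)\<^sup>\<dagger>) at_top"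
    by (intro adj_tendsto filterlim_compose[OF jcol_bot[OF jrow_assms e] filterlim_uminus_at_bot_at_top])
  moreover have "(mone e a :: 'a)\<^sup>\<dagger> = mone e a" by (simp add: mone_def)
  ultimately show ?thesis by (simp add: jrow_def)
qed

lemma jrow_homog: "e \<in> I \<Longrightarrow> jrow \<zeta> a \<phi> x e \<in> homog (gr e + gr a)"
  unfolding jrow_def by (intro adj_homog jcol_homog[OF jrow_assms])

lemma jrow_cont: "e \<in> I \<Longrightarrow> continuous_on UNIV (\<lambda>x. jrow \<zeta> a \<phi> x e)"
  by (intro continuous_at_imp_continuous_on ballI has_vector_derivative_continuous[OF jrow_deriv])

lemma jrow_bdd: "\<exists>G. \<forall>x. \<forall>e\<in>I. norm (jrow \<zeta> a \<phi> x e) \<le> G"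
  using jcol_bdd[OF jrow_assms] by (auto simp: jrow_def norm_adj)

end

subsection \<open>Fast components\<close>

text \<open>The damping of the other block is the distance of \<zeta> from the real axis.\<close>

lemma jcol_fast_to_0:
  assumes \<phi>: "\<phi> \<in> fields M N" and good: "good \<zeta> b" and b: "b \<in> I" and e: "e \<in> I"
    and fast: "sg e \<noteq> sg b" and im: "Im \<zeta> \<noteq> 0"
  shows "((\<lambda>x. jcol \<zeta> b \<phi> x e) \<longlongrightarrow> 0) at_top"
proof -
  obtain B where B: "bnd B \<phi>" using fields_bnd[OF \<phi>] .
  define \<tau> where "\<tau> = - Re (cd \<zeta> b e)"
  have \<tau>: "\<tau> > 0" using fast im good unfolding \<tau>_def cd_def good_def
    by (auto simp: sg_def split: if_splits)
  \<comment> \<open>The largest parameter that \<open>fast_bound\<close> admits for the damping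
    \<open>\<tau>\<close>.\<close>
  define \<sigma> where "\<sigma> = min 1 (\<tau> / 2)"
  have \<sigma>: "0 < \<sigma>" "\<sigma> \<le> 1" "2 * \<sigma> \<le> - Re (cd \<zeta> b e)" using \<tau> by (auto simp: \<sigma>_def \<tau>_def)
  define \<eta> where "\<eta> = (\<Sum>f\<in>I. sqrt g * B * Gc B)"
  have "norm (jcol \<zeta> b \<phi> x e) \<le> \<eta> / \<sigma> * wt \<sigma> x" for x
  proof (rule fast_bound[OF jcol_deriv[OF \<phi> good b e] _ _ \<sigma>])
    show "((\<lambda>x. jcol \<zeta> b \<phi> x e) \<longlongrightarrow> 0) at_bot"
      using jcol_bot[OF \<phi> good b e] fast by (cases "e = b") (auto simp: mone_def)
    show "norm (\<Sum>f\<in>I. Om \<phi> s e f * jcol \<zeta> b \<phi> s f) \<le> \<eta> * wt1 s" for s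
    proof -
      have "norm (\<Sum>f\<in>I. Om \<phi> s e f * jcol \<zeta> b \<phi> s f) \<le> (\<Sum>f\<in>I. sqrt g * B * wt1 s * Gc B)"
        by (intro sum_norm_le norm_mult_le Om_bd B jcol_facts(3)[OF \<phi> good b B])
      then show ?thesis by (simp add: \<eta>_def sum_distrib_right mult_ac)
    qed
  qed
  then show ?thesis
    by (rule Lim_null_comparison[OF always_eventually, rule_format])
      (use tendsto_mult_right_zero[OF wt_at_top[OF \<sigma>(1)], of "\<eta> / \<sigma>"] in simp)
qed

lemma jrow_fast_to_0:
  assumes \<phi>: "\<phi> \<in> fields M N" and good: "good \<zeta> a" and a: "a \<in> I" and e: "e \<in> I"
    and fast: "sg e \<noteq> sg a" and im: "Im \<zeta> \<noteq> 0"
  shows "((\<lambda>x. jrow \<zeta> a \<phi> x e) \<longlongrightarrow> 0) at_bot"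
proof -
  have "((\<lambda>x. jcol (- cnj \<zeta>) a (refl_cfg \<phi>) x e) \<longlongrightarrow> 0) at_top"
    by (rule jcol_fast_to_0[OF refl_fields[OF \<phi>] _ a e fast]) (use good im in \<open>simp_all add: good_cnj\<close>)
  from adj_tendsto[OF filterlim_compose[OF this filterlim_uminus_at_top_at_bot]]
  show ?thesis by (simp add: jrow_def)
qed

end

lemma tendsto_mult_bounded_right:
  fixes f h :: "'b \<Rightarrow> 'a::real_normed_algebra"
  assumes "(f \<longlongrightarrow> 0) F" and "\<And>x. norm (h x) \<le> G"
  shows "((\<lambda>x. f x * h x) \<longlongrightarrow> 0) F"
proof (rule Lim_null_comparison)
  show "\<forall>\<^sub>F x in F. norm (f x * h x) \<le> norm (f x) * G"
    by (intro always_eventually allI norm_mult_le order_refl assms)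
  show "((\<lambda>x. norm (f x) * G) \<longlongrightarrow> 0) F"
    using tendsto_mult_right[OF tendsto_norm[OF assms(1)], of G] by simp
qed

lemma tendsto_mult_bounded_left:
  fixes f h :: "'b \<Rightarrow> 'a::real_normed_algebra"
  assumes "(f \<longlongrightarrow> 0) F" and "\<And>x. norm (h x) \<le> G"
  shows "((\<lambda>x. h x * f x) \<longlongrightarrow> 0) F"
proof (rule Lim_null_comparison)
  show "\<forall>\<^sub>F x in F. norm (h x * f x) \<le> G * norm (f x)"
    by (intro always_eventually allI norm_mult_le order_refl assms)
  show "((\<lambda>x. G * norm (f x)) \<longlongrightarrow> 0) F"
    using tendsto_mult_left[OF tendsto_norm[OF assms(1)], of G] by simp
qed

lemma gsign_left_commute: "y * (gsign p * (x::'a::ring_1)) = gsign p * (y * x)"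
  by (simp add: gsign_def)

lemma schwartz_add:
  fixes f h :: "real \<Rightarrow> 'a::real_normed_vector"
  assumes "schwartz f" "schwartz h" shows "schwartz (\<lambda>x. f x + r *\<^sub>R h x)"
proof -
  obtain d where d: "d 0 = f" "\<And>n x. (d n has_vector_derivative d (Suc n) x) (at x)"
    "\<And>k n. bounded (range (\<lambda>x. x ^ k *\<^sub>R d n x))" using assms(1) by (auto simp: schwartz_def)
  obtain e where e: "e 0 = h" "\<And>n x. (e n has_vector_derivative e (Suc n) x) (at x)"
    "\<And>k n. bounded (range (\<lambda>x. x ^ k *\<^sub>R e n x))" using assms(2) by (auto simp: schwartz_def)
  have "((\<lambda>x. d n x + r *\<^sub>R e n x) has_vector_derivative d (Suc n) x + r *\<^sub>R e (Suc n) x) (at x)" for n x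
    by (intro has_vector_derivative_add d
        bounded_linear.has_vector_derivative[OF bounded_linear_scaleR_right] e)
  moreover have "bounded (range (\<lambda>x. x ^ k *\<^sub>R (d n x + r *\<^sub>R e n x)))" for k n
  proof -
    have "bounded (range (\<lambda>x. r *\<^sub>R (x ^ k *\<^sub>R e n x)))"
      using bounded_scaling[OF e(3), of r k n] by (simp add: image_image)
    from bounded_plus_comp[OF d(3) this] show ?thesis by (simp add: scaleR_add_right mult.commute)
  qed
  ultimately show ?thesis unfolding schwartz_def
    by (intro exI[of _ "\<lambda>n x. d n x + r *\<^sub>R e n x"]) (simp add: d(1) e(1))
qed

definition shift_cfg :: "'a::real_normed_vector config \<Rightarrow> real \<Rightarrow> 'a config \<Rightarrow> 'a config" where
  "shift_cfg \<phi> \<epsilon> h = (\<lambda>j x. \<phi> j x + \<epsilon> *\<^sub>R h j x)"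

lemma shift_cfg_0 [simp]: "shift_cfg \<phi> 0 h = \<phi>" by (simp add: shift_cfg_def)

lemma shift_fields:
  "\<phi> \<in> fields M N \<Longrightarrow> h \<in> fields M N \<Longrightarrow> shift_cfg \<phi> \<epsilon> h \<in> fields M N"
  unfolding fields_def shift_cfg_def
  by (auto intro!: schwartz_add homog_add homog_scaleR)

context super_nls begin

subsection \<open>The monodromy matrix as a limit of Jost solutions\<close>

lemma Sigma_eq: "Sigma_mat M N a b = (if a = b then sg a else 0)"
  by (auto simp: Sigma_mat_def mone_def elem_mat_def sg_def)

lemma mpow_diag: "a \<in> I \<Longrightarrow> mpow m (\<lambda>a b. if a = b then d a else 0) k a b
    = (if a = b then d a ^ k else (0::complex))"
proof (induction k)
  case 0 then show ?case by (simp add: mone_def)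
next
  case (Suc k)
  have "mpow m (\<lambda>a b. if a = b then d a else 0) (Suc k) a b
      = (\<Sum>c\<in>I. if c = a then d a * mpow m (\<lambda>a b. if a = b then d a else 0) k a b else 0)"
    unfolding mpow.simps mmul_def by (intro sum.cong refl) auto
  also have "\<dots> = (if a = b then d a ^ Suc k else 0)"
    using Suc by (subst sum.delta) auto
  finally show ?case .
qed

lemma exp_series: "(\<Sum>k. z ^ k / fact k) = exp (z :: complex)"
proof -
  have "z ^ k / fact k = z ^ k /\<^sub>R fact k" for k by (simp add: scaleR_conv_of_real field_simps)
  then show ?thesis by (simp add: exp_def)
qed

text \<open>\<Sigma> is diagonal, so the exponential series of the matrix reduces to scalar
  ones.\<close>

lemma cmat_E: "a \<in> I \<Longrightarrow> cmat (E_mat M N \<zeta> x) a b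
    = (if a = b then exp (\<i> * \<zeta> / 2 * sg a * of_real x) *\<^sub>C (1::'a::banach_superalgebra) else 0)"
proof -
  assume a: "a \<in> I"
  let ?d = "\<lambda>a. \<i> * \<zeta> / 2 * sg a * of_real x"
  have eq: "(\<lambda>a b. \<i> * complex_of_real x * \<zeta> / 2 * Sigma_mat M N a b) = (\<lambda>a b. if a = b then ?d a else 0)"
    by (auto simp: Sigma_eq fun_eq_iff)
  have "E_mat M N \<zeta> x a b = (\<Sum>k. (if a = b then ?d a ^ k else 0) / fact k)"
    unfolding E_mat_def mexp_def eq by (simp only: mpow_diag[OF a])
  also have "\<dots> = (if a = b then exp (?d a) else 0)"
    using exp_series[of "?d a"] by (cases "a = b") (simp_all only: if_True if_False refl div_0 suminf_zero)
  finally show ?thesis by (simp add: cmat_def scaleC.zero_left)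
qed

lemma Lax_eq: "Lax_mat M N g \<zeta> \<phi> x e f = (if e = f then (\<i> * \<zeta> / 2 * sg e) *\<^sub>C 1 else 0) + Om \<phi> x e f"
  by (simp add: Lax_mat_def cmat_def Sigma_eq scaleC.zero_left)

lemma Lax_sum: "e \<in> I \<Longrightarrow> (\<Sum>f\<in>I. Lax_mat M N g \<zeta> \<phi> x e f * X f)
    = (\<i> * \<zeta> / 2 * sg e) *\<^sub>C X e + (\<Sum>f\<in>I. Om \<phi> x e f * X f)"
proof -
  assume e: "e \<in> I"
  have "(\<Sum>f\<in>I. Lax_mat M N g \<zeta> \<phi> x e f * X f)
      = (\<Sum>f\<in>I. if f = e then (\<i> * \<zeta> / 2 * sg e) *\<^sub>C X e else 0) + (\<Sum>f\<in>I. Om \<phi> x e f * X f)"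
    unfolding sum.distrib[symmetric]
    by (intro sum.cong refl) (auto simp: Lax_eq distrib_right scaleC_mult_left)
  then show ?thesis using e by (subst (asm) sum.delta) auto
qed

text \<open>\<open>transfer_mat\<close> is defined by choice, so nothing is known of it before
  existence. The columns decouple and are solved one at a time.\<close>

lemma transfer_is_transfer:
  assumes \<phi>: "\<phi> \<in> fields M N"
  shows "is_transfer M N g \<zeta> \<phi> y (\<lambda>x. transfer_mat M N g \<zeta> \<phi> x y)"
proof -
  obtain B where B: "bnd B \<phi>" using fields_bnd[OF \<phi>] .
  have "\<exists>X. \<forall>e\<in>I. X y e = mone e b \<and> (\<forall>x\<ge>y. X x e \<in> UNIV \<and> ((\<lambda>s. X s e) has_vector_derivative
      (\<Sum>f\<in>I. Lax_mat M N g \<zeta> \<phi> x e f * X x f)) (at x within {y..}))" for b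
  proof (rule linear_ode_exists)
    fix e f x
    show "continuous_on {y..} (\<lambda>x. Lax_mat M N g \<zeta> \<phi> x e f)"
      unfolding Lax_eq by (intro continuous_intros continuous_on_subset[OF Om_cont[OF \<phi>]]) auto
    have "norm (Om \<phi> x e f) \<le> sqrt g * B * 1"
      by (rule order_trans[OF Om_bd[OF B]], rule mult_left_mono[OF wt_le_1])
        (use B g_pos in \<open>simp add: bnd_def\<close>)
    moreover have "norm (if e = f then (\<i> * \<zeta> / 2 * sg e) *\<^sub>C (1::'a) else 0) \<le> cmod \<zeta>"
      by (simp add: norm_scaleC norm_mult norm_divide sg_def)
    ultimately show "norm (Lax_mat M N g \<zeta> \<phi> x e f) \<le> cmod \<zeta> + sqrt g * B * 1"
      unfolding Lax_eq by (rule norm_triangle_mono[rotated])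
  qed (auto simp: closed_space_def)
  then obtain X where X: "\<And>b e. e \<in> I \<Longrightarrow> X b y e = mone e b"
    "\<And>b e x. e \<in> I \<Longrightarrow> x \<ge> y \<Longrightarrow> ((\<lambda>s. X b s e) has_vector_derivative
      (\<Sum>f\<in>I. Lax_mat M N g \<zeta> \<phi> x e f * X b x f)) (at x within {y..})"
    by metis
  have "is_transfer M N g \<zeta> \<phi> y (\<lambda>x a b. X b x a)"
    unfolding is_transfer_def mmul_def using X by blast
  then show ?thesis unfolding transfer_mat_def by (rule someI[of "is_transfer M N g \<zeta> \<phi> y"])
qed

lemma dressed_eq:
  assumes a: "a \<in> I" and b: "b \<in> I"
  shows "dressed_transfer M N g \<zeta> \<phi> x y a b
    = exp (\<i> * \<zeta> / 2 * (sg b * of_real y - sg a * of_real x)) *\<^sub>C transfer_mat M N g \<zeta> \<phi> x y a b"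
proof -
  let ?T = "transfer_mat M N g \<zeta> \<phi> x y"
  let ?u = "exp (\<i> * \<zeta> / 2 * sg a * of_real (- x))" and ?v = "exp (\<i> * \<zeta> / 2 * sg b * of_real y)"
  have 1: "mmul m (cmat (E_mat M N \<zeta> (- x))) ?T a c = ?u *\<^sub>C ?T a c" for c
  proof -
    have "mmul m (cmat (E_mat M N \<zeta> (- x))) ?T a c = (\<Sum>e\<in>I. if e = a then ?u *\<^sub>C ?T a c else 0)"
      unfolding mmul_def by (intro sum.cong refl) (auto simp only: cmat_E[OF a] scaleC_mult_left mult_1_left mult_zero_left split: if_splits)
    then show ?thesis using a by (subst (asm) sum.delta) auto
  qed
  have "dressed_transfer M N g \<zeta> \<phi> x y a b = (\<Sum>c\<in>I. if c = b then ?v *\<^sub>C ?u *\<^sub>C ?T a b else 0)"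
    unfolding dressed_transfer_def mmul_def[of _ "mmul _ _ _"] 1
    by (intro sum.cong refl) (auto simp only: cmat_E scaleC_mult_right mult_1_right mult_zero_right split: if_splits)
  also have "\<dots> = ?v *\<^sub>C ?u *\<^sub>C ?T a b" using b by (subst sum.delta) auto
  finally show ?thesis by (simp add: scaleC_scaleC exp_add[symmetric] algebra_simps)
qed

text \<open>Dressing by the exponentials turns column \<open>b\<close> of the transfer matrix into a
  solution \<open>Y\<close> that starts as a unit vector at \<open>y\<close>. It is within
  \<open>\<kappa> y\<close> of the Jost solution for all \<open>x \<ge> y\<close>, and this
  uniformity in \<open>x\<close> is what makes the joint limit exist.\<close>

lemma monodromy_tendsto:
  assumes \<phi>: "\<phi> \<in> fields M N" and good: "good \<zeta> b" and a: "a \<in> I" and b: "b \<in> I" and s: "sg a = sg b"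
  shows "((\<lambda>(x, y). dressed_transfer M N g \<zeta> \<phi> x y a b) \<longlongrightarrow> Tm \<zeta> a b \<phi>) (at_top \<times>\<^sub>F at_bot)"
proof -
  obtain B where B: "bnd B \<phi>" using fields_bnd[OF \<phi>] .
  define \<kappa> where "\<kappa> y = Gc B * (real (card I) * (sqrt g * B) * Gc B * (arctan y + pi / 2))" for y
  let ?L = "\<lambda>x. jcol \<zeta> b \<phi> x a"
  have est: "norm (dressed_transfer M N g \<zeta> \<phi> x y a b - ?L x) \<le> \<kappa> y" if xy: "y \<le> x" for x y
  proof -
    define Y where "Y s e = exp (\<i> * \<zeta> / 2 * sg b * (of_real y - of_real s)) *\<^sub>C transfer_mat M N g \<zeta> \<phi> s y e b" for s e
    note T = transfer_is_transfer[OF \<phi>, of \<zeta> y, unfolded is_transfer_def mmul_def, rule_format, OF _ b]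
    have "is_sol I (cd \<zeta> b) (Om \<phi>) {y..} Y"
      unfolding is_sol_def
    proof (intro ballI)
      fix e x assume e: "e \<in> I" and x: "x \<in> {y..}"
      let ?u = "exp (\<i> * \<zeta> / 2 * sg b * (of_real y - of_real x))"
      have "((\<lambda>s. transfer_mat M N g \<zeta> \<phi> s y e b) has_vector_derivative
          (\<Sum>f\<in>I. Lax_mat M N g \<zeta> \<phi> x e f * transfer_mat M N g \<zeta> \<phi> x y f b)) (at x within {y..})"
        using T[OF e] x by auto
      from exp_has_vector_derivative_scaleC[OF this, of "\<i> * \<zeta> / 2 * sg b" y]
      have "((\<lambda>s. Y s e) has_vector_derivative ?u *\<^sub>C ((\<i> * \<zeta> / 2 * sg e) *\<^sub>C transfer_mat M N g \<zeta> \<phi> x y e b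
          + (\<Sum>f\<in>I. Om \<phi> x e f * transfer_mat M N g \<zeta> \<phi> x y f b)
          - (\<i> * \<zeta> / 2 * sg b) *\<^sub>C transfer_mat M N g \<zeta> \<phi> x y e b)) (at x within {y..})"
        by (simp only: Lax_sum[OF e] Y_def)
      moreover have "?u *\<^sub>C ((\<i> * \<zeta> / 2 * sg e) *\<^sub>C transfer_mat M N g \<zeta> \<phi> x y e b
          + (\<Sum>f\<in>I. Om \<phi> x e f * transfer_mat M N g \<zeta> \<phi> x y f b)
          - (\<i> * \<zeta> / 2 * sg b) *\<^sub>C transfer_mat M N g \<zeta> \<phi> x y e b)
        = cd \<zeta> b e *\<^sub>C Y x e + (\<Sum>f\<in>I. Om \<phi> x e f * Y x f)"
      proof -
        have "u *\<^sub>C (\<alpha> *\<^sub>C v + w - \<beta> *\<^sub>C v) = (\<alpha> - \<beta>) *\<^sub>C u *\<^sub>C v + u *\<^sub>C w" for u \<alpha> \<beta> and v w :: 'a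
          by (simp add: scaleC_add_right scaleC.diff_right scaleC.diff_left scaleC_scaleC algebra_simps)
        moreover have "cd \<zeta> b e = \<i> * \<zeta> / 2 * sg e - \<i> * \<zeta> / 2 * sg b"
          unfolding cd_def by (rule right_diff_distrib)
        ultimately show ?thesis by (simp only: Y_def scaleC_mult_right scaleC.sum_right[symmetric])
      qed
      ultimately show "((\<lambda>s. Y s e) has_vector_derivative cd \<zeta> b e *\<^sub>C Y x e + (\<Sum>f\<in>I. Om \<phi> x e f * Y x f))
          (at x within {y..})" by simp
    qed
    moreover have "Y y e = mone e b" if "e \<in> I" for e using T[OF that] by (simp add: Y_def)
    ultimately have "norm (Y x a - ?L x) \<le> \<kappa> y"
      unfolding \<kappa>_def by (rule jcol_facts(4)[OF \<phi> good b B _ _ xy a])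
    \<comment> \<open>Since \<open>sg a = sg b\<close>, the two dressing exponentials combine into
      the one in \<open>Y\<close>.\<close>
    moreover have "Y x a = dressed_transfer M N g \<zeta> \<phi> x y a b"
      unfolding Y_def dressed_eq[OF a b] s by (simp only: right_diff_distrib mult.assoc)
    ultimately show ?thesis by simp
  qed
  let ?F = "at_top \<times>\<^sub>F at_bot :: (real \<times> real) filter"
  have fst: "filterlim fst at_top ?F" and snd: "filterlim snd at_bot ?F"
    by (rule filterlim_fst, rule filterlim_snd)
  have \<kappa>0: "(\<kappa> \<longlongrightarrow> 0) at_bot"
    unfolding \<kappa>_def by (rule tendsto_eq_intros arctan_bot refl | simp)+
  have "((\<lambda>p. (case p of (x, y) \<Rightarrow> dressed_transfer M N g \<zeta> \<phi> x y a b) - ?L (fst p)) \<longlongrightarrow> 0) ?F"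
  proof (rule Lim_null_comparison[OF _ filterlim_compose[OF \<kappa>0 snd]])
    have "\<forall>\<^sub>F p in ?F. 0 \<le> fst p" by (rule eventually_compose_filterlim[OF eventually_ge_at_top fst])
    moreover have "\<forall>\<^sub>F p in ?F. snd p \<le> 0" by (rule eventually_compose_filterlim[OF eventually_le_at_bot snd])
    ultimately show "\<forall>\<^sub>F p in ?F. norm ((case p of (x, y) \<Rightarrow> dressed_transfer M N g \<zeta> \<phi> x y a b) - ?L (fst p)) \<le> \<kappa> (snd p)"
      by eventually_elim (use est in \<open>auto simp: split_beta\<close>)
  qed
  from tendsto_add[OF this filterlim_compose[OF jcol_Tm[OF \<phi> good b a s] fst]]
  show ?thesis by simp
qed

lemma monodromy_eq_Tm:
  assumes "\<phi> \<in> fields M N" "good \<zeta> b" "a \<in> I" "b \<in> I" "sg a = sg b"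
  shows "monodromy_converges M N g \<zeta> \<phi> a b" and "monodromy M N g \<zeta> \<phi> a b = Tm \<zeta> a b \<phi>"
proof -
  note lim = monodromy_tendsto[OF assms]
  show "monodromy_converges M N g \<zeta> \<phi> a b" unfolding monodromy_converges_def using lim by blast
  show "monodromy M N g \<zeta> \<phi> a b = Tm \<zeta> a b \<phi>" unfolding monodromy_def
    by (rule tendsto_Lim[OF _ lim]) (simp add: prod_filter_eq_bot)
qed

subsection \<open>Variation of the monodromy matrix\<close>

context
  fixes \<phi> \<psi> :: "'a::banach_superalgebra config" and \<zeta> :: complex and a b :: nat
  assumes \<phi>: "\<phi> \<in> fields M N" and \<psi>: "\<psi> \<in> fields M N" and a: "a \<in> I" and b: "b \<in> I"
    and s: "sg a = sg b" and good: "good \<zeta> a"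
begin

lemma good_b: "good \<zeta> b" using good good_same[OF s] by simp

text \<open>The diagonal parts of row and column cancel because \<open>a\<close> and
  \<open>b\<close> lie in the same block, and what remains of \<Omega> is the difference between the
  two configurations.\<close>

lemma wronskian_deriv:
  "((\<lambda>x. \<Sum>e\<in>I. jrow \<zeta> a \<phi> x e * jcol \<zeta> b \<psi> x e) has_vector_derivative
    (\<Sum>e\<in>I. \<Sum>f\<in>I. jrow \<zeta> a \<phi> x e * (Om \<psi> x e f - Om \<phi> x e f) * jcol \<zeta> b \<psi> x f)) (at x)"
proof -
  let ?R = "jrow \<zeta> a \<phi>" and ?L = "jcol \<zeta> b \<psi>"
  have "((\<lambda>x. \<Sum>e\<in>I. ?R x e * ?L x e) has_vector_derivative
    (\<Sum>e\<in>I. ?R x e * (cd \<zeta> b e *\<^sub>C ?L x e + (\<Sum>f\<in>I. Om \<psi> x e f * ?L x f))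
      + (- (cd \<zeta> a e *\<^sub>C ?R x e) - (\<Sum>f\<in>I. ?R x f * Om \<phi> x f e)) * ?L x e)) (at x)"
    by (intro has_vector_derivative_sum has_vector_derivative_mult jcol_deriv[OF \<psi> good_b b]
        jrow_deriv[OF \<phi> good a])
  also have "(\<Sum>e\<in>I. ?R x e * (cd \<zeta> b e *\<^sub>C ?L x e + (\<Sum>f\<in>I. Om \<psi> x e f * ?L x f))
      + (- (cd \<zeta> a e *\<^sub>C ?R x e) - (\<Sum>f\<in>I. ?R x f * Om \<phi> x f e)) * ?L x e)
    = (\<Sum>e\<in>I. (\<Sum>f\<in>I. ?R x e * Om \<psi> x e f * ?L x f) - (\<Sum>f\<in>I. ?R x f * Om \<phi> x f e * ?L x e))"
    by (intro sum.cong refl) (simp only: cd_same[OF s] distrib_left left_diff_distrib scaleC_mult_left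
        scaleC_mult_right minus_mult_left[symmetric] sum_distrib_left sum_distrib_right mult.assoc, simp only: algebra_simps add_minus_cancel)
  also have "\<dots> = (\<Sum>e\<in>I. \<Sum>f\<in>I. ?R x e * Om \<psi> x e f * ?L x f) - (\<Sum>e\<in>I. \<Sum>f\<in>I. ?R x f * Om \<phi> x f e * ?L x e)"
    by (rule sum_subtractf)
  also have "(\<Sum>e\<in>I. \<Sum>f\<in>I. ?R x f * Om \<phi> x f e * ?L x e) = (\<Sum>e\<in>I. \<Sum>f\<in>I. ?R x e * Om \<phi> x e f * ?L x f)"
    by (rule sum.swap)
  also have "(\<Sum>e\<in>I. \<Sum>f\<in>I. ?R x e * Om \<psi> x e f * ?L x f) - \<dots>
    = (\<Sum>e\<in>I. \<Sum>f\<in>I. ?R x e * (Om \<psi> x e f - Om \<phi> x e f) * ?L x f)"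
    by (simp only: sum_subtractf[symmetric] right_diff_distrib left_diff_distrib)
  finally show ?thesis .
qed

text \<open>At + infinity the row converges in all components, while the column is merely bounded.
  Replacing the row by its limit first leaves the single component \<open>a\<close> of the column,
  which does converge.\<close>

lemma wronskian_top: "((\<lambda>x. \<Sum>e\<in>I. jrow \<zeta> a \<phi> x e * jcol \<zeta> b \<psi> x e) \<longlongrightarrow> Tm \<zeta> a b \<psi>) at_top"
proof -
  obtain G where G: "\<And>x e. e \<in> I \<Longrightarrow> norm (jcol \<zeta> b \<psi> x e) \<le> G" using jcol_bdd[OF \<psi> good_b b] by blast
  have "((\<lambda>x. \<Sum>e\<in>I. (jrow \<zeta> a \<phi> x e - mone e a) * jcol \<zeta> b \<psi> x e) \<longlongrightarrow> (\<Sum>e\<in>I. 0)) at_top"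
    by (intro tendsto_sum tendsto_mult_bounded_right[OF LIM_zero[OF jrow_top[OF \<phi> good a]] G])
  moreover have "((\<lambda>x. \<Sum>e\<in>I. mone e a * jcol \<zeta> b \<psi> x e) \<longlongrightarrow> Tm \<zeta> a b \<psi>) at_top"
  proof -
    have "(\<Sum>e\<in>I. mone e a * X e) = X a" for X :: "nat \<Rightarrow> 'a"
    proof -
      have "(\<Sum>e\<in>I. mone e a * X e) = (\<Sum>e\<in>I. if e = a then X e else 0)"
        by (intro sum.cong refl) (simp add: mone_def)
      then show ?thesis using a by (subst (asm) sum.delta) auto
    qed
    then show ?thesis using jcol_Tm[OF \<psi> good_b b a s] by presburger
  qed
  ultimately have "((\<lambda>x. (\<Sum>e\<in>I. (jrow \<zeta> a \<phi> x e - mone e a) * jcol \<zeta> b \<psi> x e)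
      + (\<Sum>e\<in>I. mone e a * jcol \<zeta> b \<psi> x e)) \<longlongrightarrow> (\<Sum>e\<in>I. 0) + Tm \<zeta> a b \<psi>) at_top"
    by (rule tendsto_add)
  then show ?thesis by (simp only: sum.distrib[symmetric] left_diff_distrib diff_add_cancel sum.neutral_const add_0_left)
qed

text \<open>Stated as a difference since the limit of the row at - infinity is not yet known;
  \<open>jrow_Tm\<close> derives it from this.\<close>

lemma wronskian_bot: "((\<lambda>x. (\<Sum>e\<in>I. jrow \<zeta> a \<phi> x e * jcol \<zeta> b \<psi> x e) - jrow \<zeta> a \<phi> x b) \<longlongrightarrow> 0) at_bot"
proof -
  obtain G where G: "\<And>x e. e \<in> I \<Longrightarrow> norm (jrow \<zeta> a \<phi> x e) \<le> G" using jrow_bdd[OF \<phi> good a] by blast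
  have "((\<lambda>x. \<Sum>e\<in>I. jrow \<zeta> a \<phi> x e * (jcol \<zeta> b \<psi> x e - mone e b)) \<longlongrightarrow> (\<Sum>e\<in>I. 0)) at_bot"
    by (intro tendsto_sum tendsto_mult_bounded_left[OF LIM_zero[OF jcol_bot[OF \<psi> good_b b]] G])
  moreover have "(\<Sum>e\<in>I. X e * mone e b) = X b" for X :: "nat \<Rightarrow> 'a"
  proof -
    have "(\<Sum>e\<in>I. X e * mone e b) = (\<Sum>e\<in>I. if e = b then X e else 0)"
      by (intro sum.cong refl) (simp add: mone_def)
    then show ?thesis using b by (subst (asm) sum.delta) auto
  qed
  ultimately show ?thesis by (simp only: right_diff_distrib sum_subtractf sum.neutral_const)
qed

end

text \<open>For a single configuration the Wronskian is constant. Its value at + infinity is the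
  limit of the column, at - infinity the limit of the row, so both constructions yield the same
  entry of T.\<close>

lemma jrow_Tm:
  assumes \<phi>: "\<phi> \<in> fields M N" and a: "a \<in> I" and b: "b \<in> I" and s: "sg a = sg b" and good: "good \<zeta> a"
  shows "((\<lambda>x. jrow \<zeta> a \<phi> x b) \<longlongrightarrow> Tm \<zeta> a b \<phi>) at_bot"
proof -
  let ?W = "\<lambda>x. \<Sum>e\<in>I. jrow \<zeta> a \<phi> x e * jcol \<zeta> b \<phi> x e"
  have "(?W has_vector_derivative 0) (at x within UNIV)" for x
    using wronskian_deriv[OF \<phi> \<phi> a b s good, of x] by simp
  then obtain k where k: "\<And>x. ?W x = k" using has_vector_derivative_zero_constant[of UNIV ?W] by auto
  have "k = Tm \<zeta> a b \<phi>" using wronskian_top[OF \<phi> \<phi> a b s good]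
    unfolding k by (rule tendsto_unique[OF trivial_limit_at_top_linorder tendsto_const])
  moreover have "((\<lambda>x. k - jrow \<zeta> a \<phi> x b) \<longlongrightarrow> 0) at_bot"
    using wronskian_bot[OF \<phi> \<phi> a b s good] unfolding k .
  from tendsto_diff[OF tendsto_const[of k] this]
  have "((\<lambda>x. jrow \<zeta> a \<phi> x b) \<longlongrightarrow> k) at_bot" by simp
  ultimately show ?thesis by simp
qed

section \<open>Functional derivatives of the monodromy matrix\<close>

lemma Om_bilinear:
  "(\<Sum>e\<in>I. \<Sum>f\<in>I. R e * Om h x e f * L f)
    = (\<Sum>l\<in>K. sqg *\<^sub>C (R l * h l x * L m) - sqg *\<^sub>C (R m * (h l x)\<^sup>\<dagger> * L l))"
proof -
  have "(\<Sum>e\<in>I. \<Sum>f\<in>I. R e * Om h x e f * L f) = (\<Sum>e\<in>I. R e * (\<Sum>f\<in>I. Om h x e f * L f))"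
    by (simp only: sum_distrib_left mult.assoc)
  also have "\<dots> = (\<Sum>e\<in>I. R e * (if e = m then - (sqg *\<^sub>C (\<Sum>j\<in>K. (h j x)\<^sup>\<dagger> * L j)) else sqg *\<^sub>C (h e x * L m)))"
    by (intro sum.cong refl arg_cong2[where f = times] sum_Om)
  also have "\<dots> = (\<Sum>e\<in>K. R e * (sqg *\<^sub>C (h e x * L m))) + R m * - (sqg *\<^sub>C (\<Sum>j\<in>K. (h j x)\<^sup>\<dagger> * L j))"
    unfolding sum_I by (intro arg_cong2[where f = plus] sum.cong) auto
  also have "\<dots> = (\<Sum>l\<in>K. sqg *\<^sub>C (R l * h l x * L m) - sqg *\<^sub>C (R m * (h l x)\<^sup>\<dagger> * L l))"
    by (simp only: sum_subtractf scaleC_mult_right mult_minus_right scaleC.sum_right sum_distrib_left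
        mult.assoc add_uminus_conv_diff)
  finally show ?thesis .
qed

text \<open>The row is taken at one configuration and the column at another, as in the exact
  increment formula; the derivative is the case of equal configurations. The sign results from
  moving a variation of grade \<open>gr l\<close> to the left of a row component of grade
  \<open>gr l + gr a\<close>.\<close>

definition gradA :: "complex \<Rightarrow> nat \<Rightarrow> nat \<Rightarrow> 'a::banach_superalgebra config \<Rightarrow> 'a config \<Rightarrow> nat \<Rightarrow> real \<Rightarrow> 'a" where
  "gradA \<zeta> a b \<phi> \<psi> l x = sqg *\<^sub>C (gsign ((gr l + gr a) * gr l) * (jrow \<zeta> a \<phi> x l * jcol \<zeta> b \<psi> x m))"

definition gradB :: "complex \<Rightarrow> nat \<Rightarrow> nat \<Rightarrow> 'a::banach_superalgebra config \<Rightarrow> 'a config \<Rightarrow> nat \<Rightarrow> real \<Rightarrow> 'a" where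
  "gradB \<zeta> a b \<phi> \<psi> l x = - (sqg *\<^sub>C (gsign (gr a * gr l) * (jrow \<zeta> a \<phi> x m * jcol \<zeta> b \<psi> x l)))"

text \<open>Replacing a factor of the product formula for the variation by its value at a second
  configuration makes the first-order variation exact.\<close>
lemma Tm_difference:
  assumes \<phi>: "\<phi> \<in> fields M N" and h: "h \<in> fields M N" and a: "a \<in> I" and b: "b \<in> I"
    and s: "sg a = sg b" and good: "good \<zeta> a"
  shows "((\<lambda>x. \<epsilon> *\<^sub>R (\<Sum>l\<in>K. h l x * gradA \<zeta> a b \<phi> (shift_cfg \<phi> \<epsilon> h) l x
      + (h l x)\<^sup>\<dagger> * gradB \<zeta> a b \<phi> (shift_cfg \<phi> \<epsilon> h) l x)) has_integral
      (Tm \<zeta> a b (shift_cfg \<phi> \<epsilon> h) - Tm \<zeta> a b \<phi>)) UNIV"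
proof -
  let ?\<psi> = "shift_cfg \<phi> \<epsilon> h"
  have \<psi>: "?\<psi> \<in> fields M N" by (rule shift_fields[OF \<phi> h])
  let ?R = "jrow \<zeta> a \<phi>" and ?L = "jcol \<zeta> b ?\<psi>"
  let ?W = "\<lambda>x. \<Sum>e\<in>I. ?R x e * ?L x e"
  have bot: "(?W \<longlongrightarrow> Tm \<zeta> a b \<phi>) at_bot"
    using tendsto_add[OF wronskian_bot[OF \<phi> \<psi> a b s good] jrow_Tm[OF \<phi> a b s good]] by simp
  have I1: "((\<lambda>x. \<Sum>e\<in>I. \<Sum>f\<in>I. ?R x e * (Om ?\<psi> x e f - Om \<phi> x e f) * ?L x f) has_integral
      (Tm \<zeta> a b ?\<psi> - Tm \<zeta> a b \<phi>)) UNIV"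
    by (rule has_integral_FTC_UNIV[OF wronskian_deriv[OF \<phi> \<psi> a b s good]
        wronskian_top[OF \<phi> \<psi> a b s good] bot])
  have dOm: "Om ?\<psi> x e f - Om \<phi> x e f = \<epsilon> *\<^sub>R Om h x e f" for x e f
    by (auto simp: Om_eq shift_cfg_def scaleC_add_right adj_add adj_scaleR scaleC.scaleR_right)
  have "(\<Sum>e\<in>I. \<Sum>f\<in>I. ?R x e * (Om ?\<psi> x e f - Om \<phi> x e f) * ?L x f)
      = \<epsilon> *\<^sub>R (\<Sum>l\<in>K. h l x * gradA \<zeta> a b \<phi> ?\<psi> l x + (h l x)\<^sup>\<dagger> * gradB \<zeta> a b \<phi> ?\<psi> l x)" for x
  proof -
    have "(\<Sum>e\<in>I. \<Sum>f\<in>I. ?R x e * (Om ?\<psi> x e f - Om \<phi> x e f) * ?L x f)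
        = \<epsilon> *\<^sub>R (\<Sum>l\<in>K. sqg *\<^sub>C (?R x l * h l x * ?L x m) - sqg *\<^sub>C (?R x m * (h l x)\<^sup>\<dagger> * ?L x l))"
      unfolding dOm Om_bilinear[symmetric]
      by (simp only: scaleR_sum_right mult_scaleR_left mult_scaleR_right)
    also have "sqg *\<^sub>C (?R x l * h l x * ?L x m) - sqg *\<^sub>C (?R x m * (h l x)\<^sup>\<dagger> * ?L x l)
        = h l x * gradA \<zeta> a b \<phi> ?\<psi> l x + (h l x)\<^sup>\<dagger> * gradB \<zeta> a b \<phi> ?\<psi> l x" if l: "l \<in> K" for l
    proof -
      have 1: "?R x l * h l x = gsign ((gr l + gr a) * gr l) * (h l x * ?R x l)"
        by (rule gsign_commute_homog[OF jrow_homog[OF \<phi> good a K_I[OF l]] field_homog[OF h l]])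
      have 2: "?R x m * (h l x)\<^sup>\<dagger> = gsign ((gr m + gr a) * gr l) * ((h l x)\<^sup>\<dagger> * ?R x m)"
        by (rule gsign_commute_homog[OF jrow_homog[OF \<phi> good a m_in] adj_homog[OF field_homog[OF h l]]])
      show ?thesis unfolding gradA_def gradB_def 1 2
        by (simp only: gr_m add_0_left scaleC_mult_right mult_minus_right diff_conv_add_uminus
            mult.assoc gsign_left_commute)
    qed
    then have "(\<Sum>l\<in>K. sqg *\<^sub>C (?R x l * h l x * ?L x m) - sqg *\<^sub>C (?R x m * (h l x)\<^sup>\<dagger> * ?L x l))
        = (\<Sum>l\<in>K. h l x * gradA \<zeta> a b \<phi> ?\<psi> l x + (h l x)\<^sup>\<dagger> * gradB \<zeta> a b \<phi> ?\<psi> l x)"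
      by (intro sum.cong refl)
    finally show ?thesis by simp
  qed
  then show ?thesis using I1 by simp
qed

text \<open>The difference vanishes at - infinity and solves the equation of \<open>\<phi>\<close>
  with an inhomogeneity: the difference of the two \<Omega> applied to the solution at
  \<open>\<psi>\<close>. The bound is linear in \<eta> and uniform in \<zeta>.\<close>

lemma jcol_lipschitz:
  assumes \<phi>: "\<phi> \<in> fields M N" and \<psi>: "\<psi> \<in> fields M N" and good: "good \<zeta> b" and b: "b \<in> I" and e: "e \<in> I"
    and B: "bnd B \<phi>" "bnd B' \<psi>" and d: "\<And>x e f. norm (Om \<psi> x e f - Om \<phi> x e f) \<le> \<eta> * wt1 x"
  shows "norm (jcol \<zeta> b \<psi> x e - jcol \<zeta> b \<phi> x e) \<le> Gc B * (real (card I) * Gc B' * \<eta> * pi)"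
proof -
  let ?Z = "\<lambda>x e. jcol \<zeta> b \<psi> x e - jcol \<zeta> b \<phi> x e"
  let ?r = "\<lambda>x e. \<Sum>f\<in>I. (Om \<psi> x e f - Om \<phi> x e f) * jcol \<zeta> b \<psi> x f"
  show ?thesis unfolding Gc_def[of B]
  proof (rule jsys.gronwall_from_bot[OF jsys_Om[OF \<phi> good B(1)] e, where Z = ?Z and r = ?r])
    fix e s assume e: "e \<in> I"
    show "((\<lambda>s. ?Z s e) has_vector_derivative cd \<zeta> b e *\<^sub>C ?Z s e + ((\<Sum>f\<in>I. Om \<phi> s e f * ?Z s f) + ?r s e)) (at s)"
    proof (rule has_vector_derivative_eq_rhs[OF has_vector_derivative_diff[OF
            jcol_deriv[OF \<psi> good b e] jcol_deriv[OF \<phi> good b e]]])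
      have "(\<Sum>f\<in>I. Om \<phi> s e f * ?Z s f) + ?r s e
          = (\<Sum>f\<in>I. Om \<psi> s e f * jcol \<zeta> b \<psi> s f) - (\<Sum>f\<in>I. Om \<phi> s e f * jcol \<zeta> b \<phi> s f)"
        unfolding sum.distrib[symmetric] sum_subtractf[symmetric]
        by (intro sum.cong refl) (simp add: algebra_simps)
      then show "cd \<zeta> b e *\<^sub>C jcol \<zeta> b \<psi> s e + (\<Sum>f\<in>I. Om \<psi> s e f * jcol \<zeta> b \<psi> s f)
          - (cd \<zeta> b e *\<^sub>C jcol \<zeta> b \<phi> s e + (\<Sum>f\<in>I. Om \<phi> s e f * jcol \<zeta> b \<phi> s f))
          = cd \<zeta> b e *\<^sub>C ?Z s e + ((\<Sum>f\<in>I. Om \<phi> s e f * ?Z s f) + ?r s e)"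
        by (simp only: scaleC.diff_right) (simp only: algebra_simps)
    qed
    have "norm (?r s e) \<le> (\<Sum>f\<in>I. \<eta> * wt1 s * Gc B')"
      by (intro sum_norm_le norm_mult_le d jcol_facts(3)[OF \<psi> good b B(2)])
    then show "norm (?r s e) \<le> real (card I) * Gc B' * \<eta> * wt1 s" by (simp add: mult_ac)
    show "((\<lambda>x. ?Z x e) \<longlongrightarrow> 0) at_bot"
      using tendsto_diff[OF jcol_bot[OF \<psi> good b e] jcol_bot[OF \<phi> good b e]] by simp
  qed
qed

text \<open>When the increments of \<open>F\<close> are given exactly by densities that are
  Lipschitz at \<epsilon> = 0, differentiability follows with a quadratic error, and no integral has
  to be differentiated under its sign.\<close>

lemma is_gradientI:
  fixes F :: "'a::banach_superalgebra config \<Rightarrow> 'a"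
  assumes A: "\<And>l. l \<in> K \<Longrightarrow> continuous_on UNIV (A l) \<and> bounded (range (A l)) \<and>
      continuous_on UNIV (B l) \<and> bounded (range (B l))"
    and h: "\<And>h. h \<in> fields M N \<Longrightarrow> \<exists>A' B' C. \<forall>\<epsilon>. \<bar>\<epsilon>\<bar> \<le> 1 \<longrightarrow>
      (\<forall>l\<in>K. continuous_on UNIV (A' \<epsilon> l) \<and> continuous_on UNIV (B' \<epsilon> l) \<and>
        (\<forall>x. norm (A' \<epsilon> l x - A l x) \<le> C * \<bar>\<epsilon>\<bar> \<and> norm (B' \<epsilon> l x - B l x) \<le> C * \<bar>\<epsilon>\<bar>)) \<and>
      ((\<lambda>x. \<epsilon> *\<^sub>R (\<Sum>l\<in>K. h l x * A' \<epsilon> l x + (h l x)\<^sup>\<dagger> * B' \<epsilon> l x)) has_integral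
        (F (shift_cfg \<phi> \<epsilon> h) - F \<phi>)) UNIV"
  shows "is_gradient M N F \<phi> A B"
  unfolding is_gradient_def
proof (intro conjI ballI)
  fix h :: "'a config" assume hf: "h \<in> fields M N"
  from h[OF hf] obtain A' B' C where AB0: "\<forall>\<epsilon>. \<bar>\<epsilon>\<bar> \<le> 1 \<longrightarrow>
      (\<forall>l\<in>K. continuous_on UNIV (A' \<epsilon> l) \<and> continuous_on UNIV (B' \<epsilon> l) \<and>
        (\<forall>x. norm (A' \<epsilon> l x - A l x) \<le> C * \<bar>\<epsilon>\<bar> \<and> norm (B' \<epsilon> l x - B l x) \<le> C * \<bar>\<epsilon>\<bar>)) \<and>
      ((\<lambda>x. \<epsilon> *\<^sub>R (\<Sum>l\<in>K. h l x * A' \<epsilon> l x + (h l x)\<^sup>\<dagger> * B' \<epsilon> l x)) has_integral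
        (F (shift_cfg \<phi> \<epsilon> h) - F \<phi>)) UNIV"
    by (elim exE)
  note AB = AB0[rule_format, THEN conjunct1, rule_format] AB0[rule_format, THEN conjunct2]
  obtain b where b: "bnd b h" using fields_bnd[OF hf] .
  have hb: "norm (h l x) \<le> b * wt1 x" "norm ((h l x)\<^sup>\<dagger>) \<le> b * wt1 x" if "l \<in> K" for l x
    using b that by (auto simp: bnd_def norm_adj)
  have hc: "continuous_on UNIV (h l)" "continuous_on UNIV (\<lambda>x. (h l x)\<^sup>\<dagger>)" if "l \<in> K" for l
    using schwartz_continuous[of "h l"] hf that by (auto simp: fields_def intro!: adj_continuous_on)
  have "\<forall>l\<in>K. \<exists>c. \<forall>x. norm (A l x) \<le> c \<and> norm (B l x) \<le> c"
  proof
    fix l assume "l \<in> K"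
    then obtain c d where "\<And>x. norm (A l x) \<le> c" "\<And>x. norm (B l x) \<le> d"
      using A[of l] unfolding bounded_iff by blast
    then show "\<exists>c. \<forall>x. norm (A l x) \<le> c \<and> norm (B l x) \<le> c"
      by (intro exI[of _ "max c d"]) (auto intro: max.coboundedI1 max.coboundedI2)
  qed
  then obtain c where c: "\<And>l x. l \<in> K \<Longrightarrow> norm (A l x) \<le> c l \<and> norm (B l x) \<le> c l" by metis
  let ?f = "\<lambda>x. \<Sum>l\<in>K. h l x * A l x + (h l x)\<^sup>\<dagger> * B l x"
  let ?f' = "\<lambda>\<epsilon> x. \<Sum>l\<in>K. h l x * A' \<epsilon> l x + (h l x)\<^sup>\<dagger> * B' \<epsilon> l x"
  define v where "v = integral UNIV ?f"
  have fi: "(?f has_integral v) UNIV" unfolding v_def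
  proof (rule integral_dominated_wt(1))
    show "continuous_on UNIV ?f" using A by (intro continuous_intros hc) auto
    fix x
    have "norm (?f x) \<le> (\<Sum>l\<in>K. b * wt1 x * c l + b * wt1 x * c l)"
      using c by (intro sum_norm_le norm_triangle_mono norm_mult_le hb) auto
    also have "\<dots> = (\<Sum>l\<in>K. b * c l + b * c l) * wt1 x" 
      unfolding sum_distrib_right by (intro sum.cong refl) (simp add: algebra_simps)
    finally show "norm (?f x) \<le> \<dots>" .
  qed
  define D where "D = (\<Sum>l\<in>K. b * C + b * C) * pi"
  have est: "norm (F (shift_cfg \<phi> \<epsilon> h) - F \<phi> - \<epsilon> *\<^sub>R v) \<le> \<bar>\<epsilon>\<bar> * (D * \<bar>\<epsilon>\<bar>)" if e: "\<bar>\<epsilon>\<bar> \<le> 1" for \<epsilon>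
  proof -
    let ?d = "\<lambda>x. \<Sum>l\<in>K. h l x * (A' \<epsilon> l x - A l x) + (h l x)\<^sup>\<dagger> * (B' \<epsilon> l x - B l x)"
    have dc: "continuous_on UNIV ?d" using A AB(1)[OF e] by (intro continuous_intros hc) auto
    have db: "norm (?d x) \<le> (\<Sum>l\<in>K. b * C + b * C) * \<bar>\<epsilon>\<bar> * wt1 x" for x
    proof -
      have "norm (?d x) \<le> (\<Sum>l\<in>K. b * wt1 x * (C * \<bar>\<epsilon>\<bar>) + b * wt1 x * (C * \<bar>\<epsilon>\<bar>))"
        using AB(1)[OF e] by (intro sum_norm_le norm_triangle_mono norm_mult_le hb) auto
      also have "\<dots> = (\<Sum>l\<in>K. b * C + b * C) * \<bar>\<epsilon>\<bar> * wt1 x" 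
      unfolding sum_distrib_right by (intro sum.cong refl) (simp add: algebra_simps)
      finally show ?thesis .
    qed
    have "((\<lambda>x. \<epsilon> *\<^sub>R ?f' \<epsilon> x - \<epsilon> *\<^sub>R ?f x) has_integral (F (shift_cfg \<phi> \<epsilon> h) - F \<phi> - \<epsilon> *\<^sub>R v)) UNIV"
      by (intro has_integral_diff AB(2) e has_integral_cmul fi)
    moreover have "\<epsilon> *\<^sub>R ?f' \<epsilon> x - \<epsilon> *\<^sub>R ?f x = \<epsilon> *\<^sub>R ?d x" for x
      by (simp only: scaleR_diff_right[symmetric] sum_subtractf[symmetric] right_diff_distrib)
        (simp add: algebra_simps)
    ultimately have "((\<lambda>x. \<epsilon> *\<^sub>R ?d x) has_integral (F (shift_cfg \<phi> \<epsilon> h) - F \<phi> - \<epsilon> *\<^sub>R v)) UNIV" by simp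
    moreover have "((\<lambda>x. \<epsilon> *\<^sub>R ?d x) has_integral \<epsilon> *\<^sub>R integral UNIV ?d) UNIV"
      by (intro has_integral_cmul integral_dominated_wt(1)[OF dc db])
    ultimately have "F (shift_cfg \<phi> \<epsilon> h) - F \<phi> - \<epsilon> *\<^sub>R v = \<epsilon> *\<^sub>R integral UNIV ?d"
      by (rule has_integral_unique)
    moreover have "norm (integral UNIV ?d) \<le> D * \<bar>\<epsilon>\<bar>"
      using integral_dominated_wt(2)[OF dc db] by (simp only: D_def mult_ac)
    ultimately show ?thesis by (simp add: mult_left_mono)
  qed
  have "((\<lambda>\<epsilon>. F (shift_cfg \<phi> \<epsilon> h)) has_vector_derivative v) (at 0)"
    unfolding has_vector_derivative_def has_derivative_at
  proof (rule conjI[OF bounded_linear_scaleR_left Lim_null_comparison])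
    show "((\<lambda>\<epsilon>. D * \<bar>\<epsilon>\<bar>) \<longlongrightarrow> 0) (at 0)" by (rule tendsto_eq_intros refl | simp)+
    have "\<forall>\<^sub>F \<epsilon> in at (0::real). \<epsilon> \<in> {-1<..<1}" by (rule eventually_at_in_open') auto
    moreover have "\<forall>\<^sub>F \<epsilon> in at (0::real). \<epsilon> \<noteq> 0" by (rule eventually_neq_at_within)
    ultimately show "\<forall>\<^sub>F \<epsilon> in at 0. norm (norm (F (shift_cfg \<phi> (0 + \<epsilon>) h) - F (shift_cfg \<phi> 0 h) - \<epsilon> *\<^sub>R v) / norm \<epsilon>) \<le> D * \<bar>\<epsilon>\<bar>"
    proof eventually_elim
      case (elim \<epsilon>)
      then have "\<bar>\<epsilon>\<bar> \<le> 1" by auto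
      from est[OF this] elim show ?case by (simp add: pos_divide_le_eq mult.commute)
    qed
  qed
  then show "\<exists>v. ((\<lambda>\<epsilon>. F (\<lambda>j x. \<phi> j x + \<epsilon> *\<^sub>R h j x)) has_vector_derivative v) (at 0) \<and>
        ((\<lambda>x. \<Sum>l = 1..M + N. h l x * A l x + (h l x)\<^sup>\<dagger> * B l x) has_integral v) UNIV"
    using fi unfolding shift_cfg_def by blast
qed (use A in auto)

lemma bnd_shift: "bnd b \<phi> \<Longrightarrow> bnd b' h \<Longrightarrow> \<bar>\<epsilon>\<bar> \<le> 1 \<Longrightarrow> bnd (b + b') (shift_cfg \<phi> \<epsilon> h)"
  unfolding bnd_def shift_cfg_def
proof (intro conjI ballI allI)
  fix j x assume *: "0 \<le> b \<and> (\<forall>j\<in>K. \<forall>x. norm (\<phi> j x) \<le> b * wt1 x)"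
    "0 \<le> b' \<and> (\<forall>j\<in>K. \<forall>x. norm (h j x) \<le> b' * wt1 x)" "\<bar>\<epsilon>\<bar> \<le> 1" "j \<in> K"
  have "norm (\<epsilon> *\<^sub>R h j x) \<le> 1 * norm (h j x)" unfolding norm_scaleR real_norm_def by (intro mult_right_mono *) auto
  also have "\<dots> \<le> b' * wt1 x" using * by simp
  finally have "norm (\<phi> j x + \<epsilon> *\<^sub>R h j x) \<le> b * wt1 x + b' * wt1 x" using * by (intro norm_triangle_mono) auto
  then show "norm (\<phi> j x + \<epsilon> *\<^sub>R h j x) \<le> (b + b') * wt1 x" by (simp add: distrib_right)
qed auto

lemma grad_continuous:
  assumes "\<phi> \<in> fields M N" "\<psi> \<in> fields M N" "a \<in> I" "b \<in> I" "sg a = sg b" "good \<zeta> a" "l \<in> K"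
  shows "continuous_on UNIV (gradA \<zeta> a b \<phi> \<psi> l)" "continuous_on UNIV (gradB \<zeta> a b \<phi> \<psi> l)"
  unfolding gradA_def[abs_def] gradB_def[abs_def] using assms good_same[OF assms(5)]
  by (auto intro!: continuous_intros scaleC.continuous_on jrow_cont jcol_cont)

lemma grad_bounded:
  assumes "\<phi> \<in> fields M N" "\<psi> \<in> fields M N" "a \<in> I" "b \<in> I" "sg a = sg b" "good \<zeta> a"
  shows "\<exists>c. \<forall>l\<in>K. \<forall>x. norm (gradA \<zeta> a b \<phi> \<psi> l x) \<le> c \<and> norm (gradB \<zeta> a b \<phi> \<psi> l x) \<le> c"
proof -
  have good: "good \<zeta> b" using good_same[OF assms(5)] assms(6) by simp
  obtain G where G: "\<And>x e. e \<in> I \<Longrightarrow> norm (jrow \<zeta> a \<phi> x e) \<le> G" using jrow_bdd[OF assms(1,6,3)] by blast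
  obtain G' where G': "\<And>x e. e \<in> I \<Longrightarrow> norm (jcol \<zeta> b \<psi> x e) \<le> G'" using jcol_bdd[OF assms(2) good assms(4)] by blast
  have "norm (gradA \<zeta> a b \<phi> \<psi> l x) \<le> sqrt g * (G * G') \<and> norm (gradB \<zeta> a b \<phi> \<psi> l x) \<le> sqrt g * (G * G')"
    if "l \<in> K" for l x
    unfolding gradA_def gradB_def norm_minus_cancel norm_scaleC norm_sqg norm_gsign_mult
    using g_pos that by (auto intro!: mult_left_mono norm_mult_le G G')
  then show ?thesis by blast
qed

text \<open>In the exact increment the row stays at \<open>\<phi>\<close>, so the Lipschitz
  dependence of the column on \<epsilon> suffices.\<close>

lemma Tm_gradient:
  assumes \<phi>: "\<phi> \<in> fields M N" and a: "a \<in> I" and b: "b \<in> I" and s: "sg a = sg b" and good: "good \<zeta> a"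
  shows "is_gradient M N (Tm \<zeta> a b) \<phi> (gradA \<zeta> a b \<phi> \<phi>) (gradB \<zeta> a b \<phi> \<phi>)"
proof (rule is_gradientI)
  obtain c where c: "\<And>l x. l \<in> K \<Longrightarrow> norm (gradA \<zeta> a b \<phi> \<phi> l x) \<le> c \<and> norm (gradB \<zeta> a b \<phi> \<phi> l x) \<le> c"
    using grad_bounded[OF \<phi> \<phi> a b s good] by blast
  then show "continuous_on UNIV (gradA \<zeta> a b \<phi> \<phi> l) \<and> bounded (range (gradA \<zeta> a b \<phi> \<phi> l)) \<and>
      continuous_on UNIV (gradB \<zeta> a b \<phi> \<phi> l) \<and> bounded (range (gradB \<zeta> a b \<phi> \<phi> l))" if "l \<in> K" for l
    using grad_continuous[OF \<phi> \<phi> a b s good that] that unfolding bounded_iff by blast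
  have goodb: "good \<zeta> b" using good_same[OF s] good by simp
  obtain B where B: "bnd B \<phi>" using fields_bnd[OF \<phi>] .
  obtain G where G: "\<And>x e. e \<in> I \<Longrightarrow> norm (jrow \<zeta> a \<phi> x e) \<le> G" using jrow_bdd[OF \<phi> good a] by blast
  fix h :: "'a config" assume h: "h \<in> fields M N"
  obtain b' where b': "bnd b' h" using fields_bnd[OF h] .
  define C where "C = Gc B * (real (card I) * Gc (B + b') * (sqrt g * b') * pi)"
  have lip: "norm (jcol \<zeta> b (shift_cfg \<phi> \<epsilon> h) x e - jcol \<zeta> b \<phi> x e) \<le> C * \<bar>\<epsilon>\<bar>" if "\<bar>\<epsilon>\<bar> \<le> 1" "e \<in> I" for \<epsilon> x e
  proof -
    have "norm (jcol \<zeta> b (shift_cfg \<phi> \<epsilon> h) x e - jcol \<zeta> b \<phi> x e)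
        \<le> Gc B * (real (card I) * Gc (B + b') * (\<bar>\<epsilon>\<bar> * (sqrt g * b')) * pi)"
    proof (rule jcol_lipschitz[OF \<phi> shift_fields[OF \<phi> h] goodb b that(2) B bnd_shift[OF B b' that(1)]])
      fix x e f
      have "Om (shift_cfg \<phi> \<epsilon> h) x e f - Om \<phi> x e f = \<epsilon> *\<^sub>R Om h x e f"
        by (auto simp: Om_eq shift_cfg_def scaleC_add_right adj_add adj_scaleR scaleC.scaleR_right)
      then show "norm (Om (shift_cfg \<phi> \<epsilon> h) x e f - Om \<phi> x e f) \<le> \<bar>\<epsilon>\<bar> * (sqrt g * b') * wt1 x"
        using Om_bd[OF b', of x e f] by (simp add: mult_left_mono mult.assoc)
    qed
    then show ?thesis by (simp add: C_def mult_ac)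
  qed
  have est: "norm (gradA \<zeta> a b \<phi> (shift_cfg \<phi> \<epsilon> h) l x - gradA \<zeta> a b \<phi> \<phi> l x) \<le> sqrt g * (G * C) * \<bar>\<epsilon>\<bar> \<and>
      norm (gradB \<zeta> a b \<phi> (shift_cfg \<phi> \<epsilon> h) l x - gradB \<zeta> a b \<phi> \<phi> l x) \<le> sqrt g * (G * C) * \<bar>\<epsilon>\<bar>"
    if e: "\<bar>\<epsilon>\<bar> \<le> 1" and l: "l \<in> K" for \<epsilon> l x
  proof -
    have "norm (jrow \<zeta> a \<phi> x u * (jcol \<zeta> b (shift_cfg \<phi> \<epsilon> h) x w - jcol \<zeta> b \<phi> x w)) \<le> G * (C * \<bar>\<epsilon>\<bar>)"
      if "u \<in> I" "w \<in> I" for u w by (intro norm_mult_le G lip that e)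
    then have "norm (gradA \<zeta> a b \<phi> (shift_cfg \<phi> \<epsilon> h) l x - gradA \<zeta> a b \<phi> \<phi> l x) \<le> sqrt g * (G * (C * \<bar>\<epsilon>\<bar>))"
      "norm (gradB \<zeta> a b \<phi> (shift_cfg \<phi> \<epsilon> h) l x - gradB \<zeta> a b \<phi> \<phi> l x) \<le> sqrt g * (G * (C * \<bar>\<epsilon>\<bar>))"
      unfolding gradA_def gradB_def minus_diff_minus norm_minus_cancel scaleC.diff_right[symmetric]
        right_diff_distrib[symmetric] norm_scaleC norm_sqg norm_gsign_mult
      using g_pos K_I[OF l] m_in by (auto intro!: mult_left_mono simp del: One_nat_def)
    then show ?thesis by (simp add: mult_ac)
  qed
  show "\<exists>A' B' C. \<forall>\<epsilon>. \<bar>\<epsilon>\<bar> \<le> 1 \<longrightarrow>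
      (\<forall>l\<in>K. continuous_on UNIV (A' \<epsilon> l) \<and> continuous_on UNIV (B' \<epsilon> l) \<and>
        (\<forall>x. norm (A' \<epsilon> l x - gradA \<zeta> a b \<phi> \<phi> l x) \<le> C * \<bar>\<epsilon>\<bar> \<and> norm (B' \<epsilon> l x - gradB \<zeta> a b \<phi> \<phi> l x) \<le> C * \<bar>\<epsilon>\<bar>)) \<and>
      ((\<lambda>x. \<epsilon> *\<^sub>R (\<Sum>l\<in>K. h l x * A' \<epsilon> l x + (h l x)\<^sup>\<dagger> * B' \<epsilon> l x)) has_integral
        (Tm \<zeta> a b (shift_cfg \<phi> \<epsilon> h) - Tm \<zeta> a b \<phi>)) UNIV"
    by (intro exI[of _ "\<lambda>\<epsilon>. gradA \<zeta> a b \<phi> (shift_cfg \<phi> \<epsilon> h)"]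
        exI[of _ "\<lambda>\<epsilon>. gradB \<zeta> a b \<phi> (shift_cfg \<phi> \<epsilon> h)"] exI[of _ "sqrt g * (G * C)"]
        allI impI conjI ballI Tm_difference[OF \<phi> h a b s good]
        grad_continuous[OF \<phi> shift_fields[OF \<phi> h] a b s good]
        est[THEN conjunct1] est[THEN conjunct2])
qed

end

section \<open>Poisson brackets of the monodromy matrix\<close>

lemma sum_swap_outer:
  "(\<Sum>e\<in>S. \<Sum>f\<in>S. \<Sum>k\<in>S. h e f k) = (\<Sum>e\<in>S. \<Sum>f\<in>S. \<Sum>k\<in>S. h k f (e::'i) :: 'b::comm_monoid_add)"
proof -
  have "(\<Sum>e\<in>S. \<Sum>f\<in>S. \<Sum>k\<in>S. h e f k) = (\<Sum>f\<in>S. \<Sum>e\<in>S. \<Sum>k\<in>S. h e f k)" by (rule sum.swap)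
  also have "\<dots> = (\<Sum>f\<in>S. \<Sum>e\<in>S. \<Sum>k\<in>S. h k f e)" by (intro sum.cong refl sum.swap)
  also have "\<dots> = (\<Sum>e\<in>S. \<Sum>f\<in>S. \<Sum>k\<in>S. h k f e)" by (rule sum.swap)
  finally show ?thesis .
qed

lemma sum_swap_inner:
  "(\<Sum>e\<in>S. \<Sum>f\<in>S. \<Sum>k\<in>S. h e f k) = (\<Sum>e\<in>S. \<Sum>f\<in>S. \<Sum>k\<in>S. h e k (f::'i) :: 'b::comm_monoid_add)"
  by (intro sum.cong refl sum.swap)

lemma sum_mone: "finite S \<Longrightarrow> a \<in> S \<Longrightarrow> (\<Sum>e\<in>S. mone e a * X e) = (X a :: 'a::semiring_1)"
proof -
  assume *: "finite S" "a \<in> S"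
  have "(\<Sum>e\<in>S. mone e a * X e) = (\<Sum>e\<in>S. if e = a then X e else 0)"
    by (intro sum.cong refl) (simp add: mone_def)
  then show ?thesis using * by simp
qed

lemma sum_eq_single:
  assumes "finite S" "a \<in> S" "\<And>x. x \<in> S \<Longrightarrow> x \<noteq> a \<Longrightarrow> h x = 0"
  shows "sum h S = (h a :: 'b::comm_monoid_add)"
proof -
  have "sum h S = (\<Sum>x\<in>S. if x = a then h a else 0)" using assms(3) by (intro sum.cong refl) auto
  then show ?thesis using assms(1,2) by simp
qed

lemma add_four:
  "a = A + s4 \<Longrightarrow> b = - B - s3 \<Longrightarrow> c = C + s2 \<Longrightarrow> d = - D - s1 \<Longrightarrow> A + (- B + (C + - D)) = t \<Longrightarrow>
    a + (b + (c + d)) = t + (s4 - s1 + (s2 - (s3::'a::ab_group_add)))"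
  by (hypsubst, simp add: algebra_simps)

text \<open>Factors are exchanged for their limits one at a time, so that each difference is
  multiplied by bounded factors only.\<close>

lemma quad_diff:
  fixes r :: "'a::ring"
  shows "(r - n) * (l * r' * l') + (n * l) * ((r' - n') * l') = r * l * r' * l' - n * l * n' * l'"
    and "r * (l - n) * (r' * l') + (r * n * r') * (l' - n') = r * l * r' * l' - r * n * r' * n'"
  by (simp_all add: algebra_simps)

context super_nls begin

text \<open>The integrand of \<open>has_poisson\<close> with the gradients as arguments: it is
  applied both to gradients of T and to the coefficients of their expansions.\<close>

definition brk :: "bit \<Rightarrow> (nat \<Rightarrow> real \<Rightarrow> 'a) \<Rightarrow> (nat \<Rightarrow> real \<Rightarrow> 'a) \<Rightarrow> (nat \<Rightarrow> real \<Rightarrow> 'a) \<Rightarrow> (nat \<Rightarrow> real \<Rightarrow> 'a)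
    \<Rightarrow> real \<Rightarrow> 'a::banach_superalgebra" where
  "brk p A B C D x = \<i> *\<^sub>C (\<Sum>l\<in>K. gsign (p * gr l) * (gsign (gr l) * A l x * D l x - B l x * C l x))"

text \<open>The sign with which \<open>R\<^sub>e L\<^sub>f R'\<^sub>f L'\<^sub>e\<close> enters the primitive of the bracket integrand.\<close>
definition qsign :: "nat \<Rightarrow> nat \<Rightarrow> nat \<Rightarrow> nat \<Rightarrow> 'a::banach_superalgebra" where
  "qsign b c e f = gsign ((gr e + gr f) * (gr b + gr c) + gr f)"

lemma sqg_sq: "sqg * sqg = - complex_of_real g"
proof -
  have "sqg * sqg = (\<i> * \<i>) * complex_of_real (sqrt g * sqrt g)" by (simp only: of_real_mult mult_ac)
  then show ?thesis using g_pos by simp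
qed

context
  fixes R L R' L' :: "nat \<Rightarrow> 'a::banach_superalgebra" and W :: "nat \<Rightarrow> nat \<Rightarrow> 'a" and a b c d :: nat
  assumes hR: "\<And>e. e \<in> I \<Longrightarrow> R e \<in> homog (gr e + gr a)" and hL: "\<And>e. e \<in> I \<Longrightarrow> L e \<in> homog (gr e + gr b)"
    and hR': "\<And>e. e \<in> I \<Longrightarrow> R' e \<in> homog (gr e + gr c)" and hL': "\<And>e. e \<in> I \<Longrightarrow> L' e \<in> homog (gr e + gr d)"
    and hW: "\<And>e f. W e f \<in> homog (gr e + gr f)"
begin

text \<open>The four terms containing \<Omega> cancel in pairs after relabelling: \<open>X1\<close>
  against \<open>X4\<close>, and \<open>X2\<close> against \<open>X3\<close>. To compare them an
  entry of \<Omega> has to pass the middle pair formed by \<open>L\<close> and \<open>R'\<close>,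
  and \<open>qsign\<close> is the sign for which this works. Since \<Omega> is the same at \<zeta>
  and \<mu>, nothing but the diagonal terms is left, with a coefficient proportional to \<zeta> -
  \<mu>.\<close>

lemma quad_algebra:
  fixes \<zeta> \<mu> :: complex
  assumes s: "sg a = sg b" "sg c = sg d"
  defines "DR \<equiv> \<lambda>e. - (cd \<zeta> a e *\<^sub>C R e) - (\<Sum>k\<in>I. R k * W k e)"
    and "DL \<equiv> \<lambda>f. cd \<zeta> b f *\<^sub>C L f + (\<Sum>k\<in>I. W f k * L k)"
    and "DR' \<equiv> \<lambda>e. - (cd \<mu> c e *\<^sub>C R' e) - (\<Sum>k\<in>I. R' k * W k e)"
    and "DL' \<equiv> \<lambda>f. cd \<mu> d f *\<^sub>C L' f + (\<Sum>k\<in>I. W f k * L' k)"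
  shows "(\<Sum>e\<in>I. \<Sum>f\<in>I. qsign b c e f * (R e * L f * R' f * DL' e + (R e * L f * DR' f + (R e * DL f + DR e * L f) * R' f) * L' e))
    = (\<i> * (\<zeta> - \<mu>)) *\<^sub>C (\<Sum>l\<in>K. qsign b c m l * (R m * L l * R' l * L' m) - qsign b c l m * (R l * L m * R' m * L' l))"
proof -
  let ?s = "qsign b c"
  define X1 where "X1 e f k = ?s e f * (R k * W k e * L f * R' f * L' e)" for e f k
  define X2 where "X2 e f k = ?s e f * (R e * W f k * L k * R' f * L' e)" for e f k
  define X3 where "X3 e f k = ?s e f * (R e * L f * R' k * W k f * L' e)" for e f k
  define X4 where "X4 e f k = ?s e f * (R e * L f * R' f * W e k * L' k)" for e f k
  define dg where "dg e f = ?s e f * ((\<i> * (\<zeta> - \<mu>) / 2 * (sg f - sg e)) *\<^sub>C (R e * L f * R' f * L' e))" for e f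
  have comm: "X * (Y * Z) * w = gsign ((p + q) * r) * (X * w * (Y * Z))"
    if "Y \<in> homog p" "Z \<in> homog q" "w \<in> homog r" for X Y Z w :: 'a and p q r
    using gsign_commute_homog[OF homog_mult[OF that(1,2)] that(3)] by (simp add: mult.assoc gsign_left_commute)
  \<comment> \<open>The middle pair has grade \<open>gr b + gr c\<close>, since the two
    contributions of \<open>f\<close> cancel; the resulting sign relates \<open>qsign\<close> at
    \<open>k\<close> and at \<open>e\<close>.\<close>
  have 14: "X4 k f e = X1 e f k" if "e \<in> I" "f \<in> I" "k \<in> I" for e f k
  proof -
    have "X4 k f e = ?s k f * (gsign ((gr f + gr b + (gr f + gr c)) * (gr k + gr e)) * (R k * W k e * (L f * R' f)) * L' e)"
      unfolding X4_def comm[OF hL[OF that(2)] hR'[OF that(2)] hW, symmetric] by (simp only: mult.assoc)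
    also have "\<dots> = (?s k f * gsign ((gr f + gr b + (gr f + gr c)) * (gr k + gr e))) * (R k * W k e * L f * R' f * L' e)"
      by (simp only: mult.assoc)
    also have "?s k f * gsign ((gr f + gr b + (gr f + gr c)) * (gr k + gr e)) = ?s e f"
      unfolding qsign_def gsign_mult
      by (cases "gr b"; cases "gr c"; cases "gr k"; cases "gr e"; cases "gr f"; simp)
    finally show ?thesis unfolding X1_def .
  qed
  \<comment> \<open>Here the middle pair has the additional grade \<open>gr k + gr f\<close>, which
    is that of the entry itself; its square exchanges \<open>gr k\<close> for \<open>gr f\<close> in
    \<open>qsign\<close>.\<close>
  have 23: "X3 e k f = X2 e f k" if "e \<in> I" "f \<in> I" "k \<in> I" for e f k
  proof -
    have "X3 e k f = ?s e k * (gsign ((gr k + gr b + (gr f + gr c)) * (gr f + gr k)) * (R e * W f k * (L k * R' f)) * L' e)"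
      unfolding X3_def comm[OF hL[OF that(3)] hR'[OF that(2)] hW, symmetric] by (simp only: mult.assoc)
    also have "\<dots> = (?s e k * gsign ((gr k + gr b + (gr f + gr c)) * (gr f + gr k))) * (R e * W f k * L k * R' f * L' e)"
      by (simp only: mult.assoc)
    also have "?s e k * gsign ((gr k + gr b + (gr f + gr c)) * (gr f + gr k)) = ?s e f"
      unfolding qsign_def gsign_mult
      by (cases "gr b"; cases "gr c"; cases "gr k"; cases "gr e"; cases "gr f"; simp)
    finally show ?thesis unfolding X2_def .
  qed
  have pt: "?s e f * (R e * L f * R' f * DL' e + (R e * L f * DR' f + (R e * DL f + DR e * L f) * R' f) * L' e)
      = dg e f + ((\<Sum>k\<in>I. X4 e f k) - (\<Sum>k\<in>I. X1 e f k) + ((\<Sum>k\<in>I. X2 e f k) - (\<Sum>k\<in>I. X3 e f k)))" for e f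
  proof -
    let ?q = "R e * L f * R' f * L' e"
    have 1: "R e * L f * R' f * DL' e = cd \<mu> d e *\<^sub>C ?q + (\<Sum>k\<in>I. R e * L f * R' f * W e k * L' k)"
      by (simp only: DL'_def distrib_left scaleC_mult_right sum_distrib_left mult.assoc)
    have 2: "R e * L f * DR' f * L' e = - (cd \<mu> c f *\<^sub>C ?q) - (\<Sum>k\<in>I. R e * L f * R' k * W k f * L' e)"
      by (simp only: DR'_def right_diff_distrib left_diff_distrib scaleC_mult_right scaleC_mult_left
          sum_distrib_left sum_distrib_right mult.assoc mult_minus_right mult_minus_left)
    have 3: "R e * DL f * R' f * L' e = cd \<zeta> b f *\<^sub>C ?q + (\<Sum>k\<in>I. R e * W f k * L k * R' f * L' e)"
      by (simp only: DL_def distrib_left distrib_right scaleC_mult_right scaleC_mult_left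
          sum_distrib_left sum_distrib_right mult.assoc)
    have 4: "DR e * L f * R' f * L' e = - (cd \<zeta> a e *\<^sub>C ?q) - (\<Sum>k\<in>I. R k * W k e * L f * R' f * L' e)"
      by (simp only: DR_def left_diff_distrib scaleC_mult_left sum_distrib_right mult.assoc mult_minus_left)
    have 5: "cd \<mu> d e *\<^sub>C ?q + (- (cd \<mu> c f *\<^sub>C ?q) + (cd \<zeta> b f *\<^sub>C ?q + - (cd \<zeta> a e *\<^sub>C ?q)))
        = (\<i> * (\<zeta> - \<mu>) / 2 * (sg f - sg e)) *\<^sub>C ?q"
      unfolding scaleC.minus_left[symmetric] scaleC_add_left[symmetric] cd_def s
      by (intro arg_cong[where f = "\<lambda>z. z *\<^sub>C ?q"]) (simp add: field_simps)
    from add_four[OF 1 2 3 4 5]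
    have "R e * L f * R' f * DL' e + (R e * L f * DR' f + (R e * DL f + DR e * L f) * R' f) * L' e
      = (\<i> * (\<zeta> - \<mu>) / 2 * (sg f - sg e)) *\<^sub>C ?q + ((\<Sum>k\<in>I. R e * L f * R' f * W e k * L' k)
        - (\<Sum>k\<in>I. R k * W k e * L f * R' f * L' e) + ((\<Sum>k\<in>I. R e * W f k * L k * R' f * L' e)
        - (\<Sum>k\<in>I. R e * L f * R' k * W k f * L' e)))"
      by (simp only: distrib_right)
    then show ?thesis
      by (simp only: X1_def X2_def X3_def X4_def dg_def sum_distrib_left[symmetric] distrib_left right_diff_distrib)
  qed
  have "(\<Sum>e\<in>I. \<Sum>f\<in>I. \<Sum>k\<in>I. X4 e f k) = (\<Sum>e\<in>I. \<Sum>f\<in>I. \<Sum>k\<in>I. X4 k f e)" by (rule sum_swap_outer)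
  also have "\<dots> = (\<Sum>e\<in>I. \<Sum>f\<in>I. \<Sum>k\<in>I. X1 e f k)" by (intro sum.cong refl 14)
  finally have e14: "(\<Sum>e\<in>I. \<Sum>f\<in>I. \<Sum>k\<in>I. X4 e f k) = (\<Sum>e\<in>I. \<Sum>f\<in>I. \<Sum>k\<in>I. X1 e f k)" .
  have "(\<Sum>e\<in>I. \<Sum>f\<in>I. \<Sum>k\<in>I. X3 e f k) = (\<Sum>e\<in>I. \<Sum>f\<in>I. \<Sum>k\<in>I. X3 e k f)" by (rule sum_swap_inner)
  also have "\<dots> = (\<Sum>e\<in>I. \<Sum>f\<in>I. \<Sum>k\<in>I. X2 e f k)" by (intro sum.cong refl 23)
  finally have e23: "(\<Sum>e\<in>I. \<Sum>f\<in>I. \<Sum>k\<in>I. X3 e f k) = (\<Sum>e\<in>I. \<Sum>f\<in>I. \<Sum>k\<in>I. X2 e f k)" .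
  have "(\<Sum>e\<in>I. \<Sum>f\<in>I. ?s e f * (R e * L f * R' f * DL' e + (R e * L f * DR' f + (R e * DL f + DR e * L f) * R' f) * L' e))
      = (\<Sum>e\<in>I. \<Sum>f\<in>I. dg e f)"
    unfolding pt sum.distrib sum_subtractf e14 e23 by (simp only: diff_self add_0_right)
  \<comment> \<open>Within a block the exponents agree, so only pairs with exactly one index
    \<open>m\<close> survive.\<close>
  also have "\<dots> = (\<Sum>e\<in>K. dg e m) + (\<Sum>f\<in>K. dg m f)"
  proof -
    have "dg e f = 0" if "sg e = sg f" for e f using that by (simp add: dg_def scaleC.zero_left)
    then have "(\<Sum>e\<in>K. \<Sum>f\<in>K. dg e f) = 0" "dg m m = 0" by (auto intro!: sum.neutral simp: sg_K)
    then show ?thesis unfolding sum_I sum.distrib by (simp only: add_0_left add_0_right add.commute)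
  qed
  also have "\<dots> = (\<i> * (\<zeta> - \<mu>)) *\<^sub>C (\<Sum>l\<in>K. ?s m l * (R m * L l * R' l * L' m) - ?s l m * (R l * L m * R' m * L' l))"
  proof -
    have "dg m l = (\<i> * (\<zeta> - \<mu>)) *\<^sub>C (?s m l * (R m * L l * R' l * L' m))"
      "dg l m = - ((\<i> * (\<zeta> - \<mu>)) *\<^sub>C (?s l m * (R l * L m * R' m * L' l)))" if "l \<in> K" for l
      unfolding dg_def scaleC_mult_right sg_K[OF that] sg_m
      by (simp_all add: scaleC.minus_left[symmetric])
    then have "(\<Sum>e\<in>K. dg e m) + (\<Sum>f\<in>K. dg m f) = (\<Sum>l\<in>K. - ((\<i> * (\<zeta> - \<mu>)) *\<^sub>C (?s l m * (R l * L m * R' m * L' l))))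
       + (\<Sum>l\<in>K. (\<i> * (\<zeta> - \<mu>)) *\<^sub>C (?s m l * (R m * L l * R' l * L' m)))"
      by (intro arg_cong2[where f = plus] sum.cong) simp_all
    then show ?thesis by (simp only: sum_negf sum_subtractf scaleC.sum_right[symmetric] scaleC.diff_right) simp
  qed
  finally show ?thesis .
qed

text \<open>Each gradient carries one factor \<open>sqg\<close>, and two of them give
  \<open>- complex_of_real g\<close>. After collecting signs the bracket integrand is, up to a
  constant, the sum that \<open>quad_algebra\<close> finds as a derivative.\<close>

lemma brk_algebra:
  defines "A \<equiv> \<lambda>l. sqg *\<^sub>C (gsign ((gr l + gr a) * gr l) * (R l * L m))"
    and "B \<equiv> \<lambda>l. - (sqg *\<^sub>C (gsign (gr a * gr l) * (R m * L l)))"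
    and "C \<equiv> \<lambda>l. sqg *\<^sub>C (gsign ((gr l + gr c) * gr l) * (R' l * L' m))"
    and "D \<equiv> \<lambda>l. - (sqg *\<^sub>C (gsign (gr c * gr l) * (R' m * L' l)))"
  shows "\<i> *\<^sub>C (\<Sum>l\<in>K. gsign ((gr a + gr b) * gr l) * (gsign (gr l) * A l * D l - B l * C l))
    = (\<i> * complex_of_real g) *\<^sub>C (\<Sum>l\<in>K. qsign b c l m * (R l * L m * R' m * L' l) - qsign b c m l * (R m * L l * R' l * L' m))"
proof -
  have g2: "sqg *\<^sub>C sqg *\<^sub>C x = - (complex_of_real g *\<^sub>C x)" for x :: 'a
    unfolding scaleC_scaleC sqg_sq by (rule scaleC.minus_left)
  have "gsign ((gr a + gr b) * gr l) * (gsign (gr l) * A l * D l - B l * C l)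
      = complex_of_real g *\<^sub>C (qsign b c l m * (R l * L m * R' m * L' l) - qsign b c m l * (R m * L l * R' l * L' m))" for l
  proof -
    have AD: "A l * D l = complex_of_real g *\<^sub>C (gsign ((gr l + gr a) * gr l) * (gsign (gr c * gr l) * (R l * L m * R' m * L' l)))"
      unfolding A_def D_def by (simp only: scaleC_mult_left scaleC_mult_right mult_minus_right scaleC.minus_right g2 minus_minus mult.assoc
        gsign_left_commute[of "L m"] gsign_left_commute[of "R l"])
    have BC: "B l * C l = complex_of_real g *\<^sub>C (gsign (gr a * gr l) * (gsign ((gr l + gr c) * gr l) * (R m * L l * R' l * L' m)))"
      unfolding B_def C_def by (simp only: scaleC_mult_left scaleC_mult_right mult_minus_left scaleC.minus_right g2 minus_minus mult.assoc
        gsign_left_commute[of "L l"] gsign_left_commute[of "R m"])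
    have s1: "gsign ((gr a + gr b) * gr l) * (gsign (gr l) * (gsign ((gr l + gr a) * gr l) * (gsign (gr c * gr l) * x)))
        = qsign b c l m * (x::'a)" for x
      unfolding qsign_def gr_m
      by (cases "gr a"; cases "gr b"; cases "gr c"; cases "gr l"; simp add: gsign_def)
    have s2: "gsign ((gr a + gr b) * gr l) * (gsign (gr a * gr l) * (gsign ((gr l + gr c) * gr l) * x))
        = qsign b c m l * (x::'a)" for x
      unfolding qsign_def gr_m
      by (cases "gr a"; cases "gr b"; cases "gr c"; cases "gr l"; simp add: gsign_def)
    show ?thesis
      by (simp only: mult.assoc[of _ "A l"] AD BC right_diff_distrib scaleC_mult_right s1 s2 scaleC.diff_right)
  qed
  then show ?thesis by (simp only: scaleC.sum_right[symmetric] scaleC_scaleC)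
qed

end

text \<open>By \<open>quad_algebra\<close> and \<open>brk_algebra\<close> the integrand is
  \<open>- g / (\<zeta> - \<mu>)\<close> times the derivative of the quadrilinear sum
  \<open>Q\<close>. At + infinity the rows become unit rows and leave a product of two column
  components; at - infinity the columns become unit columns and leave a product of two row
  components. The limits of these products are hypotheses because they exist for different reasons:
  convergence inside a block, or decay outside it.\<close>

lemma bracket_integral:
  fixes \<phi> :: "'a::banach_superalgebra config"
  assumes \<phi>: "\<phi> \<in> fields M N" and abcd: "a \<in> I" "b \<in> I" "c \<in> I" "d \<in> I"
    and s: "sg a = sg b" "sg c = sg d" and good: "good \<zeta> a" "good \<mu> c" and ne: "\<zeta> \<noteq> \<mu>"
    and top: "((\<lambda>x. jcol \<zeta> b \<phi> x c * jcol \<mu> d \<phi> x a) \<longlongrightarrow> u) at_top"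
    and bot: "((\<lambda>x. jrow \<zeta> a \<phi> x d * jrow \<mu> c \<phi> x b) \<longlongrightarrow> v) at_bot"
  shows "(brk (gr a + gr b) (gradA \<zeta> a b \<phi> \<phi>) (gradB \<zeta> a b \<phi> \<phi>) (gradA \<mu> c d \<phi> \<phi>) (gradB \<mu> c d \<phi> \<phi>)
    has_integral - (complex_of_real g / (\<zeta> - \<mu>)) *\<^sub>C (qsign b c a c * u - qsign b c d b * v)) UNIV"
proof -
  define R L R' L' where "R = jrow \<zeta> a \<phi>" and "L = jcol \<zeta> b \<phi>" and "R' = jrow \<mu> c \<phi>" and "L' = jcol \<mu> d \<phi>"
  note defs = R_def L_def R'_def L'_def
  have goodb: "good \<zeta> b" and goodd: "good \<mu> d" using good good_same[OF s(1), of \<zeta>] good_same[OF s(2), of \<mu>] by simp_all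
  define Q where "Q x = (\<Sum>e\<in>I. \<Sum>f\<in>I. qsign b c e f * (R x e * L x f * R' x f * L' x e))" for x
  let ?P = "brk (gr a + gr b) (gradA \<zeta> a b \<phi> \<phi>) (gradB \<zeta> a b \<phi> \<phi>) (gradA \<mu> c d \<phi> \<phi>) (gradB \<mu> c d \<phi> \<phi>)"
  have hom: "e \<in> I \<Longrightarrow> R x e \<in> homog (gr e + gr a)" "e \<in> I \<Longrightarrow> L x e \<in> homog (gr e + gr b)"
    "e \<in> I \<Longrightarrow> R' x e \<in> homog (gr e + gr c)" "e \<in> I \<Longrightarrow> L' x e \<in> homog (gr e + gr d)" for x e
    unfolding defs by (rule jrow_homog[OF \<phi> good(1) abcd(1)] jcol_homog[OF \<phi> goodb abcd(2)]
        jrow_homog[OF \<phi> good(2) abcd(3)] jcol_homog[OF \<phi> goodd abcd(4)]; assumption)+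
  define S where "S x = (\<Sum>l\<in>K. qsign b c m l * (R x m * L x l * R' x l * L' x m) - qsign b c l m * (R x l * L x m * R' x m * L' x l))" for x
  have Qd: "(Q has_vector_derivative (\<i> * (\<zeta> - \<mu>)) *\<^sub>C S x) (at x)" for x
    unfolding Q_def[abs_def] S_def
    by (rule has_vector_derivative_eq_rhs[OF _ quad_algebra[OF hom[of _ x] Om_homog[OF \<phi>, of x] s]])
      (unfold defs, intro has_vector_derivative_sum has_vector_derivative_mult_right has_vector_derivative_mult
        jrow_deriv[OF \<phi> good(1) abcd(1)] jcol_deriv[OF \<phi> goodb abcd(2)]
        jrow_deriv[OF \<phi> good(2) abcd(3)] jcol_deriv[OF \<phi> goodd abcd(4)])
  have PS: "?P x = (\<i> * complex_of_real g) *\<^sub>C (- S x)" for x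
    unfolding brk_def gradA_def gradB_def defs[symmetric]
    unfolding S_def sum_negf[symmetric] minus_diff_eq
    by (rule brk_algebra[OF hom[of _ x] Om_homog[OF \<phi>, of x]])
  have PQ: "?P x = - (complex_of_real g / (\<zeta> - \<mu>)) *\<^sub>C ((\<i> * (\<zeta> - \<mu>)) *\<^sub>C S x)" for x
    unfolding PS scaleC_scaleC scaleC.minus_right scaleC.minus_left[symmetric] using ne
    by (intro arg_cong[where f = "\<lambda>z. z *\<^sub>C S x"]) (simp add: field_simps)
  obtain G1 where G1: "\<And>x e. e \<in> I \<Longrightarrow> norm (R x e) \<le> G1"
    unfolding defs using jrow_bdd[OF \<phi> good(1) abcd(1)] by blast
  obtain G2 where G2: "\<And>x e. e \<in> I \<Longrightarrow> norm (L x e) \<le> G2"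
    unfolding defs using jcol_bdd[OF \<phi> goodb abcd(2)] by blast
  obtain G3 where G3: "\<And>x e. e \<in> I \<Longrightarrow> norm (R' x e) \<le> G3"
    unfolding defs using jrow_bdd[OF \<phi> good(2) abcd(3)] by blast
  obtain G4 where G4: "\<And>x e. e \<in> I \<Longrightarrow> norm (L' x e) \<le> G4"
    unfolding defs using jcol_bdd[OF \<phi> goodd abcd(4)] by blast
  have fin: "finite I" by simp
  have lim: "e \<in> I \<Longrightarrow> ((\<lambda>x. R x e - mone e a) \<longlongrightarrow> 0) at_top"
    "e \<in> I \<Longrightarrow> ((\<lambda>x. R' x e - mone e c) \<longlongrightarrow> 0) at_top"
    "e \<in> I \<Longrightarrow> ((\<lambda>x. L x e - mone e b) \<longlongrightarrow> 0) at_bot"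
    "e \<in> I \<Longrightarrow> ((\<lambda>x. L' x e - mone e d) \<longlongrightarrow> 0) at_bot" for e
    unfolding defs
    by (rule LIM_zero[OF jrow_top[OF \<phi> good(1) abcd(1)]] LIM_zero[OF jrow_top[OF \<phi> good(2) abcd(3)]]
      LIM_zero[OF jcol_bot[OF \<phi> goodb abcd(2)]] LIM_zero[OF jcol_bot[OF \<phi> goodd abcd(4)]]; assumption)+
  \<comment> \<open>The columns are only bounded here in general, so just the rows are replaced by
    their limits.\<close>
  have "((\<lambda>x. \<Sum>e\<in>I. \<Sum>f\<in>I. qsign b c e f * ((R x e - mone e a) * (L x f * R' x f * L' x e)
      + (mone e a * L x f) * ((R' x f - mone f c) * L' x e))) \<longlongrightarrow> (\<Sum>e\<in>I. \<Sum>f\<in>I. qsign b c e f * (0 + 0))) at_top"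
  proof (intro tendsto_sum tendsto_mult tendsto_const tendsto_add)
    fix e f assume ef: "e \<in> I" "f \<in> I"
    show "((\<lambda>x. (R x e - mone e a) * (L x f * R' x f * L' x e)) \<longlongrightarrow> 0) at_top"
      by (rule tendsto_mult_bounded_right[OF lim(1)[OF ef(1)], where G = "G2 * G3 * G4"])
        (intro norm_mult_le G2 G3 G4 ef)
    show "((\<lambda>x. (mone e a * L x f) * ((R' x f - mone f c) * L' x e)) \<longlongrightarrow> 0) at_top"
      by (rule tendsto_mult_bounded_left[OF tendsto_mult_bounded_right[OF lim(2)[OF ef(2)] G4[OF ef(1)]],
            where G = "1 * G2"]) (intro norm_mult_le norm_mone_le G2 ef)
  qed
  moreover have "(\<Sum>e\<in>I. \<Sum>f\<in>I. qsign b c e f * ((R x e - mone e a) * (L x f * R' x f * L' x e)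
      + (mone e a * L x f) * ((R' x f - mone f c) * L' x e))) = Q x - qsign b c a c * (L x c * L' x a)" for x
  proof -
    have "(\<Sum>e\<in>I. \<Sum>f\<in>I. qsign b c e f * (mone e a * L x f * mone f c * L' x e))
        = (\<Sum>e\<in>I. mone e a * (\<Sum>f\<in>I. mone f c * (qsign b c e f * (L x f * L' x e))))"
      unfolding sum_distrib_left by (intro sum.cong refl) (auto simp: mone_def)
    also have "\<dots> = qsign b c a c * (L x c * L' x a)"
      by (simp only: sum_mone[OF fin abcd(1)] sum_mone[OF fin abcd(3)])
    finally show ?thesis unfolding Q_def quad_diff by (simp only: right_diff_distrib sum_subtractf)
  qed
  ultimately have Qtop: "((\<lambda>x. Q x - qsign b c a c * (L x c * L' x a)) \<longlongrightarrow> 0) at_top" by simp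
  have "((\<lambda>x. \<Sum>e\<in>I. \<Sum>f\<in>I. qsign b c e f * (R x e * (L x f - mone f b) * (R' x f * L' x e)
      + (R x e * mone f b * R' x f) * (L' x e - mone e d))) \<longlongrightarrow> (\<Sum>e\<in>I. \<Sum>f\<in>I. qsign b c e f * (0 + 0))) at_bot"
  proof (intro tendsto_sum tendsto_mult[OF tendsto_const] tendsto_add)
    fix e f assume ef: "e \<in> I" "f \<in> I"
    show "((\<lambda>x. R x e * (L x f - mone f b) * (R' x f * L' x e)) \<longlongrightarrow> 0) at_bot"
      by (rule tendsto_mult_bounded_right[OF tendsto_mult_bounded_left[OF lim(3)[OF ef(2)] G1[OF ef(1)]],
            where G = "G3 * G4"]) (intro norm_mult_le G3 G4 ef)
    show "((\<lambda>x. (R x e * mone f b * R' x f) * (L' x e - mone e d)) \<longlongrightarrow> 0) at_bot"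
      by (rule tendsto_mult_bounded_left[OF lim(4)[OF ef(1)], where G = "G1 * 1 * G3"])
        (intro norm_mult_le norm_mone_le G1 G3 ef)
  qed
  moreover have "(\<Sum>e\<in>I. \<Sum>f\<in>I. qsign b c e f * (R x e * (L x f - mone f b) * (R' x f * L' x e)
      + (R x e * mone f b * R' x f) * (L' x e - mone e d))) = Q x - qsign b c d b * (R x d * R' x b)" for x
  proof -
    have "(\<Sum>e\<in>I. \<Sum>f\<in>I. qsign b c e f * (R x e * mone f b * R' x f * mone e d))
        = (\<Sum>e\<in>I. mone e d * (\<Sum>f\<in>I. mone f b * (qsign b c e f * (R x e * R' x f))))"
      unfolding sum_distrib_left by (intro sum.cong refl) (auto simp: mone_def)
    also have "\<dots> = qsign b c d b * (R x d * R' x b)"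
      by (simp only: sum_mone[OF fin abcd(4)] sum_mone[OF fin abcd(2)])
    finally show ?thesis unfolding Q_def quad_diff by (simp only: right_diff_distrib sum_subtractf)
  qed
  ultimately have Qbot: "((\<lambda>x. Q x - qsign b c d b * (R x d * R' x b)) \<longlongrightarrow> 0) at_bot" by simp
  have "(Q \<longlongrightarrow> qsign b c a c * u) at_top"
    using tendsto_add[OF Qtop tendsto_mult[OF tendsto_const[of "qsign b c a c"] top[folded defs]]] by simp
  moreover have "(Q \<longlongrightarrow> qsign b c d b * v) at_bot"
    using tendsto_add[OF Qbot tendsto_mult[OF tendsto_const[of "qsign b c d b"] bot[folded defs]]] by simp
  ultimately have "((\<lambda>x. (\<i> * (\<zeta> - \<mu>)) *\<^sub>C S x) has_integral (qsign b c a c * u - qsign b c d b * v)) UNIV"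
    by (rule has_integral_FTC_UNIV[OF Qd])
  from has_integral_linear[OF this scaleC.bounded_linear_right[of "- (complex_of_real g / (\<zeta> - \<mu>))"]]
  show ?thesis by (simp only: o_def PQ[symmetric])
qed

text \<open>At equal spectral parameters there is no \<zeta> - \<mu> to divide by. The gradients
  with respect to field \<open>l\<close> have grade \<open>gr l\<close>, and graded commutativity
  makes the two terms of the integrand equal at each point.\<close>

lemma brk_antisymmetric:
  fixes \<phi> :: "'a::banach_superalgebra config"
  assumes \<phi>: "\<phi> \<in> fields M N" and good: "good \<zeta> m"
  shows "brk 0 (gradA \<zeta> m m \<phi> \<phi>) (gradB \<zeta> m m \<phi> \<phi>) (gradA \<zeta> m m \<phi> \<phi>) (gradB \<zeta> m m \<phi> \<phi>) x = 0"
proof -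
  have "gsign (gr l) * gradA \<zeta> m m \<phi> \<phi> l x * gradB \<zeta> m m \<phi> \<phi> l x = gradB \<zeta> m m \<phi> \<phi> l x * gradA \<zeta> m m \<phi> \<phi> l x"
    if l: "l \<in> K" for l
  proof -
    have "gradA \<zeta> m m \<phi> \<phi> l x \<in> homog (gr l)"
      unfolding gradA_def by (intro homog_scaleC gsign_homog
          homog_mult'[OF jrow_homog[OF \<phi> good m_in K_I[OF l]] jcol_homog[OF \<phi> good m_in m_in]]) (simp only: gr_m add_0_right)
    moreover have "gradB \<zeta> m m \<phi> \<phi> l x \<in> homog (gr l)"
      unfolding gradB_def by (intro homog_minus homog_scaleC gsign_homog
          homog_mult'[OF jrow_homog[OF \<phi> good m_in m_in] jcol_homog[OF \<phi> good m_in K_I[OF l]]])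
        (simp only: gr_m add_0_right add_0_left)
    ultimately have "gradB \<zeta> m m \<phi> \<phi> l x * gradA \<zeta> m m \<phi> \<phi> l x
        = gsign (gr l * gr l) * (gradA \<zeta> m m \<phi> \<phi> l x * gradB \<zeta> m m \<phi> \<phi> l x)"
      by (rule gsign_commute_homog[rotated])
    then show ?thesis by (cases "gr l") (simp_all add: gsign_def)
  qed
  then show ?thesis unfolding brk_def by (simp add: scaleC.zero_right)
qed

text \<open>The identification of \<open>t_mat\<close> and \<open>D_fun\<close> with
  \<open>Tm\<close> holds on \<open>fields\<close> only; that is enough because a variation stays in
  \<open>fields\<close>.\<close>

lemma is_gradient_cong:
  assumes "\<phi> \<in> fields M N" and "\<And>\<psi>. \<psi> \<in> fields M N \<Longrightarrow> F \<psi> = G \<psi>" and "is_gradient M N G \<phi> A B"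
  shows "is_gradient M N F \<phi> A B"
proof -
  have "F (\<lambda>j x. \<phi> j x + \<epsilon> *\<^sub>R h j x) = G (\<lambda>j x. \<phi> j x + \<epsilon> *\<^sub>R h j x)" if "h \<in> fields M N" for h \<epsilon>
    using assms(2)[OF shift_fields[OF assms(1) that, of \<epsilon>]] by (simp add: shift_cfg_def)
  then show ?thesis using assms(3) unfolding is_gradient_def by simp
qed

lemma has_poissonI:
  assumes "\<And>\<psi>. \<psi> \<in> fields M N \<Longrightarrow> F \<psi> \<in> homog p"
    and "is_gradient M N F \<phi> A B" "is_gradient M N G \<phi> C D" "(brk p A B C D has_integral v) UNIV"
  shows "has_poisson M N p F G \<phi> v"
  unfolding has_poisson_def using assms by (auto simp: brk_def[abs_def])

section \<open>The permutation operator and graded tensor products\<close>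

lemma finite_K: "finite K" by simp

lemma P12_eq: "a \<in> K \<Longrightarrow> e \<in> K \<Longrightarrow>
  P12 M N a e c f = (if a = f \<and> e = c then gsign (gr e) else (0::'a::ring_1))"
proof -
  assume *: "a \<in> K" "e \<in> K"
  have "P12 M N a e c f = (\<Sum>j\<in>K. gsign (gr j) * elem_mat a j a e * elem_mat j a c f :: 'a)"
    unfolding P12_def by (rule sum_eq_single[OF finite_K *(1)]) (auto simp: elem_mat_def)
  also have "\<dots> = gsign (gr e) * elem_mat a e a e * elem_mat e a c f"
    by (rule sum_eq_single[OF finite_K *(2)]) (auto simp: elem_mat_def)
  finally show ?thesis by (auto simp: elem_mat_def)
qed

text \<open>In the only surviving term the second factor contributes the identity in the first slot,
  and moving an elementary matrix past it gives no sign.\<close>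

lemma tensor_mat_eq:
  fixes U V :: "nat \<Rightarrow> nat \<Rightarrow> 'a::ring_1"
  assumes "b \<in> K" "c \<in> K"
  shows "tensor_mat M N U V a b c d = U a b * V c d"
proof -
  have "tensor_mat M N U V a b c d
      = (\<Sum>f\<in>K. gsign ((gr c + gr f) * (gr b + gr b)) * (U a b * mone c f) * (mone b b * V f d))"
    unfolding tensor_mat_def tmul_def leg1_def leg2_def
    by (rule sum_eq_single[OF finite_K assms(1)]) (simp add: mone_def)
  also have "\<dots> = gsign ((gr c + gr c) * (gr b + gr b)) * (U a b * mone c c) * (mone b b * V c d)"
    by (rule sum_eq_single[OF finite_K assms(2)]) (simp add: mone_def)
  finally show ?thesis by (simp add: mone_def gsign_def)
qed

text \<open>The signs of P and of the graded tensor product combine to \<open>qsign\<close> at the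
  two index pairs that survive at the ends of the line; this is how the commutator arises from
  boundary terms.\<close>

lemma tcomm_P12_eq:
  fixes U V :: "nat \<Rightarrow> nat \<Rightarrow> 'a::banach_superalgebra"
  assumes "a \<in> K" "b \<in> K" "c \<in> K" "d \<in> K"
  shows "tcomm M N (P12 M N) (tensor_mat M N U V) a b c d
    = qsign b c a c * (U c b * V a d) - qsign b c d b * (U a d * V c b)"
proof -
  let ?X = "tensor_mat M N U V"
  have "tmul M N (P12 M N) ?X a b c d
      = (\<Sum>f\<in>K. gsign ((gr c + gr f) * (gr c + gr b)) * P12 M N a c c f * ?X c b f d)"
    unfolding tmul_def by (rule sum_eq_single[OF finite_K assms(3)]) (simp add: P12_eq[OF assms(1)] del: One_nat_def)
  also have "\<dots> = gsign ((gr c + gr a) * (gr c + gr b)) * P12 M N a c c a * ?X c b a d"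
    by (rule sum_eq_single[OF finite_K assms(1)]) (simp add: P12_eq[OF assms(1,3)])
  also have "\<dots> = (gsign ((gr c + gr a) * (gr c + gr b)) * gsign (gr c)) * (U c b * V a d)"
    by (simp only: P12_eq[OF assms(1,3)] tensor_mat_eq[OF assms(2,1)] simp_thms if_True)
  also have "gsign ((gr c + gr a) * (gr c + gr b)) * gsign (gr c) = (qsign b c a c :: 'a)"
    unfolding qsign_def gsign_mult by (simp only: add.commute)
  finally have 1: "tmul M N (P12 M N) ?X a b c d = qsign b c a c * (U c b * V a d)" .
  have "tmul M N ?X (P12 M N) a b c d
      = (\<Sum>f\<in>K. gsign ((gr c + gr f) * (gr d + gr b)) * ?X a d c f * P12 M N d b f d)"
    unfolding tmul_def by (rule sum_eq_single[OF finite_K assms(4)])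
      (intro sum.neutral ballI, simp add: P12_eq[OF _ assms(2)] del: One_nat_def)
  also have "\<dots> = gsign ((gr c + gr b) * (gr d + gr b)) * ?X a d c b * P12 M N d b b d"
    by (rule sum_eq_single[OF finite_K assms(2)]) (simp add: P12_eq[OF assms(4,2)])
  also have "\<dots> = gsign ((gr c + gr b) * (gr d + gr b)) * (gsign (gr b) * (U a d * V c b))"
    by (simp only: P12_eq[OF assms(4,2)] tensor_mat_eq[OF assms(4,3)] simp_thms if_True mult.assoc
        gsign_commute[of "gr b"])
  also have "\<dots> = qsign b c d b * (U a d * V c b)"
    unfolding mult.assoc[symmetric, of "gsign _" "gsign _"] gsign_mult qsign_def by (simp only: add.commute mult.commute)
  finally show ?thesis unfolding tcomm_def 1 by simp
qed

section \<open>The brackets of t and D\<close>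

context
  fixes \<phi> :: "'a::banach_superalgebra config"
  assumes \<phi>: "\<phi> \<in> fields M N"
begin

lemma t_mat_eq: "Im \<zeta> \<le> 0 \<Longrightarrow> a \<in> K \<Longrightarrow> b \<in> K \<Longrightarrow> \<psi> \<in> fields M N \<Longrightarrow> t_mat M N g \<zeta> \<psi> a b = Tm \<zeta> a b \<psi>"
  unfolding t_mat_def using monodromy_eq_Tm(2)[of \<psi> \<zeta> b a] sg_K[of a] sg_K[of b] K_ne_m[of b]
  by (simp add: good_def)

lemma D_fun_eq: "0 \<le> Im \<zeta> \<Longrightarrow> \<psi> \<in> fields M N \<Longrightarrow> D_fun M N g \<zeta> \<psi> = Tm \<zeta> m m \<psi>"
  unfolding D_fun_def by (rule monodromy_eq_Tm(2)) (auto simp: good_def)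

lemma t_gradient: "Im \<zeta> \<le> 0 \<Longrightarrow> a \<in> K \<Longrightarrow> b \<in> K \<Longrightarrow>
    is_gradient M N (\<lambda>\<psi>. t_mat M N g \<zeta> \<psi> a b) \<phi> (gradA \<zeta> a b \<phi> \<phi>) (gradB \<zeta> a b \<phi> \<phi>)"
  by (rule is_gradient_cong[OF \<phi> t_mat_eq Tm_gradient[OF \<phi>]]) (auto simp: sg_def good_def)

lemma D_gradient: "0 \<le> Im \<zeta> \<Longrightarrow>
    is_gradient M N (D_fun M N g \<zeta>) \<phi> (gradA \<zeta> m m \<phi> \<phi>) (gradB \<zeta> m m \<phi> \<phi>)"
  by (rule is_gradient_cong[OF \<phi> D_fun_eq Tm_gradient[OF \<phi>]]) (auto simp: good_def)

lemma D_homog: "0 \<le> Im \<zeta> \<Longrightarrow> \<psi> \<in> fields M N \<Longrightarrow> D_fun M N g \<zeta> (\<psi> :: 'a config) \<in> homog 0"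
  using Tm_homog[of \<psi> \<zeta> m m] by (simp only: D_fun_eq) (simp add: good_def)

text \<open>All indices lie in one block, so the columns at + infinity and the rows at - infinity
  converge to entries of t.\<close>

lemma poisson_t_t:
  assumes im: "Im \<zeta> \<le> 0" "Im \<mu> \<le> 0" "\<zeta> \<noteq> \<mu>"
  shows "has_poisson_mat M N (t_mat M N g \<zeta>) (t_mat M N g \<mu>) \<phi>
          (\<lambda>a b c d. - (complex_of_real g / (\<zeta> - \<mu>)) *\<^sub>C
             tcomm M N (P12 M N) (tensor_mat M N (t_mat M N g \<zeta> \<phi>) (t_mat M N g \<mu> \<phi>)) a b c d)"
  unfolding has_poisson_mat_def
proof (intro ballI)
  fix a b c d assume K: "a \<in> K" "b \<in> K" "c \<in> K" "d \<in> K"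
  note I = K[THEN K_I]
  have sg: "sg i = sg j" if "i \<in> K" "j \<in> K" for i j using that by (simp only: sg_K)
  have good: "good \<zeta> i" "good \<mu> i" if "i \<in> K" for i using that im by (auto simp: good_def)
  have br: "(brk (gr a + gr b) (gradA \<zeta> a b \<phi> \<phi>) (gradB \<zeta> a b \<phi> \<phi>) (gradA \<mu> c d \<phi> \<phi>) (gradB \<mu> c d \<phi> \<phi>)
    has_integral - (complex_of_real g / (\<zeta> - \<mu>)) *\<^sub>C (qsign b c a c * (Tm \<zeta> c b \<phi> * Tm \<mu> a d \<phi>)
      - qsign b c d b * (Tm \<zeta> a d \<phi> * Tm \<mu> c b \<phi>))) UNIV"
    by (intro bracket_integral[OF \<phi> I sg[OF K(1,2)] sg[OF K(3,4)] good(1)[OF K(1)] good(2)[OF K(3)] im(3)]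
        tendsto_mult jcol_Tm jrow_Tm \<phi> I sg K good)
  have "has_poisson M N (gr a + gr b) (\<lambda>\<psi>. t_mat M N g \<zeta> \<psi> a b) (\<lambda>\<psi>. t_mat M N g \<mu> \<psi> c d) \<phi>
     (- (complex_of_real g / (\<zeta> - \<mu>)) *\<^sub>C (qsign b c a c * (Tm \<zeta> c b \<phi> * Tm \<mu> a d \<phi>)
      - qsign b c d b * (Tm \<zeta> a d \<phi> * Tm \<mu> c b \<phi>)))"
  proof (rule has_poissonI[OF _ t_gradient[OF im(1) K(1,2)] t_gradient[OF im(2) K(3,4)] br])
    fix \<psi> :: "'a config" assume \<psi>: "\<psi> \<in> fields M N"
    show "t_mat M N g \<zeta> \<psi> a b \<in> homog (gr a + gr b)"
      unfolding t_mat_eq[OF im(1) K(1,2) \<psi>] by (rule Tm_homog[OF \<psi> good(1)[OF K(2)] I(2,1) sg[OF K(1,2)]])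
  qed
  then show "has_poisson M N (gr a + gr b) (\<lambda>\<psi>. t_mat M N g \<zeta> \<psi> a b) (\<lambda>\<psi>. t_mat M N g \<mu> \<psi> c d) \<phi>
     (- (complex_of_real g / (\<zeta> - \<mu>)) *\<^sub>C
             tcomm M N (P12 M N) (tensor_mat M N (t_mat M N g \<zeta> \<phi>) (t_mat M N g \<mu> \<phi>)) a b c d)"
    unfolding tcomm_P12_eq[OF K] t_mat_eq[OF im(1) K(3,2) \<phi>] t_mat_eq[OF im(2) K(1,4) \<phi>]
      t_mat_eq[OF im(1) K(1,4) \<phi>] t_mat_eq[OF im(2) K(3,2) \<phi>] .
qed

text \<open>For distinct parameters the two boundary terms coincide, since all four indices are
  \<open>m\<close>; equal parameters are covered by antisymmetry.\<close>

lemma brk_D_D: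
  assumes im: "0 \<le> Im \<zeta>" "0 \<le> Im \<mu>"
  shows "(brk 0 (gradA \<zeta> m m \<phi> \<phi>) (gradB \<zeta> m m \<phi> \<phi>) (gradA \<mu> m m \<phi> \<phi>) (gradB \<mu> m m \<phi> \<phi>)
    has_integral 0) UNIV"
proof (cases "\<zeta> = \<mu>")
  case True
  have "good \<mu> m" using im by (simp add: good_def)
  from brk_antisymmetric[OF \<phi> this] show ?thesis unfolding True by (simp add: has_integral_is_0)
next
  case False
  have good: "good \<zeta> m" "good \<mu> m" using im by (auto simp: good_def)
  have "(brk (gr m + gr m) (gradA \<zeta> m m \<phi> \<phi>) (gradB \<zeta> m m \<phi> \<phi>) (gradA \<mu> m m \<phi> \<phi>) (gradB \<mu> m m \<phi> \<phi>)
    has_integral - (complex_of_real g / (\<zeta> - \<mu>)) *\<^sub>C (qsign m m m m * (Tm \<zeta> m m \<phi> * Tm \<mu> m m \<phi>)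
      - qsign m m m m * (Tm \<zeta> m m \<phi> * Tm \<mu> m m \<phi>))) UNIV"
    by (intro bracket_integral[OF \<phi> m_in m_in m_in m_in refl refl good False]
        tendsto_mult jcol_Tm jrow_Tm \<phi> m_in refl good)
  then show ?thesis by (simp only: gr_m add_0_left diff_self scaleC.zero_right)
qed

text \<open>Each boundary product pairs a component from the solution for D with one from the
  solution for t, both outside their own block. Both are bounded, and the one whose parameter is off
  the real axis decays; \<open>Im \<mu> < Im \<zeta>\<close> provides such a parameter.\<close>

lemma brk_D_t:
  assumes im: "0 \<le> Im \<zeta>" "Im \<mu> \<le> 0" "Im \<mu> < Im \<zeta>" and K: "a \<in> K" "b \<in> K"
  shows "(brk 0 (gradA \<zeta> m m \<phi> \<phi>) (gradB \<zeta> m m \<phi> \<phi>) (gradA \<mu> a b \<phi> \<phi>) (gradB \<mu> a b \<phi> \<phi>)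
    has_integral 0) UNIV"
proof -
  note I = K[THEN K_I]
  have ne: "\<zeta> \<noteq> \<mu>" using im by auto
  have sg: "sg a = sg b" "sg a \<noteq> sg m" "sg b \<noteq> sg m" "sg m \<noteq> sg a" "sg m \<noteq> sg b"
    using K by (simp_all add: sg_K sg_m del: One_nat_def)
  have good: "good \<zeta> m" "good \<mu> a" "good \<mu> b" using im K by (auto simp: good_def)
  obtain G1 where G1: "\<And>x e. e \<in> I \<Longrightarrow> norm (jcol \<zeta> m \<phi> x e) \<le> G1" using jcol_bdd[OF \<phi> good(1) m_in] by blast
  obtain G2 where G2: "\<And>x e. e \<in> I \<Longrightarrow> norm (jcol \<mu> b \<phi> x e) \<le> G2" using jcol_bdd[OF \<phi> good(3) I(2)] by blast
  obtain G3 where G3: "\<And>x e. e \<in> I \<Longrightarrow> norm (jrow \<zeta> m \<phi> x e) \<le> G3" using jrow_bdd[OF \<phi> good(1) m_in] by blast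
  obtain G4 where G4: "\<And>x e. e \<in> I \<Longrightarrow> norm (jrow \<mu> a \<phi> x e) \<le> G4" using jrow_bdd[OF \<phi> good(2) I(1)] by blast
  have im': "Im \<zeta> \<noteq> 0 \<or> Im \<mu> \<noteq> 0" using im by auto
  have top: "((\<lambda>x. jcol \<zeta> m \<phi> x a * jcol \<mu> b \<phi> x m) \<longlongrightarrow> 0) at_top"
    using im'
  proof
    assume "Im \<zeta> \<noteq> 0"
    from tendsto_mult_bounded_right[OF jcol_fast_to_0[OF \<phi> good(1) m_in I(1) sg(2) this] G2[OF m_in]] show ?thesis .
  next
    assume "Im \<mu> \<noteq> 0"
    from tendsto_mult_bounded_left[OF jcol_fast_to_0[OF \<phi> good(3) I(2) m_in sg(5) this] G1[OF I(1)]] show ?thesis .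
  qed
  have bot: "((\<lambda>x. jrow \<zeta> m \<phi> x b * jrow \<mu> a \<phi> x m) \<longlongrightarrow> 0) at_bot"
    using im'
  proof
    assume "Im \<zeta> \<noteq> 0"
    from tendsto_mult_bounded_right[OF jrow_fast_to_0[OF \<phi> good(1) m_in I(2) sg(3) this] G4[OF m_in]] show ?thesis .
  next
    assume "Im \<mu> \<noteq> 0"
    from tendsto_mult_bounded_left[OF jrow_fast_to_0[OF \<phi> good(2) I(1) m_in sg(4) this] G3[OF I(2)]] show ?thesis .
  qed
  from bracket_integral[OF \<phi> m_in m_in I refl sg(1) good(1,2) ne top bot]
  show ?thesis by (simp only: gr_m add_0_left diff_self scaleC.zero_right mult_zero_right)
qed

lemma poisson_D_D:
  assumes im: "0 \<le> Im \<zeta>" "0 \<le> Im \<mu>"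
  shows "has_poisson M N 0 (D_fun M N g \<zeta>) (D_fun M N g \<mu>) \<phi> 0"
  by (rule has_poissonI[OF D_homog[OF im(1)] D_gradient[OF im(1)] D_gradient[OF im(2)] brk_D_D[OF im]])

lemma poisson_D_t:
  assumes im: "0 \<le> Im \<zeta>" "Im \<mu> \<le> 0" "Im \<mu> < Im \<zeta>" and K: "a \<in> K" "b \<in> K"
  shows "has_poisson M N 0 (D_fun M N g \<zeta>) (\<lambda>\<psi>. t_mat M N g \<mu> \<psi> a b) \<phi> 0"
  by (rule has_poissonI[OF D_homog[OF im(1)] D_gradient[OF im(1)] t_gradient[OF im(2) K] brk_D_t[OF im K]])

end

end

section \<open>Smooth families of functions on the line\<close>

text \<open>The coefficients of \<open>D\<close> are integrals of differential polynomials of unbounded order, so that their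
  dependence on the parameter of a variation \<open>\<phi> + \<epsilon> h\<close> has to be controlled together with all
  \<open>x\<close>-derivatives; Lipschitz bounds at \<open>\<epsilon> = 0\<close> suffice.\<close>
definition fam_bd :: "(real \<Rightarrow> real) \<Rightarrow> (real \<Rightarrow> real \<Rightarrow> 'a::real_normed_vector) \<Rightarrow> bool" where
  "fam_bd \<omega> F \<longleftrightarrow> (\<exists>B\<ge>0. \<forall>\<epsilon> x. \<bar>\<epsilon>\<bar> \<le> 1 \<longrightarrow>
     norm (F \<epsilon> x) \<le> B * \<omega> x \<and> norm (F \<epsilon> x - F 0 x) \<le> B * \<bar>\<epsilon>\<bar> * \<omega> x)"

definition fam_deriv :: "(real \<Rightarrow> real \<Rightarrow> 'a::real_normed_vector) \<Rightarrow> (real \<Rightarrow> real \<Rightarrow> 'a) \<Rightarrow> bool" where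
  "fam_deriv F F' \<longleftrightarrow> (\<forall>\<epsilon> x. \<bar>\<epsilon>\<bar> \<le> 1 \<longrightarrow> (F \<epsilon> has_vector_derivative F' \<epsilon> x) (at x))"

definition smooth_fam :: "(real \<Rightarrow> real) \<Rightarrow> (real \<Rightarrow> real \<Rightarrow> 'a::real_normed_vector) \<Rightarrow> bool" where
  "smooth_fam \<omega> F \<longleftrightarrow> (\<exists>d. d 0 = F \<and> (\<forall>n. fam_deriv (d n) (d (Suc n))) \<and> (\<forall>n. fam_bd \<omega> (d n)))"

lemma fam_bdE:
  assumes "fam_bd \<omega> F"
  obtains B where "B \<ge> 0" "\<And>\<epsilon> x. \<bar>\<epsilon>\<bar> \<le> 1 \<Longrightarrow> norm (F \<epsilon> x) \<le> B * \<omega> x"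
    "\<And>\<epsilon> x. \<bar>\<epsilon>\<bar> \<le> 1 \<Longrightarrow> norm (F \<epsilon> x - F 0 x) \<le> B * \<bar>\<epsilon>\<bar> * \<omega> x"
  using assms unfolding fam_bd_def by blast

lemma fam_bdI:
  assumes "B \<ge> 0" "\<And>\<epsilon> x. \<bar>\<epsilon>\<bar> \<le> 1 \<Longrightarrow> norm (F \<epsilon> x) \<le> B * \<omega> x"
    "\<And>\<epsilon> x. \<bar>\<epsilon>\<bar> \<le> 1 \<Longrightarrow> norm (F \<epsilon> x - F 0 x) \<le> B * \<bar>\<epsilon>\<bar> * \<omega> x"
  shows "fam_bd \<omega> F"
  unfolding fam_bd_def using assms by blast

text \<open>Smoothness is a greatest fixed point: a class of bounded families closed under
  \<open>x\<close>-derivatives consists of smooth ones. The derivatives of all orders come from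
  iterating one choice of derivative.\<close>

lemma smooth_fam_coinduct:
  assumes F: "P F" and step: "\<And>F. P F \<Longrightarrow> fam_bd \<omega> F \<and> (\<exists>F'. P F' \<and> fam_deriv F F')"
  shows "smooth_fam \<omega> F"
proof -
  obtain D where D: "\<And>F. P F \<Longrightarrow> P (D F) \<and> fam_deriv F (D F)" using step by metis
  have P: "P ((D ^^ n) F)" for n by (induction n) (use F D in auto)
  show ?thesis unfolding smooth_fam_def
    by (rule exI[of _ "\<lambda>n. (D ^^ n) F"]) (use P D step in auto)
qed

lemma smooth_fam_bd: "smooth_fam \<omega> F \<Longrightarrow> fam_bd \<omega> F"
  unfolding smooth_fam_def by auto

lemma abs_zero_le_one: "\<bar>0::real\<bar> \<le> 1" by simp

lemma smooth_fam_bd0: "smooth_fam \<omega> F \<Longrightarrow> \<exists>B\<ge>0. \<forall>x. norm (F 0 x) \<le> B * \<omega> x"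
  by (meson smooth_fam_bd fam_bdE abs_zero_le_one)

lemma smooth_fam_deriv: "smooth_fam \<omega> F \<Longrightarrow> \<exists>F'. smooth_fam \<omega> F' \<and> fam_deriv F F'"
proof -
  assume "smooth_fam \<omega> F"
  then obtain d where d: "d 0 = F" "\<And>n. fam_deriv (d n) (d (Suc n))" "\<And>n. fam_bd \<omega> (d n)"
    unfolding smooth_fam_def by blast
  have "smooth_fam \<omega> (d 1)" unfolding smooth_fam_def
    by (rule exI[of _ "\<lambda>n. d (Suc n)"]) (use d in auto)
  then show ?thesis using d(1) d(2)[of 0] by auto
qed

lemma fam_bd_add:
  assumes "fam_bd \<omega> F" "fam_bd \<omega> G" shows "fam_bd \<omega> (\<lambda>\<epsilon> x. F \<epsilon> x + G \<epsilon> x)"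
proof -
  obtain B where B: "B \<ge> 0" "\<And>\<epsilon> x. \<bar>\<epsilon>\<bar> \<le> 1 \<Longrightarrow> norm (F \<epsilon> x) \<le> B * \<omega> x"
    "\<And>\<epsilon> x. \<bar>\<epsilon>\<bar> \<le> 1 \<Longrightarrow> norm (F \<epsilon> x - F 0 x) \<le> B * \<bar>\<epsilon>\<bar> * \<omega> x" using fam_bdE[OF assms(1)] by blast
  obtain C where C: "C \<ge> 0" "\<And>\<epsilon> x. \<bar>\<epsilon>\<bar> \<le> 1 \<Longrightarrow> norm (G \<epsilon> x) \<le> C * \<omega> x"
    "\<And>\<epsilon> x. \<bar>\<epsilon>\<bar> \<le> 1 \<Longrightarrow> norm (G \<epsilon> x - G 0 x) \<le> C * \<bar>\<epsilon>\<bar> * \<omega> x" using fam_bdE[OF assms(2)] by blast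
  show ?thesis
  proof (rule fam_bdI[where B = "B + C"])
    fix \<epsilon> x :: real assume e: "\<bar>\<epsilon>\<bar> \<le> 1"
    show "norm (F \<epsilon> x + G \<epsilon> x) \<le> (B + C) * \<omega> x"
      using norm_triangle_mono[OF B(2)[OF e] C(2)[OF e]] by (simp add: distrib_right)
    have "norm ((F \<epsilon> x - F 0 x) + (G \<epsilon> x - G 0 x)) \<le> (B + C) * \<bar>\<epsilon>\<bar> * \<omega> x"
      using norm_triangle_mono[OF B(3)[OF e] C(3)[OF e]] by (simp add: distrib_right)
    then show "norm (F \<epsilon> x + G \<epsilon> x - (F 0 x + G 0 x)) \<le> (B + C) * \<bar>\<epsilon>\<bar> * \<omega> x" by (simp add: algebra_simps)
  qed (use B C in simp)
qed

lemma smooth_fam_add: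
  assumes "smooth_fam \<omega> F" "smooth_fam \<omega> G" shows "smooth_fam \<omega> (\<lambda>\<epsilon> x. F \<epsilon> x + G \<epsilon> x)"
proof (rule smooth_fam_coinduct[where P = "\<lambda>H. \<exists>F G. smooth_fam \<omega> F \<and> smooth_fam \<omega> G \<and> H = (\<lambda>\<epsilon> x. F \<epsilon> x + G \<epsilon> x)"])
  show "\<exists>F' G'. smooth_fam \<omega> F' \<and> smooth_fam \<omega> G' \<and> (\<lambda>\<epsilon> x. F \<epsilon> x + G \<epsilon> x) = (\<lambda>\<epsilon> x. F' \<epsilon> x + G' \<epsilon> x)"
    using assms by blast
  fix H assume "\<exists>F G. smooth_fam \<omega> F \<and> smooth_fam \<omega> G \<and> H = (\<lambda>\<epsilon> x. F \<epsilon> x + G \<epsilon> x)"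
  then obtain F G where FG: "smooth_fam \<omega> F" "smooth_fam \<omega> G" and H: "H = (\<lambda>\<epsilon> x. F \<epsilon> x + G \<epsilon> x)" by blast
  obtain F' G' where FG': "smooth_fam \<omega> F'" "fam_deriv F F'" "smooth_fam \<omega> G'" "fam_deriv G G'"
    using smooth_fam_deriv[OF FG(1)] smooth_fam_deriv[OF FG(2)] by blast
  have "fam_deriv H (\<lambda>\<epsilon> x. F' \<epsilon> x + G' \<epsilon> x)"
    using FG' unfolding fam_deriv_def H by (auto intro!: has_vector_derivative_add)
  then show "fam_bd \<omega> H \<and> (\<exists>H'. (\<exists>F G. smooth_fam \<omega> F \<and> smooth_fam \<omega> G \<and> H' = (\<lambda>\<epsilon> x. F \<epsilon> x + G \<epsilon> x)) \<and> fam_deriv H H')"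
    using FG' fam_bd_add[OF FG[THEN smooth_fam_bd]] H by blast
qed

lemma smooth_fam_linear:
  assumes L: "bounded_linear L" and "smooth_fam \<omega> F"
  shows "smooth_fam \<omega> (\<lambda>\<epsilon> x. L (F \<epsilon> x))"
proof -
  interpret bounded_linear L by (rule L)
  obtain d where d: "d 0 = F" "\<And>n. fam_deriv (d n) (d (Suc n))" "\<And>n. fam_bd \<omega> (d n)"
    using assms(2) unfolding smooth_fam_def by blast
  obtain k where k: "k \<ge> 0" "\<And>x. norm (L x) \<le> norm x * k" using nonneg_bounded by blast
  have "fam_bd \<omega> (\<lambda>\<epsilon> x. L (d n \<epsilon> x))" for n
  proof -
    obtain B where B: "B \<ge> 0" "\<And>\<epsilon> x. \<bar>\<epsilon>\<bar> \<le> 1 \<Longrightarrow> norm (d n \<epsilon> x) \<le> B * \<omega> x"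
      "\<And>\<epsilon> x. \<bar>\<epsilon>\<bar> \<le> 1 \<Longrightarrow> norm (d n \<epsilon> x - d n 0 x) \<le> B * \<bar>\<epsilon>\<bar> * \<omega> x" using fam_bdE[OF d(3)[of n]] by blast
    show ?thesis
    proof (rule fam_bdI[where B = "B * k"])
      fix \<epsilon> x :: real assume e: "\<bar>\<epsilon>\<bar> \<le> 1"
      show "norm (L (d n \<epsilon> x)) \<le> B * k * \<omega> x"
        using order_trans[OF k(2) mult_right_mono[OF B(2)[OF e] k(1)]] by (simp add: mult_ac)
      show "norm (L (d n \<epsilon> x) - L (d n 0 x)) \<le> B * k * \<bar>\<epsilon>\<bar> * \<omega> x" unfolding diff[symmetric]
        using order_trans[OF k(2) mult_right_mono[OF B(3)[OF e] k(1)]] by (simp add: mult_ac)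
    qed (use B k in simp)
  qed
  moreover have "fam_deriv (\<lambda>\<epsilon> x. L (d n \<epsilon> x)) (\<lambda>\<epsilon> x. L (d (Suc n) \<epsilon> x))" for n
    using d(2)[of n] unfolding fam_deriv_def by (auto intro: has_vector_derivative)
  ultimately show ?thesis unfolding smooth_fam_def
    by (intro exI[of _ "\<lambda>n \<epsilon> x. L (d n \<epsilon> x)"]) (simp add: d(1))
qed

lemma smooth_fam_zero: "(\<And>x. 0 \<le> \<omega> x) \<Longrightarrow> smooth_fam \<omega> (\<lambda>\<epsilon> x. 0)"
  by (rule smooth_fam_coinduct[where P = "\<lambda>F. F = (\<lambda>\<epsilon> x. 0)"])
    (auto simp: fam_deriv_def fam_bd_def intro!: exI[of _ 0])

lemma smooth_fam_const: "smooth_fam (\<lambda>_. 1) (\<lambda>\<epsilon> x. c)"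
proof -
  have "fam_bd (\<lambda>_. 1) (\<lambda>\<epsilon> x. if n = (0::nat) then c else 0)" for n
    by (rule fam_bdI[of "norm c"]) auto
  moreover have "fam_deriv (\<lambda>\<epsilon> x. if n = (0::nat) then c else 0) (\<lambda>\<epsilon> x. if Suc n = 0 then c else 0)" for n
    unfolding fam_deriv_def by simp
  ultimately show ?thesis unfolding smooth_fam_def
    by (intro exI[of _ "\<lambda>n \<epsilon> x. if n = (0::nat) then c else 0"]) simp
qed

lemma smooth_fam_sum:
  assumes "\<And>i. i \<in> J \<Longrightarrow> smooth_fam \<omega> (F i)" and "\<And>x. 0 \<le> \<omega> x"
  shows "smooth_fam \<omega> (\<lambda>\<epsilon> x. \<Sum>i\<in>J. F i \<epsilon> x)"
  using assms(1)
  by (induction J rule: infinite_finite_induct)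
    (auto intro: smooth_fam_zero[OF assms(2)] smooth_fam_add)

inductive product_sum ::
  "('a::real_normed_vector \<Rightarrow> 'a \<Rightarrow> 'a) \<Rightarrow> (real \<Rightarrow> real) \<Rightarrow> (real \<Rightarrow> real \<Rightarrow> 'a) \<Rightarrow> bool" for pr \<omega> where
  base: "smooth_fam \<omega> F \<Longrightarrow> smooth_fam (\<lambda>_. 1) G \<Longrightarrow> product_sum pr \<omega> (\<lambda>\<epsilon> x. pr (F \<epsilon> x) (G \<epsilon> x))"
| add: "product_sum pr \<omega> F \<Longrightarrow> product_sum pr \<omega> G \<Longrightarrow> product_sum pr \<omega> (\<lambda>\<epsilon> x. F \<epsilon> x + G \<epsilon> x)"

text \<open>The sums of products of the given kind are closed under differentiation, so no Leibniz
  formula for higher derivatives is needed.\<close>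
lemma smooth_fam_bilinear:
  fixes pr :: "'a::real_normed_vector \<Rightarrow> 'a \<Rightarrow> 'a"
  assumes pr: "bounded_bilinear pr" and FG: "smooth_fam \<omega> F" "smooth_fam (\<lambda>_. 1) G"
  shows "smooth_fam \<omega> (\<lambda>\<epsilon> x. pr (F \<epsilon> x) (G \<epsilon> x))"
proof (rule smooth_fam_coinduct[where P = "product_sum pr \<omega>"])
  interpret bounded_bilinear pr by (rule pr)
  obtain k where k: "k \<ge> 0" "\<And>a b. norm (pr a b) \<le> norm a * norm b * k" using nonneg_bounded by blast
  fix H assume "product_sum pr \<omega> H"
  then show "fam_bd \<omega> H \<and> (\<exists>H'. product_sum pr \<omega> H' \<and> fam_deriv H H')"
  proof (induction rule: product_sum.induct)
    case (base F G)
    obtain B where B: "B \<ge> 0" "\<And>\<epsilon> x. \<bar>\<epsilon>\<bar> \<le> 1 \<Longrightarrow> norm (F \<epsilon> x) \<le> B * \<omega> x"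
      "\<And>\<epsilon> x. \<bar>\<epsilon>\<bar> \<le> 1 \<Longrightarrow> norm (F \<epsilon> x - F 0 x) \<le> B * \<bar>\<epsilon>\<bar> * \<omega> x"
      using fam_bdE[OF smooth_fam_bd[OF base(1)]] by blast
    obtain C where C: "C \<ge> 0" "\<And>\<epsilon> x. \<bar>\<epsilon>\<bar> \<le> 1 \<Longrightarrow> norm (G \<epsilon> x) \<le> C * 1"
      "\<And>\<epsilon> x. \<bar>\<epsilon>\<bar> \<le> 1 \<Longrightarrow> norm (G \<epsilon> x - G 0 x) \<le> C * \<bar>\<epsilon>\<bar> * 1"
      using fam_bdE[OF smooth_fam_bd[OF base(2)]] by blast
    have est: "norm (pr a b) \<le> u * v * k" if "norm a \<le> u" "norm b \<le> v" for a b u v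
      by (rule order_trans[OF k(2)]) (intro mult_right_mono mult_mono that k(1) norm_ge_zero order_trans[OF norm_ge_zero that(1)])
    have "fam_bd \<omega> (\<lambda>\<epsilon> x. pr (F \<epsilon> x) (G \<epsilon> x))"
    proof (rule fam_bdI[where B = "2 * (B * C * k)"])
      fix \<epsilon> x :: real assume e: "\<bar>\<epsilon>\<bar> \<le> 1"
      have *: "norm (pr (F \<epsilon> x) (G \<epsilon> x)) \<le> B * \<omega> x * (C * 1) * k" by (rule est[OF B(2)[OF e] C(2)[OF e]])
      moreover have "0 \<le> B * \<omega> x * (C * 1) * k" by (rule order_trans[OF norm_ge_zero *])
      ultimately show "norm (pr (F \<epsilon> x) (G \<epsilon> x)) \<le> 2 * (B * C * k) * \<omega> x" by (simp add: mult_ac)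
      have "pr (F \<epsilon> x) (G \<epsilon> x) - pr (F 0 x) (G 0 x) = pr (F \<epsilon> x - F 0 x) (G \<epsilon> x) + pr (F 0 x) (G \<epsilon> x - G 0 x)"
        by (simp add: diff_left diff_right)
      also have "norm \<dots> \<le> B * \<bar>\<epsilon>\<bar> * \<omega> x * (C * 1) * k + B * \<omega> x * (C * \<bar>\<epsilon>\<bar> * 1) * k"
        by (intro norm_triangle_mono est B C e) auto
      finally show "norm (pr (F \<epsilon> x) (G \<epsilon> x) - pr (F 0 x) (G 0 x)) \<le> 2 * (B * C * k) * \<bar>\<epsilon>\<bar> * \<omega> x"
        by (simp add: mult_ac)
    qed (use B C k in simp)
    moreover obtain F' G' where FG': "smooth_fam \<omega> F'" "fam_deriv F F'" "smooth_fam (\<lambda>_. 1) G'" "fam_deriv G G'"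
      using smooth_fam_deriv[OF base(1)] smooth_fam_deriv[OF base(2)] by blast
    moreover have "fam_deriv (\<lambda>\<epsilon> x. pr (F \<epsilon> x) (G \<epsilon> x)) (\<lambda>\<epsilon> x. pr (F \<epsilon> x) (G' \<epsilon> x) + pr (F' \<epsilon> x) (G \<epsilon> x))"
      using FG' unfolding fam_deriv_def by (auto intro: has_vector_derivative)
    ultimately show ?case using base product_sum.intros by blast
  next
    case (add F G)
    then obtain F' G' where FG': "product_sum pr \<omega> F'" "fam_deriv F F'" "product_sum pr \<omega> G'" "fam_deriv G G'" by blast
    have "fam_deriv (\<lambda>\<epsilon> x. F \<epsilon> x + G \<epsilon> x) (\<lambda>\<epsilon> x. F' \<epsilon> x + G' \<epsilon> x)"
      using FG' unfolding fam_deriv_def by (auto intro!: has_vector_derivative_add)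
    then show ?case using add fam_bd_add FG' product_sum.add by blast
  qed
qed (use FG in \<open>rule product_sum.base\<close>)

lemmas smooth_fam_mult_right = smooth_fam_bilinear[OF bounded_bilinear_mult]

lemma smooth_fam_wt_weaken: "smooth_fam wt1 F \<Longrightarrow> smooth_fam (\<lambda>_. 1) F"
proof -
  have "fam_bd (\<lambda>_. 1) F" if F: "fam_bd wt1 F" for F :: "real \<Rightarrow> real \<Rightarrow> 'a"
  proof -
    obtain B where B: "B \<ge> 0" "\<And>\<epsilon> x. \<bar>\<epsilon>\<bar> \<le> 1 \<Longrightarrow> norm (F \<epsilon> x) \<le> B * wt1 x"
      "\<And>\<epsilon> x. \<bar>\<epsilon>\<bar> \<le> 1 \<Longrightarrow> norm (F \<epsilon> x - F 0 x) \<le> B * \<bar>\<epsilon>\<bar> * wt1 x" using fam_bdE[OF F] by blast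
    show ?thesis
    proof (rule fam_bdI[OF B(1)])
      fix \<epsilon> x :: real assume e: "\<bar>\<epsilon>\<bar> \<le> 1"
      show "norm (F \<epsilon> x) \<le> B * 1" by (rule order_trans[OF B(2)[OF e]]) (intro mult_left_mono wt_le_1 B)
      show "norm (F \<epsilon> x - F 0 x) \<le> B * \<bar>\<epsilon>\<bar> * 1"
        by (rule order_trans[OF B(3)[OF e]]) (intro mult_left_mono wt_le_1 mult_nonneg_nonneg B abs_ge_zero)
    qed
  qed
  then show "smooth_fam wt1 F \<Longrightarrow> smooth_fam (\<lambda>_. 1) F" unfolding smooth_fam_def by blast
qed

lemma smooth_famD:
  assumes "smooth_fam \<omega> F" and "\<bar>\<epsilon>\<bar> \<le> 1"
  shows "(F \<epsilon> has_vector_derivative vector_derivative (F \<epsilon>) (at x)) (at x)" "continuous_on UNIV (F \<epsilon>)"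
proof -
  obtain F' where F': "fam_deriv F F'" using smooth_fam_deriv[OF assms(1)] by blast
  then have d: "(F \<epsilon> has_vector_derivative F' \<epsilon> x) (at x)" for x using assms(2) by (simp add: fam_deriv_def)
  then show "(F \<epsilon> has_vector_derivative vector_derivative (F \<epsilon>) (at x)) (at x)"
    using vector_derivative_at[OF d] by simp
  show "continuous_on UNIV (F \<epsilon>)"
    by (intro continuous_at_imp_continuous_on ballI has_vector_derivative_continuous[OF d])
qed

lemma smooth_fam_cong:
  assumes "smooth_fam \<omega> F" and "\<And>\<epsilon> x. \<bar>\<epsilon>\<bar> \<le> 1 \<Longrightarrow> F \<epsilon> x = G \<epsilon> x"
  shows "smooth_fam \<omega> G"
proof -
  obtain d where d: "d 0 = F" "\<And>n. fam_deriv (d n) (d (Suc n))" "\<And>n. fam_bd \<omega> (d n)"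
    using assms(1) unfolding smooth_fam_def by blast
  have e: "F \<epsilon> = G \<epsilon>" if "\<bar>\<epsilon>\<bar> \<le> 1" for \<epsilon> using assms(2)[OF that] by blast
  define d' where "d' n = (if n = 0 then G else d n)" for n :: nat
  have "fam_deriv (d' n) (d' (Suc n))" "fam_bd \<omega> (d' n)" for n
    using d(1) d(2,3)[of n] e by (auto simp: d'_def fam_deriv_def fam_bd_def)
  then show ?thesis unfolding smooth_fam_def by (intro exI[of _ d']) (simp add: d'_def)
qed

lemma smooth_fam_vector_derivative:
  assumes "smooth_fam \<omega> F" shows "smooth_fam \<omega> (\<lambda>\<epsilon> x. vector_derivative (F \<epsilon>) (at x))"
proof -
  obtain F' where F': "smooth_fam \<omega> F'" "fam_deriv F F'" using smooth_fam_deriv[OF assms] by blast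
  show ?thesis
    by (rule smooth_fam_cong[OF F'(1)]) (use F'(2) in \<open>auto simp: fam_deriv_def vector_derivative_at[symmetric]\<close>)
qed

section \<open>Primitives normalised at - infinity\<close>

definition prim :: "(real \<Rightarrow> 'a::banach) \<Rightarrow> real \<Rightarrow> 'a" where
  "prim f = (SOME F. (\<forall>x. (F has_vector_derivative f x) (at x)) \<and> (F \<longlongrightarrow> 0) at_bot)"

lemma prim_eqI:
  fixes F :: "real \<Rightarrow> 'a::banach"
  assumes F: "\<And>x. (F has_vector_derivative f x) (at x)" and bot: "(F \<longlongrightarrow> 0) at_bot"
  shows "prim f = F"
proof -
  have *: "(\<forall>x. (prim f has_vector_derivative f x) (at x)) \<and> (prim f \<longlongrightarrow> 0) at_bot"
    unfolding prim_def by (rule someI[of _ F]) (use assms in blast)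
  have "((\<lambda>x. prim f x - F x) has_vector_derivative 0) (at x within UNIV)" for x
    using has_vector_derivative_diff[of "prim f" "f x" "at x" F "f x"] * F by simp
  then obtain k where k: "\<And>x. prim f x - F x = k"
    using has_vector_derivative_zero_constant[of UNIV "\<lambda>x. prim f x - F x"] by auto
  have "((\<lambda>x. prim f x - F x) \<longlongrightarrow> 0 - 0) at_bot" using * bot by (intro tendsto_diff) auto
  then have "k = 0" unfolding k by (simp add: tendsto_const_iff)
  then show ?thesis using k by auto
qed

lemma prim_facts:
  fixes f :: "real \<Rightarrow> 'a::banach"
  assumes cont: "continuous_on UNIV f" and bd: "\<And>x. norm (f x) \<le> C * wt1 x"
  shows "(prim f has_vector_derivative f x) (at x)" and "(prim f \<longlongrightarrow> 0) at_bot"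
    and "norm (prim f x) \<le> C * pi" and "(prim f \<longlongrightarrow> integral UNIV f) at_top"
proof -
  obtain F v where F: "\<And>x. (F has_vector_derivative f x) (at x)" "(F \<longlongrightarrow> 0) at_bot" "(F \<longlongrightarrow> v) at_top"
    "\<And>x. norm (F x) \<le> C * (arctan x + pi / 2)"
    using ex_primitive_from_bot[OF assms] by blast
  have p: "prim f = F" by (rule prim_eqI[OF F(1,2)])
  have C0: "C \<ge> 0" using order_trans[OF norm_ge_zero bd[of 0]] by (simp add: wt_def)
  have "C * (arctan x + pi / 2) \<le> C * pi" using arctan_range[of x] C0 by (intro mult_left_mono) auto
  then show "norm (prim f x) \<le> C * pi" using F(4)[of x] unfolding p by linarith
  have "(f has_integral (v - 0)) UNIV" by (rule has_integral_FTC_UNIV[OF F(1,3,2)])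
  then show "(prim f \<longlongrightarrow> integral UNIV f) at_top" using F(3) unfolding p by (simp add: integral_unique)
  show "(prim f has_vector_derivative f x) (at x)" "(prim f \<longlongrightarrow> 0) at_bot" unfolding p by (rule F)+
qed

text \<open>Integration loses the decay, hence the weight 1 in the conclusion. Higher derivatives of
  the primitive are derivatives of the integrand, and the Lipschitz bound follows from applying
  \<open>prim\<close> to the difference.\<close>

lemma smooth_fam_prim:
  fixes f :: "real \<Rightarrow> real \<Rightarrow> 'a::banach"
  assumes f: "smooth_fam wt1 f" shows "smooth_fam (\<lambda>_. 1) (\<lambda>\<epsilon>. prim (f \<epsilon>))"
proof -
  obtain d where d: "d 0 = f" "\<And>n. fam_deriv (d n) (d (Suc n))" "\<And>n. fam_bd (\<lambda>_. 1) (d n)"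
    using smooth_fam_wt_weaken[OF f] unfolding smooth_fam_def by blast
  obtain B where B: "B \<ge> 0" "\<And>\<epsilon> x. \<bar>\<epsilon>\<bar> \<le> 1 \<Longrightarrow> norm (f \<epsilon> x) \<le> B * wt1 x"
      "\<And>\<epsilon> x. \<bar>\<epsilon>\<bar> \<le> 1 \<Longrightarrow> norm (f \<epsilon> x - f 0 x) \<le> B * \<bar>\<epsilon>\<bar> * wt1 x" using fam_bdE[OF smooth_fam_bd[OF f]] by blast
  note pf = prim_facts[OF smooth_famD(2)[OF f] B(2)]
  have z: "\<bar>0::real\<bar> \<le> 1" by simp
  have "fam_bd (\<lambda>_. 1) (\<lambda>\<epsilon>. prim (f \<epsilon>))"
  proof (rule fam_bdI[where B = "B * pi"])
    fix \<epsilon> x :: real assume e: "\<bar>\<epsilon>\<bar> \<le> 1"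
    show "norm (prim (f \<epsilon>) x) \<le> B * pi * 1" using pf(3)[OF e e] by simp
    have "prim (\<lambda>x. f \<epsilon> x - f 0 x) = (\<lambda>x. prim (f \<epsilon>) x - prim (f 0) x)"
      using tendsto_diff[OF pf(2)[OF e e] pf(2)[OF z z]]
      by (intro prim_eqI has_vector_derivative_diff pf(1) e z) simp
    moreover have "norm (prim (\<lambda>x. f \<epsilon> x - f 0 x) x) \<le> B * \<bar>\<epsilon>\<bar> * pi"
      by (rule prim_facts(3)) (intro continuous_on_diff smooth_famD(2)[OF f] e z, rule B(3)[OF e])
    ultimately show "norm (prim (f \<epsilon>) x - prim (f 0) x) \<le> B * pi * \<bar>\<epsilon>\<bar> * 1" by (simp add: mult_ac)
  qed (use B in simp)
  moreover have "fam_deriv (\<lambda>\<epsilon>. prim (f \<epsilon>)) f" unfolding fam_deriv_def using pf(1) by blast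
  ultimately show ?thesis unfolding smooth_fam_def using d
    by (intro exI[of _ "\<lambda>n. case n of 0 \<Rightarrow> \<lambda>\<epsilon>. prim (f \<epsilon>) | Suc n \<Rightarrow> d n"]) (auto split: nat.split)
qed

lemma schwartz_smooth_fam:
  fixes f h :: "real \<Rightarrow> 'a::real_normed_vector"
  assumes "schwartz f" "schwartz h" shows "smooth_fam wt1 (\<lambda>\<epsilon> x. f x + \<epsilon> *\<^sub>R h x)"
proof (rule smooth_fam_coinduct[where P = "\<lambda>F. \<exists>f h. schwartz f \<and> schwartz h \<and> F = (\<lambda>\<epsilon> x. f x + \<epsilon> *\<^sub>R h x)"])
  have deriv: "\<exists>f'. schwartz f' \<and> (\<forall>x. (f has_vector_derivative f' x) (at x))" if f: "schwartz f" for f :: "real \<Rightarrow> 'a"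
  proof -
    obtain d where d: "d 0 = f" "\<And>n x. (d n has_vector_derivative d (Suc n) x) (at x)"
      "\<And>k n. bounded (range (\<lambda>x. x ^ k *\<^sub>R d n x))" using f by (auto simp: schwartz_def)
    have "schwartz (d 1)" unfolding schwartz_def by (rule exI[of _ "\<lambda>n. d (Suc n)"]) (use d in auto)
    then show ?thesis using d(1) d(2)[of 0] by auto
  qed
  fix F assume "\<exists>f h. schwartz f \<and> schwartz h \<and> F = (\<lambda>\<epsilon> x. f x + \<epsilon> *\<^sub>R h x :: 'a)"
  then obtain f h where fh: "schwartz f" "schwartz h" and F: "F = (\<lambda>\<epsilon> x. f x + \<epsilon> *\<^sub>R h x)" by blast
  obtain f' h' where fh': "schwartz f'" "schwartz h'" "\<And>x. (f has_vector_derivative f' x) (at x)"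
    "\<And>x. (h has_vector_derivative h' x) (at x)" using deriv[OF fh(1)] deriv[OF fh(2)] by blast
  have "fam_deriv F (\<lambda>\<epsilon> x. f' x + \<epsilon> *\<^sub>R h' x)" unfolding fam_deriv_def F
    by (auto intro!: has_vector_derivative_add fh' bounded_linear.has_vector_derivative[OF bounded_linear_scaleR_right])
  moreover obtain b c where b: "\<And>x. norm (f x) \<le> b * wt1 x" and c: "\<And>x. norm (h x) \<le> c * wt1 x"
    using schwartz_wt_bound[OF fh(1)] schwartz_wt_bound[OF fh(2)] by blast
  have bc: "b \<ge> 0" "c \<ge> 0" using order_trans[OF norm_ge_zero b[of 0]] order_trans[OF norm_ge_zero c[of 0]]
    by (simp_all add: wt_def)
  have "fam_bd wt1 F"
  proof (rule fam_bdI[where B = "b + c"])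
    fix \<epsilon> x :: real assume e: "\<bar>\<epsilon>\<bar> \<le> 1"
    have n: "norm (\<epsilon> *\<^sub>R h x) \<le> \<bar>\<epsilon>\<bar> * (c * wt1 x)" using c[of x] by (simp add: mult_left_mono)
    also have "\<dots> \<le> 1 * (c * wt1 x)" using e bc wt_nonneg by (intro mult_right_mono) auto
    finally show "norm (F \<epsilon> x) \<le> (b + c) * wt1 x" unfolding F
      using norm_triangle_mono[OF b[of x]] by (simp add: distrib_right)
    have "0 \<le> \<bar>\<epsilon>\<bar> * (b * wt1 x)" using bc wt_nonneg by simp
    then show "norm (F \<epsilon> x - F 0 x) \<le> (b + c) * \<bar>\<epsilon>\<bar> * wt1 x" using n by (simp add: F algebra_simps)
  qed (use bc in simp)
  ultimately show "fam_bd wt1 F \<and> (\<exists>F'. (\<exists>f h. schwartz f \<and> schwartz h \<and> F' = (\<lambda>\<epsilon> x. f x + \<epsilon> *\<^sub>R h x)) \<and> fam_deriv F F')"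
    using fh' by blast
qed (use assms in blast)

lemma schwartz_zero: "schwartz (\<lambda>x. 0)"
  unfolding schwartz_def by (rule exI[of _ "\<lambda>n x. 0"]) auto

lemma zero_fields: "(\<lambda>j x. 0) \<in> fields M N"
  by (simp add: fields_def schwartz_zero)

context super_nls begin

section \<open>Expansion of the Jost solution in inverse powers of the spectral parameter\<close>

text \<open>In the equation for component \<open>j\<close>, order n expresses the derivative of the
  present coefficient as \<open>\<i>\<close> times the next one plus
  \<open>sqg * \<psi> j * c m\<close>. This is the solution for the next one;
  \<open>\<i> * sqg\<close> is minus the square root of \<open>g\<close>.\<close>

definition coefw :: "'a::banach_superalgebra config \<Rightarrow> (real \<Rightarrow> nat \<Rightarrow> 'a) \<Rightarrow> real \<Rightarrow> nat \<Rightarrow> 'a" where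
  "coefw \<psi> c x j = (- \<i>) *\<^sub>C vector_derivative (\<lambda>s. c s j) (at x) - complex_of_real (sqrt g) *\<^sub>C (\<psi> j x * c x m)"

text \<open>Inserting the formal series of \<open>coef \<psi> n\<close> with \<open>\<zeta> ^ (- n)\<close> into the differential equation
  for the last column determines the components \<open>j \<le> M + N\<close> algebraically from the preceding order
  and the last one by integration from \<open>- \<infinity>\<close>.\<close>
primrec coef :: "'a::banach_superalgebra config \<Rightarrow> nat \<Rightarrow> real \<Rightarrow> nat \<Rightarrow> 'a" where
  "coef \<psi> 0 = (\<lambda>x e. mone e m)"
| "coef \<psi> (Suc n) = (\<lambda>x e. if e = m
     then prim (\<lambda>s. - (sqg *\<^sub>C (\<Sum>j\<in>K. (\<psi> j s)\<^sup>\<dagger> * coefw \<psi> (coef \<psi> n) s j))) x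
     else coefw \<psi> (coef \<psi> n) x e)"

text \<open>Two weights go through the induction together: the components in \<open>K\<close> stay
  integrable, being built from derivatives of such components and products with a field, while the
  last one is a primitive and only bounded. Stating this for families makes the Lipschitz dependence
  on a variation part of the same induction.\<close>

lemma coef_fam:
  fixes \<psi> :: "real \<Rightarrow> 'a::banach_superalgebra config"
  assumes \<psi>: "\<And>j. j \<in> K \<Longrightarrow> smooth_fam wt1 (\<lambda>\<epsilon>. \<psi> \<epsilon> j)"
  shows "(\<forall>j\<in>K. smooth_fam wt1 (\<lambda>\<epsilon> x. coef (\<psi> \<epsilon>) n x j)) \<and> smooth_fam (\<lambda>_. 1) (\<lambda>\<epsilon> x. coef (\<psi> \<epsilon>) n x m)"
    and "j \<in> K \<Longrightarrow> smooth_fam wt1 (\<lambda>\<epsilon> x. coefw (\<psi> \<epsilon>) (coef (\<psi> \<epsilon>) n) x j)"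
    and "smooth_fam wt1 (\<lambda>\<epsilon> s. - (sqg *\<^sub>C (\<Sum>j\<in>K. (\<psi> \<epsilon> j s)\<^sup>\<dagger> * coefw (\<psi> \<epsilon>) (coef (\<psi> \<epsilon>) n) s j)))"
proof -
  have w: "smooth_fam wt1 (\<lambda>\<epsilon> x. coefw (\<psi> \<epsilon>) (coef (\<psi> \<epsilon>) n) x j)"
    if IH: "(\<forall>j\<in>K. smooth_fam wt1 (\<lambda>\<epsilon> x. coef (\<psi> \<epsilon>) n x j)) \<and> smooth_fam (\<lambda>_. 1) (\<lambda>\<epsilon> x. coef (\<psi> \<epsilon>) n x m)"
      and j: "j \<in> K" for n j
  proof -
    have 1: "smooth_fam wt1 (\<lambda>\<epsilon> x. (- \<i>) *\<^sub>C vector_derivative (\<lambda>s. coef (\<psi> \<epsilon>) n s j) (at x))"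
      by (rule smooth_fam_linear[OF scaleC.bounded_linear_right smooth_fam_vector_derivative]) (use IH j in blast)
    have 2: "smooth_fam wt1 (\<lambda>\<epsilon> x. - complex_of_real (sqrt g) *\<^sub>C (\<psi> \<epsilon> j x * coef (\<psi> \<epsilon>) n x m))"
      by (rule smooth_fam_linear[OF scaleC.bounded_linear_right smooth_fam_mult_right[OF \<psi>[OF j]]]) (use IH in blast)
    show ?thesis using smooth_fam_add[OF 1 2] unfolding coefw_def by (simp add: scaleC.minus_left)
  qed
  have p: "smooth_fam wt1 (\<lambda>\<epsilon> s. - (sqg *\<^sub>C (\<Sum>j\<in>K. (\<psi> \<epsilon> j s)\<^sup>\<dagger> * coefw (\<psi> \<epsilon>) (coef (\<psi> \<epsilon>) n) s j)))"
    if IH: "(\<forall>j\<in>K. smooth_fam wt1 (\<lambda>\<epsilon> x. coef (\<psi> \<epsilon>) n x j)) \<and> smooth_fam (\<lambda>_. 1) (\<lambda>\<epsilon> x. coef (\<psi> \<epsilon>) n x m)" for n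
    unfolding scaleC.minus_left[symmetric]
    by (intro smooth_fam_linear[OF scaleC.bounded_linear_right] smooth_fam_sum wt_nonneg smooth_fam_mult_right
        smooth_fam_linear[OF bounded_linear_adj] \<psi> smooth_fam_wt_weaken w[OF IH])
  have c: "(\<forall>j\<in>K. smooth_fam wt1 (\<lambda>\<epsilon> x. coef (\<psi> \<epsilon>) n x j)) \<and> smooth_fam (\<lambda>_. 1) (\<lambda>\<epsilon> x. coef (\<psi> \<epsilon>) n x m)" for n
  proof (induction n)
    case 0
    have "smooth_fam wt1 (\<lambda>\<epsilon> x. mone j m :: 'a)" if "j \<in> K" for j
      using smooth_fam_zero[of wt1, OF wt_nonneg] K_ne_m[OF that] by (simp add: mone_def)
    then show ?case by (simp add: smooth_fam_const)
  next
    case (Suc n)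
    have "smooth_fam wt1 (\<lambda>\<epsilon> x. coef (\<psi> \<epsilon>) (Suc n) x j)" if "j \<in> K" for j
      using w[OF Suc that] K_ne_m[OF that] by simp
    moreover have "smooth_fam (\<lambda>_. 1) (\<lambda>\<epsilon> x. coef (\<psi> \<epsilon>) (Suc n) x m)"
      using smooth_fam_prim[OF p[OF Suc]] by simp
    ultimately show ?case by blast
  qed
  show "(\<forall>j\<in>K. smooth_fam wt1 (\<lambda>\<epsilon> x. coef (\<psi> \<epsilon>) n x j)) \<and> smooth_fam (\<lambda>_. 1) (\<lambda>\<epsilon> x. coef (\<psi> \<epsilon>) n x m)"
    "j \<in> K \<Longrightarrow> smooth_fam wt1 (\<lambda>\<epsilon> x. coefw (\<psi> \<epsilon>) (coef (\<psi> \<epsilon>) n) x j)"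
    "smooth_fam wt1 (\<lambda>\<epsilon> s. - (sqg *\<^sub>C (\<Sum>j\<in>K. (\<psi> \<epsilon> j s)\<^sup>\<dagger> * coefw (\<psi> \<epsilon>) (coef (\<psi> \<epsilon>) n) s j)))"
    by (rule c w[OF c] p[OF c]; assumption?)+
qed

lemma shift_smooth_fam:
  "\<phi> \<in> fields M N \<Longrightarrow> h \<in> fields M N \<Longrightarrow> j \<in> K \<Longrightarrow> smooth_fam wt1 (\<lambda>\<epsilon>. shift_cfg \<phi> \<epsilon> h j)"
  unfolding shift_cfg_def by (intro schwartz_smooth_fam) (auto simp: fields_def)

text \<open>The exponent \<open>cd \<zeta> m e\<close> divided by \<zeta>.\<close>

definition ik :: "nat \<Rightarrow> complex" where "ik e = (if e = m then 0 else \<i>)"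

context
  fixes \<psi> :: "'a::banach_superalgebra config"
  assumes \<psi>: "\<psi> \<in> fields M N"
begin

text \<open>A fixed configuration is a family with zero variation, so regularity in \<open>x\<close>
  needs no second induction.\<close>

lemmas const_fam = coef_fam[of "\<lambda>\<epsilon>. shift_cfg \<psi> \<epsilon> (\<lambda>_ _. 0)", OF shift_smooth_fam[OF \<psi> zero_fields]]

lemma coef_cont: "e \<in> I \<Longrightarrow> continuous_on UNIV (\<lambda>x. coef \<psi> n x e)"
proof (cases "e = m")
  case True
  then show ?thesis using smooth_famD(2)[OF conjunct2[OF const_fam(1)] abs_zero_le_one, of n] by simp
next
  case False
  assume "e \<in> I"
  then have "e \<in> K" using False I_cases by blast
  then show ?thesis using smooth_famD(2)[OF bspec[OF conjunct1[OF const_fam(1)]] abs_zero_le_one, of e n] by simp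
qed

lemma coef_bd: "\<exists>B\<ge>0. \<forall>x. norm (coef \<psi> n x m) \<le> B \<and> (\<forall>j\<in>K. norm (coef \<psi> n x j) \<le> B * wt1 x)"
proof -
  obtain B where B: "B \<ge> 0" "\<And>x. norm (coef \<psi> n x m) \<le> B"
    using smooth_fam_bd0[OF conjunct2[OF const_fam(1)[of n]]] by auto
  have "\<forall>j\<in>K. \<exists>B\<ge>0. \<forall>x. norm (coef \<psi> n x j) \<le> B * wt1 x"
  proof
    fix j assume j: "j \<in> K"
    show "\<exists>B\<ge>0. \<forall>x. norm (coef \<psi> n x j) \<le> B * wt1 x"
      using smooth_fam_bd0[OF bspec[OF conjunct1[OF const_fam(1)[of n]] j]] by simp
  qed
  then obtain b where b: "\<And>j. j \<in> K \<Longrightarrow> b j \<ge> 0" "\<And>j x. j \<in> K \<Longrightarrow> norm (coef \<psi> n x j) \<le> b j * wt1 x" by metis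
  show ?thesis
  proof (intro exI[of _ "B + sum b K"] conjI allI ballI)
    have s0: "sum b K \<ge> 0" by (intro sum_nonneg b)
    then show "0 \<le> B + sum b K" using B by simp
    fix x
    show "norm (coef \<psi> n x m) \<le> B + sum b K" using B(2)[of x] s0 by linarith
    fix j assume j: "j \<in> K"
    have "b j \<le> sum b K" using b j by (intro member_le_sum) auto
    then have "b j * wt1 x \<le> (B + sum b K) * wt1 x" using B by (intro mult_right_mono wt_nonneg) linarith
    then show "norm (coef \<psi> n x j) \<le> (B + sum b K) * wt1 x" using b(2)[OF j, of x] by linarith
  qed
qed

lemma prim_coef:
  defines "f \<equiv> \<lambda>n s. - (sqg *\<^sub>C (\<Sum>j\<in>K. (\<psi> j s)\<^sup>\<dagger> * coefw \<psi> (coef \<psi> n) s j))"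
  shows "continuous_on UNIV (f n)" and "\<exists>B\<ge>0. \<forall>x. norm (f n x) \<le> B * wt1 x"
proof -
  show "continuous_on UNIV (f n)" using smooth_famD(2)[OF const_fam(3) abs_zero_le_one, of n] by (simp add: f_def)
  show "\<exists>B\<ge>0. \<forall>x. norm (f n x) \<le> B * wt1 x"
    using smooth_fam_bd0[OF const_fam(3)[of n]] unfolding f_def by simp
qed

text \<open>This is order n of the differential equation. For \<open>n = 0\<close> and
  \<open>e = m\<close> both sides vanish because the series starts with the unit vector.\<close>

lemma coef_deriv: "e \<in> I \<Longrightarrow> ((\<lambda>s. coef \<psi> n s e) has_vector_derivative
    ik e *\<^sub>C coef \<psi> (Suc n) x e + (\<Sum>f\<in>I. Om \<psi> x e f * coef \<psi> n x f)) (at x)"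
proof (cases "e = m")
  case True
  assume e: "e \<in> I"
  show ?thesis
  proof (cases n)
    case 0
    have "(\<Sum>j\<in>K. (\<psi> j x)\<^sup>\<dagger> * mone j m) = 0" by (intro sum.neutral) (auto simp: mone_def)
    then show ?thesis unfolding sum_Om[OF e] unfolding 0 True
      by (simp add: ik_def scaleC.zero_left scaleC.zero_right del: coef.simps(2) One_nat_def)
  next
    case (Suc k)
    obtain B where B: "\<And>x. norm (- (sqg *\<^sub>C (\<Sum>j\<in>K. (\<psi> j x)\<^sup>\<dagger> * coefw \<psi> (coef \<psi> k) x j))) \<le> B * wt1 x"
      using prim_coef(2) by blast
    have "(\<Sum>j\<in>K. (\<psi> j x)\<^sup>\<dagger> * coef \<psi> (Suc k) x j) = (\<Sum>j\<in>K. (\<psi> j x)\<^sup>\<dagger> * coefw \<psi> (coef \<psi> k) x j)"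
      by (intro sum.cong refl) (auto dest: K_ne_m)
    then have "ik e *\<^sub>C coef \<psi> (Suc n) x e + (\<Sum>f\<in>I. Om \<psi> x e f * coef \<psi> n x f)
        = - (sqg *\<^sub>C (\<Sum>j\<in>K. (\<psi> j x)\<^sup>\<dagger> * coefw \<psi> (coef \<psi> k) x j))"
      unfolding True sum_Om[OF m_in] Suc by (simp only: ik_def if_True scaleC.zero_left add_0_left refl)
    then show ?thesis using prim_facts(1)[OF prim_coef(1) B, of x] unfolding Suc True coef.simps if_True refl by simp
  qed
next
  case False
  assume e: "e \<in> I"
  then have eK: "e \<in> K" using False I_cases by blast
  let ?v = "vector_derivative (\<lambda>s. coef \<psi> n s e) (at x)"
  have "((\<lambda>s. coef \<psi> n s e) has_vector_derivative ?v) (at x)"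
    using smooth_famD(1)[OF bspec[OF conjunct1[OF const_fam(1)] eK] abs_zero_le_one, of n x] by simp
  also have "?v = ik e *\<^sub>C coef \<psi> (Suc n) x e + (\<Sum>f\<in>I. Om \<psi> x e f * coef \<psi> n x f)"
    unfolding sum_Om[OF e] using False
    by (simp add: ik_def coefw_def scaleC.diff_right scaleC_scaleC)
  finally show ?thesis .
qed

lemma coef_bot: "e \<in> I \<Longrightarrow> ((\<lambda>x. coef \<psi> n x e) \<longlongrightarrow> (if n = 0 then mone e m else 0)) at_bot"
proof (cases "n = 0")
  case False
  assume e: "e \<in> I"
  show ?thesis
  proof (cases "e = m")
    case True
    obtain k where k: "n = Suc k" using False by (cases n) auto
    obtain B where B: "\<And>x. norm (- (sqg *\<^sub>C (\<Sum>j\<in>K. (\<psi> j x)\<^sup>\<dagger> * coefw \<psi> (coef \<psi> k) x j))) \<le> B * wt1 x"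
      using prim_coef(2) by blast
    show ?thesis using prim_facts(2)[OF prim_coef(1) B] True k by simp
  next
    case F: False
    then have eK: "e \<in> K" using e I_cases by blast
    obtain B where B: "\<And>x. norm (coef \<psi> n x e) \<le> B * wt1 x" using coef_bd[of n] eK by blast
    have "((\<lambda>x. wt1 (- x)) \<longlongrightarrow> 0) at_bot"
      by (rule filterlim_compose[OF wt_at_top filterlim_uminus_at_top_at_bot]) simp
    then have "((\<lambda>x. B * wt1 x) \<longlongrightarrow> 0) at_bot" using tendsto_mult_right_zero by fastforce
    then have "((\<lambda>x. coef \<psi> n x e) \<longlongrightarrow> 0) at_bot"
      by (rule Lim_null_comparison[OF always_eventually[OF allI[OF B]]])
    then show ?thesis using False by simp
  qed
qed simp

lemma coef_top: "\<exists>l. ((\<lambda>x. coef \<psi> n x m) \<longlongrightarrow> l) at_top"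
proof (cases n)
  case (Suc k)
  obtain B where B: "\<And>x. norm (- (sqg *\<^sub>C (\<Sum>j\<in>K. (\<psi> j x)\<^sup>\<dagger> * coefw \<psi> (coef \<psi> k) x j))) \<le> B * wt1 x"
    using prim_coef(2) by blast
  show ?thesis using prim_facts(4)[OF prim_coef(1) B] unfolding Suc by auto
qed auto

end

end

subsection \<open>Inverse power expansions\<close>

definition psum :: "complex \<Rightarrow> (nat \<Rightarrow> 'a::banach_superalgebra) \<Rightarrow> nat \<Rightarrow> 'a" where
  "psum \<zeta> c n = (\<Sum>k\<le>n. inverse (\<zeta> ^ k) *\<^sub>C c k)"

lemma psum_0 [simp]: "psum \<zeta> c 0 = c 0" by (simp add: psum_def)

lemma psum_Suc: "psum \<zeta> c (Suc n) = psum \<zeta> c n + inverse (\<zeta> ^ Suc n) *\<^sub>C c (Suc n)"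
  by (simp add: psum_def)

lemma psum_linear:
  "psum \<zeta> (\<lambda>k. b * c k) n = b * psum \<zeta> c n"
  "psum \<zeta> (\<lambda>k. z *\<^sub>C c k) n = z *\<^sub>C psum \<zeta> c n"
  "psum \<zeta> (\<lambda>k. c k + d k) n = psum \<zeta> c n + psum \<zeta> d n"
  "psum \<zeta> (\<lambda>k. c k - d k) n = psum \<zeta> c n - psum \<zeta> d n"
  "psum \<zeta> (\<lambda>k. \<Sum>j\<in>J. e j k) n = (\<Sum>j\<in>J. psum \<zeta> (e j) n)"
  unfolding psum_def
  by (simp_all add: scaleC_mult_left scaleC_mult_right sum_distrib_left sum_distrib_right scaleC_scaleC
      mult.commute scaleC.sum_right scaleC_add_right scaleC.diff_right sum.distrib sum_subtractf sum.swap[of _ J])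

lemma inverse_power_mono:
  fixes t :: real assumes "1 \<le> t" "i \<le> k" shows "inverse (t ^ k) \<le> inverse (t ^ i)"
  using assms by (intro le_imp_inverse_le power_increasing) auto

lemma norm_psum_le:
  assumes "1 \<le> cmod \<zeta>" and "\<And>k. k \<le> n \<Longrightarrow> norm (c k) \<le> b k"
  shows "norm (psum \<zeta> c n) \<le> (\<Sum>k\<le>n. b k)"
  unfolding psum_def
proof (rule sum_norm_le)
  fix k assume k: "k \<in> {..n}"
  have "norm (inverse (\<zeta> ^ k) *\<^sub>C c k) \<le> 1 * norm (c k)"
    unfolding norm_scaleC norm_inverse norm_power
    using inverse_power_mono[OF assms(1), of 0 k] by (intro mult_right_mono) auto
  then show "norm (inverse (\<zeta> ^ k) *\<^sub>C c k) \<le> b k" using assms(2)[of k] k by simp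
qed

text \<open>Partial sums multiply to the partial sum of the Cauchy product up to index pairs with
  sum at least n + 1; \<open>(Suc n)\<^sup>2\<close> crudely bounds the number of these.\<close>

lemma psum_mult:
  fixes c d :: "nat \<Rightarrow> 'a::banach_superalgebra"
  assumes \<zeta>: "1 \<le> cmod \<zeta>" and c: "\<And>k. k \<le> n \<Longrightarrow> norm (c k) \<le> A" and d: "\<And>k. k \<le> n \<Longrightarrow> norm (d k) \<le> B"
  shows "norm (psum \<zeta> c n * psum \<zeta> d n - psum \<zeta> (\<lambda>i. \<Sum>k\<le>i. c k * d (i - k)) n)
    \<le> real ((Suc n)\<^sup>2) * (A * B) * inverse (cmod \<zeta> ^ Suc n)"
proof -
  let ?h = "\<lambda>j k. inverse (\<zeta> ^ (j + k)) *\<^sub>C (c j * d k)"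
  let ?S = "{..n} \<times> {..n}" and ?T = "{(j, k). j + k \<le> n}"
  have T: "?T \<subseteq> ?S" by auto
  have 1: "psum \<zeta> c n * psum \<zeta> d n = (\<Sum>(j, k)\<in>?S. ?h j k)"
    unfolding psum_def sum_product sum.cartesian_product
    by (intro sum.cong refl) (auto simp: scaleC_mult_left scaleC_mult_right scaleC_scaleC power_add mult.commute)
  have "psum \<zeta> (\<lambda>i. \<Sum>k\<le>i. c k * d (i - k)) n = (\<Sum>i\<le>n. \<Sum>k\<le>i. ?h k (i - k))"
    unfolding psum_def scaleC.sum_right by (intro sum.cong refl) auto
  also have "\<dots> = (\<Sum>(j, k)\<in>?T. ?h j k)" by (rule sum.triangle_reindex_eq[symmetric])
  finally have 2: "psum \<zeta> (\<lambda>i. \<Sum>k\<le>i. c k * d (i - k)) n = (\<Sum>(j, k)\<in>?T. ?h j k)" .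
  have "psum \<zeta> c n * psum \<zeta> d n - psum \<zeta> (\<lambda>i. \<Sum>k\<le>i. c k * d (i - k)) n = (\<Sum>(j, k)\<in>?S - ?T. ?h j k)"
    unfolding 1 2 by (subst sum_diff[OF _ T]) auto
  also have "norm \<dots> \<le> (\<Sum>p\<in>?S - ?T. inverse (cmod \<zeta> ^ Suc n) * (A * B))"
  proof (rule sum_norm_le)
    fix p assume "p \<in> ?S - ?T"
    then obtain j k where p: "p = (j, k)" and jk: "j \<le> n" "k \<le> n" "Suc n \<le> j + k" by auto
    have "norm (?h j k) = inverse (cmod \<zeta> ^ (j + k)) * norm (c j * d k)" by (simp add: norm_scaleC norm_inverse norm_power)
    also have "\<dots> \<le> inverse (cmod \<zeta> ^ Suc n) * (A * B)"
      using \<zeta> jk by (intro mult_mono inverse_power_mono norm_mult_le c d) auto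
    finally show "norm (case p of (j, k) \<Rightarrow> ?h j k) \<le> inverse (cmod \<zeta> ^ Suc n) * (A * B)" by (simp add: p)
  qed
  also have "\<dots> = real (card (?S - ?T)) * (inverse (cmod \<zeta> ^ Suc n) * (A * B))" by simp
  also have "\<dots> \<le> real ((Suc n)\<^sup>2) * (inverse (cmod \<zeta> ^ Suc n) * (A * B))"
  proof (rule mult_right_mono)
    have "card (?S - ?T) \<le> card ?S" by (intro card_mono) auto
    also have "\<dots> = (Suc n)\<^sup>2" by (simp add: power2_eq_square)
    finally show "real (card (?S - ?T)) \<le> real ((Suc n)\<^sup>2)" by (rule of_nat_mono)
    have "0 \<le> A * B" using order_trans[OF norm_ge_zero c[of 0]] order_trans[OF norm_ge_zero d[of 0]] by simp
    then show "0 \<le> inverse (cmod \<zeta> ^ Suc n) * (A * B)" by simp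
  qed
  finally show ?thesis by (simp only: mult_ac)
qed

text \<open>By induction only the term of order n is left in the partial sum, and it is bounded by
  the next power of \<open>inverse \<zeta>\<close>; on the imaginary axis let the modulus
  grow.\<close>

lemma psum_unique:
  fixes a :: "nat \<Rightarrow> 'a::banach_superalgebra"
  assumes "\<And>n. \<exists>C. \<forall>\<zeta>. 2 \<le> Im \<zeta> \<longrightarrow> norm (psum \<zeta> a n) \<le> C * inverse (cmod \<zeta> ^ Suc n)"
  shows "a n = 0"
proof (induction n rule: less_induct)
  case (less n)
  obtain C where C: "\<And>\<zeta>. 2 \<le> Im \<zeta> \<Longrightarrow> norm (psum \<zeta> a n) \<le> C * inverse (cmod \<zeta> ^ Suc n)" using assms[of n] by blast
  have p: "psum \<zeta> a n = inverse (\<zeta> ^ n) *\<^sub>C a n" for \<zeta>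
    unfolding psum_def
    by (subst sum_eq_single[where a = n]) (auto simp: less scaleC.zero_right)
  have *: "norm (a n) * t \<le> C" if t: "2 \<le> t" for t :: real
  proof -
    have cm: "cmod (\<i> * complex_of_real t) = t" using t by (simp add: norm_mult)
    have "inverse (t ^ n) * norm (a n) \<le> C * inverse (t ^ Suc n)"
      using C[of "\<i> * complex_of_real t"] t unfolding p norm_scaleC norm_inverse norm_power cm by simp
    then have "inverse (t ^ n) * norm (a n) * t ^ Suc n \<le> C * inverse (t ^ Suc n) * t ^ Suc n"
      using t by (intro mult_right_mono) auto
    moreover have "inverse (t ^ n) * norm (a n) * t ^ Suc n = norm (a n) * t" using t by simp
    moreover have "C * inverse (t ^ Suc n) * t ^ Suc n = C"
    proof -
      have "inverse (t ^ Suc n) * t ^ Suc n = 1" using t by (intro left_inverse) simp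
      then show ?thesis by (simp only: mult.assoc mult_1_right)
    qed
    ultimately show ?thesis by linarith
  qed
  show ?case
  proof (rule ccontr)
    assume "a n \<noteq> 0"
    then have na: "norm (a n) > 0" by simp
    \<comment> \<open>Large enough for \<open>norm (a n) * t\<close> to exceed \<open>C\<close>, and
      at least 2 as the half-plane demands.\<close>
    define t where "t = max 2 (C / norm (a n) + 1)"
    have "C / norm (a n) < t" by (simp add: t_def less_max_iff_disj)
    then have "C < norm (a n) * t" using na by (simp add: pos_divide_less_eq mult.commute)
    then show False using *[of t] by (simp add: t_def)
  qed
qed

section \<open>Expansions with remainders uniform on the line\<close>

text \<open>In \<open>Im \<zeta> \<ge> 2\<close> the remainders are bounded by an integrable weight; on the real axis the fast components
  oscillate and only sup bounds hold.\<close>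
definition kexp :: "(real \<Rightarrow> real) \<Rightarrow> (complex \<Rightarrow> real \<Rightarrow> 'a::banach_superalgebra) \<Rightarrow> (nat \<Rightarrow> real \<Rightarrow> 'a) \<Rightarrow> bool" where
  "kexp \<omega> f c \<longleftrightarrow> (\<forall>x. 0 \<le> \<omega> x) \<and> (\<forall>\<zeta>. 2 \<le> Im \<zeta> \<longrightarrow> continuous_on UNIV (f \<zeta>)) \<and> (\<forall>n. continuous_on UNIV (c n)) \<and>
     (\<forall>n. \<exists>C\<ge>0. \<forall>x. norm (c n x) \<le> C * \<omega> x) \<and>
     (\<forall>n. \<exists>C\<ge>0. \<forall>\<zeta> x. 2 \<le> Im \<zeta> \<longrightarrow> norm (f \<zeta> x - psum \<zeta> (\<lambda>k. c k x) n) \<le> C * inverse (cmod \<zeta> ^ Suc n) * \<omega> x)"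

lemma kexpI:
  assumes "\<And>x. 0 \<le> \<omega> x" "\<And>\<zeta>. 2 \<le> Im \<zeta> \<Longrightarrow> continuous_on UNIV (f \<zeta>)" "\<And>n. continuous_on UNIV (c n)"
    "\<And>n. \<exists>C\<ge>0. \<forall>x. norm (c n x) \<le> C * \<omega> x"
    "\<And>n. \<exists>C\<ge>0. \<forall>\<zeta> x. 2 \<le> Im \<zeta> \<longrightarrow> norm (f \<zeta> x - psum \<zeta> (\<lambda>k. c k x) n) \<le> C * inverse (cmod \<zeta> ^ Suc n) * \<omega> x"
  shows "kexp \<omega> f c"
  unfolding kexp_def using assms by simp

lemma cmod_ge_1: "2 \<le> Im \<zeta> \<Longrightarrow> 1 \<le> cmod \<zeta>"
  using abs_Im_le_cmod[of \<zeta>] by linarith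

lemma kexpD:
  assumes "kexp \<omega> f c"
  shows "0 \<le> \<omega> x" "2 \<le> Im \<zeta> \<Longrightarrow> continuous_on UNIV (f \<zeta>)" "continuous_on UNIV (c n)"
    "\<exists>C\<ge>0. \<forall>x. norm (c n x) \<le> C * \<omega> x"
    "\<exists>C\<ge>0. \<forall>\<zeta> x. 2 \<le> Im \<zeta> \<longrightarrow> norm (f \<zeta> x - psum \<zeta> (\<lambda>k. c k x) n) \<le> C * inverse (cmod \<zeta> ^ Suc n) * \<omega> x"
  using assms unfolding kexp_def by blast+

lemma kexp_mult:
  assumes f: "kexp \<omega> f c" and h: "kexp \<rho> h d"
  shows "kexp (\<lambda>x. \<omega> x * \<rho> x) (\<lambda>\<zeta> x. f \<zeta> x * h \<zeta> x) (\<lambda>n x. \<Sum>k\<le>n. c k x * d (n - k) x)"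
  unfolding kexp_def
proof (intro conjI allI impI)
  note wf = kexpD(1)[OF f] and wh = kexpD(1)[OF h]
  show "0 \<le> \<omega> x * \<rho> x" for x using wf wh by simp
  show "2 \<le> Im \<zeta> \<Longrightarrow> continuous_on UNIV (\<lambda>x. f \<zeta> x * h \<zeta> x)" for \<zeta>
    by (intro continuous_on_mult kexpD(2)[OF f] kexpD(2)[OF h])
  show "continuous_on UNIV (\<lambda>x. \<Sum>k\<le>n. c k x * d (n - k) x)" for n
    by (intro continuous_on_sum continuous_on_mult kexpD(3)[OF f] kexpD(3)[OF h])
  obtain A where A: "\<And>k. A k \<ge> 0" "\<And>k x. norm (c k x) \<le> A k * \<omega> x" using kexpD(4)[OF f] by metis
  obtain B where B: "\<And>k. B k \<ge> 0" "\<And>k x. norm (d k x) \<le> B k * \<rho> x" using kexpD(4)[OF h] by metis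
  fix n
  show "\<exists>C\<ge>0. \<forall>x. norm (\<Sum>k\<le>n. c k x * d (n - k) x) \<le> C * (\<omega> x * \<rho> x)"
  proof (intro exI[of _ "\<Sum>k\<le>n. A k * B (n - k)"] conjI allI)
    show "0 \<le> (\<Sum>k\<le>n. A k * B (n - k))" using A B by (intro sum_nonneg mult_nonneg_nonneg) auto
    fix x
    have "norm (\<Sum>k\<le>n. c k x * d (n - k) x) \<le> (\<Sum>k\<le>n. (A k * \<omega> x) * (B (n - k) * \<rho> x))"
      by (intro sum_norm_le norm_mult_le A B)
    also have "\<dots> = (\<Sum>k\<le>n. A k * B (n - k)) * (\<omega> x * \<rho> x)"
      unfolding sum_distrib_right by (intro sum.cong refl) (simp only: mult_ac)
    finally show "norm (\<Sum>k\<le>n. c k x * d (n - k) x) \<le> (\<Sum>k\<le>n. A k * B (n - k)) * (\<omega> x * \<rho> x)" .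
  qed
  obtain Cf where Cf: "Cf \<ge> 0" "\<And>\<zeta> x. 2 \<le> Im \<zeta> \<Longrightarrow> norm (f \<zeta> x - psum \<zeta> (\<lambda>k. c k x) n) \<le> Cf * inverse (cmod \<zeta> ^ Suc n) * \<omega> x"
    using kexpD(5)[OF f, of n] by blast
  obtain Ch where Ch: "Ch \<ge> 0" "\<And>\<zeta> x. 2 \<le> Im \<zeta> \<Longrightarrow> norm (h \<zeta> x - psum \<zeta> (\<lambda>k. d k x) n) \<le> Ch * inverse (cmod \<zeta> ^ Suc n) * \<rho> x"
    using kexpD(5)[OF h, of n] by blast
  define SA where "SA = (\<Sum>k\<le>n. A k)" define SB where "SB = (\<Sum>k\<le>n. B k)"
  have S0: "SA \<ge> 0" "SB \<ge> 0" unfolding SA_def SB_def using A B by (auto intro: sum_nonneg)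
  have Ak: "norm (c k x) \<le> SA * \<omega> x" if "k \<le> n" for k x
  proof -
    have "A k \<le> SA" unfolding SA_def using A that by (intro member_le_sum) auto
    then show ?thesis using A(2)[of k x] mult_right_mono[OF _ wf[of x]] by fastforce
  qed
  have Bk: "norm (d k x) \<le> SB * \<rho> x" if "k \<le> n" for k x
  proof -
    have "B k \<le> SB" unfolding SB_def using B that by (intro member_le_sum) auto
    then show ?thesis using B(2)[of k x] mult_right_mono[OF _ wh[of x]] by fastforce
  qed
  define C where "C = Cf * (Ch + SB) + SA * Ch + real ((Suc n)\<^sup>2) * (SA * SB)"
  have "norm (f \<zeta> x * h \<zeta> x - psum \<zeta> (\<lambda>k. \<Sum>i\<le>k. c i x * d (k - i) x) n) \<le> C * inverse (cmod \<zeta> ^ Suc n) * (\<omega> x * \<rho> x)"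
    if \<zeta>: "2 \<le> Im \<zeta>" for \<zeta> x
  proof -
    let ?F = "psum \<zeta> (\<lambda>k. c k x) n" and ?H = "psum \<zeta> (\<lambda>k. d k x) n" and ?t = "inverse (cmod \<zeta> ^ Suc n)"
    note z1 = cmod_ge_1[OF \<zeta>]
    have t: "0 \<le> ?t" "?t \<le> 1" using inverse_power_mono[OF z1, of 0 "Suc n"] z1 by auto
    have F: "norm ?F \<le> SA * \<omega> x" using norm_psum_le[OF z1 A(2), where n = n] by (simp add: SA_def sum_distrib_right)
    have H: "norm ?H \<le> SB * \<rho> x" using norm_psum_le[OF z1 B(2), where n = n] by (simp add: SB_def sum_distrib_right)
    have "norm (h \<zeta> x) \<le> Ch * ?t * \<rho> x + SB * \<rho> x"
      using norm_triangle_mono[OF Ch(2)[OF \<zeta>, of x] H] by simp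
    also have "Ch * ?t * \<rho> x \<le> Ch * 1 * \<rho> x" using Ch(1) t wh by (intro mult_right_mono mult_left_mono) auto
    finally have h: "norm (h \<zeta> x) \<le> (Ch + SB) * \<rho> x" by (simp add: distrib_right)
    \<comment> \<open>Two remainders, each times a bounded factor, and the terms beyond order n in
      the product of the partial sums.\<close>
    have "f \<zeta> x * h \<zeta> x - psum \<zeta> (\<lambda>k. \<Sum>i\<le>k. c i x * d (k - i) x) n
        = (f \<zeta> x - ?F) * h \<zeta> x + ?F * (h \<zeta> x - ?H) + (?F * ?H - psum \<zeta> (\<lambda>k. \<Sum>i\<le>k. c i x * d (k - i) x) n)"
      by (simp add: algebra_simps)
    also have "norm \<dots> \<le> (Cf * ?t * \<omega> x) * ((Ch + SB) * \<rho> x) + (SA * \<omega> x) * (Ch * ?t * \<rho> x)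
        + real ((Suc n)\<^sup>2) * ((SA * \<omega> x) * (SB * \<rho> x)) * ?t"
      by (intro norm_triangle_mono norm_mult_le Cf(2) Ch(2) \<zeta> h F psum_mult[OF z1] Ak Bk)
    also have "\<dots> = C * ?t * (\<omega> x * \<rho> x)" unfolding C_def by (simp only: algebra_simps)
    finally show ?thesis .
  qed
  moreover have "0 \<le> C" unfolding C_def using Cf Ch S0 by simp
  ultimately show "\<exists>C\<ge>0. \<forall>\<zeta> x. 2 \<le> Im \<zeta> \<longrightarrow> norm (f \<zeta> x * h \<zeta> x - psum \<zeta> (\<lambda>k. \<Sum>i\<le>k. c i x * d (k - i) x) n)
      \<le> C * inverse (cmod \<zeta> ^ Suc n) * (\<omega> x * \<rho> x)" by blast
qed

lemma kexp_const:
  assumes b: "continuous_on UNIV b" and "\<And>x. norm (b x) \<le> G * \<omega> x" "\<And>x. 0 \<le> \<omega> x" "0 \<le> G"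
  shows "kexp \<omega> (\<lambda>\<zeta>. b) (\<lambda>n x. if n = 0 then b x else 0)"
proof -
  have p: "psum \<zeta> (\<lambda>k. if k = 0 then b x else 0) n = b x" for \<zeta> n x
    by (induction n) (simp_all add: psum_Suc scaleC.zero_right)
  show ?thesis
  proof (rule kexpI[OF assms(3) b])
    show "continuous_on UNIV (\<lambda>x. if n = (0::nat) then b x else 0)" for n using b by (cases n) auto
    show "\<exists>C\<ge>0. \<forall>x. norm (if n = 0 then b x else 0) \<le> C * \<omega> x" for n :: nat
      using assms by (intro exI[of _ G]) auto
    show "\<exists>C\<ge>0. \<forall>\<zeta> x. 2 \<le> Im \<zeta> \<longrightarrow> norm (b x - psum \<zeta> (\<lambda>k. if k = 0 then b x else 0) n)
        \<le> C * inverse (cmod \<zeta> ^ Suc n) * \<omega> x" for n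
      unfolding p by (intro exI[of _ 0]) simp
  qed
qed

lemma sum_if_0_left: "(\<Sum>k\<le>n. (if k = 0 then b else 0) * d (n - k)) = (b * d (n::nat) :: 'a::semiring_0)"
  by (subst sum_eq_single[where a = 0]) auto

lemma sum_if_0_right: "(\<Sum>k\<le>n. c k * (if n - k = 0 then b else 0)) = (c (n::nat) * b :: 'a::semiring_0)"
  by (subst sum_eq_single[where a = n]) auto

lemma kexp_mult_const:
  assumes f: "kexp \<omega> f c" and b: "continuous_on UNIV b" "\<And>x. norm (b x) \<le> G * \<rho> x" "\<And>x. 0 \<le> \<rho> x" "0 \<le> G"
  shows "kexp (\<lambda>x. \<rho> x * \<omega> x) (\<lambda>\<zeta> x. b x * f \<zeta> x) (\<lambda>n x. b x * c n x)"
    and "kexp (\<lambda>x. \<omega> x * \<rho> x) (\<lambda>\<zeta> x. f \<zeta> x * b x) (\<lambda>n x. c n x * b x)"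
proof -
  have 1: "(\<Sum>k\<le>n. (if k = 0 then b x else 0) * c (n - k) x) = b x * c n x" for n x
    by (rule sum_if_0_left[where d = "\<lambda>k. c k x"])
  have 2: "(\<Sum>k\<le>n. c k x * (if n - k = 0 then b x else 0)) = c n x * b x" for n x
    by (rule sum_if_0_right[where c = "\<lambda>k. c k x"])
  show "kexp (\<lambda>x. \<rho> x * \<omega> x) (\<lambda>\<zeta> x. b x * f \<zeta> x) (\<lambda>n x. b x * c n x)"
    "kexp (\<lambda>x. \<omega> x * \<rho> x) (\<lambda>\<zeta> x. f \<zeta> x * b x) (\<lambda>n x. c n x * b x)"
    using kexp_mult[OF kexp_const[OF b] f] kexp_mult[OF f kexp_const[OF b]] unfolding 1 2 .
qed

lemma kexp_scaleC:
  assumes f: "kexp \<omega> f c" shows "kexp \<omega> (\<lambda>\<zeta> x. z *\<^sub>C f \<zeta> x) (\<lambda>n x. z *\<^sub>C c n x)"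
  using kexp_mult_const(1)[OF f, of "\<lambda>x. z *\<^sub>C 1" "cmod z" "\<lambda>_. 1"]
  by (simp add: scaleC_mult_left norm_scaleC)

lemma kexp_gsign:
  assumes f: "kexp \<omega> f c" shows "kexp \<omega> (\<lambda>\<zeta> x. gsign p * f \<zeta> x) (\<lambda>n x. gsign p * c n x)"
  using kexp_mult_const(1)[OF f, of "\<lambda>x. gsign p" 1 "\<lambda>_. 1"] norm_gsign_mult[of p "1::'a"]
  by simp

lemma kexp_add:
  assumes f: "kexp \<omega> f c" and h: "kexp \<omega> h d"
  shows "kexp \<omega> (\<lambda>\<zeta> x. f \<zeta> x + h \<zeta> x) (\<lambda>n x. c n x + d n x)"
  unfolding kexp_def
proof (intro conjI allI impI)
  show "0 \<le> \<omega> x" for x by (rule kexpD(1)[OF f])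
  show "2 \<le> Im \<zeta> \<Longrightarrow> continuous_on UNIV (\<lambda>x. f \<zeta> x + h \<zeta> x)" for \<zeta>
    by (intro continuous_on_add kexpD(2)[OF f] kexpD(2)[OF h])
  show "continuous_on UNIV (\<lambda>x. c n x + d n x)" for n
    by (intro continuous_on_add kexpD(3)[OF f] kexpD(3)[OF h])
  fix n
  obtain A B where "A \<ge> 0" "\<And>x. norm (c n x) \<le> A * \<omega> x" "B \<ge> 0" "\<And>x. norm (d n x) \<le> B * \<omega> x"
    using kexpD(4)[OF f] kexpD(4)[OF h] by metis
  then show "\<exists>C\<ge>0. \<forall>x. norm (c n x + d n x) \<le> C * \<omega> x"
    by (intro exI[of _ "A + B"]) (auto simp: distrib_right intro!: norm_triangle_mono)
  obtain Cf where Cf: "Cf \<ge> 0" "\<And>\<zeta> x. 2 \<le> Im \<zeta> \<Longrightarrow> norm (f \<zeta> x - psum \<zeta> (\<lambda>k. c k x) n) \<le> Cf * inverse (cmod \<zeta> ^ Suc n) * \<omega> x"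
    using kexpD(5)[OF f, of n] by blast
  obtain Ch where Ch: "Ch \<ge> 0" "\<And>\<zeta> x. 2 \<le> Im \<zeta> \<Longrightarrow> norm (h \<zeta> x - psum \<zeta> (\<lambda>k. d k x) n) \<le> Ch * inverse (cmod \<zeta> ^ Suc n) * \<omega> x"
    using kexpD(5)[OF h, of n] by blast
  show "\<exists>C\<ge>0. \<forall>\<zeta> x. 2 \<le> Im \<zeta> \<longrightarrow> norm (f \<zeta> x + h \<zeta> x - psum \<zeta> (\<lambda>k. c k x + d k x) n) \<le> C * inverse (cmod \<zeta> ^ Suc n) * \<omega> x"
  proof (intro exI[of _ "Cf + Ch"] conjI allI impI)
    fix \<zeta> x assume \<zeta>: "2 \<le> Im \<zeta>"
    show "norm (f \<zeta> x + h \<zeta> x - psum \<zeta> (\<lambda>k. c k x + d k x) n) \<le> (Cf + Ch) * inverse (cmod \<zeta> ^ Suc n) * \<omega> x"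
      using norm_triangle_mono[OF Cf(2)[OF \<zeta>, of x] Ch(2)[OF \<zeta>, of x]]
      by (simp add: psum_linear add_diff_add distrib_right)
  qed (use Cf Ch in simp)
qed

lemma kexp_sum:
  assumes "finite J" "\<And>j. j \<in> J \<Longrightarrow> kexp \<omega> (f j) (c j)" "\<And>x. 0 \<le> \<omega> x"
  shows "kexp \<omega> (\<lambda>\<zeta> x. \<Sum>j\<in>J. f j \<zeta> x) (\<lambda>n x. \<Sum>j\<in>J. c j n x)"
  using assms(1,2)
proof (induction J rule: finite_induct)
  case empty
  show ?case using kexp_const[of "\<lambda>x. 0" 0 \<omega>] assms(3) by simp
next
  case (insert j J)
  then show ?case by (simp add: kexp_add)
qed

lemma kexp_diff:
  assumes "kexp \<omega> f c" "kexp \<omega> h d"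
  shows "kexp \<omega> (\<lambda>\<zeta> x. f \<zeta> x - h \<zeta> x) (\<lambda>n x. c n x - d n x)"
  using kexp_add[OF assms(1) kexp_scaleC[OF assms(2), of "- 1"]] by (simp add: scaleC_minus1)

text \<open>Integrating the uniform remainder against the weight shows that the integrals of the
  coefficients also form an expansion of \<open>v\<close>; \<open>psum_unique\<close> identifies it
  with the given one.\<close>

lemma kexp_integral:
  assumes f: "kexp wt1 f c" and v: "\<And>\<zeta>. 2 \<le> Im \<zeta> \<Longrightarrow> (f \<zeta> has_integral v \<zeta>) UNIV"
    and e: "\<And>n. \<exists>C. \<forall>\<zeta>. 2 \<le> Im \<zeta> \<longrightarrow> norm (v \<zeta> - psum \<zeta> d n) \<le> C * inverse (cmod \<zeta> ^ Suc n)"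
  shows "(c n has_integral d n) UNIV"
proof -
  have i: "(c k has_integral integral UNIV (c k)) UNIV" for k
  proof -
    obtain C where "\<And>x. norm (c k x) \<le> C * wt1 x" using kexpD(4)[OF f] by blast
    from integral_dominated_wt(1)[OF kexpD(3)[OF f] this] show ?thesis .
  qed
  define a where "a k = integral UNIV (c k) - d k" for k
  have "a n = 0"
  proof (rule psum_unique)
    fix n
    obtain C where C: "\<And>\<zeta> x. 2 \<le> Im \<zeta> \<Longrightarrow> norm (f \<zeta> x - psum \<zeta> (\<lambda>k. c k x) n) \<le> C * inverse (cmod \<zeta> ^ Suc n) * wt1 x"
      using kexpD(5)[OF f, of n] by blast
    obtain D where D: "\<And>\<zeta>. 2 \<le> Im \<zeta> \<Longrightarrow> norm (v \<zeta> - psum \<zeta> d n) \<le> D * inverse (cmod \<zeta> ^ Suc n)" using e[of n] by blast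
    have "norm (psum \<zeta> a n) \<le> (D + C * pi) * inverse (cmod \<zeta> ^ Suc n)" if \<zeta>: "2 \<le> Im \<zeta>" for \<zeta>
    proof -
      let ?r = "\<lambda>x. f \<zeta> x - psum \<zeta> (\<lambda>k. c k x) n"
      have "((\<lambda>x. psum \<zeta> (\<lambda>k. c k x) n) has_integral psum \<zeta> (\<lambda>k. integral UNIV (c k)) n) UNIV"
        unfolding psum_def
        by (intro has_integral_sum finite_atMost has_integral_linear[OF i scaleC.bounded_linear_right, unfolded o_def])
      then have "(?r has_integral (v \<zeta> - psum \<zeta> (\<lambda>k. integral UNIV (c k)) n)) UNIV"
        by (intro has_integral_diff v \<zeta>)
      then have I: "integral UNIV ?r = v \<zeta> - psum \<zeta> (\<lambda>k. integral UNIV (c k)) n" by (rule integral_unique)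
      have "continuous_on UNIV ?r" unfolding psum_def
        by (intro continuous_on_diff continuous_on_sum kexpD(2)[OF f \<zeta>] scaleC.continuous_on continuous_on_const kexpD(3)[OF f])
      from integral_dominated_wt(2)[OF this C[OF \<zeta>]]
      have "norm (v \<zeta> - psum \<zeta> (\<lambda>k. integral UNIV (c k)) n) \<le> C * inverse (cmod \<zeta> ^ Suc n) * pi" unfolding I .
      moreover have "psum \<zeta> a n = (v \<zeta> - psum \<zeta> d n) - (v \<zeta> - psum \<zeta> (\<lambda>k. integral UNIV (c k)) n)"
        unfolding a_def psum_linear by simp
      ultimately have "norm (psum \<zeta> a n) \<le> D * inverse (cmod \<zeta> ^ Suc n) + C * inverse (cmod \<zeta> ^ Suc n) * pi"
        using norm_triangle_ineq4[of "v \<zeta> - psum \<zeta> d n" "v \<zeta> - psum \<zeta> (\<lambda>k. integral UNIV (c k)) n"] D[OF \<zeta>] by simp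
      then show ?thesis by (simp only: algebra_simps)
    qed
    then show "\<exists>C. \<forall>\<zeta>. 2 \<le> Im \<zeta> \<longrightarrow> norm (psum \<zeta> a n) \<le> C * inverse (cmod \<zeta> ^ Suc n)" by blast
  qed
  then show ?thesis using i[of n] by (simp add: a_def)
qed

context super_nls begin

section \<open>The remainder of the formal series for the last column\<close>

lemma cd_ik: "cd \<zeta> m e = \<zeta> * ik e"
  by (simp add: cd_def ik_def sg_def)

text \<open>Multiplication by \<zeta> shifts the orders. The leftover of order n is what remains as
  source term in \<open>remainder_deriv\<close>.\<close>

lemma psum_telescope:
  fixes c :: "nat \<Rightarrow> 'a::banach_superalgebra"
  assumes "\<zeta> \<noteq> 0"
  shows "psum \<zeta> (\<lambda>k. c (Suc k)) n = \<zeta> *\<^sub>C psum \<zeta> c n - \<zeta> *\<^sub>C c 0 + inverse (\<zeta> ^ n) *\<^sub>C c (Suc n)"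
proof (induction n)
  case (Suc n)
  have "\<zeta> * inverse (\<zeta> ^ Suc n) = inverse (\<zeta> ^ n)" using assms by simp
  then have 1: "\<zeta> *\<^sub>C inverse (\<zeta> ^ Suc n) *\<^sub>C v = inverse (\<zeta> ^ n) *\<^sub>C v" for v :: 'a by (simp only: scaleC_scaleC)
  show ?case unfolding psum_Suc Suc scaleC_add_right 1 by (simp add: algebra_simps)
qed simp

context
  fixes \<psi> :: "'a::banach_superalgebra config"
  assumes \<psi>: "\<psi> \<in> fields M N"
begin

text \<open>The recursion for \<open>coef\<close> makes the truncated series solve the equation
  except for one term of the last order, which drives the remainder.\<close>

lemma remainder_deriv:
  fixes \<zeta> :: complex and n :: nat
  assumes "0 \<le> Im \<zeta>" "\<zeta> \<noteq> 0" and e: "e \<in> I"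
  defines "Z \<equiv> \<lambda>x e. jcol \<zeta> m \<psi> x e - psum \<zeta> (\<lambda>k. coef \<psi> k x e) n"
  shows "((\<lambda>s. Z s e) has_vector_derivative cd \<zeta> m e *\<^sub>C Z x e + ((\<Sum>f\<in>I. Om \<psi> x e f * Z x f)
      + - ((ik e * inverse (\<zeta> ^ n)) *\<^sub>C coef \<psi> (Suc n) x e))) (at x)"
proof -
  have good: "good \<zeta> m" using assms(1) by (simp add: good_def)
  let ?P = "\<lambda>x e. psum \<zeta> (\<lambda>k. coef \<psi> k x e) n"
  have "((\<lambda>s. ?P s e) has_vector_derivative psum \<zeta> (\<lambda>k. ik e *\<^sub>C coef \<psi> (Suc k) x e + (\<Sum>f\<in>I. Om \<psi> x e f * coef \<psi> k x f)) n) (at x)"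
    unfolding psum_def
    by (intro has_vector_derivative_sum
        bounded_linear.has_vector_derivative[OF scaleC.bounded_linear_right] coef_deriv[OF \<psi> e])
  also have "psum \<zeta> (\<lambda>k. ik e *\<^sub>C coef \<psi> (Suc k) x e + (\<Sum>f\<in>I. Om \<psi> x e f * coef \<psi> k x f)) n
      = cd \<zeta> m e *\<^sub>C ?P x e + (ik e * inverse (\<zeta> ^ n)) *\<^sub>C coef \<psi> (Suc n) x e + (\<Sum>f\<in>I. Om \<psi> x e f * ?P x f)"
  proof -
    have z: "ik e *\<^sub>C \<zeta> *\<^sub>C coef \<psi> 0 x e = 0" by (simp add: ik_def mone_def scaleC.zero_left scaleC.zero_right)
    have "ik e *\<^sub>C psum \<zeta> (\<lambda>k. coef \<psi> (Suc k) x e) n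
        = (ik e * \<zeta>) *\<^sub>C ?P x e - ik e *\<^sub>C \<zeta> *\<^sub>C coef \<psi> 0 x e + (ik e * inverse (\<zeta> ^ n)) *\<^sub>C coef \<psi> (Suc n) x e"
      unfolding psum_telescope[OF assms(2), of "\<lambda>k. coef \<psi> k x e" n]
      by (simp only: scaleC_add_right scaleC.diff_right scaleC_scaleC)
    then show ?thesis unfolding psum_linear z cd_ik by (simp add: mult.commute del: coef.simps)
  qed
  finally have P: "((\<lambda>s. ?P s e) has_vector_derivative cd \<zeta> m e *\<^sub>C ?P x e
      + (ik e * inverse (\<zeta> ^ n)) *\<^sub>C coef \<psi> (Suc n) x e + (\<Sum>f\<in>I. Om \<psi> x e f * ?P x f)) (at x)" .
  show ?thesis unfolding Z_def
    by (rule has_vector_derivative_eq_rhs[OF has_vector_derivative_diff[OF jcol_deriv[OF \<psi> good m_in e] P]])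
      (simp only: right_diff_distrib sum_subtractf scaleC.diff_right, simp only: algebra_simps add_minus_cancel)
qed

lemma remainder_bot:
  assumes "0 \<le> Im \<zeta>" and e: "e \<in> I"
  shows "((\<lambda>x. jcol \<zeta> m \<psi> x e - psum \<zeta> (\<lambda>k. coef \<psi> k x e) n) \<longlongrightarrow> 0) at_bot"
proof -
  have good: "good \<zeta> m" using assms(1) by (simp add: good_def)
  have "((\<lambda>x. psum \<zeta> (\<lambda>k. coef \<psi> k x e) n) \<longlongrightarrow> psum \<zeta> (\<lambda>k. if k = 0 then mone e m else 0) n) at_bot"
    unfolding psum_def by (intro tendsto_sum scaleC.tendsto tendsto_const coef_bot[OF \<psi> e])
  moreover have "psum \<zeta> (\<lambda>k. if k = 0 then b else 0) n = b" for b :: 'a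
    by (induction n) (simp_all add: psum_Suc scaleC.zero_right)
  ultimately show ?thesis using tendsto_diff[OF jcol_bot[OF \<psi> good m_in e]] by fastforce
qed

lemma remainder_bound_aux:
  "\<exists>C\<ge>0. \<forall>\<zeta> x. \<forall>e\<in>I. 0 \<le> Im \<zeta> \<longrightarrow> \<zeta> \<noteq> 0 \<longrightarrow>
    norm (jcol \<zeta> m \<psi> x e - psum \<zeta> (\<lambda>k. coef \<psi> k x e) n) \<le> C * inverse (cmod \<zeta> ^ n)"
proof -
  obtain B where B: "bnd B \<psi>" using fields_bnd[OF \<psi>] .
  obtain b where b: "b \<ge> 0" "\<And>x j. j \<in> K \<Longrightarrow> norm (coef \<psi> (Suc n) x j) \<le> b * wt1 x" using coef_bd[OF \<psi>, of "Suc n"] by blast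
  have "norm (jcol \<zeta> m \<psi> x e - psum \<zeta> (\<lambda>k. coef \<psi> k x e) n) \<le> Gc B * (b * inverse (cmod \<zeta> ^ n) * pi)"
    if e: "e \<in> I" and \<zeta>: "0 \<le> Im \<zeta>" "\<zeta> \<noteq> 0" for \<zeta> x e
  proof -
    have good: "good \<zeta> m" using \<zeta> by (simp add: good_def)
    show ?thesis unfolding Gc_def
    proof (rule jsys.gronwall_from_bot[OF jsys_Om[OF \<psi> good B] e,
          where Z = "\<lambda>x e. jcol \<zeta> m \<psi> x e - psum \<zeta> (\<lambda>k. coef \<psi> k x e) n"
            and r = "\<lambda>x e. - ((ik e * inverse (\<zeta> ^ n)) *\<^sub>C coef \<psi> (Suc n) x e)"])
      fix e s assume e: "e \<in> I"
      show "norm (- ((ik e * inverse (\<zeta> ^ n)) *\<^sub>C coef \<psi> (Suc n) s e)) \<le> b * inverse (cmod \<zeta> ^ n) * wt1 s"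
      proof (cases "e = m")
        case True
        have "0 \<le> b * inverse (cmod \<zeta> ^ n) * wt1 s" using b wt_nonneg by simp
        then show ?thesis using True by (simp add: ik_def scaleC.zero_left)
      next
        case False
        then have "e \<in> K" using e I_cases by blast
        from mult_left_mono[OF b(2)[OF this, of s], of "inverse (cmod \<zeta> ^ n)"] False show ?thesis
          by (simp add: ik_def norm_scaleC norm_mult norm_inverse norm_power mult_ac del: coef.simps)
      qed
    qed (rule remainder_deriv[OF \<zeta>] remainder_bot[OF \<zeta>(1)]; assumption)+
  qed
  moreover have "0 \<le> Gc B * (b * pi)" using b gron_pos[of "real (card I) * (sqrt g * B)"] by (simp add: Gc_def)
  ultimately show ?thesis by (intro exI[of _ "Gc B * (b * pi)"]) (simp add: mult_ac)
qed

text \<open>\<open>remainder_bound_aux\<close> is one power short, because its source term has only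
  order n in \<open>inverse \<zeta>\<close>. Applying it at order n + 1 and estimating the extra
  term of the sum recovers the power.\<close>

lemma remainder_bound:
  "\<exists>C\<ge>0. \<forall>\<zeta> x. \<forall>e\<in>I. 0 \<le> Im \<zeta> \<longrightarrow> \<zeta> \<noteq> 0 \<longrightarrow>
    norm (jcol \<zeta> m \<psi> x e - psum \<zeta> (\<lambda>k. coef \<psi> k x e) n) \<le> C * inverse (cmod \<zeta> ^ Suc n)"
proof -
  obtain C where C: "C \<ge> 0" "\<And>\<zeta> x e. e \<in> I \<Longrightarrow> 0 \<le> Im \<zeta> \<Longrightarrow> \<zeta> \<noteq> 0 \<Longrightarrow>
    norm (jcol \<zeta> m \<psi> x e - psum \<zeta> (\<lambda>k. coef \<psi> k x e) (Suc n)) \<le> C * inverse (cmod \<zeta> ^ Suc n)"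
    using remainder_bound_aux[of "Suc n"] by blast
  obtain b where b: "b \<ge> 0" "\<And>x. norm (coef \<psi> (Suc n) x m) \<le> b"
    "\<And>x j. j \<in> K \<Longrightarrow> norm (coef \<psi> (Suc n) x j) \<le> b * wt1 x" using coef_bd[OF \<psi>, of "Suc n"] by blast
  have cb: "norm (coef \<psi> (Suc n) x e) \<le> b" if e: "e \<in> I" for x e
  proof (cases "e = m")
    case False
    then have "e \<in> K" using e I_cases by blast
    then show ?thesis using b(3)[of e x] mult_left_mono[OF wt_le_1[of 1 x] b(1)] by simp
  qed (use b(2) in simp)
  have "norm (jcol \<zeta> m \<psi> x e - psum \<zeta> (\<lambda>k. coef \<psi> k x e) n) \<le> (C + b) * inverse (cmod \<zeta> ^ Suc n)"
    if "e \<in> I" "0 \<le> Im \<zeta>" "\<zeta> \<noteq> 0" for \<zeta> x e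
  proof -
    have "jcol \<zeta> m \<psi> x e - psum \<zeta> (\<lambda>k. coef \<psi> k x e) n = (jcol \<zeta> m \<psi> x e - psum \<zeta> (\<lambda>k. coef \<psi> k x e) (Suc n))
        + inverse (\<zeta> ^ Suc n) *\<^sub>C coef \<psi> (Suc n) x e" unfolding psum_Suc by simp
    also have "norm \<dots> \<le> C * inverse (cmod \<zeta> ^ Suc n) + inverse (cmod \<zeta> ^ Suc n) * b"
      unfolding norm_scaleC norm_inverse norm_power
      by (intro norm_triangle_mono C that) (simp add: norm_scaleC norm_inverse norm_power cb[OF that(1)] mult_left_mono del: coef.simps power_Suc)
    finally show ?thesis by (simp add: algebra_simps)
  qed
  then show ?thesis using C(1) b(1) by (intro exI[of _ "C + b"]) simp
qed

text \<open>For \<open>2 \<le> Im \<zeta>\<close> the damping \<open>Im \<zeta>\<close> of the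
  components in \<open>K\<close> is at least 2, so \<open>fast_bound\<close> applies with parameter
  1 and yields the weight \<open>wt1\<close> itself. This is the origin of the threshold 2.\<close>

lemma remainder_fast_aux:
  "\<exists>C\<ge>0. \<forall>\<zeta> x. \<forall>e\<in>K. 2 \<le> Im \<zeta> \<longrightarrow>
    norm (jcol \<zeta> m \<psi> x e - psum \<zeta> (\<lambda>k. coef \<psi> k x e) n) \<le> C * inverse (cmod \<zeta> ^ n) * wt1 x"
proof -
  obtain B where B: "bnd B \<psi>" using fields_bnd[OF \<psi>] .
  obtain b where b: "b \<ge> 0" "\<And>x j. j \<in> K \<Longrightarrow> norm (coef \<psi> (Suc n) x j) \<le> b * wt1 x" using coef_bd[OF \<psi>, of "Suc n"] by blast
  obtain C where C: "C \<ge> 0" "\<And>\<zeta> x e. e \<in> I \<Longrightarrow> 0 \<le> Im \<zeta> \<Longrightarrow> \<zeta> \<noteq> 0 \<Longrightarrow>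
    norm (jcol \<zeta> m \<psi> x e - psum \<zeta> (\<lambda>k. coef \<psi> k x e) n) \<le> C * inverse (cmod \<zeta> ^ n)"
    using remainder_bound_aux[of n] by blast
  define D where "D = real (card I) * (sqrt g * B * C) + b"
  have D0: "D \<ge> 0" using B C b g_pos by (simp add: D_def bnd_def)
  have "norm (jcol \<zeta> m \<psi> x e - psum \<zeta> (\<lambda>k. coef \<psi> k x e) n) \<le> D * inverse (cmod \<zeta> ^ n) / 1 * wt1 x"
    if e: "e \<in> K" and \<zeta>: "2 \<le> Im \<zeta>" for \<zeta> x e
  proof (rule fast_bound[OF remainder_deriv remainder_bot])
    show "0 \<le> Im \<zeta>" "0 \<le> Im \<zeta>" "\<zeta> \<noteq> 0" using \<zeta> by auto
    show "e \<in> I" "e \<in> I" by (rule K_I[OF e])+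
    show "2 * 1 \<le> - Re (cd \<zeta> m e)" using \<zeta> K_ne_m[OF e] unfolding cd_ik by (simp add: ik_def)
    fix s
    have "norm (- ((ik e * inverse (\<zeta> ^ n)) *\<^sub>C coef \<psi> (Suc n) s e)) \<le> inverse (cmod \<zeta> ^ n) * (b * wt1 s)"
      using mult_left_mono[OF b(2)[OF e, of s], of "inverse (cmod \<zeta> ^ n)"] K_ne_m[OF e]
      by (simp add: ik_def norm_scaleC norm_mult norm_inverse norm_power del: coef.simps)
    moreover have "norm (\<Sum>f\<in>I. Om \<psi> s e f * (jcol \<zeta> m \<psi> s f - psum \<zeta> (\<lambda>k. coef \<psi> k s f) n))
        \<le> (\<Sum>f\<in>I. sqrt g * B * wt1 s * (C * inverse (cmod \<zeta> ^ n)))"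
      using \<zeta> by (intro sum_norm_le norm_mult_le Om_bd B C(2)) auto
    ultimately have "norm ((\<Sum>f\<in>I. Om \<psi> s e f * (jcol \<zeta> m \<psi> s f - psum \<zeta> (\<lambda>k. coef \<psi> k s f) n))
        + - ((ik e * inverse (\<zeta> ^ n)) *\<^sub>C coef \<psi> (Suc n) s e))
      \<le> (\<Sum>f\<in>I. sqrt g * B * wt1 s * (C * inverse (cmod \<zeta> ^ n))) + inverse (cmod \<zeta> ^ n) * (b * wt1 s)"
      by (intro norm_triangle_mono)
    also have "\<dots> = D * inverse (cmod \<zeta> ^ n) * wt1 s" by (simp add: D_def algebra_simps)
    finally show "norm ((\<Sum>f\<in>I. Om \<psi> s e f * (jcol \<zeta> m \<psi> s f - psum \<zeta> (\<lambda>k. coef \<psi> k s f) n))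
        + - ((ik e * inverse (\<zeta> ^ n)) *\<^sub>C coef \<psi> (Suc n) s e)) \<le> \<dots>" .
  qed auto
  then show ?thesis using D0 by (intro exI[of _ D]) simp
qed

lemma kexp_jcol:
  shows "kexp (\<lambda>_. 1) (\<lambda>\<zeta> x. jcol \<zeta> m \<psi> x m) (\<lambda>n x. coef \<psi> n x m)"
    and "j \<in> K \<Longrightarrow> kexp wt1 (\<lambda>\<zeta> x. jcol \<zeta> m \<psi> x j) (\<lambda>n x. coef \<psi> n x j)"
proof -
  have good: "good \<zeta> m" if "2 \<le> Im \<zeta>" for \<zeta> using that by (simp add: good_def)
  have c: "2 \<le> Im \<zeta> \<Longrightarrow> e \<in> I \<Longrightarrow> continuous_on UNIV (\<lambda>x. jcol \<zeta> m \<psi> x e)" for \<zeta> e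
    by (rule jcol_cont[OF \<psi> good m_in])
  have "\<exists>C\<ge>0. \<forall>\<zeta> x. 2 \<le> Im \<zeta> \<longrightarrow> norm (jcol \<zeta> m \<psi> x m - psum \<zeta> (\<lambda>k. coef \<psi> k x m) n) \<le> C * inverse (cmod \<zeta> ^ Suc n) * 1" for n
  proof -
    obtain C where C: "C \<ge> 0" "\<And>\<zeta> x e. e \<in> I \<Longrightarrow> 0 \<le> Im \<zeta> \<Longrightarrow> \<zeta> \<noteq> 0 \<Longrightarrow>
      norm (jcol \<zeta> m \<psi> x e - psum \<zeta> (\<lambda>k. coef \<psi> k x e) n) \<le> C * inverse (cmod \<zeta> ^ Suc n)"
      using remainder_bound[of n] by blast
    have "norm (jcol \<zeta> m \<psi> x m - psum \<zeta> (\<lambda>k. coef \<psi> k x m) n) \<le> C * inverse (cmod \<zeta> ^ Suc n) * 1" if "2 \<le> Im \<zeta>" for \<zeta> x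
      unfolding mult_1_right by (rule C(2)[OF m_in]) (use that in auto)
    then show ?thesis using C(1) by blast
  qed
  moreover have "\<exists>C\<ge>0. \<forall>x. norm (coef \<psi> n x m) \<le> C * 1" for n using coef_bd[OF \<psi>, of n] by auto
  ultimately show "kexp (\<lambda>_. 1) (\<lambda>\<zeta> x. jcol \<zeta> m \<psi> x m) (\<lambda>n x. coef \<psi> n x m)"
    by (intro kexpI c[OF _ m_in] coef_cont[OF \<psi> m_in]) auto
  assume j: "j \<in> K"
  have "\<exists>C\<ge>0. \<forall>\<zeta> x. 2 \<le> Im \<zeta> \<longrightarrow> norm (jcol \<zeta> m \<psi> x j - psum \<zeta> (\<lambda>k. coef \<psi> k x j) n) \<le> C * inverse (cmod \<zeta> ^ Suc n) * wt1 x" for n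
  proof -
    obtain C where C: "C \<ge> 0" "\<And>\<zeta> x. 2 \<le> Im \<zeta> \<Longrightarrow>
      norm (jcol \<zeta> m \<psi> x j - psum \<zeta> (\<lambda>k. coef \<psi> k x j) (Suc n)) \<le> C * inverse (cmod \<zeta> ^ Suc n) * wt1 x"
      using remainder_fast_aux[of "Suc n"] j by blast
    obtain b where b: "b \<ge> 0" "\<And>x. norm (coef \<psi> (Suc n) x j) \<le> b * wt1 x"
      using coef_bd[OF \<psi>, of "Suc n"] j by blast
    have "norm (jcol \<zeta> m \<psi> x j - psum \<zeta> (\<lambda>k. coef \<psi> k x j) n) \<le> (C + b) * inverse (cmod \<zeta> ^ Suc n) * wt1 x"
      if "2 \<le> Im \<zeta>" for \<zeta> x
    proof -
      have "jcol \<zeta> m \<psi> x j - psum \<zeta> (\<lambda>k. coef \<psi> k x j) n = (jcol \<zeta> m \<psi> x j - psum \<zeta> (\<lambda>k. coef \<psi> k x j) (Suc n))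
          + inverse (\<zeta> ^ Suc n) *\<^sub>C coef \<psi> (Suc n) x j" unfolding psum_Suc by simp
      also have "norm \<dots> \<le> C * inverse (cmod \<zeta> ^ Suc n) * wt1 x + inverse (cmod \<zeta> ^ Suc n) * (b * wt1 x)"
        by (intro norm_triangle_mono C that) (simp add: norm_scaleC norm_inverse norm_power b mult_left_mono del: coef.simps power_Suc)
      finally show ?thesis by (simp add: algebra_simps)
    qed
    then show ?thesis using C(1) b(1) by (intro exI[of _ "C + b"]) simp
  qed
  moreover have "\<exists>C\<ge>0. \<forall>x. norm (coef \<psi> n x j) \<le> C * wt1 x" for n using coef_bd[OF \<psi>, of n] j by blast
  ultimately show "kexp wt1 (\<lambda>\<zeta> x. jcol \<zeta> m \<psi> x j) (\<lambda>n x. coef \<psi> n x j)"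
    by (intro kexpI wt_nonneg c[OF _ K_I[OF j]] coef_cont[OF \<psi> K_I[OF j]])
qed

end

end

section \<open>The Hamiltonians generated by \<open>D\<close>\<close>

lemma uhp_infinity_neq_bot: "uhp_infinity \<noteq> bot"
proof
  assume "uhp_infinity = bot"
  then have "\<forall>\<^sub>F \<zeta> in at_infinity. 0 \<le> Im \<zeta> \<longrightarrow> False"
    using eventually_inf_principal[of "\<lambda>_. False" at_infinity "{\<zeta>. 0 \<le> Im \<zeta>}"]
    by (simp add: uhp_infinity_def trivial_limit_def)
  then obtain b where b: "\<And>\<zeta>::complex. b \<le> norm \<zeta> \<Longrightarrow> \<not> 0 \<le> Im \<zeta>" by (auto simp: eventually_at_infinity)
  show False using b[of "\<i> * complex_of_real \<bar>b\<bar>"] abs_ge_self[of b] by (simp add: norm_mult)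
qed

lemma eventually_uhp_infinity: "\<forall>\<^sub>F \<zeta> in uhp_infinity. 0 \<le> Im \<zeta> \<and> \<zeta> \<noteq> 0"
  unfolding uhp_infinity_def eventually_inf_principal eventually_at_infinity by (intro exI[of _ 1]) auto

text \<open>Makes the definite description in \<open>D_coeff\<close> meaningful. Multiplying the
  difference of both expansions by \<open>\<zeta> ^ n\<close> isolates the first coefficient in
  which they could differ.\<close>

lemma has_inverse_expansion_unique:
  fixes f :: "complex \<Rightarrow> 'a::banach_superalgebra"
  assumes d: "has_inverse_expansion f d" and d': "has_inverse_expansion f d'"
  shows "d = d'"
proof
  fix n
  show "d n = d' n"
  proof (induction n rule: less_induct)
    case (less n)
    have "((\<lambda>\<zeta>. \<zeta> ^ n *\<^sub>C (f \<zeta> - psum \<zeta> d n) - \<zeta> ^ n *\<^sub>C (f \<zeta> - psum \<zeta> d' n)) \<longlongrightarrow> 0 - 0) uhp_infinity"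
      using d d' unfolding has_inverse_expansion_def psum_def by (intro tendsto_diff) blast+
    moreover have "\<forall>\<^sub>F \<zeta> in uhp_infinity. \<zeta> ^ n *\<^sub>C (f \<zeta> - psum \<zeta> d n) - \<zeta> ^ n *\<^sub>C (f \<zeta> - psum \<zeta> d' n) = d' n - d n"
      using eventually_uhp_infinity
    proof eventually_elim
      case (elim \<zeta>)
      have "psum \<zeta> d' n - psum \<zeta> d n = psum \<zeta> (\<lambda>k. d' k - d k) n" by (simp add: psum_linear)
      also have "\<dots> = inverse (\<zeta> ^ n) *\<^sub>C (d' n - d n)"
        unfolding psum_def by (subst sum_eq_single[where a = n]) (auto simp: less scaleC.zero_right)
      finally have "\<zeta> ^ n *\<^sub>C (psum \<zeta> d' n - psum \<zeta> d n) = d' n - d n"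
        using elim by (simp add: scaleC_scaleC)
      then show ?case by (simp add: scaleC.diff_right[symmetric])
    qed
    ultimately have "((\<lambda>\<zeta>. d' n - d n) \<longlongrightarrow> 0) uhp_infinity" using Lim_transform_eventually by fastforce
    then have "d' n - d n = 0" using tendsto_const_iff[OF uhp_infinity_neq_bot] by blast
    then show ?case by simp
  qed
qed

text \<open>The conjugate of \<open>(- cnj \<zeta>) ^ k\<close> is \<open>(- \<zeta>) ^ k\<close>,
  whence the alternating sign.\<close>

lemma psum_adj: "(psum (- cnj \<zeta>) c n)\<^sup>\<dagger> = psum \<zeta> (\<lambda>k. ((- 1) ^ k) *\<^sub>C (c k)\<^sup>\<dagger>) n"
proof -
  have "cnj (inverse ((- cnj \<zeta>) ^ k)) = inverse (\<zeta> ^ k) * (- 1) ^ k" for k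
  proof -
    have "cnj (inverse ((- cnj \<zeta>) ^ k)) = inverse ((- \<zeta>) ^ k)" by simp
    also have "\<dots> = inverse (\<zeta> ^ k) * (- 1) ^ k"
      by (subst power_minus) (simp add: power_inverse[symmetric])
    finally show ?thesis .
  qed
  then show ?thesis by (simp add: psum_def adj_sum adj_scaleC scaleC_scaleC)
qed

lemma kexp_adj_reflect:
  assumes f: "kexp \<omega> f c" and even: "\<And>x. \<omega> (- x) = \<omega> x"
  shows "kexp \<omega> (\<lambda>\<zeta> x. (f (- cnj \<zeta>) (- x))\<^sup>\<dagger>) (\<lambda>n x. ((- 1) ^ n) *\<^sub>C (c n (- x))\<^sup>\<dagger>)"
proof (rule kexpI)
  have cont: "continuous_on UNIV (\<lambda>x. (h (- x))\<^sup>\<dagger>)" if "continuous_on UNIV h" for h :: "real \<Rightarrow> 'a"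
    by (intro adj_continuous_on continuous_on_compose2[OF that] continuous_intros) auto
  show "0 \<le> \<omega> x" for x by (rule kexpD(1)[OF f])
  show "2 \<le> Im \<zeta> \<Longrightarrow> continuous_on UNIV (\<lambda>x. (f (- cnj \<zeta>) (- x))\<^sup>\<dagger>)" for \<zeta>
    by (intro cont kexpD(2)[OF f]) simp
  fix n
  show "continuous_on UNIV (\<lambda>x. ((- 1) ^ n) *\<^sub>C (c n (- x))\<^sup>\<dagger>)"
    by (intro scaleC.continuous_on continuous_on_const cont kexpD(3)[OF f])
  obtain C where C: "C \<ge> 0" "\<And>x. norm (c n x) \<le> C * \<omega> x" using kexpD(4)[OF f] by blast
  have "norm (((- 1) ^ n) *\<^sub>C (c n (- x))\<^sup>\<dagger>) \<le> C * \<omega> x" for x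
    using C(2)[of "- x"] by (simp add: norm_scaleC norm_power norm_adj even)
  then show "\<exists>C\<ge>0. \<forall>x. norm (((- 1) ^ n) *\<^sub>C (c n (- x))\<^sup>\<dagger>) \<le> C * \<omega> x"
    using C(1) by blast
  obtain D where D: "D \<ge> 0" "\<And>\<zeta> x. 2 \<le> Im \<zeta> \<Longrightarrow> norm (f \<zeta> x - psum \<zeta> (\<lambda>k. c k x) n) \<le> D * inverse (cmod \<zeta> ^ Suc n) * \<omega> x"
    using kexpD(5)[OF f, of n] by blast
  have "norm ((f (- cnj \<zeta>) (- x))\<^sup>\<dagger> - psum \<zeta> (\<lambda>k. ((- 1) ^ k) *\<^sub>C (c k (- x))\<^sup>\<dagger>) n) \<le> D * inverse (cmod \<zeta> ^ Suc n) * \<omega> x"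
    if "2 \<le> Im \<zeta>" for \<zeta> x
    using D(2)[of "- cnj \<zeta>" "- x"] that unfolding psum_adj[symmetric] adj_diff[symmetric] norm_adj even by simp
  then show "\<exists>C\<ge>0. \<forall>\<zeta> x. 2 \<le> Im \<zeta> \<longrightarrow> norm ((f (- cnj \<zeta>) (- x))\<^sup>\<dagger> - psum \<zeta> (\<lambda>k. ((- 1) ^ k) *\<^sub>C (c k (- x))\<^sup>\<dagger>) n)
      \<le> C * inverse (cmod \<zeta> ^ Suc n) * \<omega> x" using D(1) by blast
qed

lemma smooth_fam_lipschitz:
  "smooth_fam (\<lambda>_. 1) F \<Longrightarrow> \<exists>C\<ge>0. \<forall>\<epsilon> x. \<bar>\<epsilon>\<bar> \<le> 1 \<longrightarrow> norm (F \<epsilon> x - F 0 x) \<le> C * \<bar>\<epsilon>\<bar>"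
  by (drule smooth_fam_bd) (auto simp: fam_bd_def)

section \<open>The coefficients of D as functionals, their gradients and brackets\<close>

context super_nls begin

definition Dl :: "'a::banach_superalgebra config \<Rightarrow> nat \<Rightarrow> 'a" where
  "Dl \<psi> n = Lim at_top (\<lambda>x. coef \<psi> n x m)"

lemma coef_Dl: "\<psi> \<in> fields M N \<Longrightarrow> ((\<lambda>x. coef \<psi> n x m) \<longlongrightarrow> Dl \<psi> n) at_top"
  using coef_top[of \<psi> n] tendsto_Lim[OF trivial_limit_at_top_linorder] unfolding Dl_def by blast

text \<open>The remainder bound for the Jost solution is uniform in \<open>x\<close> and therefore
  passes to the limit at + infinity.\<close>

lemma Tm_expansion:
  assumes \<psi>: "\<psi> \<in> fields M N"
  shows "\<exists>C. \<forall>\<zeta>. 0 \<le> Im \<zeta> \<longrightarrow> \<zeta> \<noteq> 0 \<longrightarrow> norm (Tm \<zeta> m m \<psi> - psum \<zeta> (Dl \<psi>) n) \<le> C * inverse (cmod \<zeta> ^ Suc n)"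
proof -
  obtain C where C: "\<And>\<zeta> x e. e \<in> I \<Longrightarrow> 0 \<le> Im \<zeta> \<Longrightarrow> \<zeta> \<noteq> 0 \<Longrightarrow>
    norm (jcol \<zeta> m \<psi> x e - psum \<zeta> (\<lambda>k. coef \<psi> k x e) n) \<le> C * inverse (cmod \<zeta> ^ Suc n)"
    using remainder_bound[OF \<psi>, of n] by blast
  have "norm (Tm \<zeta> m m \<psi> - psum \<zeta> (Dl \<psi>) n) \<le> C * inverse (cmod \<zeta> ^ Suc n)" if \<zeta>: "0 \<le> Im \<zeta>" "\<zeta> \<noteq> 0" for \<zeta>
  proof (rule tendsto_upperbound[OF _ _ trivial_limit_at_top_linorder])
    have good: "good \<zeta> m" using \<zeta> by (simp add: good_def)
    show "((\<lambda>x. norm (jcol \<zeta> m \<psi> x m - psum \<zeta> (\<lambda>k. coef \<psi> k x m) n)) \<longlongrightarrow> norm (Tm \<zeta> m m \<psi> - psum \<zeta> (Dl \<psi>) n)) at_top"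
      unfolding psum_def
      by (intro tendsto_norm tendsto_diff jcol_Tm[OF \<psi> good m_in m_in refl] tendsto_sum scaleC.tendsto tendsto_const coef_Dl[OF \<psi>])
    show "\<forall>\<^sub>F x in at_top. norm (jcol \<zeta> m \<psi> x m - psum \<zeta> (\<lambda>k. coef \<psi> k x m) n) \<le> C * inverse (cmod \<zeta> ^ Suc n)"
      by (intro always_eventually allI C m_in \<zeta>)
  qed
  then show ?thesis by blast
qed

lemma D_expansion:
  assumes \<psi>: "\<psi> \<in> fields M N"
  shows "has_inverse_expansion (\<lambda>\<zeta>. D_fun M N g \<zeta> \<psi>) (Dl \<psi>)"
  unfolding has_inverse_expansion_def psum_def[symmetric]
proof
  fix n
  obtain C where C: "\<And>\<zeta>. 0 \<le> Im \<zeta> \<Longrightarrow> \<zeta> \<noteq> 0 \<Longrightarrow>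
      norm (Tm \<zeta> m m \<psi> - psum \<zeta> (Dl \<psi>) n) \<le> C * inverse (cmod \<zeta> ^ Suc n)"
    using Tm_expansion[OF \<psi>, of n] by blast
  show "((\<lambda>\<zeta>. \<zeta> ^ n *\<^sub>C (D_fun M N g \<zeta> \<psi> - psum \<zeta> (Dl \<psi>) n)) \<longlongrightarrow> 0) uhp_infinity"
  proof (rule Lim_null_comparison)
    show "\<forall>\<^sub>F \<zeta> in uhp_infinity. norm (\<zeta> ^ n *\<^sub>C (D_fun M N g \<zeta> \<psi> - psum \<zeta> (Dl \<psi>) n)) \<le> C * inverse (cmod \<zeta>)"
      using eventually_uhp_infinity
    proof eventually_elim
      case (elim \<zeta>)
      then have "cmod \<zeta> \<noteq> 0" by simp
      have "norm (\<zeta> ^ n *\<^sub>C (D_fun M N g \<zeta> \<psi> - psum \<zeta> (Dl \<psi>) n)) \<le> cmod \<zeta> ^ n * (C * inverse (cmod \<zeta> ^ Suc n))"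
        unfolding norm_scaleC norm_power D_fun_eq[OF \<psi> conjunct1[OF elim] \<psi>]
        using elim by (intro mult_left_mono C) auto
      also have "\<dots> = C * inverse (cmod \<zeta>)" using \<open>cmod \<zeta> \<noteq> 0\<close> by (simp add: field_simps)
      finally show ?case .
    qed
    have "((\<lambda>\<zeta>. inverse (cmod \<zeta>)) \<longlongrightarrow> 0) at_infinity"
      by (rule tendsto_inverse_0_at_top[OF filterlim_norm_at_top])
    then show "((\<lambda>\<zeta>. C * inverse (cmod \<zeta>)) \<longlongrightarrow> 0) uhp_infinity"
      unfolding uhp_infinity_def by (intro tendsto_mult_right_zero tendsto_mono[OF inf_le1])
  qed
qed

lemma D_coeff_eq: "\<psi> \<in> fields M N \<Longrightarrow> D_coeff M N g n \<psi> = Dl \<psi> n"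
  unfolding D_coeff_def using the_equality[of "has_inverse_expansion (\<lambda>\<zeta>. D_fun M N g \<zeta> \<psi>)" "Dl \<psi>"]
    D_expansion has_inverse_expansion_unique by metis

text \<open>The coefficient is the limit of \<open>\<zeta> ^ n\<close> times what remains of D after
  the lower orders are subtracted, and the even part is closed.\<close>

lemma Dl_homog:
  assumes \<psi>: "\<psi> \<in> fields M N" shows "Dl \<psi> n \<in> homog 0"
proof (induction n rule: less_induct)
  case (less n)
  let ?f = "\<lambda>\<zeta>. \<zeta> ^ n *\<^sub>C (D_fun M N g \<zeta> \<psi> - psum \<zeta> (Dl \<psi>) n)"
  have "((\<lambda>\<zeta>. ?f \<zeta> + Dl \<psi> n) \<longlongrightarrow> 0 + Dl \<psi> n) uhp_infinity"
    using D_expansion[OF \<psi>] unfolding has_inverse_expansion_def psum_def by (intro tendsto_add tendsto_const) blast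
  moreover have "\<forall>\<^sub>F \<zeta> in uhp_infinity. ?f \<zeta> + Dl \<psi> n \<in> homog 0"
    using eventually_uhp_infinity
  proof eventually_elim
    case (elim \<zeta>)
    have split: "psum \<zeta> (Dl \<psi>) n = (\<Sum>k<n. inverse (\<zeta> ^ k) *\<^sub>C Dl \<psi> k) + inverse (\<zeta> ^ n) *\<^sub>C Dl \<psi> n"
      unfolding psum_def lessThan_Suc_atMost[symmetric] by simp
    have "?f \<zeta> + Dl \<psi> n = \<zeta> ^ n *\<^sub>C (D_fun M N g \<zeta> \<psi> - (\<Sum>k<n. inverse (\<zeta> ^ k) *\<^sub>C Dl \<psi> k))"
      unfolding split using elim by (simp add: scaleC.diff_right scaleC_add_right scaleC_scaleC)
    also have "\<dots> \<in> homog 0"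
      using elim less by (intro homog_scaleC homog_diff homog_sum D_homog[OF \<psi> _ \<psi>]) auto
    finally show ?case .
  qed
  ultimately have "0 + Dl \<psi> n \<in> homog 0"
    by (intro Lim_in_closed_set[OF homog_closed _ uhp_infinity_neq_bot])
  then show ?case by simp
qed

text \<open>Order n of the row, read off from its definition by adjoint and reflection; the sign is
  that of \<open>psum_adj\<close>.\<close>

definition rcoef :: "'a::banach_superalgebra config \<Rightarrow> nat \<Rightarrow> real \<Rightarrow> nat \<Rightarrow> 'a" where
  "rcoef \<phi> n x e = ((- 1) ^ n) *\<^sub>C (coef (refl_cfg \<phi>) n (- x) e)\<^sup>\<dagger>"

lemma kexp_jrow:
  assumes \<phi>: "\<phi> \<in> fields M N"
  shows "kexp (\<lambda>_. 1) (\<lambda>\<zeta> x. jrow \<zeta> m \<phi> x m) (\<lambda>n x. rcoef \<phi> n x m)"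
    and "j \<in> K \<Longrightarrow> kexp wt1 (\<lambda>\<zeta> x. jrow \<zeta> m \<phi> x j) (\<lambda>n x. rcoef \<phi> n x j)"
  unfolding jrow_def rcoef_def using kexp_jcol[OF refl_fields[OF \<phi>]] by (auto intro!: kexp_adj_reflect)

text \<open>Order n of \<open>gradA \<zeta> m m \<phi> \<psi>\<close>: a Cauchy product of the row
  expansion at \<open>\<phi>\<close> with the column expansion at \<open>\<psi>\<close>.\<close>

definition cgA :: "'a::banach_superalgebra config \<Rightarrow> 'a config \<Rightarrow> nat \<Rightarrow> nat \<Rightarrow> real \<Rightarrow> 'a" where
  "cgA \<phi> \<psi> n l x = sqg *\<^sub>C (gsign ((gr l + gr m) * gr l) * (\<Sum>k\<le>n. rcoef \<phi> k x l * coef \<psi> (n - k) x m))"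

definition cgB :: "'a::banach_superalgebra config \<Rightarrow> 'a config \<Rightarrow> nat \<Rightarrow> nat \<Rightarrow> real \<Rightarrow> 'a" where
  "cgB \<phi> \<psi> n l x = - (sqg *\<^sub>C (gsign (gr m * gr l) * (\<Sum>k\<le>n. rcoef \<phi> k x m * coef \<psi> (n - k) x l)))"

lemma kexp_uminus: "kexp \<omega> f c \<Longrightarrow> kexp \<omega> (\<lambda>\<zeta> x. - f \<zeta> x) (\<lambda>n x. - c n x)"
  using kexp_scaleC[of \<omega> f c "- 1"] by (simp add: scaleC_minus1)

lemma kexp_grad:
  assumes \<phi>: "\<phi> \<in> fields M N" and \<psi>: "\<psi> \<in> fields M N" and l: "l \<in> K"
  shows "kexp wt1 (\<lambda>\<zeta>. gradA \<zeta> m m \<phi> \<psi> l) (\<lambda>n. cgA \<phi> \<psi> n l)"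
    and "kexp wt1 (\<lambda>\<zeta>. gradB \<zeta> m m \<phi> \<psi> l) (\<lambda>n. cgB \<phi> \<psi> n l)"
proof -
  have "kexp wt1 (\<lambda>\<zeta> x. jrow \<zeta> m \<phi> x l * jcol \<zeta> m \<psi> x m) (\<lambda>n x. \<Sum>k\<le>n. rcoef \<phi> k x l * coef \<psi> (n - k) x m)"
    using kexp_mult[OF kexp_jrow(2)[OF \<phi> l] kexp_jcol(1)[OF \<psi>]] by (simp only: mult_1_right)
  then show "kexp wt1 (\<lambda>\<zeta>. gradA \<zeta> m m \<phi> \<psi> l) (\<lambda>n. cgA \<phi> \<psi> n l)"
    unfolding gradA_def[abs_def] cgA_def[abs_def] by (intro kexp_scaleC kexp_gsign)
  have "kexp wt1 (\<lambda>\<zeta> x. jrow \<zeta> m \<phi> x m * jcol \<zeta> m \<psi> x l) (\<lambda>n x. \<Sum>k\<le>n. rcoef \<phi> k x m * coef \<psi> (n - k) x l)"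
    using kexp_mult[OF kexp_jrow(1)[OF \<phi>] kexp_jcol(2)[OF \<psi> l]] by (simp only: mult_1_left)
  then show "kexp wt1 (\<lambda>\<zeta>. gradB \<zeta> m m \<phi> \<psi> l) (\<lambda>n. cgB \<phi> \<psi> n l)"
    unfolding gradB_def[abs_def] cgB_def[abs_def] by (intro kexp_uminus kexp_scaleC kexp_gsign)
qed

text \<open>Both sides of \<open>Tm_difference\<close> have expansions in
  \<open>inverse \<zeta>\<close>, the integrand with an integrable weight uniformly in
  \<open>x\<close>, so \<open>kexp_integral\<close> allows the coefficients to be compared.\<close>

lemma Dl_difference:
  assumes \<phi>: "\<phi> \<in> fields M N" and h: "h \<in> fields M N"
  shows "((\<lambda>x. \<epsilon> *\<^sub>R (\<Sum>l\<in>K. h l x * cgA \<phi> (shift_cfg \<phi> \<epsilon> h) n l x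
      + (h l x)\<^sup>\<dagger> * cgB \<phi> (shift_cfg \<phi> \<epsilon> h) n l x)) has_integral
      (Dl (shift_cfg \<phi> \<epsilon> h) n - Dl \<phi> n)) UNIV"
proof -
  let ?\<psi> = "shift_cfg \<phi> \<epsilon> h"
  have \<psi>: "?\<psi> \<in> fields M N" by (rule shift_fields[OF \<phi> h])
  obtain b where b: "bnd b h" using fields_bnd[OF h] .
  have hb: "norm (h l x) \<le> b * 1" "norm ((h l x)\<^sup>\<dagger>) \<le> b * 1" "0 \<le> b" if "l \<in> K" for l x
  proof -
    have "norm (h l x) \<le> b * wt1 x" using b that by (simp add: bnd_def)
    also have "\<dots> \<le> b * 1" using b by (intro mult_left_mono wt_le_1) (simp add: bnd_def)
    finally show "norm (h l x) \<le> b * 1" "norm ((h l x)\<^sup>\<dagger>) \<le> b * 1" by (simp_all add: norm_adj)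
    show "0 \<le> b" using b by (simp add: bnd_def)
  qed
  have hc: "continuous_on UNIV (h l)" "continuous_on UNIV (\<lambda>x. (h l x)\<^sup>\<dagger>)" if "l \<in> K" for l
    using schwartz_continuous[of "h l"] h that by (auto simp: fields_def intro!: adj_continuous_on)
  have kA: "kexp wt1 (\<lambda>\<zeta> x. h l x * gradA \<zeta> m m \<phi> ?\<psi> l x) (\<lambda>n x. h l x * cgA \<phi> ?\<psi> n l x)" if l: "l \<in> K" for l
    using kexp_mult_const(1)[OF kexp_grad(1)[OF \<phi> \<psi> l] hc(1)[OF l] hb(1)[OF l] zero_le_one hb(3)[OF l]]
    by (simp only: mult_1_left)
  have kB: "kexp wt1 (\<lambda>\<zeta> x. (h l x)\<^sup>\<dagger> * gradB \<zeta> m m \<phi> ?\<psi> l x) (\<lambda>n x. (h l x)\<^sup>\<dagger> * cgB \<phi> ?\<psi> n l x)" if l: "l \<in> K" for l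
    using kexp_mult_const(1)[OF kexp_grad(2)[OF \<phi> \<psi> l] hc(2)[OF l] hb(2)[OF l] zero_le_one hb(3)[OF l]]
    by (simp only: mult_1_left)
  have k: "kexp wt1 (\<lambda>\<zeta> x. \<epsilon> *\<^sub>R (\<Sum>l\<in>K. h l x * gradA \<zeta> m m \<phi> ?\<psi> l x + (h l x)\<^sup>\<dagger> * gradB \<zeta> m m \<phi> ?\<psi> l x))
     (\<lambda>n x. \<epsilon> *\<^sub>R (\<Sum>l\<in>K. h l x * cgA \<phi> ?\<psi> n l x + (h l x)\<^sup>\<dagger> * cgB \<phi> ?\<psi> n l x))"
    unfolding scaleR_eq_scaleC by (intro kexp_scaleC kexp_sum[OF finite_K] kexp_add kA kB wt_nonneg)
  show ?thesis
  proof (rule kexp_integral[OF k, where d = "\<lambda>n. Dl ?\<psi> n - Dl \<phi> n" and v = "\<lambda>\<zeta>. Tm \<zeta> m m ?\<psi> - Tm \<zeta> m m \<phi>"])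
    fix \<zeta> :: complex assume "2 \<le> Im \<zeta>"
    then have "good \<zeta> m" by (simp add: good_def)
    from Tm_difference[OF \<phi> h m_in m_in refl this, of \<epsilon>]
    show "((\<lambda>x. \<epsilon> *\<^sub>R (\<Sum>l\<in>K. h l x * gradA \<zeta> m m \<phi> ?\<psi> l x + (h l x)\<^sup>\<dagger> * gradB \<zeta> m m \<phi> ?\<psi> l x))
        has_integral (Tm \<zeta> m m ?\<psi> - Tm \<zeta> m m \<phi>)) UNIV" .
  next
    fix n
    obtain C where C: "\<And>\<zeta>. 0 \<le> Im \<zeta> \<Longrightarrow> \<zeta> \<noteq> 0 \<Longrightarrow> norm (Tm \<zeta> m m ?\<psi> - psum \<zeta> (Dl ?\<psi>) n) \<le> C * inverse (cmod \<zeta> ^ Suc n)"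
      using Tm_expansion[OF \<psi>, of n] by blast
    obtain D where D: "\<And>\<zeta>. 0 \<le> Im \<zeta> \<Longrightarrow> \<zeta> \<noteq> 0 \<Longrightarrow> norm (Tm \<zeta> m m \<phi> - psum \<zeta> (Dl \<phi>) n) \<le> D * inverse (cmod \<zeta> ^ Suc n)"
      using Tm_expansion[OF \<phi>, of n] by blast
    have "norm (Tm \<zeta> m m ?\<psi> - Tm \<zeta> m m \<phi> - psum \<zeta> (\<lambda>n. Dl ?\<psi> n - Dl \<phi> n) n) \<le> (C + D) * inverse (cmod \<zeta> ^ Suc n)"
      if \<zeta>: "2 \<le> Im \<zeta>" for \<zeta>
    proof -
      have *: "0 \<le> Im \<zeta>" "\<zeta> \<noteq> 0" using \<zeta> by auto
      have "Tm \<zeta> m m ?\<psi> - Tm \<zeta> m m \<phi> - psum \<zeta> (\<lambda>n. Dl ?\<psi> n - Dl \<phi> n) n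
          = (Tm \<zeta> m m ?\<psi> - psum \<zeta> (Dl ?\<psi>) n) - (Tm \<zeta> m m \<phi> - psum \<zeta> (Dl \<phi>) n)" by (simp add: psum_linear)
      also have "norm \<dots> \<le> C * inverse (cmod \<zeta> ^ Suc n) + D * inverse (cmod \<zeta> ^ Suc n)"
        using norm_triangle_ineq4 C[OF *] D[OF *] by (rule order_trans[OF _ add_mono])
      finally show ?thesis by (simp only: distrib_right)
    qed
    then show "\<exists>C. \<forall>\<zeta>. 2 \<le> Im \<zeta> \<longrightarrow> norm (Tm \<zeta> m m ?\<psi> - Tm \<zeta> m m \<phi> - psum \<zeta> (\<lambda>n. Dl ?\<psi> n - Dl \<phi> n) n)
        \<le> C * inverse (cmod \<zeta> ^ Suc n)" by blast
  qed
qed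

context
  fixes \<phi> :: "'a::banach_superalgebra config"
  assumes \<phi>: "\<phi> \<in> fields M N"
begin

lemma cg_continuous: "l \<in> K \<Longrightarrow> \<psi> \<in> fields M N \<Longrightarrow> continuous_on UNIV (cgA \<phi> \<psi> n l)"
    "l \<in> K \<Longrightarrow> \<psi> \<in> fields M N \<Longrightarrow> continuous_on UNIV (cgB \<phi> \<psi> n l)"
  using kexpD(3)[OF kexp_grad(1)[OF \<phi>]] kexpD(3)[OF kexp_grad(2)[OF \<phi>]] by blast+

lemma cg_bounded: "\<exists>c\<ge>0. \<forall>l\<in>K. \<forall>x. norm (cgA \<phi> \<phi> n l x) \<le> c \<and> norm (cgB \<phi> \<phi> n l x) \<le> c"
proof -
  have "\<forall>l\<in>K. \<exists>c\<ge>0. \<forall>x. norm (cgA \<phi> \<phi> n l x) \<le> c \<and> norm (cgB \<phi> \<phi> n l x) \<le> c"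
  proof
    fix l assume l: "l \<in> K"
    obtain C D where C: "C \<ge> 0" "\<And>x. norm (cgA \<phi> \<phi> n l x) \<le> C * wt1 x"
      and D: "D \<ge> 0" "\<And>x. norm (cgB \<phi> \<phi> n l x) \<le> D * wt1 x"
      using kexpD(4)[OF kexp_grad(1)[OF \<phi> \<phi> l], of n] kexpD(4)[OF kexp_grad(2)[OF \<phi> \<phi> l], of n] by blast
    have "norm (cgA \<phi> \<phi> n l x) \<le> C + D" "norm (cgB \<phi> \<phi> n l x) \<le> C + D" for x
      using C(2)[of x] D(2)[of x] mult_left_mono[OF wt_le_1[of 1 x] C(1)] mult_left_mono[OF wt_le_1[of 1 x] D(1)]
        C(1) D(1) by linarith+
    then show "\<exists>c\<ge>0. \<forall>x. norm (cgA \<phi> \<phi> n l x) \<le> c \<and> norm (cgB \<phi> \<phi> n l x) \<le> c"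
      using C(1) D(1) by (intro exI[of _ "C + D"]) auto
  qed
  then obtain c where c: "\<And>l. l \<in> K \<Longrightarrow> c l \<ge> 0"
    "\<And>l x. l \<in> K \<Longrightarrow> norm (cgA \<phi> \<phi> n l x) \<le> c l \<and> norm (cgB \<phi> \<phi> n l x) \<le> c l" by metis
  have le: "c l \<le> sum c K" if "l \<in> K" for l using c that by (intro member_le_sum) auto
  show ?thesis
    by (intro exI[of _ "sum c K"] conjI ballI allI sum_nonneg c(1)) (use c(2) le order_trans in blast)+
qed

lemma coef_lipschitz:
  assumes h: "h \<in> fields M N"
  shows "\<exists>C\<ge>0. \<forall>\<epsilon> x. \<forall>e\<in>I. \<bar>\<epsilon>\<bar> \<le> 1 \<longrightarrow> norm (coef (shift_cfg \<phi> \<epsilon> h) k x e - coef \<phi> k x e) \<le> C * \<bar>\<epsilon>\<bar>"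
proof -
  note fam = coef_fam(1)[of "\<lambda>\<epsilon>. shift_cfg \<phi> \<epsilon> h" k, OF shift_smooth_fam[OF \<phi> h]]
  have "\<forall>e\<in>I. \<exists>C\<ge>0. \<forall>\<epsilon> x. \<bar>\<epsilon>\<bar> \<le> 1 \<longrightarrow> norm (coef (shift_cfg \<phi> \<epsilon> h) k x e - coef \<phi> k x e) \<le> C * \<bar>\<epsilon>\<bar>"
  proof
    fix e assume e: "e \<in> I"
    have "smooth_fam (\<lambda>_. 1) (\<lambda>\<epsilon> x. coef (shift_cfg \<phi> \<epsilon> h) k x e)"
    proof (cases "e = m")
      case False
      then have "e \<in> K" using e I_cases by blast
      then show ?thesis by (intro smooth_fam_wt_weaken bspec[OF conjunct1[OF fam]])
    qed (use conjunct2[OF fam] in simp)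
    from smooth_fam_lipschitz[OF this]
    show "\<exists>C\<ge>0. \<forall>\<epsilon> x. \<bar>\<epsilon>\<bar> \<le> 1 \<longrightarrow> norm (coef (shift_cfg \<phi> \<epsilon> h) k x e - coef \<phi> k x e) \<le> C * \<bar>\<epsilon>\<bar>"
      by (simp only: shift_cfg_0)
  qed
  then obtain c where c: "\<And>e. e \<in> I \<Longrightarrow> c e \<ge> 0"
    "\<And>e \<epsilon> x. e \<in> I \<Longrightarrow> \<bar>\<epsilon>\<bar> \<le> 1 \<Longrightarrow> norm (coef (shift_cfg \<phi> \<epsilon> h) k x e - coef \<phi> k x e) \<le> c e * \<bar>\<epsilon>\<bar>" by metis
  have "norm (coef (shift_cfg \<phi> \<epsilon> h) k x e - coef \<phi> k x e) \<le> sum c I * \<bar>\<epsilon>\<bar>" if "e \<in> I" "\<bar>\<epsilon>\<bar> \<le> 1" for e \<epsilon> x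
  proof -
    have "c e \<le> sum c I" using c that by (intro member_le_sum) auto
    then show ?thesis using c(2)[OF that, of x] mult_right_mono[of "c e" "sum c I" "\<bar>\<epsilon>\<bar>"] by fastforce
  qed
  moreover have "0 \<le> sum c I" by (intro sum_nonneg c(1))
  ultimately show ?thesis by blast
qed

lemma rcoef_bd: "\<exists>G\<ge>0. \<forall>x. \<forall>e\<in>I. norm (rcoef \<phi> k x e) \<le> G"
proof -
  obtain B where B: "B \<ge> 0" "\<And>x. norm (coef (refl_cfg \<phi>) k x m) \<le> B"
    "\<And>x j. j \<in> K \<Longrightarrow> norm (coef (refl_cfg \<phi>) k x j) \<le> B * wt1 x" using coef_bd[OF refl_fields[OF \<phi>], of k] by blast
  have "norm (coef (refl_cfg \<phi>) k x e) \<le> B" if e: "e \<in> I" for x e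
  proof (cases "e = m")
    case False
    then have "e \<in> K" using e I_cases by blast
    then show ?thesis using B(3)[of e x] mult_left_mono[OF wt_le_1[of 1 x] B(1)] by simp
  qed (use B(2) in simp)
  then have "norm (rcoef \<phi> k x e) \<le> B" if "e \<in> I" for x e
    unfolding rcoef_def norm_scaleC norm_power norm_minus_cancel norm_one power_one mult_1_left norm_adj using that by blast
  then show ?thesis using B(1) by blast
qed

text \<open>As for T, the factors coming from the row stay at \<open>\<phi>\<close>, and only
  \<open>coef\<close> varies with \<epsilon>.\<close>

lemma D_coeff_gradient:
  "is_gradient M N (D_coeff M N g n) \<phi> (cgA \<phi> \<phi> n) (cgB \<phi> \<phi> n)"
proof (rule is_gradient_cong[OF \<phi> D_coeff_eq is_gradientI])
  show "continuous_on UNIV (cgA \<phi> \<phi> n l) \<and> bounded (range (cgA \<phi> \<phi> n l)) \<and>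
      continuous_on UNIV (cgB \<phi> \<phi> n l) \<and> bounded (range (cgB \<phi> \<phi> n l))" if "l \<in> K" for l
    using cg_continuous[OF that \<phi>] cg_bounded[of n] that unfolding bounded_iff by blast
  fix h :: "'a config" assume h: "h \<in> fields M N"
  obtain C where C: "\<And>k. C k \<ge> 0" "\<And>k \<epsilon> x e. e \<in> I \<Longrightarrow> \<bar>\<epsilon>\<bar> \<le> 1 \<Longrightarrow>
      norm (coef (shift_cfg \<phi> \<epsilon> h) k x e - coef \<phi> k x e) \<le> C k * \<bar>\<epsilon>\<bar>" using coef_lipschitz[OF h] by metis
  obtain G where G: "\<And>k. G k \<ge> 0" "\<And>k x e. e \<in> I \<Longrightarrow> norm (rcoef \<phi> k x e) \<le> G k" using rcoef_bd by metis
  define D where "D = sqrt g * (\<Sum>k\<le>n. G k * C (n - k))"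
  have est: "norm (cgA \<phi> (shift_cfg \<phi> \<epsilon> h) n l x - cgA \<phi> \<phi> n l x) \<le> D * \<bar>\<epsilon>\<bar> \<and>
      norm (cgB \<phi> (shift_cfg \<phi> \<epsilon> h) n l x - cgB \<phi> \<phi> n l x) \<le> D * \<bar>\<epsilon>\<bar>"
    if e: "\<bar>\<epsilon>\<bar> \<le> 1" and l: "l \<in> K" for \<epsilon> l x
  proof -
    have s: "sqrt g * norm (\<Sum>k\<le>n. rcoef \<phi> k x u * (coef (shift_cfg \<phi> \<epsilon> h) (n - k) x w - coef \<phi> (n - k) x w))
        \<le> D * \<bar>\<epsilon>\<bar>" if "u \<in> I" "w \<in> I" for u w
    proof -
      have "norm (\<Sum>k\<le>n. rcoef \<phi> k x u * (coef (shift_cfg \<phi> \<epsilon> h) (n - k) x w - coef \<phi> (n - k) x w))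
          \<le> (\<Sum>k\<le>n. G k * (C (n - k) * \<bar>\<epsilon>\<bar>))"
        by (intro sum_norm_le norm_mult_le G C e that)
      also have "\<dots> = (\<Sum>k\<le>n. G k * C (n - k)) * \<bar>\<epsilon>\<bar>" unfolding sum_distrib_right by (simp only: mult.assoc)
      finally show ?thesis unfolding D_def mult.assoc using g_pos by (intro mult_left_mono) simp_all
    qed
    have "norm (cgA \<phi> (shift_cfg \<phi> \<epsilon> h) n l x - cgA \<phi> \<phi> n l x)
        = sqrt g * norm (\<Sum>k\<le>n. rcoef \<phi> k x l * (coef (shift_cfg \<phi> \<epsilon> h) (n - k) x m - coef \<phi> (n - k) x m))"
      unfolding cgA_def scaleC.diff_right[symmetric] right_diff_distrib[symmetric] sum_subtractf[symmetric]
        norm_scaleC norm_sqg norm_gsign_mult ..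
    moreover have "norm (cgB \<phi> (shift_cfg \<phi> \<epsilon> h) n l x - cgB \<phi> \<phi> n l x)
        = sqrt g * norm (\<Sum>k\<le>n. rcoef \<phi> k x m * (coef (shift_cfg \<phi> \<epsilon> h) (n - k) x l - coef \<phi> (n - k) x l))"
      unfolding cgB_def minus_diff_minus norm_minus_cancel scaleC.diff_right[symmetric] right_diff_distrib[symmetric]
        sum_subtractf[symmetric] norm_scaleC norm_sqg norm_gsign_mult ..
    ultimately show ?thesis using s[OF K_I[OF l] m_in] s[OF m_in K_I[OF l]] by simp
  qed
  show "\<exists>A' B' C. \<forall>\<epsilon>. \<bar>\<epsilon>\<bar> \<le> 1 \<longrightarrow>
      (\<forall>l\<in>K. continuous_on UNIV (A' \<epsilon> l) \<and> continuous_on UNIV (B' \<epsilon> l) \<and>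
        (\<forall>x. norm (A' \<epsilon> l x - cgA \<phi> \<phi> n l x) \<le> C * \<bar>\<epsilon>\<bar> \<and> norm (B' \<epsilon> l x - cgB \<phi> \<phi> n l x) \<le> C * \<bar>\<epsilon>\<bar>)) \<and>
      ((\<lambda>x. \<epsilon> *\<^sub>R (\<Sum>l\<in>K. h l x * A' \<epsilon> l x + (h l x)\<^sup>\<dagger> * B' \<epsilon> l x)) has_integral
        (Dl (shift_cfg \<phi> \<epsilon> h) n - Dl \<phi> n)) UNIV"
    by (intro exI[of _ "\<lambda>\<epsilon>. cgA \<phi> (shift_cfg \<phi> \<epsilon> h) n"] exI[of _ "\<lambda>\<epsilon>. cgB \<phi> (shift_cfg \<phi> \<epsilon> h) n"] exI[of _ D]
        allI impI conjI ballI Dl_difference[OF \<phi> h] cg_continuous shift_fields[OF \<phi> h]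
        est[THEN conjunct1] est[THEN conjunct2])
qed

text \<open>One pair of gradients is expanded while the other is fixed and merely bounded; the
  weight comes from the expanded pair.\<close>

lemma kexp_brk_left:
  assumes A: "\<And>l. l \<in> K \<Longrightarrow> kexp wt1 (\<lambda>\<zeta>. A \<zeta> l) (\<lambda>n. Ac n l)" and B: "\<And>l. l \<in> K \<Longrightarrow> kexp wt1 (\<lambda>\<zeta>. B \<zeta> l) (\<lambda>n. Bc n l)"
    and CD: "\<And>l. l \<in> K \<Longrightarrow> continuous_on UNIV (C l)" "\<And>l. l \<in> K \<Longrightarrow> continuous_on UNIV (D l)"
      "\<And>l x. l \<in> K \<Longrightarrow> norm (C l x) \<le> G \<and> norm (D l x) \<le> G" "0 \<le> G"
  shows "kexp wt1 (\<lambda>\<zeta>. brk p (A \<zeta>) (B \<zeta>) C D) (\<lambda>n. brk p (Ac n) (Bc n) C D)"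
proof -
  have 1: "kexp wt1 (\<lambda>\<zeta> x. gsign (gr l) * A \<zeta> l x * D l x) (\<lambda>n x. gsign (gr l) * Ac n l x * D l x)" if l: "l \<in> K" for l
    using kexp_mult_const(2)[OF kexp_gsign[OF A[OF l], of "gr l"] CD(2)[OF l], of G "\<lambda>_. 1"] CD(3)[OF l] CD(4)
    by simp
  have 2: "kexp wt1 (\<lambda>\<zeta> x. B \<zeta> l x * C l x) (\<lambda>n x. Bc n l x * C l x)" if l: "l \<in> K" for l
    using kexp_mult_const(2)[OF B[OF l] CD(1)[OF l], of G "\<lambda>_. 1"] CD(3)[OF l] CD(4) by simp
  show ?thesis unfolding brk_def[abs_def]
    by (intro kexp_scaleC kexp_sum[OF finite_K] kexp_gsign kexp_diff 1 2 wt_nonneg)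
qed

lemma kexp_brk_right:
  assumes A: "\<And>l. l \<in> K \<Longrightarrow> continuous_on UNIV (A l)" "\<And>l. l \<in> K \<Longrightarrow> continuous_on UNIV (B l)"
      "\<And>l x. l \<in> K \<Longrightarrow> norm (A l x) \<le> G \<and> norm (B l x) \<le> G" "0 \<le> G"
    and C: "\<And>l. l \<in> K \<Longrightarrow> kexp wt1 (\<lambda>\<zeta>. C \<zeta> l) (\<lambda>n. Cc n l)" and D: "\<And>l. l \<in> K \<Longrightarrow> kexp wt1 (\<lambda>\<zeta>. D \<zeta> l) (\<lambda>n. Dc n l)"
  shows "kexp wt1 (\<lambda>\<zeta>. brk p A B (C \<zeta>) (D \<zeta>)) (\<lambda>n. brk p A B (Cc n) (Dc n))"
proof -
  have 1: "kexp wt1 (\<lambda>\<zeta> x. gsign (gr l) * A l x * D \<zeta> l x) (\<lambda>n x. gsign (gr l) * A l x * Dc n l x)" if l: "l \<in> K" for l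
    using kexp_gsign[OF kexp_mult_const(1)[OF D[OF l] A(1)[OF l], of G "\<lambda>_. 1"], of "gr l"] A(3)[OF l] A(4)
    by (simp add: mult.assoc)
  have 2: "kexp wt1 (\<lambda>\<zeta> x. B l x * C \<zeta> l x) (\<lambda>n x. B l x * Cc n l x)" if l: "l \<in> K" for l
    using kexp_mult_const(1)[OF C[OF l] A(2)[OF l], of G "\<lambda>_. 1"] A(3)[OF l] A(4) by simp
  show ?thesis unfolding brk_def[abs_def]
    by (intro kexp_scaleC kexp_sum[OF finite_K] kexp_gsign kexp_diff 1 2 wt_nonneg)
qed

lemma kexp_integral_zero:
  assumes "kexp wt1 f c" and "\<And>\<zeta>. 2 \<le> Im \<zeta> \<Longrightarrow> (f \<zeta> has_integral (0::'a)) UNIV"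
  shows "(c n has_integral 0) UNIV"
proof (rule kexp_integral[OF assms, where d = "\<lambda>_. 0"])
  have "psum \<zeta> (\<lambda>_. 0) n = (0::'a)" for \<zeta> n by (simp add: psum_def scaleC.zero_right)
  then show "\<exists>C. \<forall>\<zeta>. 2 \<le> Im \<zeta> \<longrightarrow> norm (0 - psum \<zeta> (\<lambda>_. 0::'a) n) \<le> C * inverse (cmod \<zeta> ^ Suc n)" for n
    by (intro exI[of _ 0]) simp
qed

text \<open>The expansion uses parameters with \<open>2 \<le> Im \<zeta>\<close>, which lie strictly
  above \<mu>; so \<open>brk_D_t\<close> applies for real \<mu> as well.\<close>

lemma poisson_Dc_t:
  assumes im: "Im \<mu> \<le> 0" and K: "a \<in> K" "b \<in> K"
  shows "has_poisson M N 0 (D_coeff M N g n) (\<lambda>\<psi>. t_mat M N g \<mu> \<psi> a b) \<phi> 0"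
proof (rule has_poissonI[OF _ D_coeff_gradient t_gradient[OF \<phi> im K]])
  show "D_coeff M N g n \<psi> \<in> homog 0" if "\<psi> \<in> fields M N" for \<psi> :: "'a config"
    unfolding D_coeff_eq[OF that] by (rule Dl_homog[OF that])
  have sg: "sg a = sg b" and good: "good \<mu> a" using K im by (simp_all only: sg_K) (auto simp: good_def)
  note I = K[THEN K_I]
  obtain c where c: "\<And>l x. l \<in> K \<Longrightarrow> norm (gradA \<mu> a b \<phi> \<phi> l x) \<le> c \<and> norm (gradB \<mu> a b \<phi> \<phi> l x) \<le> c"
    using grad_bounded[OF \<phi> \<phi> I sg good] by blast
  have "0 \<le> c" using order_trans[OF norm_ge_zero conjunct1[OF c[OF K(1)]]] .
  show "(brk 0 (cgA \<phi> \<phi> n) (cgB \<phi> \<phi> n) (gradA \<mu> a b \<phi> \<phi>) (gradB \<mu> a b \<phi> \<phi>) has_integral 0) UNIV"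
  proof (rule kexp_integral_zero[OF kexp_brk_left[OF kexp_grad[OF \<phi> \<phi>] grad_continuous[OF \<phi> \<phi> I sg good] c \<open>0 \<le> c\<close>]])
    fix \<zeta> :: complex assume "2 \<le> Im \<zeta>"
    then show "(brk 0 (gradA \<zeta> m m \<phi> \<phi>) (gradB \<zeta> m m \<phi> \<phi>) (gradA \<mu> a b \<phi> \<phi>) (gradB \<mu> a b \<phi> \<phi>) has_integral 0) UNIV"
      using im by (intro brk_D_t[OF \<phi> _ im _ K]) auto
  qed
qed

text \<open>Expanded in one argument at a time: the left one for fixed \<mu>, then the right one,
  for which the first step supplies the vanishing integrals.\<close>

lemma poisson_Dc_Dc: "has_poisson M N 0 (D_coeff M N g k) (D_coeff M N g n) \<phi> 0"
proof (rule has_poissonI[OF _ D_coeff_gradient D_coeff_gradient])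
  show "D_coeff M N g k \<psi> \<in> homog 0" if "\<psi> \<in> fields M N" for \<psi> :: "'a config"
    unfolding D_coeff_eq[OF that] by (rule Dl_homog[OF that])
  obtain c' where c': "c' \<ge> 0" "\<And>l x. l \<in> K \<Longrightarrow> norm (cgA \<phi> \<phi> k l x) \<le> c' \<and> norm (cgB \<phi> \<phi> k l x) \<le> c'"
    using cg_bounded[of k] by blast
  have 1: "(brk 0 (cgA \<phi> \<phi> k) (cgB \<phi> \<phi> k) (gradA \<mu> m m \<phi> \<phi>) (gradB \<mu> m m \<phi> \<phi>) has_integral 0) UNIV"
    if \<mu>: "2 \<le> Im \<mu>" for \<mu>
  proof -
    have good: "good \<mu> m" using \<mu> by (simp add: good_def)
    obtain c where c: "\<And>l x. l \<in> K \<Longrightarrow> norm (gradA \<mu> m m \<phi> \<phi> l x) \<le> c \<and> norm (gradB \<mu> m m \<phi> \<phi> l x) \<le> c"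
      using grad_bounded[OF \<phi> \<phi> m_in m_in refl good] by blast
    \<comment> \<open>The maximum with 0 covers the case of no fields, where \<open>c\<close> is
      arbitrary.\<close>
    then have c2: "\<And>l x. l \<in> K \<Longrightarrow> norm (gradA \<mu> m m \<phi> \<phi> l x) \<le> max 0 c \<and> norm (gradB \<mu> m m \<phi> \<phi> l x) \<le> max 0 c"
      by (meson max.coboundedI2)
    show ?thesis
    proof (rule kexp_integral_zero[OF kexp_brk_left[OF kexp_grad[OF \<phi> \<phi>] grad_continuous[OF \<phi> \<phi> m_in m_in refl good] c2]])
      fix \<zeta> :: complex assume "2 \<le> Im \<zeta>"
      then show "(brk 0 (gradA \<zeta> m m \<phi> \<phi>) (gradB \<zeta> m m \<phi> \<phi>) (gradA \<mu> m m \<phi> \<phi>) (gradB \<mu> m m \<phi> \<phi>) has_integral 0) UNIV"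
        using \<mu> by (intro brk_D_D[OF \<phi>]) auto
    qed auto
  qed
  show "(brk 0 (cgA \<phi> \<phi> k) (cgB \<phi> \<phi> k) (cgA \<phi> \<phi> n) (cgB \<phi> \<phi> n) has_integral 0) UNIV"
    by (rule kexp_integral_zero[OF kexp_brk_right[OF cg_continuous[OF _ \<phi>] c'(2,1) kexp_grad[OF \<phi> \<phi>]] 1])
qed

end

end

subsection \<open>The first three Hamiltonians\<close>

lemma even_central:
  assumes "(r::'a::banach_superalgebra) \<in> homog 0" shows "y * r = r * y"
proof -
  obtain u v where "u \<in> homog 0" "v \<in> homog 1" and y: "y = u + v" using homog_decomp[of y] by blast
  then have "u * r = r * u" "v * r = r * v"
    using supercommute[of u 0 r 0] supercommute[of v 1 r 0] assms by simp_all
  then show ?thesis by (simp add: y distrib_left distrib_right)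
qed

lemma smooth_fam_times:
  fixes F G :: "real \<Rightarrow> real \<Rightarrow> 'a::real_normed_algebra"
  shows "smooth_fam wt1 F \<Longrightarrow> smooth_fam wt1 G \<Longrightarrow> smooth_fam wt1 (\<lambda>\<epsilon> x. F \<epsilon> x * G \<epsilon> x)"
  by (intro smooth_fam_mult_right smooth_fam_wt_weaken)

lemma smooth_fam_bound: "smooth_fam \<omega> F \<Longrightarrow> \<bar>\<epsilon>\<bar> \<le> 1 \<Longrightarrow> \<exists>B. \<forall>x. norm (F \<epsilon> x) \<le> B * \<omega> x"
  by (drule smooth_fam_bd) (auto simp: fam_bd_def)

lemma smooth_fam_prim_facts:
  fixes f :: "real \<Rightarrow> real \<Rightarrow> 'a::banach"
  assumes f: "smooth_fam wt1 f" and e: "\<bar>\<epsilon>\<bar> \<le> 1"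
  shows "(prim (f \<epsilon>) has_vector_derivative f \<epsilon> x) (at x)" and "(prim (f \<epsilon>) \<longlongrightarrow> 0) at_bot"
    and "(prim (f \<epsilon>) \<longlongrightarrow> integral UNIV (f \<epsilon>)) at_top"
    and "(f \<epsilon> has_integral integral UNIV (f \<epsilon>)) UNIV"
proof -
  obtain B where B: "\<And>x. norm (f \<epsilon> x) \<le> B * wt1 x" using smooth_fam_bound[OF f e] by blast
  note c = smooth_famD(2)[OF f e]
  show "(prim (f \<epsilon>) has_vector_derivative f \<epsilon> x) (at x)" "(prim (f \<epsilon>) \<longlongrightarrow> 0) at_bot"
    "(prim (f \<epsilon>) \<longlongrightarrow> integral UNIV (f \<epsilon>)) at_top" "(f \<epsilon> has_integral integral UNIV (f \<epsilon>)) UNIV"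
    by (rule prim_facts[OF c B] integral_dominated_wt(1)[OF c B])+
qed

lemma smooth_fam_decay:
  assumes f: "smooth_fam wt1 f" and e: "\<bar>\<epsilon>\<bar> \<le> 1"
  shows "(f \<epsilon> \<longlongrightarrow> 0) at_bot" and "(f \<epsilon> \<longlongrightarrow> 0) at_top"
proof -
  obtain B where B: "\<And>x. norm (f \<epsilon> x) \<le> B * wt1 x" using smooth_fam_bound[OF f e] by blast
  have t: "((\<lambda>x. B * wt1 x) \<longlongrightarrow> 0) at_top" by (intro tendsto_mult_right_zero wt_at_top) simp
  have b: "((\<lambda>x. B * wt1 x) \<longlongrightarrow> 0) at_bot"
    using filterlim_compose[OF t filterlim_uminus_at_top_at_bot] by simp
  show "(f \<epsilon> \<longlongrightarrow> 0) at_bot" "(f \<epsilon> \<longlongrightarrow> 0) at_top"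
    using b t by (auto intro: Lim_null_comparison[OF always_eventually[OF allI[OF B]]])
qed

lemma integral_of_derivative_zero:
  fixes f :: "real \<Rightarrow> real \<Rightarrow> 'a::banach"
  assumes "smooth_fam wt1 f" "\<bar>\<epsilon>\<bar> \<le> 1" and "\<And>x. (f \<epsilon> has_vector_derivative f' x) (at x)"
  shows "(f' has_integral 0) UNIV"
  using has_integral_FTC_UNIV[OF assms(3) smooth_fam_decay(2,1)[OF assms(1,2)]] by simp

lemma finite_uniform_bound:
  fixes u :: "'i \<Rightarrow> 't \<Rightarrow> real"
  assumes "finite J" and "\<And>j. j \<in> J \<Longrightarrow> \<exists>C\<ge>0. \<forall>t. P t \<longrightarrow> u j t \<le> C * w t" and "\<And>t. 0 \<le> w t"
  shows "\<exists>C\<ge>0. \<forall>j\<in>J. \<forall>t. P t \<longrightarrow> u j t \<le> C * w t"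
proof -
  obtain c where c: "\<And>j. j \<in> J \<Longrightarrow> c j \<ge> 0" "\<And>j t. j \<in> J \<Longrightarrow> P t \<Longrightarrow> u j t \<le> c j * w t"
    using assms(2) by metis
  have "u j t \<le> sum c J * w t" if "j \<in> J" "P t" for j t
  proof -
    have "c j \<le> sum c J" using c(1) that assms(1) by (intro member_le_sum) auto
    then show ?thesis using c(2)[OF that] mult_right_mono[OF _ assms(3)[of t]] by fastforce
  qed
  moreover have "0 \<le> sum c J" by (intro sum_nonneg c(1))
  ultimately show ?thesis by blast
qed

text \<open>The check for the third order: on the left the product rule applied to
  \<open>n3\<close>, on the right what the recursion demands. Here \<open>r\<close> stands for the
  density, \<open>n\<close> for \<open>n1\<close>, \<open>p\<close> and \<open>w\<close> for the
  primitive and the value of the momentum density, and \<open>S\<close> for \<open>kin2\<close>. The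
  density is even, hence central.\<close>

lemma third_order_algebra:
  fixes r n p w S :: "'a::banach_superalgebra"
  assumes central: "\<And>y. y * r = r * y"
  shows "k *\<^sub>C (- S + \<gamma> *\<^sub>C (r * r)) + \<gamma> *\<^sub>C (p * (k *\<^sub>C r) + w * n)
      + (1 / 6) *\<^sub>C ((n * n) * (k *\<^sub>C r) + (n * (k *\<^sub>C r) + (k *\<^sub>C r) * n) * n)
    = - (k *\<^sub>C S) + \<gamma> *\<^sub>C (w * n + r * (k *\<^sub>C r)) + k *\<^sub>C (r * (\<gamma> *\<^sub>C p + (1 / 2) *\<^sub>C (n * n)))"
proof -
  have six: "(1 / 6) *\<^sub>C (v + (v + v)) = (1 / 2) *\<^sub>C v" for v :: 'a
  proof -
    have "v + (v + v) = (1 + (1 + 1)) *\<^sub>C v" unfolding scaleC_add_left scaleC_one ..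
    then show ?thesis by (simp add: scaleC_scaleC)
  qed
  have c1: "n * (n * r) = r * (n * n)" "n * (r * n) = r * (n * n)"
    using central[of "n * n"] central[of n] by (simp_all only: mult.assoc[symmetric])
  have "(n * n) * (k *\<^sub>C r) + (n * (k *\<^sub>C r) + (k *\<^sub>C r) * n) * n
      = k *\<^sub>C (r * (n * n)) + (k *\<^sub>C (r * (n * n)) + k *\<^sub>C (r * (n * n)))"
    by (simp only: scaleC_mult_left scaleC_mult_right distrib_right mult.assoc c1)
  then have "(1 / 6) *\<^sub>C ((n * n) * (k *\<^sub>C r) + (n * (k *\<^sub>C r) + (k *\<^sub>C r) * n) * n)
      = (1 / 2) *\<^sub>C k *\<^sub>C (r * (n * n))" by (simp only: six)
  then show ?thesis
    by (simp only: scaleC_mult_left scaleC_mult_right central[of p] distrib_left scaleC_add_right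
        scaleC.minus_right scaleC_scaleC) (simp only: ac_simps)
qed

abbreviation dv :: "(real \<Rightarrow> 'a::real_normed_vector) \<Rightarrow> real \<Rightarrow> 'a" where
  "dv f x \<equiv> vector_derivative f (at x)"

context super_nls begin

lemma sqg_sqrt: "sqg * complex_of_real (sqrt g) = \<i> * complex_of_real g"
  using g_pos by (simp add: of_real_mult[symmetric] mult.assoc del: of_real_mult)

context
  fixes \<phi> :: "'a::banach_superalgebra config"
  assumes \<phi>: "\<phi> \<in> fields M N"
begin

lemma field_fam: "l \<in> K \<Longrightarrow> smooth_fam wt1 (\<lambda>_. \<phi> l)"
  using shift_smooth_fam[OF \<phi> zero_fields, of l] by (simp add: shift_cfg_def)

lemma field_fam':
  "l \<in> K \<Longrightarrow> smooth_fam wt1 (\<lambda>_. dv (\<phi> l))" "l \<in> K \<Longrightarrow> smooth_fam wt1 (\<lambda>_. dv (dv (\<phi> l)))"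
  by (intro smooth_fam_vector_derivative field_fam; assumption)+

lemma field_deriv:
  "l \<in> K \<Longrightarrow> (\<phi> l has_vector_derivative dv (\<phi> l) x) (at x)"
  "l \<in> K \<Longrightarrow> (dv (\<phi> l) has_vector_derivative dv (dv (\<phi> l)) x) (at x)"
  "l \<in> K \<Longrightarrow> ((\<lambda>x. (\<phi> l x)\<^sup>\<dagger>) has_vector_derivative (dv (\<phi> l) x)\<^sup>\<dagger>) (at x)"
  "l \<in> K \<Longrightarrow> ((\<lambda>x. (dv (\<phi> l) x)\<^sup>\<dagger>) has_vector_derivative (dv (dv (\<phi> l)) x)\<^sup>\<dagger>) (at x)"
  using smooth_famD(1)[OF field_fam abs_zero_le_one] smooth_famD(1)[OF field_fam'(1) abs_zero_le_one]
  by (auto intro!: adj_has_vector_derivative)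

lemma dv_homog: "l \<in> K \<Longrightarrow> dv (\<phi> l) x \<in> homog (gr l)" "l \<in> K \<Longrightarrow> dv (dv (\<phi> l)) x \<in> homog (gr l)"
proof -
  assume l: "l \<in> K"
  show 1: "dv (\<phi> l) x \<in> homog (gr l)" for x
    by (rule has_vector_derivative_closed_space[OF field_deriv(1)[OF l] closed_space_homog field_homog[OF \<phi> l]])
  show "dv (dv (\<phi> l)) x \<in> homog (gr l)"
    by (rule has_vector_derivative_closed_space[OF field_deriv(2)[OF l] closed_space_homog 1])
qed

lemma self_grade: "gr l + gr l = 0" by (cases "gr l") simp_all

lemma density_fam: "smooth_fam wt1 (\<lambda>_. field_density M N \<phi>)"
  unfolding field_density_def[abs_def]
  by (intro smooth_fam_sum smooth_fam_times smooth_fam_linear[OF bounded_linear_adj] field_fam wt_nonneg)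

lemma density_even: "field_density M N \<phi> x \<in> homog 0"
  unfolding field_density_def
  by (rule homog_sum) (rule homog_mult'[OF adj_homog[OF field_homog[OF \<phi>]] field_homog[OF \<phi>] self_grade])

lemma density_central: "y * field_density M N \<phi> x = field_density M N \<phi> x * y"
  by (rule even_central[OF density_even])

section \<open>Closed forms of the first three orders\<close>

definition mom_density :: "real \<Rightarrow> 'a" where "mom_density x = (\<Sum>j\<in>K. (\<phi> j x)\<^sup>\<dagger> * dv (\<phi> j) x)"

definition kin2 :: "real \<Rightarrow> 'a" where "kin2 x = (\<Sum>j\<in>K. (\<phi> j x)\<^sup>\<dagger> * dv (dv (\<phi> j)) x)"

lemma mom_density_fam: "smooth_fam wt1 (\<lambda>_. mom_density)" and kin2_fam: "smooth_fam wt1 (\<lambda>_. kin2)"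
  unfolding mom_density_def[abs_def] kin2_def[abs_def]
  by (intro smooth_fam_sum smooth_fam_times smooth_fam_linear[OF bounded_linear_adj] field_fam field_fam' wt_nonneg; assumption)+

abbreviation "rho \<equiv> field_density M N \<phi>"
abbreviation "ig \<equiv> \<i> * complex_of_real g"

text \<open>The forms of \<open>n1\<close>, \<open>n2\<close>, \<open>n3\<close> follow the
  exponential series: to third order the last component is the exponential of primitives of local
  densities, whence the factors 1/2 and 1/6.\<close>

definition n1 :: "real \<Rightarrow> 'a" where "n1 x = ig *\<^sub>C prim rho x"
definition n2 :: "real \<Rightarrow> 'a" where "n2 x = complex_of_real g *\<^sub>C prim mom_density x + (1 / 2) *\<^sub>C (n1 x * n1 x)"
text \<open>Differs from the Hamiltonian density by a total derivative; see
  \<open>integral_h3\<close>.\<close>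

definition h3 :: "real \<Rightarrow> 'a" where "h3 x = - kin2 x + complex_of_real g *\<^sub>C (rho x * rho x)"

lemma h3_fam: "smooth_fam wt1 (\<lambda>_. h3)"
proof -
  have "smooth_fam wt1 (\<lambda>_ x. (- 1) *\<^sub>C kin2 x + complex_of_real g *\<^sub>C (rho x * rho x))"
    by (intro smooth_fam_add smooth_fam_linear[OF scaleC.bounded_linear_right] kin2_fam smooth_fam_times density_fam)
  then show ?thesis by (simp add: h3_def[abs_def] scaleC_minus1)
qed

definition n3 :: "real \<Rightarrow> 'a" where
  "n3 x = ig *\<^sub>C prim h3 x + complex_of_real g *\<^sub>C (prim mom_density x * n1 x) + (1 / 6) *\<^sub>C (n1 x * n1 x * n1 x)"

lemmas rho_prim = smooth_fam_prim_facts[OF density_fam abs_zero_le_one]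
lemmas mom_prim = smooth_fam_prim_facts[OF mom_density_fam abs_zero_le_one]
lemmas h3_prim = smooth_fam_prim_facts[OF h3_fam abs_zero_le_one]

lemma n1_deriv: "(n1 has_vector_derivative ig *\<^sub>C rho x) (at x)"
  unfolding n1_def[abs_def]
  by (rule bounded_linear.has_vector_derivative[OF scaleC.bounded_linear_right rho_prim(1)])

lemma n1_bot: "(n1 \<longlongrightarrow> 0) at_bot"
  unfolding n1_def[abs_def] using scaleC.tendsto[OF tendsto_const rho_prim(2), of ig] by (simp add: scaleC.zero_right)

lemma n1_top: "(n1 \<longlongrightarrow> ig *\<^sub>C number_fun M N \<phi>) at_top"
  unfolding n1_def[abs_def] number_fun_def by (intro scaleC.tendsto tendsto_const rho_prim(3))

lemma coef1_j: "j \<in> K \<Longrightarrow> coefw \<phi> (coef \<phi> 0) x j = - (complex_of_real (sqrt g) *\<^sub>C \<phi> j x)"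
  using K_ne_m[of j] by (simp add: coefw_def mone_def scaleC.zero_right)

text \<open>The recursion defines this component by \<open>prim\<close>; the closed form has the
  right derivative and vanishes at - infinity, so \<open>prim_eqI\<close> identifies the two. The
  next two orders are treated in the same way.\<close>

lemma coef1_m: "coef \<phi> (Suc 0) x m = n1 x"
proof -
  have "- (sqg *\<^sub>C (\<Sum>j\<in>K. (\<phi> j s)\<^sup>\<dagger> * coefw \<phi> (coef \<phi> 0) s j)) = ig *\<^sub>C rho s" for s
  proof -
    have "(\<Sum>j\<in>K. (\<phi> j s)\<^sup>\<dagger> * coefw \<phi> (coef \<phi> 0) s j) = - (complex_of_real (sqrt g) *\<^sub>C rho s)"
      unfolding field_density_def scaleC.sum_right sum_negf[symmetric]
      by (intro sum.cong refl) (simp add: coef1_j scaleC_mult_right del: coef.simps atLeastAtMost_iff)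
    then show ?thesis by (simp only: scaleC.minus_right minus_minus scaleC_scaleC sqg_sqrt)
  qed
  then have "coef \<phi> (Suc 0) x m = prim (\<lambda>s. ig *\<^sub>C rho s) x" by (simp only: coef.simps(2) if_True refl)
  also have "prim (\<lambda>s. ig *\<^sub>C rho s) = n1" by (rule prim_eqI[OF n1_deriv n1_bot])
  finally show ?thesis .
qed

lemma coef2_j: "j \<in> K \<Longrightarrow> coefw \<phi> (coef \<phi> (Suc 0)) x j
    = sqg *\<^sub>C dv (\<phi> j) x - complex_of_real (sqrt g) *\<^sub>C (\<phi> j x * n1 x)"
proof -
  assume j: "j \<in> K"
  have "(\<lambda>s. coef \<phi> (Suc 0) s j) = (\<lambda>s. (- complex_of_real (sqrt g)) *\<^sub>C \<phi> j s)"
    using K_ne_m[OF j] coef1_j[OF j] by (simp add: scaleC.minus_left)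
  moreover have "((\<lambda>s. (- complex_of_real (sqrt g)) *\<^sub>C \<phi> j s) has_vector_derivative (- complex_of_real (sqrt g)) *\<^sub>C dv (\<phi> j) x) (at x)"
    by (rule bounded_linear.has_vector_derivative[OF scaleC.bounded_linear_right field_deriv(1)[OF j]])
  ultimately have "dv (\<lambda>s. coef \<phi> (Suc 0) s j) x = (- complex_of_real (sqrt g)) *\<^sub>C dv (\<phi> j) x"
    by (simp only: vector_derivative_at)
  then show ?thesis unfolding coefw_def coef1_m by (simp only: scaleC_scaleC) simp
qed

lemma n2_deriv: "(n2 has_vector_derivative complex_of_real g *\<^sub>C mom_density x + ig *\<^sub>C (rho x * n1 x)) (at x)"
proof -
  have half: "(1 / 2) *\<^sub>C (v + v) = v" for v :: 'a
  proof -
    have "v + v = (1 + 1) *\<^sub>C v" unfolding scaleC_add_left scaleC_one ..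
    then show ?thesis by (simp add: scaleC_scaleC)
  qed
  have "(n2 has_vector_derivative complex_of_real g *\<^sub>C mom_density x
      + (1 / 2) *\<^sub>C (n1 x * (ig *\<^sub>C rho x) + (ig *\<^sub>C rho x) * n1 x)) (at x)"
    unfolding n2_def[abs_def]
    by (intro has_vector_derivative_add bounded_linear.has_vector_derivative[OF scaleC.bounded_linear_right]
        has_vector_derivative_mult n1_deriv mom_prim(1))
  then show ?thesis by (simp only: scaleC_mult_left scaleC_mult_right density_central[of "n1 x"] half)
qed

lemma n2_bot: "(n2 \<longlongrightarrow> 0) at_bot"
proof -
  have "(n2 \<longlongrightarrow> complex_of_real g *\<^sub>C 0 + (1 / 2) *\<^sub>C (0 * 0)) at_bot"
    unfolding n2_def[abs_def] by (intro tendsto_add scaleC.tendsto tendsto_const tendsto_mult n1_bot mom_prim(2))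
  then show ?thesis by (simp add: scaleC.zero_right)
qed

lemma coef2_m: "coef \<phi> (Suc (Suc 0)) x m = n2 x"
proof -
  have "- (sqg *\<^sub>C (\<Sum>j\<in>K. (\<phi> j s)\<^sup>\<dagger> * coefw \<phi> (coef \<phi> (Suc 0)) s j))
      = complex_of_real g *\<^sub>C mom_density s + ig *\<^sub>C (rho s * n1 s)" for s
  proof -
    have "(\<Sum>j\<in>K. (\<phi> j s)\<^sup>\<dagger> * coefw \<phi> (coef \<phi> (Suc 0)) s j)
        = (\<Sum>j\<in>K. sqg *\<^sub>C ((\<phi> j s)\<^sup>\<dagger> * dv (\<phi> j) s) - complex_of_real (sqrt g) *\<^sub>C ((\<phi> j s)\<^sup>\<dagger> * \<phi> j s * n1 s))"
      by (intro sum.cong refl) (simp only: coef2_j right_diff_distrib scaleC_mult_right mult.assoc)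
    also have "\<dots> = sqg *\<^sub>C mom_density s - complex_of_real (sqrt g) *\<^sub>C (rho s * n1 s)"
      unfolding mom_density_def field_density_def by (simp only: sum_subtractf scaleC.sum_right sum_distrib_right)
    finally show ?thesis
      by (simp only: scaleC.diff_right scaleC_scaleC sqg_sq sqg_sqrt scaleC.minus_left minus_diff_eq diff_minus_eq_add)
        (simp only: add.commute)
  qed
  then have "coef \<phi> (Suc (Suc 0)) x m = prim (\<lambda>s. complex_of_real g *\<^sub>C mom_density s + ig *\<^sub>C (rho s * n1 s)) x"
    by (simp only: coef.simps(2)[of \<phi> "Suc 0"] if_True refl)
  also have "prim (\<lambda>s. complex_of_real g *\<^sub>C mom_density s + ig *\<^sub>C (rho s * n1 s)) = n2" by (rule prim_eqI[OF n2_deriv n2_bot])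
  finally show ?thesis .
qed

lemma coef3_j: "j \<in> K \<Longrightarrow> coefw \<phi> (coef \<phi> (Suc (Suc 0))) x j
    = complex_of_real (sqrt g) *\<^sub>C dv (dv (\<phi> j)) x + sqg *\<^sub>C (dv (\<phi> j) x * n1 x + \<phi> j x * (ig *\<^sub>C rho x))
      - complex_of_real (sqrt g) *\<^sub>C (\<phi> j x * n2 x)"
proof -
  assume j: "j \<in> K"
  have "(\<lambda>s. coef \<phi> (Suc (Suc 0)) s j) = (\<lambda>s. sqg *\<^sub>C dv (\<phi> j) s - complex_of_real (sqrt g) *\<^sub>C (\<phi> j s * n1 s))"
    unfolding coef.simps(2)[of \<phi> "Suc 0"] using K_ne_m[OF j] by (simp only: if_False coef2_j[OF j])
  moreover have "((\<lambda>s. sqg *\<^sub>C dv (\<phi> j) s - complex_of_real (sqrt g) *\<^sub>C (\<phi> j s * n1 s)) has_vector_derivative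
      (sqg *\<^sub>C dv (dv (\<phi> j)) x - complex_of_real (sqrt g) *\<^sub>C (\<phi> j x * (ig *\<^sub>C rho x) + dv (\<phi> j) x * n1 x))) (at x)"
    by (intro has_vector_derivative_diff bounded_linear.has_vector_derivative[OF scaleC.bounded_linear_right]
        has_vector_derivative_mult n1_deriv field_deriv j)
  ultimately have "dv (\<lambda>s. coef \<phi> (Suc (Suc 0)) s j) x
      = sqg *\<^sub>C dv (dv (\<phi> j)) x - complex_of_real (sqrt g) *\<^sub>C (\<phi> j x * (ig *\<^sub>C rho x) + dv (\<phi> j) x * n1 x)"
    by (simp only: vector_derivative_at)
  moreover have "- \<i> * sqg = complex_of_real (sqrt g)" by (simp add: mult.assoc[symmetric])
  ultimately show ?thesis unfolding coefw_def coef2_m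
    by (simp only: scaleC.diff_right scaleC_scaleC mult_minus_left scaleC.minus_left diff_minus_eq_add add.commute)
qed

lemma n3_deriv: "(n3 has_vector_derivative - (ig *\<^sub>C kin2 x)
    + complex_of_real g *\<^sub>C (mom_density x * n1 x + rho x * (ig *\<^sub>C rho x)) + ig *\<^sub>C (rho x * n2 x)) (at x)"
  unfolding n2_def third_order_algebra[OF density_central, symmetric]
  unfolding n3_def[abs_def] h3_def[symmetric]
  by (intro has_vector_derivative_add bounded_linear.has_vector_derivative[OF scaleC.bounded_linear_right]
      has_vector_derivative_mult n1_deriv mom_prim(1) h3_prim(1))

lemma n3_bot: "(n3 \<longlongrightarrow> 0) at_bot"
proof -
  have "(n3 \<longlongrightarrow> ig *\<^sub>C 0 + complex_of_real g *\<^sub>C (0 * 0) + (1 / 6) *\<^sub>C (0 * 0 * 0)) at_bot"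
    unfolding n3_def[abs_def]
    by (intro tendsto_add scaleC.tendsto tendsto_const tendsto_mult n1_bot mom_prim(2) h3_prim(2))
  then show ?thesis by (simp add: scaleC.zero_right)
qed

lemma coef3_m: "coef \<phi> (Suc (Suc (Suc 0))) x m = n3 x"
proof -
  have "- (sqg *\<^sub>C (\<Sum>j\<in>K. (\<phi> j s)\<^sup>\<dagger> * coefw \<phi> (coef \<phi> (Suc (Suc 0))) s j))
      = - (ig *\<^sub>C kin2 s) + complex_of_real g *\<^sub>C (mom_density s * n1 s + rho s * (ig *\<^sub>C rho s)) + ig *\<^sub>C (rho s * n2 s)" for s
  proof -
    have "(\<Sum>j\<in>K. (\<phi> j s)\<^sup>\<dagger> * coefw \<phi> (coef \<phi> (Suc (Suc 0))) s j)
        = (\<Sum>j\<in>K. complex_of_real (sqrt g) *\<^sub>C ((\<phi> j s)\<^sup>\<dagger> * dv (dv (\<phi> j)) s)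
          + sqg *\<^sub>C ((\<phi> j s)\<^sup>\<dagger> * dv (\<phi> j) s * n1 s + (\<phi> j s)\<^sup>\<dagger> * \<phi> j s * (ig *\<^sub>C rho s))
          - complex_of_real (sqrt g) *\<^sub>C ((\<phi> j s)\<^sup>\<dagger> * \<phi> j s * n2 s))"
      by (intro sum.cong refl) (simp only: coef3_j right_diff_distrib distrib_left scaleC_mult_right mult.assoc)
    also have "\<dots> = complex_of_real (sqrt g) *\<^sub>C kin2 s + sqg *\<^sub>C (mom_density s * n1 s + rho s * (ig *\<^sub>C rho s))
        - complex_of_real (sqrt g) *\<^sub>C (rho s * n2 s)"
      unfolding kin2_def mom_density_def field_density_def[of _ _ _ s]
      by (simp only: sum_subtractf sum.distrib scaleC.sum_right[symmetric] sum_distrib_right[symmetric])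
    finally show ?thesis
      by (simp only: scaleC.diff_right scaleC_add_right scaleC_scaleC sqg_sq sqg_sqrt scaleC.minus_left)
        (simp only: scaleC_add_right minus_diff_eq minus_add_distrib minus_minus diff_conv_add_uminus ac_simps)
  qed
  then have "coef \<phi> (Suc (Suc (Suc 0))) x m = prim (\<lambda>s. - (ig *\<^sub>C kin2 s)
      + complex_of_real g *\<^sub>C (mom_density s * n1 s + rho s * (ig *\<^sub>C rho s)) + ig *\<^sub>C (rho s * n2 s)) x"
    by (simp only: coef.simps(2)[of \<phi> "Suc (Suc 0)"] if_True refl)
  also have "\<dots> = n3 x" by (simp only: prim_eqI[OF n3_deriv n3_bot])
  finally show ?thesis .
qed

definition kin :: "real \<Rightarrow> 'a" where "kin x = (\<Sum>j\<in>K. (dv (\<phi> j) x)\<^sup>\<dagger> * dv (\<phi> j) x)"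

lemma kin_fam: "smooth_fam wt1 (\<lambda>_. kin)"
  unfolding kin_def[abs_def]
  by (intro smooth_fam_sum smooth_fam_times smooth_fam_linear[OF bounded_linear_adj] field_fam' wt_nonneg)

lemma hamiltonian_eq: "hamiltonian_fun M N g \<phi> = integral UNIV kin + g *\<^sub>R integral UNIV (\<lambda>x. rho x * rho x)"
proof -
  have "(\<Sum>j\<in>K. dv (\<lambda>y. (\<phi> j y)\<^sup>\<dagger>) x * dv (\<phi> j) x) = kin x" for x
    unfolding kin_def by (intro sum.cong refl) (simp only: vector_derivative_at[OF field_deriv(3)])
  then show ?thesis unfolding hamiltonian_fun_def by (simp only: power2_eq_square)
qed

lemma rho2_fam: "smooth_fam wt1 (\<lambda>_ x. rho x * rho x)"
  by (intro smooth_fam_times density_fam)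

text \<open>Integration by parts: \<open>kin2 + kin\<close> is the derivative of the momentum
  density, which decays at both ends.\<close>

lemma integral_h3: "integral UNIV h3 = hamiltonian_fun M N g \<phi>"
proof -
  have "((\<lambda>x. \<Sum>j\<in>K. (\<phi> j x)\<^sup>\<dagger> * dv (\<phi> j) x) has_vector_derivative
      (\<Sum>j\<in>K. (\<phi> j x)\<^sup>\<dagger> * dv (dv (\<phi> j)) x + (dv (\<phi> j) x)\<^sup>\<dagger> * dv (\<phi> j) x)) (at x)" for x
    by (intro has_vector_derivative_sum has_vector_derivative_mult field_deriv)
  then have "(mom_density has_vector_derivative kin2 x + kin x) (at x)" for x
    unfolding mom_density_def[abs_def] kin2_def kin_def sum.distrib .
  from integral_of_derivative_zero[OF mom_density_fam abs_zero_le_one this]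
  have z: "((\<lambda>x. kin2 x + kin x) has_integral 0) UNIV" .
  have 1: "((\<lambda>x. h3 x + (kin2 x + kin x)) has_integral (integral UNIV h3 + 0)) UNIV"
    by (intro has_integral_add z h3_prim(4))
  have 2: "h3 x + (kin2 x + kin x) = kin x + g *\<^sub>R (rho x * rho x)" for x
    by (simp add: h3_def scaleR_eq_scaleC)
  have 3: "((\<lambda>x. kin x + g *\<^sub>R (rho x * rho x)) has_integral (integral UNIV kin + g *\<^sub>R integral UNIV (\<lambda>x. rho x * rho x))) UNIV"
    by (intro has_integral_add has_integral_cmul smooth_fam_prim_facts(4)[OF kin_fam abs_zero_le_one]
        smooth_fam_prim_facts(4)[OF rho2_fam abs_zero_le_one])
  from has_integral_unique[OF 1[unfolded 2] 3] show ?thesis unfolding hamiltonian_eq by (simp only: add_0_right)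
qed

lemma number_even: "number_fun M N \<phi> \<in> homog 0"
  unfolding number_fun_def by (rule has_integral_closed_space[OF rho_prim(4) closed_space_homog density_even])

lemma hamiltonian_even: "hamiltonian_fun M N g \<phi> \<in> homog 0"
proof -
  have "kin x \<in> homog 0" for x
    unfolding kin_def by (rule homog_sum) (rule homog_mult'[OF adj_homog[OF dv_homog(1)] dv_homog(1) self_grade])
  moreover have "rho x * rho x \<in> homog 0" for x using homog_mult[OF density_even density_even, of x x] by simp
  ultimately show ?thesis unfolding hamiltonian_eq
    by (intro homog_add homog_scaleR has_integral_closed_space[OF smooth_fam_prim_facts(4)[OF kin_fam abs_zero_le_one] closed_space_homog]
        has_integral_closed_space[OF smooth_fam_prim_facts(4)[OF rho2_fam abs_zero_le_one] closed_space_homog])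
qed

lemma Dl_unique: "(\<And>x. coef \<phi> n x m = F x) \<Longrightarrow> (F \<longlongrightarrow> l) at_top \<Longrightarrow> Dl \<phi> n = l"
  using coef_Dl[OF \<phi>, of n] tendsto_unique[OF trivial_limit_at_top_linorder] by simp

lemma D1_eq: "D_coeff M N g 1 \<phi> = ig *\<^sub>C number_fun M N \<phi>"
  unfolding D_coeff_eq[OF \<phi>] One_nat_def by (rule Dl_unique[OF coef1_m n1_top])

lemma mom_top: "(prim mom_density \<longlongrightarrow> momentum_fun M N \<phi>) at_top"
  using mom_prim(3) unfolding momentum_fun_def mom_density_def[abs_def] .

lemma D2_eq: "D_coeff M N g 2 \<phi> = (- (1/2) * g\<^sup>2) *\<^sub>R (number_fun M N \<phi>)\<^sup>2 + g *\<^sub>R momentum_fun M N \<phi>"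
proof -
  let ?N = "number_fun M N \<phi>" and ?P = "momentum_fun M N \<phi>"
  have "D_coeff M N g 2 \<phi> = complex_of_real g *\<^sub>C ?P + (1 / 2) *\<^sub>C ((ig *\<^sub>C ?N) * (ig *\<^sub>C ?N))"
    unfolding D_coeff_eq[OF \<phi>] numeral_2_eq_2
  proof (rule Dl_unique[OF coef2_m])
    show "(n2 \<longlongrightarrow> complex_of_real g *\<^sub>C ?P + (1 / 2) *\<^sub>C ((ig *\<^sub>C ?N) * (ig *\<^sub>C ?N))) at_top"
      unfolding n2_def[abs_def] by (intro tendsto_add scaleC.tendsto tendsto_const tendsto_mult n1_top mom_top)
  qed
  moreover have "1 / 2 * (ig * ig) = complex_of_real (- (1/2) * g\<^sup>2)" by (simp add: complex_eq_iff power2_eq_square)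
  then have "(1 / 2) *\<^sub>C ((ig *\<^sub>C ?N) * (ig *\<^sub>C ?N)) = (- (1/2) * g\<^sup>2) *\<^sub>R ?N\<^sup>2"
    unfolding scaleC_mult_left scaleC_mult_right scaleC_scaleC scaleR_eq_scaleC power2_eq_square[of ?N]
    by (simp only: mult.assoc)
  ultimately show ?thesis by (simp only: scaleR_eq_scaleC[of g] add.commute)
qed

lemma D3_eq: "D_coeff M N g 3 \<phi> = (- \<i> * complex_of_real (g ^ 3) / 6) *\<^sub>C (number_fun M N \<phi>) ^ 3
       + (\<i> * complex_of_real (g\<^sup>2)) *\<^sub>C (number_fun M N \<phi> * momentum_fun M N \<phi>)
       + ig *\<^sub>C hamiltonian_fun M N g \<phi>"
proof -
  let ?N = "number_fun M N \<phi>" and ?P = "momentum_fun M N \<phi>" and ?H = "hamiltonian_fun M N g \<phi>"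
  let ?n = "ig *\<^sub>C ?N"
  have "D_coeff M N g 3 \<phi> = ig *\<^sub>C ?H + complex_of_real g *\<^sub>C (?P * ?n) + (1 / 6) *\<^sub>C (?n * ?n * ?n)"
    unfolding D_coeff_eq[OF \<phi>] numeral_3_eq_3
  proof (rule Dl_unique[OF coef3_m])
    show "(n3 \<longlongrightarrow> ig *\<^sub>C ?H + complex_of_real g *\<^sub>C (?P * ?n) + (1 / 6) *\<^sub>C (?n * ?n * ?n)) at_top"
      unfolding n3_def[abs_def] integral_h3[symmetric]
      by (intro tendsto_add scaleC.tendsto tendsto_const tendsto_mult n1_top mom_top h3_prim(3))
  qed
  \<comment> \<open>The expansion produces the momentum to the left of the number; the number is
    even, hence central, and the factors may be exchanged.\<close>
  moreover have "complex_of_real g *\<^sub>C (?P * ?n) = (\<i> * complex_of_real (g\<^sup>2)) *\<^sub>C (?N * ?P)"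
    unfolding scaleC_mult_right scaleC_scaleC even_central[OF number_even]
    by (simp only: power2_eq_square of_real_mult mult_ac)
  moreover have "(1 / 6) *\<^sub>C (?n * ?n * ?n) = (- \<i> * complex_of_real (g ^ 3) / 6) *\<^sub>C ?N ^ 3"
  proof -
    have "1 / 6 * (ig * (ig * ig)) = - \<i> * complex_of_real (g ^ 3) / 6" by (simp add: complex_eq_iff power3_eq_cube)
    then show ?thesis unfolding scaleC_mult_left scaleC_mult_right scaleC_scaleC power3_eq_cube[of ?N]
      by (simp only: mult.assoc)
  qed
  ultimately show ?thesis by (simp only: ac_simps)
qed

end

end

subsection \<open>The equation of motion\<close>

text \<open>Keeping one factor at the base point and moving the other makes the increment exactly
  \<epsilon> times a sum, in the form that \<open>is_gradientI\<close> asks for.\<close>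

lemma quadratic_increment:
  fixes a h :: "'i \<Rightarrow> 'a::banach_superalgebra"
  shows "(\<Sum>j\<in>J. (a j + \<epsilon> *\<^sub>R h j)\<^sup>\<dagger> * (a j + \<epsilon> *\<^sub>R h j)) - (\<Sum>j\<in>J. (a j)\<^sup>\<dagger> * a j)
    = \<epsilon> *\<^sub>R (\<Sum>j\<in>J. (a j)\<^sup>\<dagger> * h j + (h j)\<^sup>\<dagger> * (a j + \<epsilon> *\<^sub>R h j))"
  unfolding sum_subtractf[symmetric] scaleR_right.sum
  by (intro sum.cong refl) (simp add: adj_add adj_scaleR algebra_simps)

lemma mult_gsign_self:
  assumes "(x::'a::banach_superalgebra) \<in> homog p" "y \<in> homog p"
  shows "x * (gsign p * y) = y * x"
  using supercommute[OF assms] by (cases p) (simp_all add: gsign_def)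

lemma schwartz_constant_fam: "schwartz f \<Longrightarrow> smooth_fam wt1 (\<lambda>_. f)"
  using schwartz_smooth_fam[OF _ schwartz_zero, of f] by simp

lemma smooth_fam_scaled:
  fixes u :: "real \<Rightarrow> 'a::real_normed_algebra_1"
  assumes "schwartz f" "smooth_fam wt1 (\<lambda>_. u)"
  shows "smooth_fam wt1 (\<lambda>_ x. f x *\<^sub>R u x)"
proof -
  have "smooth_fam wt1 (\<lambda>_ x. (f x *\<^sub>R 1) * u x)"
    by (intro smooth_fam_times assms(2) smooth_fam_linear[OF bounded_linear_scaleR_left] schwartz_constant_fam assms(1))
  then show ?thesis by simp
qed

context super_nls begin

text \<open>The difference of the squared densities is their sum times their difference, which
  explains the sum of densities at \<open>\<psi>\<close> and \<open>\<phi>\<close> and makes the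
  increments of H exact. The sign comes from moving the variation to the left.\<close>

definition ham_gradA :: "'a::banach_superalgebra config \<Rightarrow> 'a config \<Rightarrow> nat \<Rightarrow> real \<Rightarrow> 'a" where
  "ham_gradA \<phi> \<psi> l x = gsign (gr l) * (- (dv (dv (\<phi> l)) x)\<^sup>\<dagger>
     + g *\<^sub>R ((\<phi> l x)\<^sup>\<dagger> * (field_density M N \<psi> x + field_density M N \<phi> x)))"

definition ham_gradB :: "'a::banach_superalgebra config \<Rightarrow> 'a config \<Rightarrow> nat \<Rightarrow> real \<Rightarrow> 'a" where
  "ham_gradB \<phi> \<psi> l x = - dv (dv (\<psi> l)) x
     + g *\<^sub>R ((field_density M N \<psi> x + field_density M N \<phi> x) * \<psi> l x)"

context
  fixes \<phi> :: "'a::banach_superalgebra config"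
  assumes \<phi>: "\<phi> \<in> fields M N"
begin

context
  fixes h :: "'a config"
  assumes h: "h \<in> fields M N"
begin

lemma shift_density_fam: "smooth_fam wt1 (\<lambda>\<epsilon>. field_density M N (shift_cfg \<phi> \<epsilon> h))"
  unfolding field_density_def[abs_def]
  by (intro smooth_fam_sum smooth_fam_times smooth_fam_linear[OF bounded_linear_adj] shift_smooth_fam \<phi> h wt_nonneg)

lemma ham_gradA_fam: "l \<in> K \<Longrightarrow> smooth_fam wt1 (\<lambda>\<epsilon>. ham_gradA \<phi> (shift_cfg \<phi> \<epsilon> h) l)"
  unfolding ham_gradA_def[abs_def]
  by (intro smooth_fam_add smooth_fam_times smooth_fam_linear[OF bounded_linear_mult_right]
      smooth_fam_linear[OF bounded_linear_minus[OF bounded_linear_ident]]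
      smooth_fam_linear[OF bounded_linear_scaleR_right]
      smooth_fam_linear[OF bounded_linear_adj] field_fam[OF \<phi>] field_fam'(2)[OF \<phi>] shift_density_fam density_fam[OF \<phi>])

lemma ham_gradB_fam: "l \<in> K \<Longrightarrow> smooth_fam wt1 (\<lambda>\<epsilon>. ham_gradB \<phi> (shift_cfg \<phi> \<epsilon> h) l)"
  unfolding ham_gradB_def[abs_def]
  by (intro smooth_fam_add smooth_fam_times
      smooth_fam_linear[OF bounded_linear_minus[OF bounded_linear_ident]]
      smooth_fam_linear[OF bounded_linear_scaleR_right] smooth_fam_vector_derivative
      shift_smooth_fam \<phi> h shift_density_fam density_fam[OF \<phi>])

text \<open>The kinetic increment contains first derivatives of \<open>h\<close>; subtracting a
  total derivative with vanishing integral frees \<open>h\<close> of them, as a gradient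
  requires.\<close>

lemma hamiltonian_increment:
  "((\<lambda>x. \<epsilon> *\<^sub>R (\<Sum>l\<in>K. h l x * ham_gradA \<phi> (shift_cfg \<phi> \<epsilon> h) l x
      + (h l x)\<^sup>\<dagger> * ham_gradB \<phi> (shift_cfg \<phi> \<epsilon> h) l x))
    has_integral (hamiltonian_fun M N g (shift_cfg \<phi> \<epsilon> h) - hamiltonian_fun M N g \<phi>)) UNIV"
proof -
  define \<psi> where "\<psi> = shift_cfg \<phi> \<epsilon> h"
  have \<psi>: "\<psi> \<in> fields M N" unfolding \<psi>_def by (rule shift_fields[OF \<phi> h])
  let ?R = "field_density M N \<psi>" and ?r = "field_density M N \<phi>"
  have \<psi>_eq: "\<psi> l x = \<phi> l x + \<epsilon> *\<^sub>R h l x" for l x by (simp add: \<psi>_def shift_cfg_def)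
  have dv\<psi>: "dv (\<psi> l) x = dv (\<phi> l) x + \<epsilon> *\<^sub>R dv (h l) x" if "l \<in> K" for l x
  proof (rule vector_derivative_at)
    have "((\<lambda>x. \<phi> l x + \<epsilon> *\<^sub>R h l x) has_vector_derivative dv (\<phi> l) x + \<epsilon> *\<^sub>R dv (h l) x) (at x)"
      by (intro has_vector_derivative_add field_deriv(1)[OF \<phi> that]
          bounded_linear.has_vector_derivative[OF bounded_linear_scaleR_right field_deriv(1)[OF h that]])
    then show "(\<psi> l has_vector_derivative dv (\<phi> l) x + \<epsilon> *\<^sub>R dv (h l) x) (at x)"
      by (simp only: \<psi>_eq[abs_def])
  qed
  \<comment> \<open>The boundary term of both integrations by parts: one for the variation of the
    adjoint field, one for that of the field itself.\<close>
  define V where "V x = (\<Sum>l\<in>K. (h l x)\<^sup>\<dagger> * dv (\<psi> l) x + (dv (\<phi> l) x)\<^sup>\<dagger> * h l x)" for x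
  define V' where "V' x = (\<Sum>l\<in>K. ((h l x)\<^sup>\<dagger> * dv (dv (\<psi> l)) x + (dv (h l) x)\<^sup>\<dagger> * dv (\<psi> l) x)
      + ((dv (\<phi> l) x)\<^sup>\<dagger> * dv (h l) x + (dv (dv (\<phi> l)) x)\<^sup>\<dagger> * h l x))" for x
  have "smooth_fam wt1 (\<lambda>_. V)" unfolding V_def[abs_def]
    by (intro smooth_fam_sum smooth_fam_add smooth_fam_times smooth_fam_linear[OF bounded_linear_adj]
        field_fam[OF h] field_fam'(1)[OF \<psi>] field_fam'(1)[OF \<phi>] wt_nonneg)
  moreover have "(V has_vector_derivative V' x) (at x)" for x unfolding V_def[abs_def] V'_def
    by (intro has_vector_derivative_sum has_vector_derivative_add has_vector_derivative_mult
        field_deriv[OF h] field_deriv[OF \<psi>] field_deriv[OF \<phi>])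
  ultimately have V0: "(V' has_integral 0) UNIV" by (rule integral_of_derivative_zero[OF _ abs_zero_le_one])
  have pointwise: "\<epsilon> *\<^sub>R (\<Sum>l\<in>K. h l x * ham_gradA \<phi> \<psi> l x + (h l x)\<^sup>\<dagger> * ham_gradB \<phi> \<psi> l x)
      = (kin \<psi> x - kin \<phi> x) + g *\<^sub>R (?R x * ?R x - ?r x * ?r x) - \<epsilon> *\<^sub>R V' x" for x
  proof -
    let ?S = "?R x + ?r x"
    have S: "y * ?S = ?S * y" for y
      by (simp only: distrib_left distrib_right density_central[OF \<phi>] density_central[OF \<psi>])
    have S0: "?S \<in> homog 0" by (rule homog_add[OF density_even[OF \<psi>] density_even[OF \<phi>]])
    have summand: "h l x * ham_gradA \<phi> \<psi> l x + (h l x)\<^sup>\<dagger> * ham_gradB \<phi> \<psi> l x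
        = ((dv (\<phi> l) x)\<^sup>\<dagger> * dv (h l) x + (dv (h l) x)\<^sup>\<dagger> * dv (\<psi> l) x)
          + g *\<^sub>R (?S * ((\<phi> l x)\<^sup>\<dagger> * h l x + (h l x)\<^sup>\<dagger> * \<psi> l x))
          - (((h l x)\<^sup>\<dagger> * dv (dv (\<psi> l)) x + (dv (h l) x)\<^sup>\<dagger> * dv (\<psi> l) x)
            + ((dv (\<phi> l) x)\<^sup>\<dagger> * dv (h l) x + (dv (dv (\<phi> l)) x)\<^sup>\<dagger> * h l x))" if l: "l \<in> K" for l
    proof -
      have "(\<phi> l x)\<^sup>\<dagger> * ?S \<in> homog (gr l)"
        by (rule homog_mult'[OF adj_homog[OF field_homog[OF \<phi> l]] S0]) simp
      then have "- (dv (dv (\<phi> l)) x)\<^sup>\<dagger> + g *\<^sub>R ((\<phi> l x)\<^sup>\<dagger> * ?S) \<in> homog (gr l)"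
        by (intro homog_add homog_minus homog_scaleR adj_homog dv_homog(2)[OF \<phi> l])
      from mult_gsign_self[OF field_homog[OF h l] this]
      have "h l x * ham_gradA \<phi> \<psi> l x = (- (dv (dv (\<phi> l)) x)\<^sup>\<dagger> + g *\<^sub>R ((\<phi> l x)\<^sup>\<dagger> * ?S)) * h l x"
        unfolding ham_gradA_def .
      also have "\<dots> = - ((dv (dv (\<phi> l)) x)\<^sup>\<dagger> * h l x) + g *\<^sub>R (?S * ((\<phi> l x)\<^sup>\<dagger> * h l x))"
        by (simp only: S[of "(\<phi> l x)\<^sup>\<dagger>"] distrib_right[of _ "g *\<^sub>R _"] minus_mult_left mult_scaleR_left mult.assoc)
      finally have A: "h l x * ham_gradA \<phi> \<psi> l x
        = - ((dv (dv (\<phi> l)) x)\<^sup>\<dagger> * h l x) + g *\<^sub>R (?S * ((\<phi> l x)\<^sup>\<dagger> * h l x))" .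
      have "(h l x)\<^sup>\<dagger> * (?S * \<psi> l x) = ?S * ((h l x)\<^sup>\<dagger> * \<psi> l x)"
        by (simp only: mult.assoc[symmetric] S[of "(h l x)\<^sup>\<dagger>"])
      then have B: "(h l x)\<^sup>\<dagger> * ham_gradB \<phi> \<psi> l x
        = - ((h l x)\<^sup>\<dagger> * dv (dv (\<psi> l)) x) + g *\<^sub>R (?S * ((h l x)\<^sup>\<dagger> * \<psi> l x))"
        unfolding ham_gradB_def by (simp only: distrib_left[of "(h l x)\<^sup>\<dagger>"] mult_minus_right mult_scaleR_right)
      have C: "?S * ((\<phi> l x)\<^sup>\<dagger> * h l x + (h l x)\<^sup>\<dagger> * \<psi> l x)
          = ?S * ((\<phi> l x)\<^sup>\<dagger> * h l x) + ?S * ((h l x)\<^sup>\<dagger> * \<psi> l x)" by (rule distrib_left)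
      show ?thesis unfolding A B C scaleR_add_right by simp
    qed
    have kin_diff: "kin \<psi> x - kin \<phi> x = \<epsilon> *\<^sub>R (\<Sum>l\<in>K. (dv (\<phi> l) x)\<^sup>\<dagger> * dv (h l) x + (dv (h l) x)\<^sup>\<dagger> * dv (\<psi> l) x)"
    proof -
      have "kin \<psi> x = (\<Sum>j\<in>K. (dv (\<phi> j) x + \<epsilon> *\<^sub>R dv (h j) x)\<^sup>\<dagger> * (dv (\<phi> j) x + \<epsilon> *\<^sub>R dv (h j) x))"
        unfolding kin_def[OF \<psi>] by (intro sum.cong refl) (simp only: dv\<psi>)
      moreover have "(\<Sum>l\<in>K. (dv (\<phi> l) x)\<^sup>\<dagger> * dv (h l) x + (dv (h l) x)\<^sup>\<dagger> * dv (\<psi> l) x)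
          = (\<Sum>l\<in>K. (dv (\<phi> l) x)\<^sup>\<dagger> * dv (h l) x + (dv (h l) x)\<^sup>\<dagger> * (dv (\<phi> l) x + \<epsilon> *\<^sub>R dv (h l) x))"
        by (intro sum.cong refl) (simp only: dv\<psi>)
      ultimately show ?thesis unfolding kin_def[OF \<phi>] by (simp only: quadratic_increment)
    qed
    have density_diff: "?R x - ?r x = \<epsilon> *\<^sub>R (\<Sum>l\<in>K. (\<phi> l x)\<^sup>\<dagger> * h l x + (h l x)\<^sup>\<dagger> * \<psi> l x)"
      unfolding field_density_def \<psi>_eq quadratic_increment ..
    \<comment> \<open>The densities are even and commute, so the mixed terms cancel.\<close>
    have "?R x * ?R x - ?r x * ?r x = ?S * (?R x - ?r x)"
      by (simp only: distrib_right right_diff_distrib density_central[OF \<phi>, of "?R x"]) simp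
    then have sq: "?R x * ?R x - ?r x * ?r x
        = \<epsilon> *\<^sub>R (\<Sum>l\<in>K. ?S * ((\<phi> l x)\<^sup>\<dagger> * h l x + (h l x)\<^sup>\<dagger> * \<psi> l x))"
      by (simp only: density_diff mult_scaleR_right sum_distrib_left)
    have "(\<Sum>l\<in>K. h l x * ham_gradA \<phi> \<psi> l x + (h l x)\<^sup>\<dagger> * ham_gradB \<phi> \<psi> l x)
        = (\<Sum>l\<in>K. (dv (\<phi> l) x)\<^sup>\<dagger> * dv (h l) x + (dv (h l) x)\<^sup>\<dagger> * dv (\<psi> l) x)
          + g *\<^sub>R (\<Sum>l\<in>K. ?S * ((\<phi> l x)\<^sup>\<dagger> * h l x + (h l x)\<^sup>\<dagger> * \<psi> l x)) - V' x"
      unfolding V'_def scaleR_right.sum sum.distrib[symmetric] sum_subtractf[symmetric]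
      by (rule sum.cong[OF refl summand])
    then show ?thesis unfolding kin_diff sq
      by (simp only: scaleR_diff_right scaleR_add_right scaleR_left_commute[of g])
  qed
  note kint = smooth_fam_prim_facts(4)[OF kin_fam abs_zero_le_one]
    and rint = smooth_fam_prim_facts(4)[OF rho2_fam abs_zero_le_one]
  have "((\<lambda>x. (kin \<psi> x - kin \<phi> x) + g *\<^sub>R (?R x * ?R x - ?r x * ?r x) - \<epsilon> *\<^sub>R V' x) has_integral
      (integral UNIV (kin \<psi>) - integral UNIV (kin \<phi>))
      + g *\<^sub>R (integral UNIV (\<lambda>x. ?R x * ?R x) - integral UNIV (\<lambda>x. ?r x * ?r x)) - \<epsilon> *\<^sub>R 0) UNIV"
    by (intro has_integral_diff has_integral_add has_integral_cmul kint[OF \<phi>] kint[OF \<psi>] rint[OF \<phi>] rint[OF \<psi>] V0)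
  also have "(integral UNIV (kin \<psi>) - integral UNIV (kin \<phi>))
      + g *\<^sub>R (integral UNIV (\<lambda>x. ?R x * ?R x) - integral UNIV (\<lambda>x. ?r x * ?r x)) - \<epsilon> *\<^sub>R 0
      = hamiltonian_fun M N g \<psi> - hamiltonian_fun M N g \<phi>"
    unfolding hamiltonian_eq[OF \<phi>] hamiltonian_eq[OF \<psi>] by (simp add: scaleR_diff_right)
  finally show ?thesis unfolding \<psi>_def[symmetric] pointwise .
qed

end

lemma hamiltonian_gradient: "is_gradient M N (hamiltonian_fun M N g) \<phi> (ham_gradA \<phi> \<phi>) (ham_gradB \<phi> \<phi>)"
proof (rule is_gradientI)
  \<comment> \<open>Continuity and boundedness of the gradient itself are read off from the families
    with zero variation.\<close>
  have zero: "shift_cfg \<phi> \<epsilon> (\<lambda>j x. 0) = \<phi>" for \<epsilon> by (simp add: shift_cfg_def)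
  show "continuous_on UNIV (ham_gradA \<phi> \<phi> l) \<and> bounded (range (ham_gradA \<phi> \<phi> l)) \<and>
      continuous_on UNIV (ham_gradB \<phi> \<phi> l) \<and> bounded (range (ham_gradB \<phi> \<phi> l))" if l: "l \<in> K" for l
  proof -
    have *: "continuous_on UNIV F \<and> bounded (range F)" if "smooth_fam wt1 (\<lambda>_. F)" for F :: "real \<Rightarrow> 'a"
      using smooth_famD(2)[OF that abs_zero_le_one] smooth_fam_bd0[OF smooth_fam_wt_weaken[OF that]]
      unfolding bounded_iff by auto
    show ?thesis using *[OF ham_gradA_fam[OF zero_fields l, unfolded zero]] *[OF ham_gradB_fam[OF zero_fields l, unfolded zero]]
      by blast
  qed
  fix h :: "'a config" assume h: "h \<in> fields M N"
  let ?A = "\<lambda>\<epsilon>. ham_gradA \<phi> (shift_cfg \<phi> \<epsilon> h)" and ?B = "\<lambda>\<epsilon>. ham_gradB \<phi> (shift_cfg \<phi> \<epsilon> h)"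
  \<comment> \<open>The pair \<open>t\<close> packs \<epsilon> and \<open>x\<close> into the single
    parameter of \<open>finite_uniform_bound\<close>, which adds up the constants of the finitely
    many \<open>l\<close>.\<close>
  have "\<exists>C\<ge>0. \<forall>l\<in>K. \<forall>t. \<bar>fst t\<bar> \<le> 1 \<longrightarrow> norm (?A (fst t) l (snd t) - ham_gradA \<phi> \<phi> l (snd t)) \<le> C * \<bar>fst t\<bar>"
    using smooth_fam_lipschitz[OF smooth_fam_wt_weaken[OF ham_gradA_fam[OF h]]]
    by (intro finite_uniform_bound finite_K) auto
  then obtain C1 where C1: "C1 \<ge> 0" "\<And>l \<epsilon> x. l \<in> K \<Longrightarrow> \<bar>\<epsilon>\<bar> \<le> 1 \<Longrightarrow> norm (?A \<epsilon> l x - ham_gradA \<phi> \<phi> l x) \<le> C1 * \<bar>\<epsilon>\<bar>"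
    by fastforce
  have "\<exists>C\<ge>0. \<forall>l\<in>K. \<forall>t. \<bar>fst t\<bar> \<le> 1 \<longrightarrow> norm (?B (fst t) l (snd t) - ham_gradB \<phi> \<phi> l (snd t)) \<le> C * \<bar>fst t\<bar>"
    using smooth_fam_lipschitz[OF smooth_fam_wt_weaken[OF ham_gradB_fam[OF h]]]
    by (intro finite_uniform_bound finite_K) auto
  then obtain C2 where C2: "C2 \<ge> 0" "\<And>l \<epsilon> x. l \<in> K \<Longrightarrow> \<bar>\<epsilon>\<bar> \<le> 1 \<Longrightarrow> norm (?B \<epsilon> l x - ham_gradB \<phi> \<phi> l x) \<le> C2 * \<bar>\<epsilon>\<bar>"
    by fastforce
  have le: "c * \<bar>\<epsilon>\<bar> \<le> (C1 + C2) * \<bar>\<epsilon>\<bar>" if "c = C1 \<or> c = C2" for c \<epsilon> :: real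
    using that C1(1) C2(1) by (intro mult_right_mono) auto
  show "\<exists>A' B' C. \<forall>\<epsilon>. \<bar>\<epsilon>\<bar> \<le> 1 \<longrightarrow>
      (\<forall>l\<in>K. continuous_on UNIV (A' \<epsilon> l) \<and> continuous_on UNIV (B' \<epsilon> l) \<and>
        (\<forall>x. norm (A' \<epsilon> l x - ham_gradA \<phi> \<phi> l x) \<le> C * \<bar>\<epsilon>\<bar> \<and> norm (B' \<epsilon> l x - ham_gradB \<phi> \<phi> l x) \<le> C * \<bar>\<epsilon>\<bar>)) \<and>
      ((\<lambda>x. \<epsilon> *\<^sub>R (\<Sum>l\<in>K. h l x * A' \<epsilon> l x + (h l x)\<^sup>\<dagger> * B' \<epsilon> l x)) has_integral
        (hamiltonian_fun M N g (shift_cfg \<phi> \<epsilon> h) - hamiltonian_fun M N g \<phi>)) UNIV"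
  proof (rule exI[of _ ?A], rule exI[of _ ?B], rule exI[of _ "C1 + C2"], intro allI impI conjI ballI hamiltonian_increment[OF h])
    fix \<epsilon> :: real and l x assume e: "\<bar>\<epsilon>\<bar> \<le> 1" and l: "l \<in> K"
    show "continuous_on UNIV (?A \<epsilon> l)" by (rule smooth_famD(2)[OF ham_gradA_fam[OF h l] e])
    show "continuous_on UNIV (?B \<epsilon> l)" by (rule smooth_famD(2)[OF ham_gradB_fam[OF h l] e])
    show "norm (?A \<epsilon> l x - ham_gradA \<phi> \<phi> l x) \<le> (C1 + C2) * \<bar>\<epsilon>\<bar>"
      by (rule order_trans[OF C1(2)[OF l e] le]) simp
    show "norm (?B \<epsilon> l x - ham_gradB \<phi> \<phi> l x) \<le> (C1 + C2) * \<bar>\<epsilon>\<bar>"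
      by (rule order_trans[OF C2(2)[OF l e] le]) simp
  qed
qed

section \<open>Smeared fields and their bracket with the Hamiltonian\<close>

lemma schwartz_scaleR_integrable:
  fixes f :: "real \<Rightarrow> real" and u :: "real \<Rightarrow> 'a"
  assumes "schwartz f" "schwartz u"
  shows "((\<lambda>x. f x *\<^sub>R u x) has_integral integral UNIV (\<lambda>x. f x *\<^sub>R u x)) UNIV"
proof -
  note smooth_fam_scaled[OF assms(1) schwartz_constant_fam[OF assms(2)]]
  from smooth_fam_prim_facts(4)[OF this abs_zero_le_one] show ?thesis .
qed

text \<open>The functional is linear, so its increment is exactly \<epsilon> times the smeared
  variation.\<close>

lemma smeared_gradient:
  fixes f :: "real \<Rightarrow> real"
  assumes f: "schwartz f" and j: "j \<in> K"
  shows "is_gradient M N (smeared j f) \<phi> (\<lambda>l x. if l = j then f x *\<^sub>R 1 else 0) (\<lambda>l x. 0)"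
  unfolding is_gradient_def
proof (intro conjI ballI)
  fix l assume "l \<in> K"
  note F = schwartz_constant_fam[OF f]
  show "continuous_on UNIV (\<lambda>x. if l = j then f x *\<^sub>R (1::'a) else 0)"
    using smooth_famD(2)[OF F abs_zero_le_one] by (cases "l = j") (auto intro!: continuous_intros)
  show "bounded (range (\<lambda>x. if l = j then f x *\<^sub>R (1::'a) else 0))"
    using smooth_fam_bd0[OF smooth_fam_wt_weaken[OF F]] unfolding bounded_iff by (cases "l = j") auto
  show "continuous_on UNIV (\<lambda>x. 0 :: 'a)" "bounded (range (\<lambda>x::real. 0 :: 'a))" by auto
next
  fix h :: "'a config" assume h: "h \<in> fields M N"
  have s: "schwartz (\<phi> j)" "schwartz (h j)" using \<phi> h j by (auto simp: fields_def)
  note i = schwartz_scaleR_integrable[OF f s(1)] schwartz_scaleR_integrable[OF f s(2)]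
  have "smeared j f (\<lambda>j x. \<phi> j x + \<epsilon> *\<^sub>R h j x)
      = integral UNIV (\<lambda>x. f x *\<^sub>R \<phi> j x) + \<epsilon> *\<^sub>R integral UNIV (\<lambda>x. f x *\<^sub>R h j x)" for \<epsilon>
  proof -
    have "((\<lambda>x. f x *\<^sub>R \<phi> j x + \<epsilon> *\<^sub>R (f x *\<^sub>R h j x)) has_integral
        integral UNIV (\<lambda>x. f x *\<^sub>R \<phi> j x) + \<epsilon> *\<^sub>R integral UNIV (\<lambda>x. f x *\<^sub>R h j x)) UNIV"
      by (intro has_integral_add has_integral_cmul i)
    moreover have "f x *\<^sub>R \<phi> j x + \<epsilon> *\<^sub>R (f x *\<^sub>R h j x) = f x *\<^sub>R (\<phi> j x + \<epsilon> *\<^sub>R h j x)" for x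
      by (simp add: scaleR_add_right mult.commute)
    ultimately show ?thesis unfolding smeared_def by (simp only: integral_unique)
  qed
  then have "((\<lambda>\<epsilon>. smeared j f (\<lambda>j x. \<phi> j x + \<epsilon> *\<^sub>R h j x)) has_vector_derivative
      integral UNIV (\<lambda>x. f x *\<^sub>R h j x)) (at 0)"
    by (auto intro!: derivative_eq_intros)
  moreover have "(\<Sum>l\<in>K. h l x * (if l = j then f x *\<^sub>R 1 else 0) + (h l x)\<^sup>\<dagger> * 0) = f x *\<^sub>R h j x" for x
    by (subst sum_eq_single[where a = j]) (use j in auto)
  ultimately show "\<exists>v. ((\<lambda>\<epsilon>. smeared j f (\<lambda>j x. \<phi> j x + \<epsilon> *\<^sub>R h j x)) has_vector_derivative v) (at 0) \<and>
      ((\<lambda>x. \<Sum>l\<in>K. h l x * (if l = j then f x *\<^sub>R 1 else 0) + (h l x)\<^sup>\<dagger> * 0) has_integral v) UNIV"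
    using i(2) by (intro exI conjI) (assumption, simp only:)
qed

lemma nlss_eq: "ham_gradB \<phi> \<phi> l x = nlss M N g \<phi> l x"
  by (simp add: ham_gradB_def nlss_def distrib_right scaleR_add_right scaleR_add_left[symmetric])

text \<open>The smeared field does not vary with the adjoint fields, so only the term with
  \<open>ham_gradB\<close> survives in the bracket, and \<open>nlss_eq\<close> recognises it as the
  right-hand side of the equation.\<close>

lemma equation_of_motion:
  fixes f :: "real \<Rightarrow> real"
  assumes f: "schwartz f" and j: "j \<in> K"
  shows "has_poisson M N 0 (hamiltonian_fun M N g) (smeared j f) \<phi>
    (- \<i> *\<^sub>C integral UNIV (\<lambda>x. f x *\<^sub>R nlss M N g \<phi> j x))"
proof (rule has_poissonI[OF hamiltonian_even hamiltonian_gradient smeared_gradient[OF f j]])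
  let ?n = "\<lambda>x. f x *\<^sub>R nlss M N g \<phi> j x"
  have "smooth_fam wt1 (\<lambda>\<epsilon>::real. ham_gradB \<phi> \<phi> j)"
    using ham_gradB_fam[OF zero_fields j] by (simp add: shift_cfg_def)
  then have "smooth_fam wt1 (\<lambda>\<epsilon>::real. ?n)" unfolding nlss_eq[abs_def, symmetric]
    by (rule smooth_fam_scaled[OF f])
  from has_integral_linear[OF smooth_fam_prim_facts(4)[OF this abs_zero_le_one] scaleC.bounded_linear_right[of "- \<i>"]]
  have I: "((\<lambda>x. - \<i> *\<^sub>C ?n x) has_integral - \<i> *\<^sub>C integral UNIV ?n) UNIV" by (simp only: o_def)
  have e: "brk 0 (ham_gradA \<phi> \<phi>) (ham_gradB \<phi> \<phi>) (\<lambda>l x. if l = j then f x *\<^sub>R 1 else 0) (\<lambda>l x. 0) x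
      = - \<i> *\<^sub>C ?n x" for x
    unfolding brk_def nlss_eq
    by (subst sum_eq_single[where a = j]) (use j in \<open>auto simp: gsign_def scaleC.minus_right scaleC.minus_left\<close>)
  show "(brk 0 (ham_gradA \<phi> \<phi>) (ham_gradB \<phi> \<phi>) (\<lambda>l x. if l = j then f x *\<^sub>R 1 else 0) (\<lambda>l x. 0)
      has_integral - \<i> *\<^sub>C integral UNIV (\<lambda>x. f x *\<^sub>R nlss M N g \<phi> j x)) UNIV"
    unfolding e[abs_def] by (rule I)
qed

end

end

theorem mainTheorem6:
  fixes M N :: nat and g :: real and \<phi> :: "'a::banach_superalgebra config"
  assumes "0 < g" and "\<phi> \<in> fields M N"
  shows
    "(\<forall>\<zeta>. 0 \<le> Im \<zeta> \<longrightarrow> monodromy_converges M N g \<zeta> \<phi> (M + N + 1) (M + N + 1)) \<and>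
     (\<forall>\<zeta>. Im \<zeta> \<le> 0 \<longrightarrow>
        (\<forall>a\<in>{1..M + N}. \<forall>b\<in>{1..M + N}. monodromy_converges M N g \<zeta> \<phi> a b)) \<and>

     has_inverse_expansion (\<lambda>\<zeta>. D_fun M N g \<zeta> \<phi>) (\<lambda>n. D_coeff M N g n \<phi>) \<and>
     D_coeff M N g 1 \<phi> = (\<i> * complex_of_real g) *\<^sub>C number_fun M N \<phi> \<and>
     D_coeff M N g 2 \<phi> = (- (1/2) * g\<^sup>2) *\<^sub>R (number_fun M N \<phi>)\<^sup>2 + g *\<^sub>R momentum_fun M N \<phi> \<and>
     D_coeff M N g 3 \<phi> = (- \<i> * complex_of_real (g ^ 3) / 6) *\<^sub>C (number_fun M N \<phi>) ^ 3
       + (\<i> * complex_of_real (g\<^sup>2)) *\<^sub>C (number_fun M N \<phi> * momentum_fun M N \<phi>)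
       + (\<i> * complex_of_real g) *\<^sub>C hamiltonian_fun M N g \<phi> \<and>

     (\<forall>j\<in>{1..M + N}. \<forall>f. schwartz f \<longrightarrow>
        has_poisson M N 0 (hamiltonian_fun M N g) (smeared j f) \<phi>
          (- \<i> *\<^sub>C integral UNIV (\<lambda>x. f x *\<^sub>R nlss M N g \<phi> j x))) \<and>

     (\<forall>\<zeta> \<mu>. Im \<zeta> \<le> 0 \<and> Im \<mu> \<le> 0 \<and> \<zeta> \<noteq> \<mu> \<longrightarrow>
        has_poisson_mat M N (t_mat M N g \<zeta>) (t_mat M N g \<mu>) \<phi>
          (\<lambda>a b c d. - (complex_of_real g / (\<zeta> - \<mu>)) *\<^sub>C
             tcomm M N (P12 M N) (tensor_mat M N (t_mat M N g \<zeta> \<phi>) (t_mat M N g \<mu> \<phi>)) a b c d)) \<and>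

     (\<forall>\<zeta> \<mu>. 0 \<le> Im \<zeta> \<and> 0 \<le> Im \<mu> \<longrightarrow>
        has_poisson M N 0 (D_fun M N g \<zeta>) (D_fun M N g \<mu>) \<phi> 0) \<and>
     (\<forall>\<zeta> \<mu>. 0 \<le> Im \<zeta> \<and> Im \<mu> \<le> 0 \<and> Im \<mu> < Im \<zeta> \<longrightarrow>
        (\<forall>a\<in>{1..M + N}. \<forall>b\<in>{1..M + N}.
           has_poisson M N 0 (D_fun M N g \<zeta>) (\<lambda>\<psi>. t_mat M N g \<mu> \<psi> a b) \<phi> 0)) \<and>

     (\<forall>m n. has_poisson M N 0 (D_coeff M N g m) (D_coeff M N g n) \<phi> 0) \<and>
     (\<forall>n \<mu>. Im \<mu> \<le> 0 \<longrightarrow>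
        (\<forall>a\<in>{1..M + N}. \<forall>b\<in>{1..M + N}.
           has_poisson M N 0 (D_coeff M N g n) (\<lambda>\<psi>. t_mat M N g \<mu> \<psi> a b) \<phi> 0))"
proof -
  interpret super_nls M N g by unfold_locales (rule assms(1))
  note \<phi> = assms(2)
  let ?K = "{1..M + N}"
  have 1: "monodromy_converges M N g \<zeta> \<phi> (M + N + 1) (M + N + 1)" if "0 \<le> Im \<zeta>" for \<zeta>
    using that by (intro monodromy_eq_Tm(1)[OF \<phi> _ m_in m_in refl]) (simp add: good_def)
  have 2: "monodromy_converges M N g \<zeta> \<phi> a b" if "Im \<zeta> \<le> 0" "a \<in> ?K" "b \<in> ?K" for \<zeta> a b
  proof (rule monodromy_eq_Tm(1)[OF \<phi> _ K_I[OF that(2)] K_I[OF that(3)]])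
    show "good \<zeta> b" using that(1) K_ne_m[OF that(3)] unfolding good_def by (simp only: if_False)
    show "sg a = sg b" unfolding sg_K[OF that(2)] sg_K[OF that(3)] ..
  qed
  have 3: "has_inverse_expansion (\<lambda>\<zeta>. D_fun M N g \<zeta> \<phi>) (\<lambda>n. D_coeff M N g n \<phi>)"
    unfolding D_coeff_eq[OF \<phi>] by (rule D_expansion[OF \<phi>])
  show ?thesis
    by (intro conjI allI ballI impI; (elim conjE)?;
      rule 1 2 3 D1_eq[OF \<phi>] D2_eq[OF \<phi>] D3_eq[OF \<phi>] equation_of_motion[OF \<phi>] poisson_t_t[OF \<phi>]
        poisson_D_D[OF \<phi>] poisson_D_t[OF \<phi>] poisson_Dc_Dc[OF \<phi>] poisson_Dc_t[OF \<phi>]; assumption)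
qed

end
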